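(* Let $\mathbb{F}$ be a field of characteristic different from $2$. Let $b$ be a non-degenerate symmetric bilinear form on a finite-dimensional vector space $V$ over $\mathbb{F}$, and let $u$ be a $b$-skew-selfadjoint endomorphism of $V$. For $u$ to be the sum of two $b$-skew-selfadjoint square-zero endomorphisms of $V$, it is necessary and sufficient that all the following conditions hold: (i) for every $p\in\mathrm{Irr}_0(\mathbb{F})$ and every integer $r\ge1$, the Hermitian form $(b,u)_{p,r}$ is hyperbolic; (ii) for every $p\in\mathrm{Irr}(\mathbb{F})\setminus(\mathrm{Irr}_0(\mathbb{F})\cup\{t\})$ and every integer $k\ge1$, the Jordan number $n_{p,k}(u)$ is even; (iii) for every integer $k\ge0$, the non-degenerate symmetric bilinear form $(-1)^k(b,u)_{t,2k+1}$ Witt-simplifies $\underset{i>k}{\bot}\,(-1)^i(b,u)_{t,2i+1}$.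
   Context: $u$ is $b$-skew-selfadjoint if $b(u(x),y)=-b(x,u(y))$ for all $x,y$. $\mathrm{Irr}(\mathbb{F})$ is the set of monic irreducible polynomials of $\mathbb{F}[t]$, and $\mathrm{Irr}_0(\mathbb{F})=\mathrm{Irr}(\mathbb{F})\cap\mathbb{F}[t^2]$. For $p\in\mathrm{Irr}(\mathbb{F})$ and $k\ge1$, set $V_{p,k}:=\mathrm{Ker}\,p(u)^k/\bigl(\mathrm{Ker}\,p(u)^{k-1}+(\mathrm{Ker}\,p(u)^k\cap\mathrm{Im}\,p(u))\bigr)$, a vector space over $\mathbb{L}:=\mathbb{F}[t]/(p)$ (the class of $t$ acting through $u$). The Jordan number is $n_{p,k}(u):=\dim_{\mathbb{L}}V_{p,k}$. Hermitian invariants. Let $p\in\mathrm{Irr}_0(\mathbb{F})$ have degree $d$; equip $\mathbb{L}=\mathbb{F}[t]/(p)$ with the involution $x\mapsto x^\bullet$ taking the class of $q(t)$ to that of $q(-t)$. Let $e_p:\mathbb{L}\to\mathbb{F}$ be the $\mathbb{F}$-linear form with $e_p(\overline{1})=1$ and $e_p(\overline{t^i})=0$ for $1\le i\le d-1$. The form $(x,y)\mapsto b(x,p(u)^{k-1}[y])$ induces a non-degenerate $\mathbb{F}$-bilinear form $B$ on $V_{p,k}$, and $(b,u)_{p,k}$ is the unique map $B^{\mathbb{L}}:V_{p,k}^2\to\mathbb{L}$ such that $B(x,\lambda y)=e_p(\lambda B^{\mathbb{L}}(x,y))$ for all $\lambda\in\mathbb{L}$ and all $x,y$; it is a non-degenerate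 Hermitian form over $(\mathbb{L},\bullet)$. It is hyperbolic if its space has even dimension $2m$ and contains a totally isotropic subspace of dimension $m$ (the form on the zero space is hyperbolic). For $k\ge1$, $(b,u)_{t,k}$ is the non-degenerate bilinear form over $\mathbb{F}$ induced by $(x,y)\mapsto b(x,u^{k-1}(y))$ on $V_{t,k}$; it is symmetric when $k$ is odd. Witt-simplification. For a non-degenerate symmetric bilinear form $B$ over $\mathbb{F}$, $\nu(B)$ (Witt index) is the greatest dimension of a totally $B$-isotropic subspace and $\mathrm{rk}(B)$ is the dimension of its space; $B$ is the orthogonal sum of a hyperbolic form of rank $2\nu(B)$ and of a nonisotropic form, unique up to equivalence, called a nonisotropic part of $B$. $B$ Witt-simplifies $B'$ if every nonisotropic part of $B'$ is equivalent to a subform of $-B$ (restriction of $-B$ to a linear subspace); equivalently $\nu(B')+\nu(B'\bot B)\ge\mathrm{rk}(B')$. *)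

theory Defs
  imports "Jordan_Normal_Form.VS_Connect" "HOL-Algebra.QuotRing"
begin

section \<open>Forms on vector spaces\<close>

text \<open>
  The definitions of this section are stated over an arbitrary field record \<open>K\<close>, because they are
  used both for the base field and for the residue fields \<open>F[t]/(p)\<close>.
\<close>

definition bilinear_form ::
    "('k, 'm) ring_scheme \<Rightarrow> ('k, 'v, 'n) module_scheme \<Rightarrow> ('v \<Rightarrow> 'v \<Rightarrow> 'k) \<Rightarrow> bool" where
  "bilinear_form K V B \<longleftrightarrow>
     (\<forall>x\<in>carrier V. \<forall>y\<in>carrier V. B x y \<in> carrier K) \<and>
     (\<forall>x\<in>carrier V. \<forall>y\<in>carrier V. \<forall>z\<in>carrier V.
        B (x \<oplus>\<^bsub>V\<^esub> y) z = B x z \<oplus>\<^bsub>K\<^esub> B y z \<and> B z (x \<oplus>\<^bsub>V\<^esub> y) = B z x \<oplus>\<^bsub>K\<^esub> B z y) \<and>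
     (\<forall>c\<in>carrier K. \<forall>x\<in>carrier V. \<forall>y\<in>carrier V.
        B (c \<odot>\<^bsub>V\<^esub> x) y = c \<otimes>\<^bsub>K\<^esub> B x y \<and> B x (c \<odot>\<^bsub>V\<^esub> y) = c \<otimes>\<^bsub>K\<^esub> B x y)"

definition symmetric_form :: "('k, 'v, 'n) module_scheme \<Rightarrow> ('v \<Rightarrow> 'v \<Rightarrow> 'k) \<Rightarrow> bool" where
  "symmetric_form V B \<longleftrightarrow> (\<forall>x\<in>carrier V. \<forall>y\<in>carrier V. B x y = B y x)"

definition nondegenerate ::
    "('k, 'm) ring_scheme \<Rightarrow> ('k, 'v, 'n) module_scheme \<Rightarrow> ('v \<Rightarrow> 'v \<Rightarrow> 'k) \<Rightarrow> bool" where
  "nondegenerate K V B \<longleftrightarrow>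
     (\<forall>x\<in>carrier V. (\<forall>y\<in>carrier V. B x y = \<zero>\<^bsub>K\<^esub>) \<longrightarrow> x = \<zero>\<^bsub>V\<^esub>)"

definition totally_isotropic ::
    "('k, 'm) ring_scheme \<Rightarrow> ('k, 'v, 'n) module_scheme \<Rightarrow> ('v \<Rightarrow> 'v \<Rightarrow> 'k) \<Rightarrow> 'v set \<Rightarrow> bool" where
  "totally_isotropic K V B W \<longleftrightarrow>
     VectorSpace.subspace K W V \<and> (\<forall>x\<in>W. \<forall>y\<in>W. B x y = \<zero>\<^bsub>K\<^esub>)"

text \<open>Meant for non-degenerate forms, symmetric bilinear as well as Hermitian.\<close>

definition hyperbolic ::
    "('k, 'm) ring_scheme \<Rightarrow> ('k, 'v, 'n) module_scheme \<Rightarrow> ('v \<Rightarrow> 'v \<Rightarrow> 'k) \<Rightarrow> bool" where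
  "hyperbolic K V B \<longleftrightarrow>
     (\<exists>m. vectorspace.dim K V = 2 * m \<and>
          (\<exists>W. totally_isotropic K V B W \<and> vectorspace.dim K (V\<lparr>carrier := W\<rparr>) = m))"

definition nonisotropic ::
    "('k, 'm) ring_scheme \<Rightarrow> ('k, 'v, 'n) module_scheme \<Rightarrow> ('v \<Rightarrow> 'v \<Rightarrow> 'k) \<Rightarrow> bool" where
  "nonisotropic K V B \<longleftrightarrow> (\<forall>x\<in>carrier V. B x x = \<zero>\<^bsub>K\<^esub> \<longrightarrow> x = \<zero>\<^bsub>V\<^esub>)"

definition witt_index ::
    "('k, 'm) ring_scheme \<Rightarrow> ('k, 'v, 'n) module_scheme \<Rightarrow> ('v \<Rightarrow> 'v \<Rightarrow> 'k) \<Rightarrow> nat" where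
  "witt_index K V B =
     (GREATEST n. \<exists>W. totally_isotropic K V B W \<and> vectorspace.dim K (V\<lparr>carrier := W\<rparr>) = n)"

text \<open>
  The nonisotropic parts of a form, realised as the subspaces \<open>W\<close> carrying them: \<open>V\<close> is the
  orthogonal direct sum of \<open>W\<close> and of a subspace on which the form is hyperbolic.
\<close>

definition nonisotropic_part ::
    "('k, 'm) ring_scheme \<Rightarrow> ('k, 'v, 'n) module_scheme \<Rightarrow> ('v \<Rightarrow> 'v \<Rightarrow> 'k) \<Rightarrow> 'v set \<Rightarrow> bool" where
  "nonisotropic_part K V B W \<longleftrightarrow>
     VectorSpace.subspace K W V \<and> nonisotropic K (V\<lparr>carrier := W\<rparr>) B \<and>
     (\<exists>H. VectorSpace.subspace K H V \<and>
          H <+>\<^bsub>V\<^esub> W = carrier V \<and> H \<inter> W = {\<zero>\<^bsub>V\<^esub>} \<and>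
          (\<forall>x\<in>H. \<forall>y\<in>W. B x y = \<zero>\<^bsub>K\<^esub>) \<and>
          hyperbolic K (V\<lparr>carrier := H\<rparr>) B \<and>
          vectorspace.dim K (V\<lparr>carrier := H\<rparr>) = 2 * witt_index K V B)"

definition equivalent_forms ::
    "('k, 'm) ring_scheme \<Rightarrow> ('k, 'v, 'n) module_scheme \<Rightarrow> ('v \<Rightarrow> 'v \<Rightarrow> 'k) \<Rightarrow>
     ('k, 'w, 'l) module_scheme \<Rightarrow> ('w \<Rightarrow> 'w \<Rightarrow> 'k) \<Rightarrow> bool" where
  "equivalent_forms K V B V' B' \<longleftrightarrow>
     (\<exists>f. linear_map K V V' f \<and> bij_betw f (carrier V) (carrier V') \<and>
          (\<forall>x\<in>carrier V. \<forall>y\<in>carrier V. B' (f x) (f y) = B x y))"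

definition witt_simplifies ::
    "('k, 'm) ring_scheme \<Rightarrow> ('k, 'v, 'n) module_scheme \<Rightarrow> ('v \<Rightarrow> 'v \<Rightarrow> 'k) \<Rightarrow>
     ('k, 'w, 'l) module_scheme \<Rightarrow> ('w \<Rightarrow> 'w \<Rightarrow> 'k) \<Rightarrow> bool" where
  "witt_simplifies K V B V' B' \<longleftrightarrow>
     (\<forall>W. nonisotropic_part K V' B' W \<longrightarrow>
        (\<exists>U. VectorSpace.subspace K U V \<and>
             equivalent_forms K (V'\<lparr>carrier := W\<rparr>) B' (V\<lparr>carrier := U\<rparr>) (\<lambda>x y. \<ominus>\<^bsub>K\<^esub> B x y)))"

text \<open>
  External orthogonal direct sum of a family of forms; \<open>I\<close> may be infinite, hence the
  restriction to families of finite support.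
\<close>

definition direct_sum_space :: "'i set \<Rightarrow> ('i \<Rightarrow> ('k, 'v) module) \<Rightarrow> ('k, 'i \<Rightarrow> 'v) module" where
  "direct_sum_space I V =
     \<lparr>carrier = {f \<in> (\<Pi>\<^sub>E i\<in>I. carrier (V i)). finite {i \<in> I. f i \<noteq> \<zero>\<^bsub>V i\<^esub>}},
      mult = undefined, one = undefined,
      zero = (\<lambda>i\<in>I. \<zero>\<^bsub>V i\<^esub>),
      add = (\<lambda>f g. \<lambda>i\<in>I. f i \<oplus>\<^bsub>V i\<^esub> g i),
      smult = (\<lambda>c f. \<lambda>i\<in>I. c \<odot>\<^bsub>V i\<^esub> f i)\<rparr>"

definition orthogonal_sum ::
    "('k, 'm) ring_scheme \<Rightarrow> 'i set \<Rightarrow> ('i \<Rightarrow> ('k, 'v) module) \<Rightarrow> ('i \<Rightarrow> 'v \<Rightarrow> 'v \<Rightarrow> 'k) \<Rightarrow>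
     ('i \<Rightarrow> 'v) \<Rightarrow> ('i \<Rightarrow> 'v) \<Rightarrow> 'k" where
  "orthogonal_sum K I V B f g =
     (\<Oplus>\<^bsub>K\<^esub> i \<in> {i \<in> I. f i \<noteq> \<zero>\<^bsub>V i\<^esub>}. B i (f i) (g i))"


section \<open>Polynomials in an endomorphism\<close>

definition Irr :: "'f::field poly set" where
  "Irr = {p. Factorial_Ring.irreducible p \<and> lead_coeff p = 1}"

definition Irr0 :: "'f::field poly set" where
  "Irr0 = Irr \<inter> range (\<lambda>q. pcompose q (monom 1 2))"

definition poly_map :: "('f::field, 'v) module \<Rightarrow> ('v \<Rightarrow> 'v) \<Rightarrow> 'f poly \<Rightarrow> 'v \<Rightarrow> 'v" where
  "poly_map V u q x = (\<Oplus>\<^bsub>V\<^esub> i \<in> {..degree q}. coeff q i \<odot>\<^bsub>V\<^esub> (u ^^ i) x)"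

definition skew_selfadjoint :: "('f::field, 'v) module \<Rightarrow> ('v \<Rightarrow> 'v \<Rightarrow> 'f) \<Rightarrow> ('v \<Rightarrow> 'v) \<Rightarrow> bool" where
  "skew_selfadjoint V b u \<longleftrightarrow>
     linear_map class_ring V V u \<and> (\<forall>x\<in>carrier V. \<forall>y\<in>carrier V. b (u x) y = - b x (u y))"

definition square_zero :: "('f::field, 'v) module \<Rightarrow> ('v \<Rightarrow> 'v) \<Rightarrow> bool" where
  "square_zero V a \<longleftrightarrow> (\<forall>x\<in>carrier V. a (a x) = \<zero>\<^bsub>V\<^esub>)"

definition sum_of_two_skew_square_zero ::
    "('f::field, 'v) module \<Rightarrow> ('v \<Rightarrow> 'v \<Rightarrow> 'f) \<Rightarrow> ('v \<Rightarrow> 'v) \<Rightarrow> bool" where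
  "sum_of_two_skew_square_zero V b u \<longleftrightarrow>
     (\<exists>a1 a2. skew_selfadjoint V b a1 \<and> square_zero V a1 \<and>
              skew_selfadjoint V b a2 \<and> square_zero V a2 \<and>
              (\<forall>x\<in>carrier V. u x = a1 x \<oplus>\<^bsub>V\<^esub> a2 x))"


section \<open>The residue field\<close>

definition residue_field :: "'f::field poly \<Rightarrow> 'f poly set ring" where
  "residue_field p = class_ring Quot (PIdl\<^bsub>class_ring\<^esub> p)"

text \<open>
  The linear form \<open>e\<^sub>p\<close> with \<open>e\<^sub>p(1) = 1\<close> and \<open>e\<^sub>p(t\<^sup>i) = 0\<close> for \<open>1 \<le> i < degree p\<close>: the constant
  coefficient of the representative of degree \<open>< degree p\<close>.
\<close>

definition e_form :: "'f::field poly \<Rightarrow> 'f poly set \<Rightarrow> 'f" where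
  "e_form p c = coeff (THE r. r \<in> c \<and> degree r < degree p) 0"

lemma e_form_coset:
  fixes p q :: "'f::field poly"
  assumes "degree p > 0"
  shows "e_form p ((PIdl\<^bsub>class_ring\<^esub> p) +>\<^bsub>class_ring\<^esub> q) = coeff (q mod p) 0"
proof -
  let ?C = "(PIdl\<^bsub>class_ring\<^esub> p) +>\<^bsub>class_ring\<^esub> q"
  have mem: "r \<in> ?C \<longleftrightarrow> p dvd (r - q)" for r
    apply (auto simp: cgenideal_def a_r_coset_def' dvd_def)
    by (metis diff_add_cancel mult.commute)
  have "(THE r. r \<in> ?C \<and> degree r < degree p) = q mod p"
  proof (rule the_equality)
    show "q mod p \<in> ?C \<and> degree (q mod p) < degree p"
      unfolding mem using assms degree_mod_less'[of p q]
      by (metis degree_0 less_irrefl dvd_diff_commute dvd_minus_mod)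
  next
    fix r assume "r \<in> ?C \<and> degree r < degree p"
    then show "r = q mod p" unfolding mem by (metis mod_eq_dvd_iff mod_poly_less)
  qed
  then show ?thesis by (simp add: e_form_def)
qed

lemma e_form_monom:
  fixes p :: "'f::field poly"
  assumes "i < degree p"
  shows "e_form p ((PIdl\<^bsub>class_ring\<^esub> p) +>\<^bsub>class_ring\<^esub> monom 1 i) = (if i = 0 then 1 else 0)"
  using assms by (simp add: e_form_coset mod_poly_less degree_monom_eq)


section \<open>Jordan numbers and the invariants of a pair \<open>(b, u)\<close>\<close>

definition jordan_numerator ::
    "('f::field, 'v) module \<Rightarrow> ('v \<Rightarrow> 'v) \<Rightarrow> 'f poly \<Rightarrow> nat \<Rightarrow> 'v set" where
  "jordan_numerator V u p k = a_kernel V V (poly_map V u p ^^ k)"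

definition jordan_denominator ::
    "('f::field, 'v) module \<Rightarrow> ('v \<Rightarrow> 'v) \<Rightarrow> 'f poly \<Rightarrow> nat \<Rightarrow> 'v set" where
  "jordan_denominator V u p k =
     a_kernel V V (poly_map V u p ^^ (k - 1)) <+>\<^bsub>V\<^esub>
     (a_kernel V V (poly_map V u p ^^ k) \<inter> poly_map V u p ` carrier V)"

text \<open>
  \<open>V\<^bsub>p,k\<^esub>\<close>, whose elements are cosets, as a vector space over the base field and over the
  residue field. In both cases the scalar action is that on representatives; the unions are over
  cosets that all coincide (compare \<^const>\<open>rcoset_mult\<close>).
\<close>

definition jordan_space ::
    "('f::field, 'v) module \<Rightarrow> ('v \<Rightarrow> 'v) \<Rightarrow> 'f poly \<Rightarrow> nat \<Rightarrow> ('f, 'v set) module" where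
  "jordan_space V u p k =
     \<lparr>carrier = a_rcosets\<^bsub>V\<lparr>carrier := jordan_numerator V u p k\<rparr>\<^esub> (jordan_denominator V u p k),
      mult = undefined, one = undefined,
      zero = jordan_denominator V u p k,
      add = set_add V,
      smult = (\<lambda>c X. \<Union>x\<in>X. jordan_denominator V u p k +>\<^bsub>V\<^esub> (c \<odot>\<^bsub>V\<^esub> x))\<rparr>"

definition jordan_residue_space ::
    "('f::field, 'v) module \<Rightarrow> ('v \<Rightarrow> 'v) \<Rightarrow> 'f poly \<Rightarrow> nat \<Rightarrow> ('f poly set, 'v set) module" where
  "jordan_residue_space V u p k =
     \<lparr>carrier = a_rcosets\<^bsub>V\<lparr>carrier := jordan_numerator V u p k\<rparr>\<^esub> (jordan_denominator V u p k),
      mult = undefined, one = undefined,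
      zero = jordan_denominator V u p k,
      add = set_add V,
      smult = (\<lambda>c X. \<Union>q\<in>c. \<Union>x\<in>X. jordan_denominator V u p k +>\<^bsub>V\<^esub> poly_map V u q x)\<rparr>"

definition jordan_number ::
    "('f::field, 'v) module \<Rightarrow> ('v \<Rightarrow> 'v) \<Rightarrow> 'f poly \<Rightarrow> nat \<Rightarrow> nat" where
  "jordan_number V u p k = vectorspace.dim (residue_field p) (jordan_residue_space V u p k)"

text \<open>
  The form on \<open>V\<^bsub>p,k\<^esub>\<close> induced by \<open>(x, y) \<mapsto> b x (p(u)\<^sup>k\<^sup>-\<^sup>1 y)\<close>. With \<open>p = t\<close> this is the
  invariant \<open>(b, u)\<^bsub>t,k\<^esub>\<close>.
\<close>

definition induced_form ::
    "('f::field, 'v) module \<Rightarrow> ('v \<Rightarrow> 'v \<Rightarrow> 'f) \<Rightarrow> ('v \<Rightarrow> 'v) \<Rightarrow> 'f poly \<Rightarrow> nat \<Rightarrow>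
     'v set \<Rightarrow> 'v set \<Rightarrow> 'f" where
  "induced_form V b u p k X Y =
     (THE c. \<forall>x\<in>X. \<forall>y\<in>Y. b x ((poly_map V u p ^^ (k - 1)) y) = c)"

text \<open>
  The form \<open>(b, u)\<^bsub>p,k\<^esub>\<close>, whose defining condition determines it pointwise. It is Hermitian for the
  involution \<open>q(t) \<mapsto> q(-t)\<close> of the residue field; the involution enters neither the definition of the
  form nor that of hyperbolicity.
\<close>

definition hermitian_invariant ::
    "('f::field, 'v) module \<Rightarrow> ('v \<Rightarrow> 'v \<Rightarrow> 'f) \<Rightarrow> ('v \<Rightarrow> 'v) \<Rightarrow> 'f poly \<Rightarrow> nat \<Rightarrow>
     'v set \<Rightarrow> 'v set \<Rightarrow> 'f poly set" where
  "hermitian_invariant V b u p k X Y =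
     (THE z. z \<in> carrier (residue_field p) \<and>
        (\<forall>c\<in>carrier (residue_field p).
           induced_form V b u p k X (c \<odot>\<^bsub>jordan_residue_space V u p k\<^esub> Y) =
           e_form p (c \<otimes>\<^bsub>residue_field p\<^esub> z)))"

abbreviation t_space ::
    "('f::field, 'v) module \<Rightarrow> ('v \<Rightarrow> 'v) \<Rightarrow> nat \<Rightarrow> ('f, 'v set) module" where
  "t_space V u i \<equiv> jordan_space V u [:0, 1:] (2 * i + 1)"

definition signed_t_form ::
    "('f::field, 'v) module \<Rightarrow> ('v \<Rightarrow> 'v \<Rightarrow> 'f) \<Rightarrow> ('v \<Rightarrow> 'v) \<Rightarrow> nat \<Rightarrow>
     'v set \<Rightarrow> 'v set \<Rightarrow> 'f" where
  "signed_t_form V b u i X Y = (- 1) ^ i * induced_form V b u [:0, 1:] (2 * i + 1) X Y"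

end

theory Submission
  imports Defs "HOL-Library.Function_Algebras"
begin

text \<open>If \<open>u = a + a'\<close> is a decomposition as in the theorem, then \<open>v = a - a'\<close> is skew,
  anticommutes with \<open>u\<close> and satisfies \<open>v\<^sup>2 = - u\<^sup>2\<close>, and every such \<open>v\<close> yields a decomposition.
  Necessity follows by counting dimensions with maximal isotropic subspaces stable under \<open>u\<close>, and
  under \<open>u\<close> and \<open>v\<close>. For sufficiency one splits off a non-degenerate subspace with such a \<open>v\<close>, generated
  as an \<open>F[t]\<close>-module by two dual vectors, and by a cancellation argument the conditions pass to its
  orthogonal complement. Off \<open>t\<close>, such a pair comes from an isotropic vector made isotropic for the
  whole cyclic module by Hensel lifting. For \<open>p = t\<close> the anisotropic vectors of top odd height
  \<open>2K + 1\<close> remain: condition (iii) for \<open>k = K - 1\<close> provides an anti-isometric partner of height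
  \<open>2K - 1\<close>, and \<open>v\<close> exchanges the two.\<close>

section \<open>Bilinear forms on finite-dimensional subspaces\<close>

text \<open>The obstacle is cancellation: after a pairable piece is split off, the three conditions
  must hold again for the complement, and neither quotients nor Witt classes restrict well. Each of
  (i) and (iii) is therefore recast as the existence of a subspace equal to its own orthogonal for a
  possibly degenerate form. Such a subspace contains the radical, so no quotient is formed, and it
  descends from a space to any subspace representing the orthogonal of an isotropic \<open>S\<close>
  modulo \<open>S\<close>; this replaces Witt cancellation. The signs in (iii) come from restricting
  b to Im u^k: modulo its radical, this form is the orthogonal sum of the forms (-1)^i
  (b,u)_{t,2i+1} with i >= k, because moving u^i across b costs (-1)^i. Witt-simplification at k
  then means that some space between Im u^(k+1) and Im u^k has a subspace equal to its own
  orthogonal. The parity in (ii) has another source: when p(t) and p(-t) are coprime, Ker p(u)^k is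
  totally isotropic, and only a second block of the same size yields a vector whose cyclic module is
  isotropic and has an even annihilator.\<close>

locale lin_space = vector_space scale
  for scale :: "'a::field \<Rightarrow> 'b::ab_group_add \<Rightarrow> 'b"  (infixr \<open>*s\<close> 75)
begin

text \<open>Finiteness is attached to the subspace and not to the type of vectors: the type used in
  the end, scalar functions on the elements of the given space, may be infinite-dimensional.\<close>

definition fd :: "'b set \<Rightarrow> bool" where
  "fd S \<longleftrightarrow> subspace S \<and> (\<exists>B. finite B \<and> S \<subseteq> span B)"

definition bilform :: "('b \<Rightarrow> 'b \<Rightarrow> 'a) \<Rightarrow> bool" where
  "bilform \<beta> \<longleftrightarrow> (\<forall>x y z. \<beta> (x + y) z = \<beta> x z + \<beta> y z \<and> \<beta> z (x + y) = \<beta> z x + \<beta> z y) \<and>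
     (\<forall>c x y. \<beta> (c *s x) y = c * \<beta> x y \<and> \<beta> x (c *s y) = c * \<beta> x y)"

definition ssum :: "'b set \<Rightarrow> 'b set \<Rightarrow> 'b set" where
  "ssum S T = {x + y |x y. x \<in> S \<and> y \<in> T}"

lemma bilformD:
  assumes "bilform \<beta>"
  shows bilform_add_left: "\<beta> (x + y) z = \<beta> x z + \<beta> y z"
    and bilform_add_right: "\<beta> z (x + y) = \<beta> z x + \<beta> z y"
    and bilform_scale_left: "\<beta> (c *s x) y = c * \<beta> x y"
    and bilform_scale_right: "\<beta> x (c *s y) = c * \<beta> x y"
    and bilform_zero_left: "\<beta> 0 y = 0"
    and bilform_zero_right: "\<beta> x 0 = 0"
    and bilform_minus_left: "\<beta> (- x) y = - \<beta> x y"
    and bilform_minus_right: "\<beta> x (- y) = - \<beta> x y"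
    and bilform_diff_left: "\<beta> (x - y) z = \<beta> x z - \<beta> y z"
    and bilform_diff_right: "\<beta> z (x - y) = \<beta> z x - \<beta> z y"
proof -
  have al: "\<beta> (x + y) z = \<beta> x z + \<beta> y z" for x y z using assms by (simp add: bilform_def)
  have ar: "\<beta> z (x + y) = \<beta> z x + \<beta> z y" for x y z using assms by (simp add: bilform_def)
  have sl: "\<beta> (c *s x) y = c * \<beta> x y" for c x y using assms by (simp add: bilform_def)
  have sr: "\<beta> x (c *s y) = c * \<beta> x y" for c x y using assms by (simp add: bilform_def)
  have ml: "\<beta> (- x) y = - \<beta> x y" for x y using sl[of "- 1" x y] by simp
  have mr: "\<beta> x (- y) = - \<beta> x y" for x y using sr[of x "- 1" y] by simp
  show "\<beta> (x + y) z = \<beta> x z + \<beta> y z" by (rule al)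
  show "\<beta> z (x + y) = \<beta> z x + \<beta> z y" by (rule ar)
  show "\<beta> (c *s x) y = c * \<beta> x y" by (rule sl)
  show "\<beta> x (c *s y) = c * \<beta> x y" by (rule sr)
  show "\<beta> 0 y = 0" using sl[of 0 0 y] by simp
  show "\<beta> x 0 = 0" using sr[of x 0 0] by simp
  show "\<beta> (- x) y = - \<beta> x y" by (rule ml)
  show "\<beta> x (- y) = - \<beta> x y" by (rule mr)
  show "\<beta> (x - y) z = \<beta> x z - \<beta> y z" using al[of x "- y" z] ml by simp
  show "\<beta> z (x - y) = \<beta> z x - \<beta> z y" using ar[of z x "- y"] mr by simp
qed

lemma fd_subspace: "fd S \<Longrightarrow> subspace S" by (simp add: fd_def)

lemma fd_mono: "fd T \<Longrightarrow> subspace S \<Longrightarrow> S \<subseteq> T \<Longrightarrow> fd S" unfolding fd_def by blast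

lemma fd_span: "finite B \<Longrightarrow> fd (span B)" unfolding fd_def by auto

lemma fd_basis:
  assumes "fd S"
  obtains B where "finite B" "independent B" "B \<subseteq> S" "span B = S" "card B = dim S"
proof -
  obtain B where B: "B \<subseteq> S" "independent B" "S \<subseteq> span B" "card B = dim S"
    using basis_exists by blast
  obtain C where "finite C" "S \<subseteq> span C" using assms unfolding fd_def by blast
  then have "finite B" using independent_span_bound[of C B] B by auto
  moreover have "span B = S" using B assms fd_subspace span_minimal by blast
  ultimately show thesis using that B by blast
qed

lemma span_insert_span: "span (insert x (span S)) = span (insert x S)" by (simp add: span_insert span_span)

lemma fd_insert:
  assumes "fd S" shows "fd (span (insert x S))"
proof -
  obtain B where B: "finite B" "span B = S" using fd_basis[OF assms] by metis
  then show ?thesis using span_insert_span[of x B] fd_span[of "insert x B"] by auto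
qed

lemma dim_insert_notin:
  assumes "fd S" "x \<notin> S" shows "dim (span (insert x S)) = dim S + 1"
proof -
  obtain B where B: "finite B" "independent B" "B \<subseteq> S" "span B = S" "card B = dim S"
    using fd_basis[OF assms(1)] by metis
  have x: "x \<notin> span B" using B assms by simp
  then have ind: "independent (insert x B)" using B independent_insertI by blast
  have "span (insert x S) = span (insert x B)" using span_insert_span[of x B] B by simp
  moreover have "x \<notin> B" using x span_base by blast
  ultimately show ?thesis using dim_span_eq_card_independent[OF ind] B by simp
qed

lemma dim_mono_fd:
  assumes "fd T" "subspace S" "S \<subseteq> T" shows "dim S \<le> dim T"
proof -
  obtain B where B: "finite B" "independent B" "B \<subseteq> S" "span B = S" "card B = dim S"
    using fd_basis[OF fd_mono[OF assms]] by metis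
  obtain C where C: "finite C" "independent C" "C \<subseteq> T" "span C = T" "card C = dim T"
    using fd_basis[OF assms(1)] by metis
  have "B \<subseteq> span C" using B(3) C(4) assms(3) by simp
  then show ?thesis using independent_span_bound[of C B] B(2,5) C(1,5) by simp
qed

lemma dim_eq_fd:
  assumes "fd T" "subspace S" "S \<subseteq> T" "dim S \<ge> dim T" shows "S = T"
proof (rule ccontr)
  assume "S \<noteq> T"
  then obtain x where x: "x \<in> T" "x \<notin> S" using assms by blast
  have "span (insert x S) \<subseteq> T" using x assms fd_subspace span_minimal by blast
  then have "dim S + 1 \<le> dim T" using dim_mono_fd[OF assms(1) subspace_span, of "insert x S"]
      dim_insert_notin[OF fd_mono[OF assms(1-3)] x(2)] by simp
  with assms show False by simp
qed

text \<open>Dimensions are bounded by that of \<open>T\<close>, so a largest one occurs, and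
  \<open>dim_eq_fd\<close> makes it maximal for inclusion. Inclusion drives the enlargement
  arguments; the bound on dimensions identifies the Witt index.\<close>

lemma max_dim_exists:
  assumes "fd T" "P S0" "\<And>S. P S \<Longrightarrow> subspace S \<and> S \<subseteq> T"
  shows "\<exists>M. P M \<and> (\<forall>M'. P M' \<longrightarrow> M \<subseteq> M' \<longrightarrow> M' = M) \<and> (\<forall>M'. P M' \<longrightarrow> dim M' \<le> dim M)"
proof -
  obtain M where M: "P M" "\<And>M'. P M' \<Longrightarrow> dim M' \<le> dim M"
  proof -
    have "\<exists>M. P M \<and> (\<forall>M'. P M' \<longrightarrow> dim M' \<le> dim M)"
    proof (rule ccontr)
      assume no: "\<not> ?thesis"
      have "\<exists>M. P M \<and> n \<le> dim M" for n
      proof (induction n)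
        case 0
        then show ?case using assms(2) by auto
      next
        case (Suc n)
        then obtain M where M: "P M" "n \<le> dim M" by blast
        with no obtain M' where "P M'" "\<not> dim M' \<le> dim M" by blast
        then show ?case using M by (intro exI[of _ M']) simp
      qed
      then obtain M where "P M" "Suc (dim T) \<le> dim M" by blast
      then show False using assms dim_mono_fd[of T M] by fastforce
    qed
    then show thesis using that by blast
  qed
  moreover have "M' = M" if "P M'" "M \<subseteq> M'" for M'
  proof -
    have "fd M'" "subspace M" using assms(3)[OF that(1)] assms(3)[OF M(1)] fd_mono[OF assms(1)] by auto
    then show ?thesis using dim_eq_fd[of M' M] M(2)[OF that(1)] that(2) by simp
  qed
  ultimately show ?thesis by blast
qed

lemma mem_span_insert:
  assumes "subspace S" shows "z \<in> span (insert x S) \<longleftrightarrow> (\<exists>c. \<exists>s\<in>S. z = c *s x + s)"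
proof
  assume "z \<in> span (insert x S)"
  moreover have "span S = S" using assms span_eq_iff by blast
  ultimately have "\<exists>c. z - c *s x \<in> S" unfolding span_insert by simp
  then obtain c where "z - c *s x \<in> S" by blast
  moreover have "z = c *s x + (z - c *s x)" by simp
  ultimately show "\<exists>c. \<exists>s\<in>S. z = c *s x + s" by blast
next
  assume "\<exists>c. \<exists>s\<in>S. z = c *s x + s"
  then show "z \<in> span (insert x S)" by (auto intro!: span_add span_scale intro: span_base)
qed

lemma subspace_ssum: "subspace S \<Longrightarrow> subspace T \<Longrightarrow> subspace (ssum S T)"
  unfolding ssum_def by (rule subspace_sums)

lemma ssum_mem: "x \<in> S \<Longrightarrow> y \<in> T \<Longrightarrow> x + y \<in> ssum S T" unfolding ssum_def by blast

lemma ssum_upper: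
  assumes "subspace S" "subspace T" shows "S \<subseteq> ssum S T" "T \<subseteq> ssum S T"
  using ssum_mem[of _ S 0 T] ssum_mem[of 0 S _ T] assms subspace_0 by fastforce+

lemma ssum_least: "subspace U \<Longrightarrow> S \<subseteq> U \<Longrightarrow> T \<subseteq> U \<Longrightarrow> ssum S T \<subseteq> U"
  unfolding ssum_def using subspace_add by blast

lemma fd_ssum:
  assumes "fd S" "fd T" shows "fd (ssum S T)"
proof -
  obtain B where B: "finite B" "span B = S" using fd_basis[OF assms(1)] by metis
  obtain C where C: "finite C" "span C = T" using fd_basis[OF assms(2)] by metis
  have "ssum S T = span (B \<union> C)" unfolding ssum_def using B C span_Un[of B C] by auto
  then show ?thesis using B C fd_span[of "B \<union> C"] by auto
qed

lemma dim_ssum: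
  assumes "fd S" "fd T" "S \<inter> T = {0}" shows "dim (ssum S T) = dim S + dim T"
proof -
  obtain C where C: "finite C" "independent C" "C \<subseteq> T" "span C = T" "card C = dim T"
    using fd_basis[OF assms(2)] by metis
  have "dim (ssum S (span A)) = dim S + card A" if "A \<subseteq> C" for A
    using finite_subset[OF that C(1)] that
  proof (induction A rule: finite_induct)
    case empty
    then show ?case unfolding ssum_def by simp
  next
    case (insert a A)
    have "ssum S (span A) = span (S \<union> A)" for A
      unfolding ssum_def span_Un span_eq_iff[THEN iffD2, OF fd_subspace[OF assms(1)]] ..
    then have eq: "ssum S (span (insert a A)) = span (insert a (ssum S (span A)))"
      by (simp add: span_insert_span)
    have "a \<notin> ssum S (span A)"
    proof
      assume "a \<in> ssum S (span A)"
      then obtain s t where st: "a = s + t" "s \<in> S" "t \<in> span A" unfolding ssum_def by blast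
      have "t \<in> T" "a \<in> T" using st(3) insert.prems C span_mono by blast+
      then have "s \<in> T" using st subspace_diff[OF fd_subspace[OF assms(2)], of a t] by simp
      then have "s = 0" using assms(3) st by blast
      then have "a \<in> span A" using st by simp
      moreover have "A \<subseteq> C - {a}" using insert by blast
      ultimately have "a \<in> span (C - {a})" using span_mono by blast
      then show False using C(2) insert.prems unfolding dependent_def by blast
    qed
    moreover have "fd (ssum S (span A))" using assms(1) fd_ssum fd_span insert.hyps(1) by blast
    ultimately show ?case using insert eq dim_insert_notin by simp
  qed
  then show ?thesis using C by auto
qed

text \<open>A functional vanishing wherever finitely many others vanish is a combination of them.
  \<open>Y\<close> varies in the induction because a new \<open>e\<close> is handled by restricting
  to its kernel in \<open>Y\<close>.\<close>

lemma dual_span: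
  assumes \<beta>: "bilform \<beta>" and "finite B" and "subspace Y"
    and "\<And>y. y \<in> Y \<Longrightarrow> (\<forall>e\<in>B. \<beta> e y = 0) \<Longrightarrow> \<beta> x y = 0"
  shows "\<exists>m\<in>span B. \<forall>y\<in>Y. \<beta> x y = \<beta> m y" using assms(2-4)
proof (induction B arbitrary: Y rule: finite_induct)
  case empty
  then show ?case by (auto simp: bilformD[OF \<beta>])
next
  case (insert e B)
  let ?Y = "{y\<in>Y. \<beta> e y = 0}"
  have sub: "subspace ?Y" using insert.prems(1) unfolding subspace_def by (auto simp: bilformD[OF \<beta>])
  have "\<exists>m\<in>span B. \<forall>y\<in>?Y. \<beta> x y = \<beta> m y"
    by (rule insert.IH[OF sub]) (use insert.prems in auto)
  then obtain m where m: "m \<in> span B" "\<forall>y\<in>?Y. \<beta> x y = \<beta> m y" by blast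
  have mi: "m \<in> span (insert e B)" using m span_mono[of B "insert e B"] by blast
  show ?case
  proof (cases "\<forall>y\<in>Y. \<beta> e y = 0")
    case True
    then show ?thesis using m mi by blast
  next
    case False
    then obtain y1 where y1: "y1 \<in> Y" "\<beta> e y1 \<noteq> 0" by blast
    \<comment> \<open>Chosen so that \<open>m + c *s e\<close> agrees with \<open>x\<close> at
      \<open>y1\<close>; every vector of \<open>Y\<close> is a multiple of \<open>y1\<close> modulo
      the kernel of \<open>e\<close>.\<close>
    define c where "c = (\<beta> x y1 - \<beta> m y1) / \<beta> e y1"
    have "\<beta> x y = \<beta> (m + c *s e) y" if "y \<in> Y" for y
    proof -
      define k where "k = \<beta> e y / \<beta> e y1"
      have "y - k *s y1 \<in> ?Y" using that y1 insert.prems(1)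
        by (simp add: subspace_diff subspace_scale bilformD[OF \<beta>] k_def)
      then have "\<beta> x (y - k *s y1) = \<beta> m (y - k *s y1)" using m by blast
      then show ?thesis using y1 by (simp add: bilformD[OF \<beta>] c_def k_def field_simps)
    qed
    moreover have "m + c *s e \<in> span (insert e B)" using mi by (simp add: span_add span_scale span_base)
    ultimately show ?thesis by blast
  qed
qed

text \<open>Double orthogonality, stated as an equality of functionals on \<open>Y\<close>:
  \<open>x\<close> itself may lie outside \<open>M\<close>, and differs from a member of
  \<open>M\<close> by something orthogonal to \<open>Y\<close>. This form survives degenerate
  restrictions of b, which is how it is used throughout.\<close>

lemma perp_perp:
  assumes "bilform \<beta>" "fd M" "subspace Y"
    and "\<And>y. y \<in> Y \<Longrightarrow> (\<forall>m\<in>M. \<beta> m y = 0) \<Longrightarrow> \<beta> x y = 0"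
  shows "\<exists>m\<in>M. \<forall>y\<in>Y. \<beta> x y = \<beta> m y"
proof -
  obtain B where B: "finite B" "B \<subseteq> M" "span B = M" using fd_basis[OF assms(2)] by metis
  have "\<beta> x y = 0" if "y \<in> Y" "\<forall>e\<in>B. \<beta> e y = 0" for y
  proof (rule assms(4)[OF that(1)])
    have "subspace {m. \<beta> m y = 0}" unfolding subspace_def by (auto simp: bilformD[OF assms(1)])
    moreover have "B \<subseteq> {m. \<beta> m y = 0}" using that by blast
    ultimately have "span B \<subseteq> {m. \<beta> m y = 0}" by (rule span_minimal[rotated])
    then show "\<forall>m\<in>M. \<beta> m y = 0" using B by blast
  qed
  then show ?thesis using dual_span[OF assms(1) B(1) assms(3), of x] B(3) by blast
qed

text \<open>A basis of \<open>X\<close> receives a dual family in \<open>Y\<close>, and the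
  representing vector is the corresponding combination.\<close>

lemma functional_rep:
  assumes \<beta>: "bilform \<beta>" and X: "fd X" and Y: "subspace Y"
    and nd: "\<And>x. x \<in> X \<Longrightarrow> (\<forall>y\<in>Y. \<beta> x y = 0) \<Longrightarrow> x = 0"
    and add: "\<And>x x'. x \<in> X \<Longrightarrow> x' \<in> X \<Longrightarrow> f (x + x') = f x + f x'"
    and sc: "\<And>c x. x \<in> X \<Longrightarrow> f (c *s x) = c * f x"
  shows "\<exists>y\<in>Y. \<forall>x\<in>X. \<beta> x y = f x"
proof -
  obtain B where B: "finite B" "independent B" "B \<subseteq> X" "span B = X" using fd_basis[OF X] by metis
  \<comment> \<open>If no such \<open>y\<close> existed, \<open>e\<close> would vanish wherever the
    other basis vectors do, hence agree on \<open>Y\<close> with a combination of them; by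
    \<open>nd\<close> it would equal that combination, against independence.\<close>
  have "\<exists>y\<in>Y. \<beta> e y = 1 \<and> (\<forall>e'\<in>B - {e}. \<beta> e' y = 0)" if e: "e \<in> B" for e
  proof (rule ccontr)
    assume no: "\<not> ?thesis"
    have "\<beta> e y = 0" if "y \<in> Y" "\<forall>e'\<in>B - {e}. \<beta> e' y = 0" for y
    proof (rule ccontr)
      assume "\<beta> e y \<noteq> 0"
      then have "(1 / \<beta> e y) *s y \<in> Y \<and> \<beta> e ((1 / \<beta> e y) *s y) = 1 \<and>
          (\<forall>e'\<in>B - {e}. \<beta> e' ((1 / \<beta> e y) *s y) = 0)"
        using that Y by (simp add: bilformD[OF \<beta>] subspace_scale)
      with no show False by blast
    qed
    then obtain m where m: "m \<in> span (B - {e})" "\<forall>y\<in>Y. \<beta> e y = \<beta> m y"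
      using dual_span[OF \<beta> _ Y, of "B - {e}" e] B by auto
    have "m \<in> X" using m B span_mono[of "B - {e}" B] by blast
    then have "e - m \<in> X" using e B X subspace_diff fd_subspace by blast
    then have "e = m" using nd[of "e - m"] m by (simp add: bilformD[OF \<beta>])
    with m e B show False unfolding dependent_def by blast
  qed
  then obtain d where d: "\<And>e. e \<in> B \<Longrightarrow> d e \<in> Y \<and> \<beta> e (d e) = 1 \<and> (\<forall>e'\<in>B - {e}. \<beta> e' (d e) = 0)"
    by metis
  define y where "y = (\<Sum>e\<in>B. f e *s d e)"
  have yY: "y \<in> Y" unfolding y_def using d Y by (intro subspace_sum) (auto simp: subspace_scale)
  have bs: "\<beta> x (\<Sum>e\<in>A. g e) = (\<Sum>e\<in>A. \<beta> x (g e))" for x A and g :: "'b \<Rightarrow> 'b"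
    by (induction A rule: infinite_finite_induct) (auto simp: bilformD[OF \<beta>])
  have eB: "\<beta> e y = f e" if "e \<in> B" for e
  proof -
    have "\<beta> e y = (\<Sum>e'\<in>B. f e' * \<beta> e (d e'))" unfolding y_def bs by (simp add: bilformD[OF \<beta>])
    also have "\<dots> = (\<Sum>e'\<in>B. if e' = e then f e else 0)" using d that by (intro sum.cong) auto
    also have "\<dots> = f e" using B that by simp
    finally show ?thesis .
  qed
  have f0: "f 0 = 0" using sc[of 0 0] fd_subspace[OF X] subspace_0 by auto
  have "subspace {x\<in>X. \<beta> x y = f x}"
    using fd_subspace[OF X] unfolding subspace_def by (auto simp: bilformD[OF \<beta>] add sc f0)
  moreover have "B \<subseteq> {x\<in>X. \<beta> x y = f x}" using B eB by auto
  ultimately have "span B \<subseteq> {x\<in>X. \<beta> x y = f x}" by (rule span_minimal[rotated])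
  then have "X \<subseteq> {x\<in>X. \<beta> x y = f x}" using B by simp
  then show ?thesis using yY by blast
qed

lemma complement_exists:
  assumes X: "fd X" and D: "subspace D" "D \<subseteq> X"
  shows "\<exists>C. subspace C \<and> C \<subseteq> X \<and> C \<inter> D = {0} \<and> ssum C D = X"
proof -
  define P where "P C \<longleftrightarrow> subspace C \<and> C \<subseteq> X \<and> C \<inter> D = {0}" for C
  have sX: "subspace X" by (rule fd_subspace[OF X])
  have P0: "P {0}" using sX D by (auto simp: P_def subspace_0)
  have "\<exists>M. P M \<and> (\<forall>M'. P M' \<longrightarrow> M \<subseteq> M' \<longrightarrow> M' = M) \<and> (\<forall>M'. P M' \<longrightarrow> dim M' \<le> dim M)"
    by (rule max_dim_exists[of X P "{0}", OF X P0]) (simp add: P_def)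
  then obtain C where PC: "P C" and Cmax: "\<forall>C'. P C' \<longrightarrow> C \<subseteq> C' \<longrightarrow> C' = C"
    by (elim exE conjE) (rule that)
  have C: "subspace C \<and> C \<subseteq> X \<and> C \<inter> D = {0}" using PC by (simp only: P_def)
  have "X \<subseteq> ssum C D"
  proof
    fix x assume x: "x \<in> X"
    show "x \<in> ssum C D"
    proof (rule ccontr)
      assume nx: "x \<notin> ssum C D"
      let ?C = "span (insert x C)"
      have "?C \<subseteq> X" using x C sX by (intro span_minimal) auto
      moreover have "?C \<inter> D = {0}"
      proof (intro equalityI subsetI)
        fix z assume z: "z \<in> ?C \<inter> D"
        then obtain c s where cs: "s \<in> C" "z = c *s x + s" using C by (auto simp: mem_span_insert)
        have "c = 0"
        proof (rule ccontr)
          assume c: "c \<noteq> 0"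
          have "c *s x = - s + z" using cs by simp
          then have "x = inverse c *s (- s + z)" using c by (metis scale_scale left_inverse scale_one)
          moreover have "- s + z \<in> ssum C D" using cs z C by (intro ssum_mem) (auto simp: subspace_neg)
          ultimately show False using nx subspace_scale[OF subspace_ssum] C D by metis
        qed
        then show "z \<in> {0}" using cs z C by auto
      qed (use D in \<open>auto simp: subspace_0\<close>)
      ultimately have "P ?C" by (simp add: P_def)
      then have "?C = C" using Cmax span_superset[of "insert x C"] by blast
      then have "x \<in> C" using span_base[of x "insert x C"] by simp
      then show False using nx ssum_upper(1) C D(1) by blast
    qed
  qed
  then have "ssum C D = X" using ssum_least[OF sX _ D(2)] C by blast
  then show ?thesis using C by blast
qed

lemma dim_zero: "dim {0} = 0"
  by (metis span_empty dim_span dim_eq_card_independent independent_empty card.empty)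

text \<open>A complement \<open>W\<close> of the radical part in \<open>M\<close> imposes
  independent conditions on \<open>X\<close>, while the radical part imposes none; counting is by
  induction along a basis of \<open>W\<close>.\<close>

lemma dim_perp:
  assumes \<beta>: "bilform \<beta>" and X: "fd X" and M: "subspace M" "M \<subseteq> X"
  shows "dim {x\<in>X. \<forall>m\<in>M. \<beta> m x = 0} + dim M = dim X + dim {m\<in>M. \<forall>x\<in>X. \<beta> m x = 0}"
proof -
  let ?P = "\<lambda>M. {x\<in>X. \<forall>m\<in>M. \<beta> m x = 0}" and ?R = "{m\<in>M. \<forall>x\<in>X. \<beta> m x = 0}"
  have sX: "subspace X" using X fd_subspace by blast
  have fM: "fd M" by (rule fd_mono[OF X M])
  have sR: "subspace ?R" using M(1) unfolding subspace_def by (auto simp: bilformD[OF \<beta>])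
  have RM: "?R \<subseteq> M" by blast
  obtain W where W: "subspace W" "W \<subseteq> M" "W \<inter> ?R = {0}" "ssum W ?R = M"
    using complement_exists[OF fM sR RM] by (elim exE conjE) (rule that)
  have fW: "fd W" by (rule fd_mono[OF fM W(1,2)])
  obtain C where C: "finite C" "independent C" "C \<subseteq> W" "span C = W" using fd_basis[OF fW] by metis
  have "dim (?P (span B)) + dim (span B) = dim X" if "B \<subseteq> C" for B
    using finite_subset[OF that C(1)] that
  proof (induction B rule: finite_induct)
    case empty
    then show ?case by (simp add: bilformD[OF \<beta>] dim_zero)
  next
    case (insert e B)
    let ?S = "span B" and ?S' = "span (insert e B)"
    have fS: "fd ?S" using insert fd_span by blast
    have "B \<subseteq> C - {e}" "e \<in> C" using insert by auto
    then have eS: "e \<notin> ?S" using C(2) span_mono[of B "C - {e}"] unfolding dependent_def by blast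
    have SW: "?S \<subseteq> W" "e \<in> W" using insert.prems C span_mono[of B C] by auto
    \<comment> \<open>The condition given by \<open>e\<close> is new: otherwise \<open>e\<close>
      would agree on \<open>X\<close> with some \<open>m\<close> in the earlier span, and
      \<open>e - m\<close> would be a radical vector inside \<open>W\<close>.\<close>
    have "\<exists>y\<in>X. (\<forall>m\<in>?S. \<beta> m y = 0) \<and> \<beta> e y \<noteq> 0"
    proof (rule ccontr)
      assume "\<not> ?thesis"
      then obtain m where m: "m \<in> ?S" "\<forall>x\<in>X. \<beta> e x = \<beta> m x"
        using perp_perp[OF \<beta> fS sX, of e] by blast
      have "e - m \<in> W" using m SW W(1) by (auto intro: subspace_diff)
      then have "e - m \<in> W \<inter> ?R" using m W(2) by (auto simp: bilformD[OF \<beta>])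
      then have "e = m" using W(3) by simp
      then show False using m eS by simp
    qed
    then obtain y where y: "y \<in> X" "\<forall>m\<in>?S. \<beta> m y = 0" "\<beta> e y \<noteq> 0" by blast
    have Pc: "x \<in> ?P ?S' \<longleftrightarrow> \<beta> e x = 0 \<and> x \<in> ?P ?S" for x
    proof
      assume "x \<in> ?P ?S'"
      then show "\<beta> e x = 0 \<and> x \<in> ?P ?S"
        using span_mono[of B "insert e B"] span_base[of e "insert e B"] by blast
    next
      assume *: "\<beta> e x = 0 \<and> x \<in> ?P ?S"
      have "subspace {m. \<beta> m x = 0}" unfolding subspace_def by (simp add: bilformD[OF \<beta>])
      then have "?S' \<subseteq> {m. \<beta> m x = 0}" by (intro span_minimal) (use * span_base in auto)
      then show "x \<in> ?P ?S'" using * by blast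
    qed
    have sP: "subspace (?P S)" for S using sX unfolding subspace_def by (auto simp: bilformD[OF \<beta>])
    have eq: "?P ?S = span (insert y (?P ?S'))"
    proof
      have "insert y (?P ?S') \<subseteq> ?P ?S" using y Pc by blast
      then show "span (insert y (?P ?S')) \<subseteq> ?P ?S" by (rule span_minimal[OF _ sP])
      show "?P ?S \<subseteq> span (insert y (?P ?S'))"
      proof
        fix z assume z: "z \<in> ?P ?S"
        define c where "c = \<beta> e z / \<beta> e y"
        have "z - c *s y \<in> ?P ?S'" unfolding Pc
          using z y sX by (simp add: bilformD[OF \<beta>] c_def subspace_diff subspace_scale)
        moreover have "z = c *s y + (z - c *s y)" by simp
        ultimately show "z \<in> span (insert y (?P ?S'))" using mem_span_insert[OF sP] by blast
      qed
    qed
    have fP: "fd (?P ?S')" by (rule fd_mono[OF X sP]) blast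
    have "y \<notin> ?P ?S'" using Pc y(3) by blast
    then have "dim (?P ?S) = dim (?P ?S') + 1" unfolding eq by (rule dim_insert_notin[OF fP])
    then show ?case using insert dim_insert_notin[OF fS eS] by (simp add: span_insert_span)
  qed
  from this[of C] have "dim (?P W) + dim W = dim X" using C by simp
  moreover have "?P W = ?P M"
  proof (intro Set.equalityI subsetI CollectI conjI ballI)
    fix x m assume x: "x \<in> ?P W" and "m \<in> M"
    then obtain w r where "w \<in> W" "r \<in> ?R" "m = w + r" using W(4) unfolding ssum_def by blast
    then show "\<beta> m x = 0" using x by (simp add: bilformD[OF \<beta>])
  qed (use W(2) in auto)
  moreover have "dim M = dim W + dim ?R" using dim_ssum[OF fW fd_mono[OF fM sR] W(3)] W(4) by simp
  ultimately show ?thesis by simp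
qed

end

section \<open>Polynomials in a skew endomorphism\<close>

text \<open>The substitution of -t for t. Since u is skew, q(-u) is the adjoint of q(u); on the
  residue field of an even p this is the involution of the Hermitian forms.\<close>

definition negp :: "'a::field poly \<Rightarrow> 'a poly" where
  "negp q = pcompose q [:0, - 1:]"

lemma negp_simps [simp]:
  "negp 0 = 0" "negp 1 = 1" "negp (p + q) = negp p + negp q" "negp (p * q) = negp p * negp q"
  "negp (- p) = - negp p" "negp (p - q) = negp p - negp q" "negp [:c:] = [:c:]"
  by (simp_all add: negp_def pcompose_add pcompose_mult pcompose_uminus pcompose_diff pcompose_1)

lemma negp_power [simp]: "negp (p ^ n) = negp p ^ n" by (induction n) simp_all

lemma negp_pCons: "negp (pCons c p) = [:c:] - [:0, 1:] * negp p" by (simp add: negp_def pcompose_pCons)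

lemma negp_X [simp]: "negp [:0, 1:] = - [:0, 1:]" by (simp add: negp_pCons)

lemma negp_negp [simp]: "negp (negp q) = q"
proof (induction q)
  case (pCons a q)
  have "negp (negp (pCons a q)) = negp [:a:] - negp [:0, 1:] * negp (negp q)"
    unfolding negp_pCons[of a q] by (simp only: negp_simps)
  also have "\<dots> = [:a:] + [:0, 1:] * q" unfolding negp_X pCons by simp
  finally show ?case by simp
qed simp

text \<open>A nonzero element of least degree in the ideal generated by \<open>p\<close> and
  \<open>q\<close> divides all of it, by division with remainder; being a common divisor it is a
  unit.\<close>

lemma bezout_poly:
  fixes p q :: "'a::field poly"
  assumes cop: "\<And>d. d dvd p \<Longrightarrow> d dvd q \<Longrightarrow> d dvd 1"
  shows "\<exists>r s. r * p + s * q = 1"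
proof -
  define I where "I = {r * p + s * q |r s. True}"
  have pI: "p \<in> I" "q \<in> I" unfolding I_def
    by (intro CollectI exI[of _ 1] exI[of _ 0], simp, intro CollectI exI[of _ 0] exI[of _ 1], simp)
  have comb: "x - t * y \<in> I" if xI: "x \<in> I" and yI: "y \<in> I" for x y t
  proof -
    obtain r s where "x = r * p + s * q" using xI unfolding I_def by blast
    moreover obtain r' s' where "y = r' * p + s' * q" using yI unfolding I_def by blast
    ultimately have "x - t * y = (r - t * r') * p + (s - t * s') * q" by (simp add: algebra_simps)
    then show ?thesis unfolding I_def by blast
  qed
  have "\<exists>x\<in>I. x \<noteq> 0"
  proof (rule ccontr)
    assume "\<not> ?thesis"
    then have "p = 0" "q = 0" using pI by auto
    then show False using cop[of 0] by simp
  qed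
  then obtain d where d: "d \<in> I" "d \<noteq> 0" "\<And>x. x \<in> I \<Longrightarrow> x \<noteq> 0 \<Longrightarrow> degree d \<le> degree x"
    using ex_has_least_nat[of "\<lambda>x. x \<in> I \<and> x \<noteq> 0" _ degree] by blast
  have dv: "d dvd x" if "x \<in> I" for x
  proof (rule ccontr)
    assume "\<not> d dvd x"
    then have nz: "x mod d \<noteq> 0" by (simp add: dvd_eq_mod_eq_0)
    have "x mod d = x - (x div d) * d" by (simp add: minus_div_mult_eq_mod)
    then have "x mod d \<in> I" using comb[OF that d(1)] by simp
    then show False using d(3)[OF _ nz] degree_mod_less[OF d(2), of x] nz by auto
  qed
  have "d dvd 1" using cop dv pI by blast
  then obtain e where e: "1 = d * e" by (rule dvdE)
  obtain r s where "d = r * p + s * q" using d(1) unfolding I_def by blast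
  then have "(e * r) * p + (e * s) * q = 1" using e by (simp add: algebra_simps)
  then show ?thesis by blast
qed

lemma irreducible_bezout:
  fixes p q :: "'a::field poly"
  assumes p: "Factorial_Ring.irreducible p" and "\<not> p dvd q"
  shows "\<exists>r s. r * p + s * q = 1"
proof (rule bezout_poly)
  fix d assume d: "d dvd p" "d dvd q"
  then obtain e where e: "p = d * e" by blast
  have "d dvd 1 \<or> e dvd 1" using irreducibleD[OF p e] .
  moreover have False if u: "e dvd 1"
  proof -
    obtain f where "1 = e * f" using u by (rule dvdE)
    then have "d = p * f" using e by (simp add: mult.assoc)
    then have "p dvd d" by simp
    then show False using d(2) assms(2) dvd_trans by blast
  qed
  ultimately show "d dvd 1" by blast
qed

lemma degree_negp [simp]: "degree (negp q) = degree q" by (simp add: negp_def degree_pcompose)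

lemma coeff_negp: "coeff (negp q) i = (- 1) ^ i * coeff q i"
proof (induction q arbitrary: i)
  case (pCons a q)
  show ?case
  proof (cases i)
    case 0
    then show ?thesis by (simp add: negp_pCons)
  next
    case (Suc j)
    then show ?thesis using pCons.IH[of j] by (simp add: negp_pCons)
  qed
qed simp

text \<open>Form and endomorphism live on the whole type, and non-degeneracy is later asked of
  subspaces only. An orthogonal complement is thus again an object of the same kind, and inductions
  on dimension stay inside this locale.\<close>

locale skew_space = lin_space scale
  for scale :: "'a::field \<Rightarrow> 'b::ab_group_add \<Rightarrow> 'b"  (infixr \<open>*s\<close> 75) +
  fixes b :: "'b \<Rightarrow> 'b \<Rightarrow> 'a" and u :: "'b \<Rightarrow> 'b"
  assumes b_bil: "bilform b" and b_sym: "b x y = b y x"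
    and u_add: "u (x + y) = u x + u y" and u_scale: "u (c *s x) = c *s u x"
    and b_skew: "b (u x) y = - b x (u y)" and two: "(2::'a) \<noteq> 0"
begin

lemmas bD = bilformD[OF b_bil]

lemma u_0 [simp]: "u 0 = 0" using u_scale[of 0 0] by simp
lemma u_minus: "u (- x) = - u x" using u_scale[of "- 1" x] by simp
lemma u_diff: "u (x - y) = u x - u y" using u_add[of x "- y"] u_minus[of y] by simp

lemma upow_add: "(u ^^ n) (x + y) = (u ^^ n) x + (u ^^ n) y" by (induction n) (simp_all add: u_add)
lemma upow_scale: "(u ^^ n) (c *s x) = c *s (u ^^ n) x" by (induction n) (simp_all add: u_scale)
lemma u_sum: "u (sum f A) = (\<Sum>i\<in>A. u (f i))"
  by (induction A rule: infinite_finite_induct) (simp_all add: u_add)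

definition pev :: "'a poly \<Rightarrow> 'b \<Rightarrow> 'b" where
  "pev q x = (\<Sum>i\<le>degree q. coeff q i *s (u ^^ i) x)"

lemma pev_bound: "degree q \<le> n \<Longrightarrow> pev q x = (\<Sum>i\<le>n. coeff q i *s (u ^^ i) x)"
  unfolding pev_def by (rule sum.mono_neutral_left) (auto simp: coeff_eq_0)

lemma pev_0 [simp]: "pev 0 x = 0" by (simp add: pev_def)

lemma pev_pCons: "pev (pCons a q) x = a *s x + u (pev q x)"
proof -
  have "pev (pCons a q) x = (\<Sum>i\<le>Suc (degree q). coeff (pCons a q) i *s (u ^^ i) x)"
    by (rule pev_bound) (rule degree_pCons_le)
  also have "\<dots> = a *s x + (\<Sum>i\<le>degree q. coeff q i *s (u ^^ Suc i) x)"
    by (simp add: sum.atMost_Suc_shift del: sum.atMost_Suc)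
  also have "(\<Sum>i\<le>degree q. coeff q i *s (u ^^ Suc i) x) = u (pev q x)"
    by (simp add: pev_def u_sum u_scale)
  finally show ?thesis .
qed

lemma pev_1 [simp]: "pev 1 x = x" by (simp add: pev_def)
lemma pev_const [simp]: "pev [:c:] x = c *s x" by (simp add: pev_pCons)
lemma pev_X [simp]: "pev [:0, 1:] x = u x" by (simp add: pev_pCons)

lemma pev_add: "pev (p + q) x = pev p x + pev q x"
proof -
  let ?n = "max (degree p) (degree q)"
  have "pev (p + q) x = (\<Sum>i\<le>?n. coeff (p + q) i *s (u ^^ i) x)"
    by (rule pev_bound) (rule degree_add_le_max)
  then show ?thesis
    using pev_bound[of p ?n x] pev_bound[of q ?n x] by (simp add: scale_left_distrib sum.distrib)
qed

lemma pev_arg: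
  shows pev_add_arg: "pev q (x + y) = pev q x + pev q y"
    and pev_scale_arg: "pev q (c *s x) = c *s pev q x"
    and pev_u: "pev q (u x) = u (pev q x)"
    and pev_zero_arg [simp]: "pev q 0 = 0"
proof -
  show "pev q (x + y) = pev q x + pev q y" by (simp add: pev_def upow_add scale_right_distrib sum.distrib)
  show sc: "pev q (c *s x) = c *s pev q x" for c x
    by (simp add: pev_def upow_scale scale_sum_right mult.commute)
  show "pev q (u x) = u (pev q x)" by (simp add: pev_def u_sum u_scale funpow_swap1)
  show "pev q 0 = 0" using sc[of 0 0] by simp
qed

lemma pev_minus_arg: "pev q (- x) = - pev q x" using pev_scale_arg[of q "- 1" x] by simp
lemma pev_diff_arg: "pev q (x - y) = pev q x - pev q y"
  using pev_add_arg[of q x "- y"] pev_minus_arg[of q y] by simp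

lemma pev_mult: "pev (p * q) x = pev p (pev q x)"
proof (induction p)
  case (pCons a p)
  have "pev (pCons a p * q) x = pev ([:a:] * q) x + pev (pCons 0 (p * q)) x"
    by (simp add: pev_add[symmetric])
  also have "pev ([:a:] * q) x = a *s pev q x"
    by (induction q) (simp_all add: pev_pCons scale_right_distrib u_scale)
  finally show ?case using pCons by (simp add: pev_pCons)
qed simp

lemma pev_minus: "pev (- q) x = - pev q x" using pev_mult[of "[:- 1:]" q x] by simp

lemma pev_diff: "pev (p - q) x = pev p x - pev q x" using pev_add[of p "- q" x] by (simp add: pev_minus)

lemma pev_commute: "pev p (pev q x) = pev q (pev p x)" by (metis mult.commute pev_mult)

lemma pev_X_power: "pev ([:0, 1:] ^ n) x = (u ^^ n) x"
  by (induction n) (simp_all add: pev_mult del: mult_pCons_left)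

lemma pev_adj: "b (pev q x) y = b x (pev (negp q) y)"
proof (induction q arbitrary: x)
  case (pCons a q)
  have "b (pev (pCons a q) x) y = a * b x y - b (pev q x) (u y)" by (simp add: pev_pCons bD b_skew)
  also have "b (pev q x) (u y) = - b (u (pev q x)) y" by (simp add: b_skew)
  also have "b (u (pev q x)) y = b (u x) (pev (negp q) y)" by (simp add: pev_u[symmetric] pCons.IH)
  also have "\<dots> = - b x (u (pev (negp q) y))" by (simp add: b_skew)
  finally show ?case unfolding negp_pCons by (simp add: pev_diff pev_pCons bD pev_minus u_minus)
qed (simp add: bD)

lemma pev_adj': "b x (pev q y) = b (pev (negp q) x) y" by (simp add: pev_adj)

lemma pev_dvd_0: "pev p x = 0 \<Longrightarrow> p dvd q \<Longrightarrow> pev q x = 0"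
  by (metis dvdE mult.commute pev_mult pev_zero_arg)

section \<open>Stable non-degenerate subspaces, cyclic submodules and orthogonal splitting\<close>

definition ustable :: "'b set \<Rightarrow> bool" where "ustable S \<longleftrightarrow> (\<forall>x\<in>S. u x \<in> S)"

definition good :: "'b set \<Rightarrow> bool" where
  "good X \<longleftrightarrow> fd X \<and> ustable X \<and> (\<forall>x\<in>X. (\<forall>y\<in>X. b x y = 0) \<longrightarrow> x = 0)"

lemma goodD:
  assumes "good X"
  shows "fd X" "subspace X" "ustable X" "\<And>x. x \<in> X \<Longrightarrow> (\<And>y. y \<in> X \<Longrightarrow> b x y = 0) \<Longrightarrow> x = 0"
  using assms fd_subspace unfolding good_def by auto

lemma pev_stable: "subspace S \<Longrightarrow> ustable S \<Longrightarrow> x \<in> S \<Longrightarrow> pev q x \<in> S"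
  by (induction q) (auto simp: pev_pCons subspace_0 subspace_add subspace_scale ustable_def)

definition cyc :: "'b \<Rightarrow> 'b set" where "cyc x = range (\<lambda>q. pev q x)"

lemma cycI [simp]: "pev q x \<in> cyc x" by (simp add: cyc_def)
lemma cyc_self [simp]: "x \<in> cyc x" using cycI[of 1 x] by simp
lemma cycE: "z \<in> cyc x \<Longrightarrow> (\<And>q. z = pev q x \<Longrightarrow> thesis) \<Longrightarrow> thesis" by (auto simp: cyc_def)

lemma subspace_cyc: "subspace (cyc x)" unfolding subspace_def
proof (intro conjI ballI allI)
  show "0 \<in> cyc x" using cycI[of 0 x] by simp
  fix y z c assume "y \<in> cyc x"
  then obtain q where q: "y = pev q x" by (rule cycE)
  show "c *s y \<in> cyc x" using cycI[of "[:c:] * q" x] by (simp only: pev_mult pev_const q)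
  assume "z \<in> cyc x"
  then obtain r where "z = pev r x" by (rule cycE)
  then show "y + z \<in> cyc x" using cycI[of "q + r" x] by (simp add: pev_add q)
qed

lemma ustable_cyc: "ustable (cyc x)" unfolding ustable_def by (metis cycE cycI pev_X pev_mult)

lemma cyc_sub: "subspace S \<Longrightarrow> ustable S \<Longrightarrow> x \<in> S \<Longrightarrow> cyc x \<subseteq> S"
  by (auto simp: cyc_def pev_stable)

lemma ustable_ssum: "ustable S \<Longrightarrow> ustable T \<Longrightarrow> ustable (ssum S T)"
  unfolding ustable_def ssum_def by (auto, metis u_add)

lemma subspace_image_pev: "subspace S \<Longrightarrow> subspace (pev q ` S)"
  unfolding subspace_def by (auto simp: image_iff) (metis pev_zero_arg, metis pev_add_arg, metis pev_scale_arg)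

lemma subspace_ker_pev: "subspace S \<Longrightarrow> subspace {x\<in>S. pev q x = 0}"
  unfolding subspace_def by (auto simp: pev_add_arg pev_scale_arg)

lemma ustable_image_pev: "ustable S \<Longrightarrow> ustable (pev q ` S)"
  unfolding ustable_def by (auto simp: pev_u[symmetric])

lemma ustable_ker_pev: "ustable S \<Longrightarrow> ustable {x\<in>S. pev q x = 0}"
  unfolding ustable_def by (auto simp: pev_u)

text \<open>The orthogonal of the kernel of an endomorphism is the image of its adjoint, here the
  image of q(-u).\<close>

lemma perp_ker:
  assumes X: "good X" and z: "z \<in> X" and perp: "\<And>x. x \<in> X \<Longrightarrow> pev q x = 0 \<Longrightarrow> b z x = 0"
  shows "\<exists>w\<in>X. z = pev (negp q) w"
proof -
  have fI: "fd (pev (negp q) ` X)" using fd_mono[OF goodD(1)[OF X] subspace_image_pev[OF goodD(2)[OF X]]]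
      pev_stable[OF goodD(2,3)[OF X]] by blast
  have "b z y = 0" if y: "y \<in> X" "\<forall>m\<in>pev (negp q) ` X. b m y = 0" for y
  proof (rule perp[OF y(1)])
    have "b (pev q y) w = 0" if "w \<in> X" for w using y(2) that by (simp add: pev_adj b_sym[of _ y])
    then show "pev q y = 0" using goodD(4)[OF X] pev_stable[OF goodD(2,3)[OF X] y(1)] by blast
  qed
  then obtain m where m: "m \<in> pev (negp q) ` X" "\<forall>y\<in>X. b z y = b m y"
    using perp_perp[OF b_bil fI goodD(2)[OF X], of z] by blast
  have "m \<in> X" using m pev_stable[OF goodD(2,3)[OF X]] by blast
  then have "z - m = 0"
    using goodD(4)[OF X, of "z - m"] m z subspace_diff[OF goodD(2)[OF X]] by (simp add: bD)
  then show ?thesis using m by auto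
qed

definition operp :: "'b set \<Rightarrow> 'b set \<Rightarrow> 'b set" where
  "operp X C = {x\<in>X. \<forall>c\<in>C. b c x = 0}"

text \<open>Skewness makes the orthogonal of a stable subspace stable. The projection of
  \<open>x\<close> to \<open>C\<close> is the vector of \<open>C\<close> representing the functional
  given by \<open>x\<close>, which exists because \<open>C\<close> is non-degenerate.\<close>

lemma split_good:
  assumes X: "good X" and C: "good C" "C \<subseteq> X"
  shows "good (operp X C)" "ssum C (operp X C) = X" "C \<inter> operp X C = {0}"
proof -
  let ?D = "operp X C"
  have sD: "subspace ?D" using goodD(2)[OF X] unfolding operp_def subspace_def by (auto simp: bD)
  have uD: "ustable ?D" unfolding ustable_def operp_def
  proof (intro ballI CollectI conjI)
    fix x assume x: "x \<in> {x \<in> X. \<forall>c\<in>C. b c x = 0}"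
    then show "u x \<in> X" using goodD(3)[OF X] by (auto simp: ustable_def)
    fix c assume "c \<in> C"
    then have "u c \<in> C" using goodD(3)[OF C(1)] by (auto simp: ustable_def)
    then show "b c (u x) = 0" using x b_skew[of c x] by simp
  qed
  have proj: "\<exists>c\<in>C. x - c \<in> ?D" if x: "x \<in> X" for x
  proof -
    obtain c where c: "c \<in> C" "\<forall>z\<in>C. b z c = b z x"
      using functional_rep[OF b_bil goodD(1)[OF C(1)] goodD(2)[OF C(1)], of "\<lambda>z. b z x"]
        goodD(4)[OF C(1)] by (auto simp: bD)
    then show ?thesis using x C goodD(2)[OF X] unfolding operp_def
      by (intro bexI[of _ c]) (auto simp: bD subspace_diff)
  qed
  show int: "C \<inter> ?D = {0}"
  proof
    show "C \<inter> ?D \<subseteq> {0}" using goodD(4)[OF C(1)] unfolding operp_def by (auto simp: b_sym)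
    show "{0} \<subseteq> C \<inter> ?D" using sD goodD(2)[OF C(1)] subspace_0 by blast
  qed
  show sum: "ssum C ?D = X"
  proof
    show "ssum C ?D \<subseteq> X" by (rule ssum_least[OF goodD(2)[OF X] C(2)]) (auto simp: operp_def)
    show "X \<subseteq> ssum C ?D"
    proof
      fix x assume "x \<in> X"
      then obtain c where "c \<in> C" "x - c \<in> ?D" using proj by blast
      then show "x \<in> ssum C ?D" using ssum_mem[of c C "x - c" ?D] by simp
    qed
  qed
  show "good ?D" unfolding good_def
  proof (intro conjI ballI impI)
    show "fd ?D" by (rule fd_mono[OF goodD(1)[OF X] sD]) (auto simp: operp_def)
    show "ustable ?D" by (rule uD)
    fix x assume x: "x \<in> ?D" "\<forall>y\<in>?D. b x y = 0"
    show "x = 0"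
    proof (rule goodD(4)[OF X])
      show "x \<in> X" using x by (simp add: operp_def)
      fix y assume "y \<in> X"
      then obtain c where c: "c \<in> C" "y - c \<in> ?D" using proj by blast
      have "b x y = b x (y - c) + b x c" by (simp add: bD)
      then show "b x y = 0" using x c by (simp add: operp_def b_sym[of x c])
    qed
  qed
qed

lemma operpD: "x \<in> operp X C \<Longrightarrow> c \<in> C \<Longrightarrow> b c x = 0" "x \<in> operp X C \<Longrightarrow> c \<in> C \<Longrightarrow> b x c = 0"
  "x \<in> operp X C \<Longrightarrow> x \<in> X" by (auto simp: operp_def b_sym)

text \<open>With \<open>u = a + a'\<close> and \<open>v = a - a'\<close>, the condition \<open>a\<^sup>2 = a'\<^sup>2 = 0\<close> says that \<open>v\<close> anticommutes
  with \<open>u\<close> and \<open>v\<^sup>2 = - u\<^sup>2\<close>.\<close>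

definition pairable :: "'b set \<Rightarrow> bool" where
  "pairable X \<longleftrightarrow> (\<exists>v. (\<forall>x y. v (x + y) = v x + v y) \<and> (\<forall>c x. v (c *s x) = c *s v x) \<and>
     (\<forall>x\<in>X. v x \<in> X \<and> v (u x) = - u (v x) \<and> v (v x) = - u (u x)) \<and>
     (\<forall>x\<in>X. \<forall>y\<in>X. b (v x) y = - b x (v y)))"

text \<open>It suffices to give the graph of \<open>v\<close>: single-valuedness follows from skewness.\<close>

lemma pairable_rel:
  assumes X: "good X" and GX: "\<And>x y. (x, y) \<in> G \<Longrightarrow> x \<in> X \<and> y \<in> X"
    and add: "\<And>x y x' y'. (x, y) \<in> G \<Longrightarrow> (x', y') \<in> G \<Longrightarrow> (x + x', y + y') \<in> G"
    and sc: "\<And>c x y. (x, y) \<in> G \<Longrightarrow> (c *s x, c *s y) \<in> G"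
    and tot: "\<And>x. x \<in> X \<Longrightarrow> \<exists>y. (x, y) \<in> G"
    and skew: "\<And>x y x' y'. (x, y) \<in> G \<Longrightarrow> (x', y') \<in> G \<Longrightarrow> b y x' = - b x y'"
    and anti: "\<And>x y. (x, y) \<in> G \<Longrightarrow> (u x, - u y) \<in> G"
    and sq: "\<And>x y. (x, y) \<in> G \<Longrightarrow> (y, - u (u x)) \<in> G"
  shows "pairable X"
proof -
  interpret vp: vector_space_pair scale scale by unfold_locales
  have zero: "y = 0" if "(0, y) \<in> G" for y
  proof (rule goodD(4)[OF X])
    show "y \<in> X" using GX that by blast
    fix x assume "x \<in> X"
    then obtain x' where "(x, x') \<in> G" using tot by blast
    then show "b y x = 0" using skew[OF that] by (simp add: bD)
  qed
  have single: "y = y'" if "(x, y) \<in> G" "(x, y') \<in> G" for x y y'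
    using zero[of "y - y'"] add[OF that(1) sc[OF that(2), of "- 1"]] by simp
  obtain B where B: "independent B" "B \<subseteq> X" "span B = X" using fd_basis[OF goodD(1)[OF X]] by metis
  \<comment> \<open>\<open>pairable\<close> wants a map linear on the whole type, so values are
    chosen on a basis of \<open>X\<close> only and extended; the graph being closed under linear
    combinations then puts every \<open>(x, v x)\<close> with \<open>x\<close> in \<open>X\<close>
    into it.\<close>
  obtain v where v: "Vector_Spaces.linear scale scale v" "\<forall>x\<in>B. v x = (SOME y. (x, y) \<in> G)"
    using vp.linear_independent_extend[OF B(1), of "\<lambda>x. SOME y. (x, y) \<in> G"] by blast
  have lin: "v (x + y) = v x + v y" "v (c *s x) = c *s v x" for x y c
    using v(1) unfolding Vector_Spaces.linear_iff by auto
  have v0: "v 0 = 0" using lin(2)[of 0 0] by simp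
  have "subspace {x. (x, v x) \<in> G}" unfolding subspace_def
  proof (intro conjI allI ballI)
    obtain y where "(0, y) \<in> G" using tot[of 0] subspace_0[OF goodD(2)[OF X]] by blast
    then show "0 \<in> {x. (x, v x) \<in> G}" using sc[of 0 y 0] v0 by simp
    fix x y c assume x: "x \<in> {x. (x, v x) \<in> G}"
    then show "c *s x \<in> {x. (x, v x) \<in> G}" using sc[of x "v x" c] lin by simp
    assume "y \<in> {x. (x, v x) \<in> G}"
    then show "x + y \<in> {x. (x, v x) \<in> G}" using x add[of x "v x" y "v y"] lin by simp
  qed
  moreover have "B \<subseteq> {x. (x, v x) \<in> G}"
  proof
    fix x assume "x \<in> B"
    then show "x \<in> {x. (x, v x) \<in> G}" using v(2) tot[of x] B(2) someI_ex[of "\<lambda>y. (x, y) \<in> G"] by auto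
  qed
  ultimately have "span B \<subseteq> {x. (x, v x) \<in> G}" by (rule span_minimal[rotated])
  then have G: "(x, v x) \<in> G" if "x \<in> X" for x using B that by blast
  show ?thesis unfolding pairable_def
  proof (intro exI[of _ v] conjI allI ballI)
    show "v (x + y) = v x + v y" "v (c *s x) = c *s v x" for x y c by (rule lin)+
    fix x assume x: "x \<in> X"
    show vx: "v x \<in> X" using GX[OF G[OF x]] by simp
    have ux: "u x \<in> X" using goodD(3)[OF X] x by (simp add: ustable_def)
    show "v (u x) = - u (v x)" using single[OF G[OF ux] anti[OF G[OF x]]] .
    show "v (v x) = - u (u x)" using single[OF G[OF vx] sq[OF G[OF x]]] .
    fix y assume "y \<in> X"
    then show "b (v x) y = - b x (v y)" using skew[OF G[OF x] G] by blast
  qed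
qed

text \<open>The two partners are glued as graphs, so that no projections onto the summands are
  needed; orthogonality kills the mixed terms in the skewness condition.\<close>

lemma pairable_sum:
  assumes X: "good X" and C: "C \<subseteq> X" "pairable C" "ustable C" and D: "D \<subseteq> X" "pairable D" "ustable D"
    and sum: "ssum C D = X" and orth: "\<And>c d. c \<in> C \<Longrightarrow> d \<in> D \<Longrightarrow> b c d = 0"
    and sub: "subspace C" "subspace D"
  shows "pairable X"
proof -
  obtain v where v: "\<And>x y. v (x + y) = v x + v y" "\<And>c x. v (c *s x) = c *s v x"
     "\<And>x. x \<in> C \<Longrightarrow> v x \<in> C \<and> v (u x) = - u (v x) \<and> v (v x) = - u (u x)"
     "\<And>x y. x \<in> C \<Longrightarrow> y \<in> C \<Longrightarrow> b (v x) y = - b x (v y)"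
    using C(2) unfolding pairable_def by blast
  obtain w where w: "\<And>x y. w (x + y) = w x + w y" "\<And>c x. w (c *s x) = c *s w x"
     "\<And>x. x \<in> D \<Longrightarrow> w x \<in> D \<and> w (u x) = - u (w x) \<and> w (w x) = - u (u x)"
     "\<And>x y. x \<in> D \<Longrightarrow> y \<in> D \<Longrightarrow> b (w x) y = - b x (w y)"
    using D(2) unfolding pairable_def by blast
  have uC: "u x \<in> C" if "x \<in> C" for x using C(3) that by (simp add: ustable_def)
  have uD: "u x \<in> D" if "x \<in> D" for x using D(3) that by (simp add: ustable_def)
  let ?G = "{(c + d, v c + w d) |c d. c \<in> C \<and> d \<in> D}"
  show ?thesis
  proof (rule pairable_rel[OF X, of ?G])
    fix x y assume xy: "(x, y) \<in> ?G"
    then obtain c d where cd: "c \<in> C" "d \<in> D" "x = c + d" "y = v c + w d" by blast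
    show "x \<in> X \<and> y \<in> X"
      using cd C(1) D(1) v(3)[OF cd(1)] w(3)[OF cd(2)] subspace_add[OF goodD(2)[OF X]] by blast
    show "(k *s x, k *s y) \<in> ?G" for k
      using cd sub by (intro CollectI exI[of _ "k *s c"] exI[of _ "k *s d"])
        (simp add: v w scale_right_distrib subspace_scale)
    show "(u x, - u y) \<in> ?G" using cd uC uD v(3)[OF cd(1)] w(3)[OF cd(2)]
      by (intro CollectI exI[of _ "u c"] exI[of _ "u d"]) (simp add: u_add)
    show "(y, - u (u x)) \<in> ?G" using cd v(3)[OF cd(1)] w(3)[OF cd(2)]
      by (intro CollectI exI[of _ "v c"] exI[of _ "w d"]) (simp add: u_add)
    fix x' y' assume "(x', y') \<in> ?G"
    then obtain c' d' where cd': "c' \<in> C" "d' \<in> D" "x' = c' + d'" "y' = v c' + w d'" by blast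
    show "(x + x', y + y') \<in> ?G"
      using cd cd' sub by (intro CollectI exI[of _ "c + c'"] exI[of _ "d + d'"])
        (simp add: v w subspace_add ac_simps)
    have "b (v c) d' = 0" "b (w d) c' = 0" "b c (w d') = 0" "b d (v c') = 0"
      using cd cd' v(3) w(3) orth b_sym by (metis)+
    then show "b y x' = - b x y'" using cd cd' v(4)[OF cd(1) cd'(1)] w(4)[OF cd(2) cd'(2)] by (simp add: bD)
  next
    fix x assume "x \<in> X"
    then obtain c d where "c \<in> C" "d \<in> D" "x = c + d" using sum unfolding ssum_def by blast
    then show "\<exists>y. (x, y) \<in> ?G" by blast
  qed
qed

text \<open>Anticommutation forces v(q(u)x) = q(-u)v(x), so v is determined by the images
  \<open>x'\<close> and \<open>y'\<close> of two generators. The adjoint relation carries skewness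
  from the generators to all of \<open>C\<close>, and \<open>sqx\<close>, \<open>sqy\<close> say
  that v applied to \<open>x'\<close> and \<open>y'\<close> gives -u^2 on the generators.\<close>

lemma pairable_gen:
  assumes C: "good C" "C = ssum (cyc x) (cyc y)" and mem: "x' \<in> C" "y' \<in> C"
    and xx: "\<And>q. b x' (pev q x) = - b (pev q x) x'"
    and yy: "\<And>q. b y' (pev q y) = - b (pev q y) y'"
    and xy: "\<And>q. b x' (pev q y) = - b (pev q x) y'"
    and sqx: "\<exists>q r. x' = pev q x + pev r y \<and> - u (u x) = pev (negp q) x' + pev (negp r) y'"
    and sqy: "\<exists>q r. y' = pev q x + pev r y \<and> - u (u y) = pev (negp q) x' + pev (negp r) y'"
  shows "pairable C"
proof -
  let ?G = "{(pev q x + pev r y, pev (negp q) x' + pev (negp r) y') |q r. True}"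
  have GI: "(pev q x + pev r y, pev (negp q) x' + pev (negp r) y') \<in> ?G" for q r by blast
  have xC: "x \<in> C" "y \<in> C" using C(2) ssum_upper[OF subspace_cyc subspace_cyc] cyc_self by blast+
  have add: "(a + a', e + e') \<in> ?G" if ae: "(a, e) \<in> ?G" and ae': "(a', e') \<in> ?G" for a e a' e'
  proof -
    obtain q r where 1: "a = pev q x + pev r y" "e = pev (negp q) x' + pev (negp r) y'" using ae by blast
    obtain q' r' where 2: "a' = pev q' x + pev r' y" "e' = pev (negp q') x' + pev (negp r') y'"
      using ae' by blast
    have "a + a' = pev (q + q') x + pev (r + r') y"
      "e + e' = pev (negp (q + q')) x' + pev (negp (r + r')) y'" using 1 2 by (simp_all add: pev_add)
    then show ?thesis using GI[of "q + q'" "r + r'"] by (simp only:)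
  qed
  have mul: "(pev s a, pev (negp s) e) \<in> ?G" if ae: "(a, e) \<in> ?G" for s a e
  proof -
    obtain q r where 1: "a = pev q x + pev r y" "e = pev (negp q) x' + pev (negp r) y'" using ae by blast
    have "pev s a = pev (s * q) x + pev (s * r) y"
      "pev (negp s) e = pev (negp (s * q)) x' + pev (negp (s * r)) y'"
      using 1 by (simp_all add: pev_mult pev_add_arg)
    then show ?thesis using GI[of "s * q" "s * r"] by (simp only:)
  qed
  have yx: "b y' (pev q x) = - b (pev q y) x'" for q
  proof -
    have "b y' (pev q x) = b (pev q x) y'" by (rule b_sym)
    also have "\<dots> = - b x' (pev q y)" using xy[of q] by simp
    finally show ?thesis by (simp add: b_sym)
  qed
  have gen: "b (pev (negp q) z') (pev r w) = - b (pev q z) (pev (negp r) w')"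
    if "\<And>q. b z' (pev q w) = - b (pev q z) w'" for q r z z' w w'
  proof -
    have "b (pev (negp q) z') (pev r w) = b z' (pev (q * r) w)" by (simp add: pev_adj pev_mult)
    also have "\<dots> = - b (pev (r * q) z) w'" by (simp add: that mult.commute)
    also have "\<dots> = - b (pev q z) (pev (negp r) w')" by (simp add: pev_adj pev_mult)
    finally show ?thesis .
  qed
  show ?thesis
  proof (rule pairable_rel[OF C(1), of ?G])
    fix a e assume ae: "(a, e) \<in> ?G"
    then obtain q r where 1: "a = pev q x + pev r y" "e = pev (negp q) x' + pev (negp r) y'" by blast
    show "a \<in> C \<and> e \<in> C"
      unfolding 1 using xC mem pev_stable[OF goodD(2,3)[OF C(1)]] subspace_add[OF goodD(2)[OF C(1)]] by blast
    show "(k *s a, k *s e) \<in> ?G" for k using mul[OF ae, of "[:k:]"] by simp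
    show "(u a, - u e) \<in> ?G" using mul[OF ae, of "[:0, 1:]"] by (simp only: negp_X pev_minus pev_X)
    show "(e, - u (u a)) \<in> ?G"
    proof -
      have x: "(x', - u (u x)) \<in> ?G" and y: "(y', - u (u y)) \<in> ?G" using sqx sqy by blast+
      have "(e, pev (negp (negp q)) (- u (u x)) + pev (negp (negp r)) (- u (u y))) \<in> ?G"
        unfolding 1 by (rule add[OF mul[OF x] mul[OF y]])
      then show ?thesis unfolding 1 by (simp add: pev_minus_arg pev_u u_add)
    qed
    fix a' e' assume "(a', e') \<in> ?G"
    then obtain q' r' where 2: "a' = pev q' x + pev r' y" "e' = pev (negp q') x' + pev (negp r') y'" by blast
    show "(a + a', e + e') \<in> ?G" using add[OF ae \<open>(a', e') \<in> ?G\<close>] .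
    show "b e a' = - b a e'" unfolding 1 2 by (simp add: bD gen[OF xx] gen[OF yy] gen[OF xy] gen[OF yx])
  next
    fix a assume "a \<in> C"
    then show "\<exists>e. (a, e) \<in> ?G" unfolding C(2) ssum_def cyc_def by blast
  qed
qed

end

text \<open>Reduction by an isotropic subspace: the part of \<open>L\<close> orthogonal to
  \<open>S\<close> descends to the orthogonal of \<open>S\<close> modulo \<open>S\<close>, for which
  \<open>E'\<close> is a model by \<open>dec\<close>. The form may be degenerate on
  \<open>E\<close>. All cancellation of Hermitian and symmetric forms rests on this.\<close>

lemma (in lin_space) neutral_cancel:
  assumes \<beta>: "bilform \<beta>" "\<And>x y. \<beta> x y = \<beta> y x" and E: "fd E"
    and L: "subspace L" "L = {x\<in>E. \<forall>y\<in>L. \<beta> x y = 0}"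
    and S: "subspace S" "S \<subseteq> E" "\<And>x y. x \<in> S \<Longrightarrow> y \<in> S \<Longrightarrow> \<beta> x y = 0"
    and E': "E' \<subseteq> E" "\<And>x y. x \<in> E' \<Longrightarrow> y \<in> S \<Longrightarrow> \<beta> x y = 0"
    and dec: "\<And>y. y \<in> E \<Longrightarrow> (\<And>c. c \<in> S \<Longrightarrow> \<beta> y c = 0) \<Longrightarrow> \<exists>c\<in>S. \<exists>z\<in>E'. y = c + z"
  shows "{x\<in>E'. \<exists>c\<in>S. x + c \<in> L} = {x\<in>E'. \<forall>y\<in>{x\<in>E'. \<exists>c\<in>S. x + c \<in> L}. \<beta> x y = 0}"
    (is "?L' = ?R")
proof
  have LE: "x \<in> E" "\<And>y. y \<in> L \<Longrightarrow> \<beta> x y = 0" if "x \<in> L" for x using L(2) that by blast+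
  show "?L' \<subseteq> ?R"
  proof (intro subsetI CollectI conjI ballI)
    fix x assume x: "x \<in> ?L'"
    then show "x \<in> E'" by blast
    obtain c where c: "c \<in> S" "x + c \<in> L" using x by blast
    fix y assume y: "y \<in> ?L'"
    then obtain d where d: "d \<in> S" "y + d \<in> L" by blast
    have "\<beta> (x + c) (y + d) = 0" using LE c d by blast
    moreover have "\<beta> x d = 0" "\<beta> c d = 0" "\<beta> c y = 0"
      using x y c d S(3) E'(2) \<beta>(2)[of c y] by auto
    ultimately show "\<beta> x y = 0" by (simp add: bilformD[OF \<beta>(1)])
  qed
  show "?R \<subseteq> ?L'"
  proof
    fix x assume x: "x \<in> ?R"
    have sE: "subspace E" using E fd_subspace by blast
    have LsE: "ssum L S \<subseteq> E" using ssum_least[OF sE] LE S(2) by blast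
    have f: "fd (ssum L S)" by (rule fd_mono[OF E subspace_ssum[OF L(1) S(1)] LsE])
    \<comment> \<open>A vector orthogonal to L + S lies in \<open>L\<close>, since \<open>L\<close>
      is its own orthogonal, and splits by \<open>dec\<close>; its \<open>E'\<close>-component is in
      the candidate subspace. So double orthogonality places \<open>x\<close> in L + S, up to a
      radical vector, which \<open>L\<close> contains.\<close>
    have "\<beta> x y = 0" if y: "y \<in> E" "\<forall>m\<in>ssum L S. \<beta> m y = 0" for y
    proof -
      have yL: "y \<in> L"
      proof -
        have "\<forall>m\<in>L. \<beta> y m = 0" using y(2) ssum_upper(1)[OF L(1) S(1)] \<beta>(2)[of y] by auto
        then show ?thesis using L(2) y(1) by blast
      qed
      have yS: "\<beta> y c = 0" if "c \<in> S" for c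
        using y(2) ssum_upper(2)[OF L(1) S(1)] \<beta>(2)[of y] that by auto
      obtain c z where cz: "c \<in> S" "z \<in> E'" "y = c + z" using dec[OF y(1) yS] by blast
      have "z + c \<in> L" using yL cz by (simp add: add.commute)
      then have "\<beta> x z = 0" using x cz by blast
      moreover have "\<beta> x c = 0" using x cz E'(2) by blast
      ultimately show ?thesis using cz by (simp add: bilformD[OF \<beta>(1)])
    qed
    then obtain m where m: "m \<in> ssum L S" "\<forall>y\<in>E. \<beta> x y = \<beta> m y"
      using perp_perp[OF \<beta>(1) f sE, of x] by blast
    then obtain l c where lc: "l \<in> L" "c \<in> S" "m = l + c" unfolding ssum_def by blast
    have xE: "x \<in> E" using x E' by blast
    have "x - m \<in> E" using xE m(1) LsE sE subspace_diff by blast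
    moreover have "\<forall>y\<in>L. \<beta> (x - m) y = 0" using m(2) LE by (simp add: bilformD[OF \<beta>(1)])
    ultimately have "x - m \<in> L" using L(2) by blast
    then have "x - m + l \<in> L" using lc L(1) subspace_add by blast
    then have "x + (- c) \<in> L" using lc by simp
    moreover have "- c \<in> S" using lc S(1) subspace_neg by blast
    ultimately show "x \<in> ?L'" using x by blast
  qed
qed

section \<open>The three conditions as statements about kernels and images\<close>

context skew_space
begin

definition ker :: "'b set \<Rightarrow> 'a poly \<Rightarrow> 'b set" where
  "ker X q = {x\<in>X. pev q x = 0}"

text \<open>The denominator Ker p(u)^(k-1) + (Ker p(u)^k \<inter> Im p(u)) of V_{p,k} as a single
  condition: x - p(u)z is killed by p(u)^(k-1) for some z. It is also the radical of the form b(x,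
  p(u)^(k-1) y) on Ker p(u)^k when p is even or odd.\<close>

definition jden :: "'b set \<Rightarrow> 'a poly \<Rightarrow> nat \<Rightarrow> 'b set" where
  "jden X p k = {x\<in>ker X (p ^ k). \<exists>z\<in>X. pev (p ^ (k - 1)) x = pev (p ^ k) z}"

text \<open>Conditions (i), (ii) and (iii) without quotients. In \<open>condN\<close>, the space \<open>E\<close> carries
  the forms of all indices above \<open>k\<close> and a part of the form of index \<open>k\<close>; having a Lagrangian
  \<open>L\<close> means that this part cancels them.\<close>

definition condI :: "'b set \<Rightarrow> 'a poly \<Rightarrow> nat \<Rightarrow> bool" where
  "condI X p k \<longleftrightarrow> (\<exists>M. subspace M \<and> ustable M \<and>
     M = {x\<in>ker X (p ^ k). \<forall>y\<in>M. b x (pev (p ^ (k - 1)) y) = 0})"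

text \<open>Dimensions are taken over the base field, so the codimension is \<open>degree p\<close>
  times the Jordan number; this explains the factor.\<close>

definition condII :: "'b set \<Rightarrow> 'a poly \<Rightarrow> nat \<Rightarrow> bool" where
  "condII X p k \<longleftrightarrow> (\<exists>m. dim (ker X (p ^ k)) = dim (jden X p k) + 2 * degree p * m)"

definition condN :: "'b set \<Rightarrow> nat \<Rightarrow> bool" where
  "condN X k \<longleftrightarrow> (\<exists>E L. subspace E \<and> subspace L \<and> (u ^^ Suc k) ` X \<subseteq> E \<and> E \<subseteq> (u ^^ k) ` X \<and>
     L = {x\<in>E. \<forall>y\<in>L. b x y = 0})"

lemma kerD: "x \<in> ker X q \<Longrightarrow> x \<in> X" "x \<in> ker X q \<Longrightarrow> pev q x = 0" by (auto simp: ker_def)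
lemma subspace_ker: "subspace X \<Longrightarrow> subspace (ker X q)" unfolding ker_def by (rule subspace_ker_pev)
lemma ustable_ker: "ustable X \<Longrightarrow> ustable (ker X q)" unfolding ker_def by (rule ustable_ker_pev)
lemma fd_ker: "fd X \<Longrightarrow> fd (ker X q)"
  by (rule fd_mono[OF _ subspace_ker]) (auto simp: ker_def fd_subspace)

lemma subspace_jden: "subspace X \<Longrightarrow> subspace (jden X p k)"
  unfolding subspace_def[of "jden X p k"]
proof (intro conjI ballI allI)
  assume X: "subspace X"
  show "0 \<in> jden X p k" using subspace_0[OF X] subspace_0[OF subspace_ker[OF X]]
    by (auto simp: jden_def intro!: bexI[of _ 0])
  fix x y c assume x: "x \<in> jden X p k"
  then obtain z where z: "z \<in> X" "pev (p ^ (k - 1)) x = pev (p ^ k) z" "x \<in> ker X (p ^ k)"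
    by (auto simp: jden_def)
  show "c *s x \<in> jden X p k" using z subspace_scale[OF X] subspace_scale[OF subspace_ker[OF X]]
    by (auto simp: jden_def pev_scale_arg intro!: bexI[of _ "c *s z"])
  assume "y \<in> jden X p k"
  then obtain w where w: "w \<in> X" "pev (p ^ (k - 1)) y = pev (p ^ k) w" "y \<in> ker X (p ^ k)"
    by (auto simp: jden_def)
  show "x + y \<in> jden X p k" using z w subspace_add[OF X] subspace_add[OF subspace_ker[OF X]]
    by (auto simp: jden_def pev_add_arg intro!: bexI[of _ "z + w"])
qed

lemma ustable_jden: "ustable X \<Longrightarrow> ustable (jden X p k)"
  unfolding ustable_def[of "jden X p k"]
proof
  assume X: "ustable X"
  fix x assume "x \<in> jden X p k"
  then obtain z where z: "z \<in> X" "pev (p ^ (k - 1)) x = pev (p ^ k) z" "x \<in> ker X (p ^ k)"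
    by (auto simp: jden_def)
  then show "u x \<in> jden X p k" using X ustable_ker[OF X, of "p ^ k"]
    by (auto simp: jden_def pev_u ustable_def intro!: bexI[of _ "u z"])
qed

lemma jden_sub: "jden X p k \<subseteq> ker X (p ^ k)" by (auto simp: jden_def)

lemma fd_jden: "fd X \<Longrightarrow> fd (jden X p k)"
  using fd_mono[OF fd_ker subspace_jden jden_sub] fd_subspace by blast

lemma upow_adj: "b ((u ^^ n) x) y = (- 1) ^ n * b x ((u ^^ n) y)"
proof (induction n arbitrary: y)
  case (Suc n)
  have "u ((u ^^ n) y) = (u ^^ n) (u y)" by (rule funpow_swap1)
  then show ?case by (simp add: b_skew Suc.IH)
qed simp

text \<open>Dividing q(u)x = 0 by the nonzero constant coefficient expresses x as a polynomial in u
  applied to u x: off t, u is invertible on kernels, with polynomial inverse.\<close>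

lemma inv_u:
  assumes "coeff q 0 \<noteq> 0" "pev q x = 0" shows "\<exists>s. x = pev s (u x)"
proof -
  obtain c h where q: "q = pCons c h" by (cases q)
  then have c: "c \<noteq> 0" using assms(1) by simp
  have e: "c *s x = - u (pev h x)" using assms(2) q by (simp add: pev_pCons eq_neg_iff_add_eq_0)
  have "x = (1 / c) *s (c *s x)" using c by simp
  also have "\<dots> = pev ([:- (1 / c):] * h) (u x)"
    unfolding e by (simp only: pev_mult pev_const pev_u u_scale u_minus scale_minus_left scale_minus_right)
  finally show ?thesis by blast
qed

lemma bezout_mult:
  fixes p q q' :: "'a poly"
  assumes "\<exists>r s. r * p + s * q = 1" "\<exists>r s. r * p + s * q' = 1"
  shows "\<exists>r s. r * p + s * (q * q') = 1"
proof -
  obtain r s r' s' where 1: "r * p + s * q = 1" and 2: "r' * p + s' * q' = 1" using assms by blast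
  have "(r * p + s * q) * (r' * p + s' * q') = 1" unfolding 1 2 by simp
  then have "(r * r' * p + r * s' * q' + s * q * r') * p + (s * s') * (q * q') = 1"
    by (simp add: algebra_simps)
  then show ?thesis by blast
qed

lemma bezout_power:
  fixes p q :: "'a poly"
  assumes "\<exists>r s. r * p + s * q = 1"
  shows "\<exists>r s. r * p ^ i + s * q ^ j = 1"
proof -
  have 1: "\<exists>r s. r * p + s * q ^ j = 1"
  proof (induction j)
    case 0
    show ?case by (rule exI[of _ 0], rule exI[of _ 1]) simp
  next
    case (Suc j)
    then show ?case using bezout_mult[OF assms Suc.IH] by simp
  qed
  then obtain r s where "r * p + s * q ^ j = 1" by blast
  then have "s * q ^ j + r * p = 1" by (simp add: add.commute)
  then have 2: "\<exists>r s. r * q ^ j + s * p = 1" by blast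
  have "\<exists>r s. r * q ^ j + s * p ^ i = 1"
  proof (induction i)
    case 0
    show ?case by (rule exI[of _ 0], rule exI[of _ 1]) simp
  next
    case (Suc i)
    then show ?case using bezout_mult[OF 2 Suc.IH] by simp
  qed
  then obtain r' s' where "r' * q ^ j + s' * p ^ i = 1" by blast
  then have "s' * p ^ i + r' * q ^ j = 1" by (simp add: add.commute)
  then show ?thesis by blast
qed

text \<open>\<open>D\<close> together with the first \<open>j\<close> iterates of \<open>x\<close>.
  The polynomials of degree below \<open>j\<close> are described by vanishing coefficients so that
  \<open>j = 0\<close> gives just \<open>D\<close>.\<close>

definition pspan :: "'b set \<Rightarrow> 'b \<Rightarrow> nat \<Rightarrow> 'b set" where
  "pspan D x j = {d + pev q x |d q. d \<in> D \<and> (\<forall>i\<ge>j. coeff q i = 0)}"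

lemma pspanI: "d \<in> D \<Longrightarrow> (\<And>i. i \<ge> j \<Longrightarrow> coeff q i = 0) \<Longrightarrow> d + pev q x \<in> pspan D x j"
  unfolding pspan_def by blast

lemma pev_monom: "pev (monom 1 j) x = (u ^^ j) x" using pev_X_power[of j x] by (simp add: monom_altdef)

lemma pspan_dim:
  assumes D: "fd D" and nin: "\<And>j. j < n \<Longrightarrow> (u ^^ j) x \<notin> pspan D x j"
  shows "subspace (pspan D x n)" "dim (pspan D x n) = dim D + n"
proof -
  define S where "S = pspan D x"
  have S_def': "S j = {d + pev q x |d q. d \<in> D \<and> (\<forall>i\<ge>j. coeff q i = 0)}" for j
    by (simp add: S_def pspan_def)
  note SI = pspanI[of _ D _ _ x, folded S_def]
  have sD: "subspace D" using D fd_subspace by blast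
  have S0: "S 0 = D" unfolding S_def'
  proof (intro Set.set_eqI iffI)
    fix z assume "z \<in> {d + pev q x |d q. d \<in> D \<and> (\<forall>i\<ge>0. coeff q i = 0)}"
    then obtain d q where "z = d + pev q x" "d \<in> D" "\<forall>i. coeff q i = 0" by blast
    then show "z \<in> D" by (simp add: poly_eq_iff[of q 0, symmetric] pev_def)
  next
    fix z assume "z \<in> D"
    then show "z \<in> {d + pev q x |d q. d \<in> D \<and> (\<forall>i\<ge>0. coeff q i = 0)}"
      by (intro CollectI exI[of _ z] exI[of _ 0]) simp
  qed
  have sS: "subspace (S j)" for j unfolding subspace_def
  proof (intro conjI ballI allI)
    show "0 \<in> S j" using SI[of 0 j 0] subspace_0[OF sD] by simp
    fix y z c assume "y \<in> S j"
    then obtain d q where 1: "y = d + pev q x" "d \<in> D" "\<forall>i\<ge>j. coeff q i = 0" unfolding S_def' by blast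
    have "c *s y = c *s d + pev ([:c:] * q) x"
      using 1 by (simp only: pev_mult pev_const scale_right_distrib)
    then show "c *s y \<in> S j" using SI[of "c *s d" j "[:c:] * q"] 1 subspace_scale[OF sD] by simp
    assume "z \<in> S j"
    then obtain d' q' where 2: "z = d' + pev q' x" "d' \<in> D" "\<forall>i\<ge>j. coeff q' i = 0"
      unfolding S_def' by blast
    have eq: "y + z = (d + d') + pev (q + q') x" using 1 2 by (simp add: pev_add)
    show "y + z \<in> S j" unfolding eq by (rule SI) (use 1 2 subspace_add[OF sD] in auto)
  qed
  note mon = pev_monom[of _ x]
  have Ssuc: "S (Suc j) = span (insert ((u ^^ j) x) (S j))" for j
  proof (intro Set.set_eqI iffI)
    fix z assume "z \<in> S (Suc j)"
    then obtain d q where 1: "z = d + pev q x" "d \<in> D" "\<forall>i\<ge>Suc j. coeff q i = 0" unfolding S_def' by blast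
    define q' where "q' = q - monom (coeff q j) j"
    have "coeff q' i = 0" if "i \<ge> j" for i using 1(3) that unfolding q'_def by (cases "i = j") auto
    then have "d + pev q' x \<in> S j" using SI 1 by blast
    moreover have "z = coeff q j *s (u ^^ j) x + (d + pev q' x)"
    proof -
      have "monom (coeff q j) j = [:coeff q j:] * monom 1 j" by (simp add: smult_monom)
      then have "q = q' + [:coeff q j:] * monom 1 j" unfolding q'_def by simp
      then have "pev q x = pev (q' + [:coeff q j:] * monom 1 j) x" by simp
      then have "pev q x = pev q' x + coeff q j *s (u ^^ j) x"
        by (simp only: pev_add pev_mult pev_const mon)
      then show ?thesis using 1 by simp
    qed
    ultimately show "z \<in> span (insert ((u ^^ j) x) (S j))" using mem_span_insert[OF sS] by blast
  next
    fix z assume z: "z \<in> span (insert ((u ^^ j) x) (S j))"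
    have "S j \<subseteq> S (Suc j)"
    proof
      fix w assume "w \<in> S j"
      then obtain d q where "w = d + pev q x" "d \<in> D" "\<forall>i\<ge>j. coeff q i = 0" unfolding S_def' by blast
      then show "w \<in> S (Suc j)" using SI[of d "Suc j" q] by simp
    qed
    moreover have "(u ^^ j) x \<in> S (Suc j)"
      using SI[of 0 "Suc j" "monom 1 j"] subspace_0[OF sD] mon by simp
    ultimately show "z \<in> S (Suc j)" using z span_minimal[OF _ sS[of "Suc j"]] by blast
  qed
  have fS: "fd (S j)" for j by (induction j) (simp_all add: S0 D Ssuc fd_insert)
  have dS: "dim (S j) = dim D + j" if "j \<le> n" for j using that
  proof (induction j)
    case 0
    then show ?case by (simp add: S0)
  next
    case (Suc j)
    then show ?case using dim_insert_notin[OF fS nin[of j, folded S_def]] by (simp add: Ssuc)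
  qed
  show "subspace (pspan D x n)" "dim (pspan D x n) = dim D + n"
    using sS[of n] dS[of n] unfolding S_def by simp_all
qed

text \<open>Modulo \<open>D\<close> the vector \<open>x\<close> generates a copy of the field
  F[t]/(p). A relation among fewer than \<open>degree p\<close> iterates would be coprime to p, and
  by Bezout would put \<open>x\<close> into \<open>D\<close>.\<close>

lemma step_dim:
  assumes p: "Factorial_Ring.irreducible p" and D: "fd D" "ustable D" and x: "x \<notin> D" "pev p x \<in> D"
  shows "dim (ssum D (cyc x)) = dim D + degree p"
proof -
  have sD: "subspace D" using D fd_subspace by blast
  note S_def = pspan_def[of D x] and SI = pspanI[of _ D _ _ x] and mon = pev_monom[of _ x]
  let ?S = "pspan D x"
  have nin: "(u ^^ j) x \<notin> ?S j" if j: "j < degree p" for j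
  proof
    assume "(u ^^ j) x \<in> ?S j"
    then obtain d q where 1: "(u ^^ j) x = d + pev q x" "d \<in> D" "\<forall>i\<ge>j. coeff q i = 0" unfolding S_def by blast
    define r where "r = monom 1 j - q"
    have "coeff r j = 1" using 1(3) unfolding r_def by simp
    then have r0: "r \<noteq> 0" by auto
    have "degree r \<le> j"
    proof (rule degree_le)
      show "\<forall>i>j. coeff r i = 0" using 1(3) unfolding r_def by simp
    qed
    then have "\<not> p dvd r" using dvd_imp_degree_le[of p r] r0 j by auto
    then obtain s t where st: "s * p + t * r = 1" using irreducible_bezout[OF p] by blast
    have rx: "pev r x \<in> D" using 1 unfolding r_def by (simp add: pev_diff mon)
    have "x = pev s (pev p x) + pev t (pev r x)"
      using st by (simp only: pev_mult[symmetric] pev_add[symmetric] pev_1)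
    moreover have "pev s (pev p x) + pev t (pev r x) \<in> D"
      using pev_stable[OF sD D(2)] x(2) rx subspace_add[OF sD] by blast
    ultimately have "x \<in> D" by simp
    with x show False by blast
  qed
  have "?S (degree p) = ssum D (cyc x)"
  proof
    show "?S (degree p) \<subseteq> ssum D (cyc x)" unfolding S_def by (auto intro: ssum_mem)
    show "ssum D (cyc x) \<subseteq> ?S (degree p)"
    proof
      fix z assume "z \<in> ssum D (cyc x)"
      then obtain d q where z: "z = d + pev q x" "d \<in> D" unfolding ssum_def cyc_def by blast
      have "pev q x = pev ((q div p) * p + q mod p) x" by simp
      then have "pev q x = pev (q div p) (pev p x) + pev (q mod p) x" by (simp only: pev_add pev_mult)
      then have "z = (d + pev (q div p) (pev p x)) + pev (q mod p) x" using z by simp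
      moreover have "d + pev (q div p) (pev p x) \<in> D"
        using z x(2) pev_stable[OF sD D(2)] subspace_add[OF sD] by blast
      moreover have "coeff (q mod p) i = 0" if "i \<ge> degree p" for i
      proof (cases "q mod p = 0")
        case False
        have "p \<noteq> 0" using p by auto
        then have "degree (q mod p) < degree p" using degree_mod_less[of p q] False by blast
        then show ?thesis using that by (simp add: coeff_eq_0)
      qed simp
      ultimately show "z \<in> ?S (degree p)" using SI by simp
    qed
  qed
  then show ?thesis using pspan_dim(2)[OF D(1) nin, of "degree p"] by simp
qed

text \<open>M/D is a vector space over F[t]/(p). The quotient is avoided by a filtration whose steps
  add one cyclic submodule each.\<close>

lemma chain_dim:
  assumes p: "Factorial_Ring.irreducible p" "degree p > 0" and M: "fd M" "ustable M"
    and D: "subspace D" "ustable D" "D \<subseteq> M" "\<And>x. x \<in> M \<Longrightarrow> pev p x \<in> D"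
  shows "\<exists>m. dim M = dim D + degree p * m" using D
proof (induction "dim M - dim D" arbitrary: D rule: less_induct)
  case less
  show ?case
  proof (cases "D = M")
    case True
    then show ?thesis by (intro exI[of _ 0]) simp
  next
    case False
    then obtain x where x: "x \<in> M" "x \<notin> D" using less.prems by blast
    let ?D = "ssum D (cyc x)"
    have fD: "fd D" by (rule fd_mono[OF M(1) less.prems(1,3)])
    have d: "dim ?D = dim D + degree p"
      by (rule step_dim[OF p(1) fD less.prems(2) x(2) less.prems(4)[OF x(1)]])
    have sub: "?D \<subseteq> M"
      by (rule ssum_least[OF fd_subspace[OF M(1)] less.prems(3) cyc_sub[OF fd_subspace[OF M(1)] M(2) x(1)]])
    have sD: "subspace ?D" by (rule subspace_ssum[OF less.prems(1) subspace_cyc])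
    have le: "dim ?D \<le> dim M" by (rule dim_mono_fd[OF M(1) sD sub])
    have "\<exists>m. dim M = dim ?D + degree p * m"
    proof (rule less.hyps[OF _ sD ustable_ssum[OF less.prems(2) ustable_cyc] sub])
      show "dim M - dim ?D < dim M - dim D" using d le p(2) by linarith
      show "pev p z \<in> ?D" if "z \<in> M" for z
        using less.prems(4)[OF that] ssum_upper(1)[OF less.prems(1) subspace_cyc] by blast
    qed
    then obtain m where "dim M = dim D + degree p + degree p * m" using d by auto
    then have "dim M = dim D + degree p * Suc m" by simp
    then show ?thesis by blast
  qed
qed

text \<open>\<open>I1\<close> plus the radical of the sum is its own orthogonal: what is orthogonal
  to \<open>I1\<close> has an \<open>I2\<close>-component orthogonal to both summands.\<close>

lemma neutral_sum:
  assumes I: "fd I1" "fd I2" and iso: "\<And>x y. x \<in> I1 \<Longrightarrow> y \<in> I1 \<Longrightarrow> b x y = 0"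
      "\<And>x y. x \<in> I2 \<Longrightarrow> y \<in> I2 \<Longrightarrow> b x y = 0"
  shows "\<exists>L. subspace L \<and> L = {x\<in>ssum I1 I2. \<forall>y\<in>L. b x y = 0}"
proof -
  let ?E = "ssum I1 I2"
  have s: "subspace I1" "subspace I2" using I fd_subspace by auto
  have sE: "subspace ?E" by (rule subspace_ssum[OF s])
  let ?R = "{x\<in>?E. \<forall>y\<in>?E. b x y = 0}"
  have sR: "subspace ?R" using sE unfolding subspace_def by (auto simp: bD)
  let ?L = "ssum I1 ?R"
  have "?L = {x\<in>?E. \<forall>y\<in>?L. b x y = 0}"
  proof (intro Set.set_eqI iffI)
    fix x assume "x \<in> ?L"
    then obtain i r where ir: "x = i + r" "i \<in> I1" "r \<in> ?R" unfolding ssum_def by blast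
    have iE: "i \<in> ?E" if "i \<in> I1" for i using that ssum_upper(1)[OF s] by blast
    have "b x y = 0" if y: "y \<in> ?L" for y
    proof -
      obtain j t where jt: "y = j + t" "j \<in> I1" "t \<in> ?R" using y unfolding ssum_def by blast
      have "b i t = 0" "b r j = 0" "b r t = 0" "b i j = 0" using ir jt iE iso(1) b_sym[of i t] by auto
      then show ?thesis using ir jt by (simp add: bD)
    qed
    then show "x \<in> {x\<in>?E. \<forall>y\<in>?L. b x y = 0}" using ir iE subspace_add[OF sE] by blast
  next
    fix x assume x: "x \<in> {x\<in>?E. \<forall>y\<in>?L. b x y = 0}"
    then obtain i j where ij: "x = i + j" "i \<in> I1" "j \<in> I2" unfolding ssum_def by blast
    have "b j y = 0" if y: "y \<in> ?E" for y
    proof -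
      obtain i' j' where y': "y = i' + j'" "i' \<in> I1" "j' \<in> I2" using y unfolding ssum_def by blast
      have "i' \<in> ?L" using ssum_upper(1)[OF s(1) sR] y' by blast
      then have "b x i' = 0" using x by blast
      then show ?thesis using y' ij iso by (simp add: bD)
    qed
    moreover have "j \<in> ?E" using ij ssum_upper(2)[OF s] by blast
    ultimately have "j \<in> ?R" by blast
    then have "i + j \<in> ?L" by (rule ssum_mem[OF ij(2)])
    then show "x \<in> ?L" using ij(1) by simp
  qed
  then show ?thesis using subspace_ssum[OF s(1) sR] by blast
qed

end

section \<open>Necessity: consequences of an anticommuting partner v\<close>

locale paired = skew_space scale b u
  for scale :: "'a::field \<Rightarrow> 'b::ab_group_add \<Rightarrow> 'b"  (infixr \<open>*s\<close> 75) and b u +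
  fixes X :: "'b set" and v :: "'b \<Rightarrow> 'b"
  assumes X: "good X" and v_add: "v (x + y) = v x + v y" and v_scale: "v (c *s x) = c *s v x"
    and v_in: "x \<in> X \<Longrightarrow> v x \<in> X" and v_u: "x \<in> X \<Longrightarrow> v (u x) = - u (v x)"
    and v_v: "x \<in> X \<Longrightarrow> v (v x) = - u (u x)"
    and v_skew: "x \<in> X \<Longrightarrow> y \<in> X \<Longrightarrow> b (v x) y = - b x (v y)"
begin

lemma v_0 [simp]: "v 0 = 0" using v_scale[of 0 0] by simp

lemma pevX: "x \<in> X \<Longrightarrow> pev q x \<in> X" using pev_stable[OF goodD(2,3)[OF X]] .
lemma uX: "x \<in> X \<Longrightarrow> u x \<in> X" using goodD(3)[OF X] by (simp add: ustable_def)

lemma v_pev: "x \<in> X \<Longrightarrow> v (pev q x) = pev (negp q) (v x)"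
proof (induction q)
  case (pCons a q)
  have "v (pev (pCons a q) x) = a *s v x - u (v (pev q x))"
    using pCons.prems by (simp add: pev_pCons v_add v_scale v_u pevX)
  then show ?case using pCons unfolding negp_pCons by (simp add: pev_diff pev_pCons pev_minus u_minus)
qed simp

text \<open>u + s v is twice one of the two square-zero summands, so \<open>y\<close> lies in its
  image; this makes v act on \<open>y\<close> as -s u. Comparing b(y, q(u)y) for \<open>q\<close>
  and \<open>negp q\<close>, skewness of v gives opposite values and symmetry of b equal
  ones.\<close>

lemma sub_iso:
  assumes x: "x \<in> X" and s: "s = 1 \<or> s = - 1" and y: "y = u x + s *s v x"
  shows "v y = - (s *s u y)" "b y (pev q y) = 0" "y \<in> X"
proof -
  have ss: "s *s s *s z = z" "s * s = 1" for z using s by auto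
  show yX: "y \<in> X" using y x uX v_in subspace_add[OF goodD(2)[OF X]] subspace_scale[OF goodD(2)[OF X]] by blast
  show vy: "v y = - (s *s u y)"
    unfolding y by (simp add: v_add v_scale v_u v_v x ss u_add u_scale scale_right_distrib)
  have h: "b y (pev q y) = - b x (pev (q - negp q) (u y))" for q
  proof -
    have "b y (pev q y) = b (u x) (pev q y) + s * b (v x) (pev q y)" by (subst (1) y) (simp add: bD)
    also have "\<dots> = - b x (u (pev q y)) - s * b x (v (pev q y))" by (simp add: b_skew v_skew x pevX yX)
    also have "v (pev q y) = - (s *s pev (negp q) (u y))"
      by (simp add: v_pev yX vy pev_minus_arg pev_scale_arg)
    also have "- b x (u (pev q y)) - s * b x (- (s *s pev (negp q) (u y)))
        = - b x (pev q (u y)) + s * s * b x (pev (negp q) (u y))" by (simp add: bD pev_u)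
    also have "s * s = 1" using s by auto
    finally show ?thesis by (simp add: pev_diff bD)
  qed
  have "b y (pev q y) = b y (pev (negp q) y)" using pev_adj'[of y q y] b_sym[of "pev (negp q) y" y] by simp
  moreover have "b y (pev (negp q) y) = - b y (pev q y)"
    unfolding h[of "negp q"] h[of q] by (simp add: pev_diff bD)
  ultimately have "2 * b y (pev q y) = 0" by simp
  then show "b y (pev q y) = 0" using two by simp
qed

text \<open>Take \<open>M\<close> maximal among the isotropic subspaces stable under both u and v.
  For \<open>x\<close> orthogonal to \<open>M\<close>, the cyclic modules of u x + v x and u x - v x
  are isotropic and stable by \<open>sub_iso\<close>, so maximality absorbs them and
  \<open>M\<close> turns out to be its own orthogonal.\<close>

lemma condI_paired:
  assumes p: "negp p = p" "coeff p 0 \<noteq> 0"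
  shows "condI X p k"
proof -
  let ?P = "p ^ (k - 1)" and ?K = "ker X (p ^ k)"
  have P: "negp ?P = ?P" and pk: "negp (p ^ k) = p ^ k" using p by simp_all
  have sK: "subspace ?K" and fK: "fd ?K" and uK: "ustable ?K"
    using subspace_ker fd_ker ustable_ker goodD[OF X] by blast+
  have KX: "x \<in> X" if "x \<in> ?K" for x using that kerD by blast
  have vK: "v x \<in> ?K" if "x \<in> ?K" for x
    using that v_in v_pev[of x "p ^ k"] pk by (simp add: ker_def)
  let ?F = "\<lambda>M. subspace M \<and> M \<subseteq> ?K \<and> ustable M \<and> (\<forall>x\<in>M. v x \<in> M) \<and> (\<forall>x\<in>M. \<forall>y\<in>M. b x (pev ?P y) = 0)"
  have F0: "?F {0}" using subspace_0[OF sK] by (auto simp: ustable_def bD subspace_single_0)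
  obtain M where M: "?F M" "\<And>M'. ?F M' \<Longrightarrow> M \<subseteq> M' \<Longrightarrow> M' = M"
  proof -
    have "\<exists>M. ?F M \<and> (\<forall>M'. ?F M' \<longrightarrow> M \<subseteq> M' \<longrightarrow> M' = M) \<and> (\<forall>M'. ?F M' \<longrightarrow> dim M' \<le> dim M)"
      by (rule max_dim_exists[of ?K ?F "{0}", OF fK F0]) blast
    then obtain M where M: "?F M \<and> (\<forall>M'. ?F M' \<longrightarrow> M \<subseteq> M' \<longrightarrow> M' = M) \<and> (\<forall>M'. ?F M' \<longrightarrow> dim M' \<le> dim M)"
      by (rule exE)
    show thesis
    proof (rule that)
      show "?F M" using M by (rule conjunct1)
      show "M' = M" if "?F M'" "M \<subseteq> M'" for M'
        using M[THEN conjunct2, THEN conjunct1, rule_format, OF that] .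
    qed
  qed
  have sM: "subspace M" and MK: "M \<subseteq> ?K" and uM: "ustable M" and vM: "\<And>x. x \<in> M \<Longrightarrow> v x \<in> M"
    and iM: "\<And>x y. x \<in> M \<Longrightarrow> y \<in> M \<Longrightarrow> b x (pev ?P y) = 0" using M(1) by auto
  have uMd: "u x \<in> M" if "x \<in> M" for x using uM that by (simp add: ustable_def)
  have key: "y \<in> M" if x: "x \<in> ?K" "\<And>m. m \<in> M \<Longrightarrow> b m (pev ?P x) = 0"
      and s: "s = 1 \<or> s = - 1" and y: "y = u x + s *s v x" for x y s
  proof -
    note f = sub_iso[OF KX[OF x(1)] s y]
    have yK: "y \<in> ?K" unfolding y using x(1) vK uK sK
      by (auto simp: ustable_def subspace_add subspace_scale)
    have my: "b m (pev ?P y) = 0" if m: "m \<in> M" for m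
    proof -
      have "b m (pev ?P (u x)) = - b (u m) (pev ?P x)" by (simp add: b_skew pev_u)
      moreover have "b m (pev ?P (v x)) = - b (v m) (pev ?P x)"
        using v_pev[of x ?P] P v_skew[of m "pev ?P x"] KX[OF x(1)] KX MK m pevX by auto
      ultimately show ?thesis using x(2)[OF uMd[OF m]] x(2)[OF vM[OF m]]
        unfolding y by (simp add: pev_add_arg pev_scale_arg bD)
    qed
    have mq: "b m (pev ?P (pev q y)) = 0" if m: "m \<in> M" for m q
    proof -
      have "b m (pev ?P (pev q y)) = b (pev (negp q) m) (pev ?P y)"
        by (simp only: pev_adj negp_negp pev_commute[of ?P q y])
      then show ?thesis using my pev_stable[OF sM uM m] by simp
    qed
    have qm: "b (pev q y) (pev ?P m) = 0" if m: "m \<in> M" for m q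
    proof -
      have "b (pev q y) (pev ?P m) = b (pev ?P m) (pev q y)" by (rule b_sym)
      also have "\<dots> = b m (pev (negp ?P) (pev q y))" by (rule pev_adj)
      finally show ?thesis using mq[OF m] unfolding P by simp
    qed
    let ?M = "ssum M (cyc y)"
    have "?F ?M"
    proof (intro conjI ballI)
      show "subspace ?M" by (rule subspace_ssum[OF sM subspace_cyc])
      show "?M \<subseteq> ?K" by (rule ssum_least[OF sK MK cyc_sub[OF sK uK yK]])
      show "ustable ?M" by (rule ustable_ssum[OF uM ustable_cyc])
      fix z assume "z \<in> ?M"
      then obtain m q where z: "z = m + pev q y" "m \<in> M" unfolding ssum_def cyc_def by blast
      have "v z = v m + pev (negp q) (- (s *s u y))" using z f by (simp add: v_add v_pev)
      also have "\<dots> = v m + pev (negp q * [:0, - s:]) y"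
        by (simp only: pev_mult) (simp add: pev_pCons u_scale u_minus)
      finally show "v z \<in> ?M" using ssum_mem[OF vM[OF z(2)] cycI] by simp
      fix w assume "w \<in> ?M"
      then obtain m' q' where w: "w = m' + pev q' y" "m' \<in> M" unfolding ssum_def cyc_def by blast
      have "b (pev q y) (pev ?P (pev q' y)) = 0"
        using f(2)[of "negp q * ?P * q'"] by (simp add: pev_adj pev_mult)
      then show "b z (pev ?P w) = 0" using z w iM mq qm by (simp add: pev_add_arg bD)
    qed
    then have "?M = M" using M(2) ssum_upper(1)[OF sM subspace_cyc] by blast
    then show ?thesis using ssum_upper(2)[OF sM subspace_cyc[of y]] cyc_self[of y] by blast
  qed
  have "M = {x\<in>?K. \<forall>y\<in>M. b x (pev ?P y) = 0}"
  proof
    show "M \<subseteq> {x\<in>?K. \<forall>y\<in>M. b x (pev ?P y) = 0}" using MK iM by blast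
    show "{x\<in>?K. \<forall>y\<in>M. b x (pev ?P y) = 0} \<subseteq> M"
    proof
      fix x assume x: "x \<in> {x\<in>?K. \<forall>y\<in>M. b x (pev ?P y) = 0}"
      have x': "b m (pev ?P x) = 0" if "m \<in> M" for m
      proof -
        have "b m (pev ?P x) = b x (pev ?P m)" using pev_adj[of ?P m x] P by (simp add: b_sym[of x])
        then show ?thesis using x that by simp
      qed
      \<comment> \<open>Adding the two signs removes v and leaves 2 u x; then \<open>x\<close>
        itself is recovered because u is invertible on Ker p(u)^k.\<close>
      have "u x + 1 *s v x \<in> M" "u x + (- 1) *s v x \<in> M" using key[of x] x x' by blast+
      then have "(u x + 1 *s v x) + (u x + (- 1) *s v x) \<in> M" using subspace_add[OF sM] by blast
      then have "(1 / 2) *s (u x + u x) \<in> M" using subspace_scale[OF sM] by simp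
      moreover have "(1 / 2) *s (u x + u x) = u x"
      proof -
        have "(1 / 2) *s (u x + u x) = (1 / 2 + 1 / 2) *s u x"
          by (simp only: scale_right_distrib scale_left_distrib)
        also have "(1 / 2 + 1 / 2 :: 'a) = 1" using two by (simp add: field_simps)
        finally show ?thesis by simp
      qed
      ultimately have "u x \<in> M" by simp
      moreover obtain s where "x = pev s (u x)"
        using inv_u[of "p ^ k" x] x p(2) by (auto simp: ker_def coeff_0_power)
      ultimately show "x \<in> M" using pev_stable[OF sM uM, of "u x" s] by simp
    qed
  qed
  then show ?thesis unfolding condI_def using sM uM by blast
qed

text \<open>Inserting v into the form makes it alternating, so the half-dimensional isotropic
  subspaces exist without any arithmetic condition. Hence dim K + dim D = 2 dim M for a maximal
  stable one, and M/D contributes a multiple of \<open>degree p\<close>.\<close>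

lemma condII_paired:
  assumes p: "Factorial_Ring.irreducible p" "coeff p 0 \<noteq> 0" "degree p > 0" and k: "k \<ge> 1"
  shows "condII X p k"
proof -
  let ?P = "p ^ (k - 1)" and ?K = "ker X (p ^ k)" and ?D = "jden X p k"
  have pk: "p ^ k = p * ?P" using k by (cases k) auto
  have sK: "subspace ?K" and fK: "fd ?K" and uK: "ustable ?K"
    using subspace_ker fd_ker ustable_ker goodD[OF X] by blast+
  have KX: "x \<in> X" if "x \<in> ?K" for x using that kerD by blast
  \<comment> \<open>The anticommutation of v with u makes u selfadjoint for \<open>c\<close>, and
    \<open>c\<close> is alternating on \<open>X\<close>; so every cyclic submodule of Ker p(u)^k is
    isotropic for \<open>c\<close>.\<close>
  define c where "c x y = b x (v (pev ?P y))" for x y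
  have c_bil: "bilform c" unfolding bilform_def c_def
    by (simp add: bD pev_add_arg pev_scale_arg v_add v_scale)
  have c_alt: "c y x = - c x y" if "x \<in> X" "y \<in> X" for x y
  proof -
    have "c y x = - b (v y) (pev ?P x)" unfolding c_def using that v_skew pevX by simp
    also have "\<dots> = - b (v (pev ?P y)) x" using that by (simp add: v_pev pev_adj')
    finally show ?thesis by (simp add: c_def b_sym)
  qed
  have c_u: "c (pev q x) y = c x (pev q y)" if "x \<in> X" "y \<in> X" for x y q
  proof -
    have "c (pev q x) y = b x (pev (negp q) (v (pev ?P y)))" unfolding c_def by (simp add: pev_adj)
    also have "\<dots> = b x (v (pev q (pev ?P y)))" using that v_pev pevX by simp
    finally show ?thesis unfolding c_def by (simp add: pev_commute[of q])
  qed
  let ?F = "\<lambda>M. subspace M \<and> M \<subseteq> ?K \<and> ustable M \<and> (\<forall>x\<in>M. \<forall>y\<in>M. c x y = 0)"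
  have F0: "?F {0}" using subspace_0[OF sK] by (auto simp: ustable_def bilformD[OF c_bil] subspace_single_0)
  obtain M where M: "?F M" "\<And>M'. ?F M' \<Longrightarrow> M \<subseteq> M' \<Longrightarrow> M' = M"
  proof -
    have "\<exists>M. ?F M \<and> (\<forall>M'. ?F M' \<longrightarrow> M \<subseteq> M' \<longrightarrow> M' = M) \<and> (\<forall>M'. ?F M' \<longrightarrow> dim M' \<le> dim M)"
      by (rule max_dim_exists[of ?K ?F "{0}", OF fK F0]) blast
    then obtain M where M: "?F M \<and> (\<forall>M'. ?F M' \<longrightarrow> M \<subseteq> M' \<longrightarrow> M' = M) \<and> (\<forall>M'. ?F M' \<longrightarrow> dim M' \<le> dim M)"
      by (rule exE)
    show thesis
    proof (rule that)
      show "?F M" using M by (rule conjunct1)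
      show "M' = M" if "?F M'" "M \<subseteq> M'" for M'
        using M[THEN conjunct2, THEN conjunct1, rule_format, OF that] .
    qed
  qed
  have sM: "subspace M" and MK: "M \<subseteq> ?K" and uM: "ustable M"
    and iM: "\<And>x y. x \<in> M \<Longrightarrow> y \<in> M \<Longrightarrow> c x y = 0" using M(1) by auto
  have MX: "x \<in> X" if "x \<in> M" for x using KX MK that by blast
  have key: "x \<in> M" if x: "x \<in> ?K" "\<And>m. m \<in> M \<Longrightarrow> c m x = 0" for x
  proof -
    let ?M = "ssum M (cyc x)"
    have xX: "x \<in> X" using KX x by blast
    have xx: "c (pev q x) (pev r x) = 0" for q r
    proof -
      have 1: "c (pev q x) (pev r x) = c x (pev (q * r) x)" using c_u xX pevX by (simp add: pev_mult)
      have "c x (pev s x) = - c x (pev s x)" for s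
        using c_alt[OF xX pevX[OF xX], of s] c_u[OF xX xX, of s] by simp
      then have "2 * c x (pev s x) = 0" for s
        unfolding mult_2 using eq_neg_iff_add_eq_0[of "c x (pev s x)" "c x (pev s x)"] by blast
      then show ?thesis using 1 two by simp
    qed
    have mx: "c m (pev q x) = 0" if "m \<in> M" for m q
      using c_u[OF MX[OF that] xX, of q] x(2)[OF pev_stable[OF sM uM that, of q]] by simp
    have xm: "c (pev q x) m = 0" if "m \<in> M" for m q
      using c_alt[OF MX[OF that] pevX[OF xX]] mx[OF that] by simp
    have "?F ?M"
    proof (intro conjI ballI)
      show "subspace ?M" by (rule subspace_ssum[OF sM subspace_cyc])
      show "?M \<subseteq> ?K" by (rule ssum_least[OF sK MK cyc_sub[OF sK uK x(1)]])
      show "ustable ?M" by (rule ustable_ssum[OF uM ustable_cyc])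
      fix z w assume "z \<in> ?M" "w \<in> ?M"
      then obtain m q m' q' where "z = m + pev q x" "m \<in> M" "w = m' + pev q' x" "m' \<in> M"
        unfolding ssum_def cyc_def by blast
      then show "c z w = 0" using iM mx xm xx by (simp add: bilformD[OF c_bil])
    qed
    then have "?M = M" using M(2) ssum_upper(1)[OF sM subspace_cyc] by blast
    then show ?thesis using ssum_upper(2)[OF sM subspace_cyc[of x]] cyc_self[of x] by blast
  qed
  have perpM: "{x\<in>?K. \<forall>m\<in>M. c m x = 0} = M" using key iM MK by blast
  have D_rad: "c x m = 0" if m: "m \<in> ?D" and x: "x \<in> ?K" for x m
  proof -
    obtain z where z: "z \<in> X" "pev ?P m = pev (p ^ k) z" using m unfolding jden_def by blast
    have "c x m = b x (pev (negp (p ^ k)) (v z))" unfolding c_def z(2) using z(1) by (simp only: v_pev)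
    also have "\<dots> = b (pev (p ^ k) x) (v z)" by (simp only: pev_adj)
    finally show ?thesis using x by (simp add: ker_def bD)
  qed
  have R: "{m\<in>M. \<forall>x\<in>?K. c m x = 0} = ?D"
  proof (intro Set.set_eqI iffI)
    fix m assume m: "m \<in> {m\<in>M. \<forall>x\<in>?K. c m x = 0}"
    have mX: "m \<in> X" using m MX by blast
    have h: "b (v (pev ?P m)) x = 0" if "x \<in> X" "pev (p ^ k) x = 0" for x
    proof -
      have "c x m = 0" using c_alt[OF mX that(1)] m that by (simp add: ker_def)
      then show ?thesis by (simp add: c_def b_sym)
    qed
    obtain w where w: "w \<in> X" "v (pev ?P m) = pev (negp (p ^ k)) w"
      using perp_ker[OF X v_in[OF pevX[OF mX]] h] by blast
    let ?y = "pev ?P m"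
    have y: "?y \<in> X" using pevX mX by blast
    \<comment> \<open>v sends p(u)^(k-1) m into Im p(-u)^k; a second application gives -u^2 on one
      side and Im p(u)^k on the other. Invertibility of u on Ker p(u) then removes u^2, so the
      radical of \<open>c\<close> is exactly \<open>jden X p k\<close>.\<close>
    have uu: "u (u ?y) = pev (p ^ k) (- v w)"
      using v_v[OF y] w v_pev[OF w(1), of "negp (p ^ k)"] by (simp add: pev_minus_arg eq_neg_iff_add_eq_0 add.commute)
    have "pev p ?y = 0" using m MK pk by (auto simp: ker_def pev_mult)
    then obtain s where s: "?y = pev s (u ?y)" using inv_u[OF p(2)] by blast
    have "?y = pev s (u (pev s (u ?y)))" using s by simp
    also have "\<dots> = pev (s * s) (u (u ?y))" by (simp add: pev_mult pev_u)
    also have "\<dots> = pev (p ^ k) (pev (s * s) (- v w))" unfolding uu by (rule pev_commute)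
    finally have "?y = pev (p ^ k) (pev (s * s) (- v w))" .
    moreover have "pev (s * s) (- v w) \<in> X"
      using pevX v_in w(1) subspace_neg[OF goodD(2)[OF X]] by blast
    ultimately show "m \<in> ?D" using m MK unfolding jden_def by blast
  next
    fix m assume m: "m \<in> ?D"
    then have mK: "m \<in> ?K" using jden_sub by blast
    have "m \<in> M" using key[OF mK] D_rad[OF m] MK by blast
    then show "m \<in> {m\<in>M. \<forall>x\<in>?K. c m x = 0}"
      using D_rad[OF m] c_alt[OF KX KX[OF mK]] by auto
  qed
  have d1: "dim M + dim M = dim ?K + dim ?D" using dim_perp[OF c_bil fK sM MK] perpM R by simp
  have "pev p x \<in> ?D" if "x \<in> M" for x
  proof -
    have "x \<in> ?K" using that MK by blast
    then have "pev ?P (pev p x) = 0" "pev p x \<in> ?K"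
      using pev_stable[OF sK uK] kerD(2)[of x X "p ^ k"] pev_commute[of ?P p x] by (auto simp: pk pev_mult)
    then show ?thesis unfolding jden_def using subspace_0[OF goodD(2)[OF X]] by (auto intro!: bexI[of _ 0])
  qed
  moreover have "?D \<subseteq> M" using R by blast
  ultimately obtain m where "dim M = dim ?D + degree p * m"
    using chain_dim[OF p(1,3) fd_mono[OF fK sM MK] uM subspace_jden[OF goodD(2)[OF X]]
        ustable_jden[OF goodD(3)[OF X]], of p k] by blast
  then have "dim ?K = dim ?D + 2 * degree p * m" using d1 by simp
  then show ?thesis unfolding condII_def by blast
qed

text \<open>The images of u^k (u + v) and u^k (u - v) are totally isotropic, and their sum lies
  between Im u^(k+1) and Im u^k because the two maps add up to 2 u^(k+1). It therefore serves as
  \<open>E\<close>.\<close>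

lemma condN_paired: "condN X k"
proof -
  define I where "I s = (\<lambda>x. (u ^^ k) (u x + s *s v x)) ` X" for s
  have sI: "fd (I s)" for s
  proof (rule fd_mono[OF goodD(1)[OF X]])
    show "subspace (I s)" unfolding subspace_def I_def
    proof (intro conjI ballI allI)
      show "0 \<in> (\<lambda>x. (u ^^ k) (u x + s *s v x)) ` X"
        using subspace_0[OF goodD(2)[OF X]] upow_scale[of k 0 0] by (auto intro!: image_eqI[of _ _ 0])
      fix y z c assume "y \<in> (\<lambda>x. (u ^^ k) (u x + s *s v x)) ` X"
      then obtain x where x: "x \<in> X" "y = (u ^^ k) (u x + s *s v x)" by blast
      have "u (c *s x) + s *s v (c *s x) = c *s (u x + s *s v x)"
        by (simp add: u_scale v_scale scale_right_distrib mult.commute)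
      then have "c *s y = (u ^^ k) (u (c *s x) + s *s v (c *s x))" using x by (simp only: upow_scale)
      then show "c *s y \<in> (\<lambda>x. (u ^^ k) (u x + s *s v x)) ` X"
        using x subspace_scale[OF goodD(2)[OF X]] by blast
      assume "z \<in> (\<lambda>x. (u ^^ k) (u x + s *s v x)) ` X"
      then obtain w where w: "w \<in> X" "z = (u ^^ k) (u w + s *s v w)" by blast
      have "u (x + w) + s *s v (x + w) = (u x + s *s v x) + (u w + s *s v w)"
        by (simp add: u_add v_add scale_right_distrib)
      then have "y + z = (u ^^ k) (u (x + w) + s *s v (x + w))" using x w by (simp only: upow_add)
      then show "y + z \<in> (\<lambda>x. (u ^^ k) (u x + s *s v x)) ` X"
        using x w subspace_add[OF goodD(2)[OF X]] by blast
    qed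
    show "I s \<subseteq> X" unfolding I_def
      using uX v_in subspace_add[OF goodD(2)[OF X]] subspace_scale[OF goodD(2)[OF X]]
        pevX[of _ "[:0, 1:] ^ k"] by (auto simp: pev_X_power)
  qed
  have iso: "b x y = 0" if s: "s = 1 \<or> s = - 1" and xy: "x \<in> I s" "y \<in> I s" for s x y
  proof -
    obtain z where z: "z \<in> X" "x = (u ^^ k) (u z + s *s v z)" using xy(1) unfolding I_def by blast
    obtain w where w: "w \<in> X" "y = (u ^^ k) (u w + s *s v w)" using xy(2) unfolding I_def by blast
    note f = sub_iso[OF w(1) s refl]
    let ?w = "u w + s *s v w" and ?q = "[:0, 1:] ^ (k + k) :: 'a poly"
    have q: "negp ?q = ?q" 
      by (simp only: negp_power negp_X) (simp only: power_add flip: power_mult_distrib, simp)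
    have yq: "(u ^^ k) y = pev ?q ?w" unfolding w(2) by (simp only: pev_X_power funpow_add o_apply)
    have "b x y = (- 1) ^ k * b (u z + s *s v z) (pev ?q ?w)" unfolding z(2) upow_adj yq ..
    also have "b (u z + s *s v z) (pev ?q ?w) = - b z (u (pev ?q ?w)) - s * b z (v (pev ?q ?w))"
      using v_skew[OF z(1) pevX[OF f(3)]] by (simp add: bD b_skew)
    also have "v (pev ?q ?w) = - (s *s pev ?q (u ?w))"
      using v_pev[OF f(3), of ?q] q f(1) by (simp add: pev_minus_arg pev_scale_arg)
    also have "- b z (u (pev ?q ?w)) - s * b z (- (s *s pev ?q (u ?w))) = (s * s - 1) * b z (pev ?q (u ?w))"
      by (simp add: bD pev_u algebra_simps)
    also have "s * s = 1" using s by auto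
    finally show ?thesis by simp
  qed
  let ?E = "ssum (I 1) (I (- 1))"
  obtain L where L: "subspace L" "L = {x\<in>?E. \<forall>y\<in>L. b x y = 0}"
    using neutral_sum[OF sI[of 1] sI[of "- 1"]] iso[of 1] iso[of "- 1"] by blast
  have "(u ^^ Suc k) ` X \<subseteq> ?E"
  proof
    fix y assume "y \<in> (u ^^ Suc k) ` X"
    then obtain x where x: "x \<in> X" "y = (u ^^ k) (u x)" by (auto simp: funpow_swap1)
    let ?x = "(1 / 2) *s x"
    have "?x \<in> X" using x subspace_scale[OF goodD(2)[OF X]] by blast
    then have "(u ^^ k) (u ?x + 1 *s v ?x) + (u ^^ k) (u ?x + (- 1) *s v ?x) \<in> ?E"
      unfolding I_def by (intro ssum_mem) auto
    moreover have "(u ?x + 1 *s v ?x) + (u ?x + (- 1) *s v ?x) = u x"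
    proof -
      have "(u ?x + 1 *s v ?x) + (u ?x + (- 1) *s v ?x) = u ?x + u ?x" by simp
      also have "\<dots> = (1 / 2 + 1 / 2) *s u x" by (simp only: u_scale scale_left_distrib)
      also have "(1 / 2 + 1 / 2 :: 'a) = 1" using two by (simp add: field_simps)
      finally show ?thesis by simp
    qed
    moreover have "(u ^^ k) (u ?x + 1 *s v ?x) + (u ^^ k) (u ?x + (- 1) *s v ?x)
        = (u ^^ k) ((u ?x + 1 *s v ?x) + (u ?x + (- 1) *s v ?x))" by (rule upow_add[symmetric])
    ultimately show "y \<in> ?E" using x by simp
  qed
  moreover have "?E \<subseteq> (u ^^ k) ` X"
  proof (rule ssum_least)
    show "subspace ((u ^^ k) ` X)"
      using subspace_image_pev[OF goodD(2)[OF X], of "[:0, 1:] ^ k"] by (simp add: pev_X_power)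
    show "I 1 \<subseteq> (u ^^ k) ` X" "I (- 1) \<subseteq> (u ^^ k) ` X" unfolding I_def
      using uX v_in subspace_add[OF goodD(2)[OF X]] subspace_scale[OF goodD(2)[OF X]] by blast+
  qed
  ultimately show ?thesis unfolding condN_def
    using L subspace_ssum[OF fd_subspace[OF sI] fd_subspace[OF sI], of 1 "- 1"] by blast
qed

text \<open>v turns q(u) into q(-u), hence preserves the kernel when \<open>q\<close> is even or
  odd. Applied to a power of t, this restricts v to the nilpotent part.\<close>

lemma pairable_ker:
  assumes "negp q = q \<or> negp q = - q" shows "pairable (ker X q)" unfolding pairable_def
proof (intro exI[of _ v] conjI allI ballI)
  show "v (x + y) = v x + v y" "v (c *s x) = c *s v x" for x y c by (rule v_add v_scale)+
  fix x assume "x \<in> ker X q"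
  then have x: "x \<in> X" "pev q x = 0" by (auto simp: ker_def)
  show "v (u x) = - u (v x)" "v (v x) = - u (u x)" using x v_u v_v by auto
  show "v x \<in> ker X q" using v_pev[OF x(1), of q] x v_in assms by (auto simp: ker_def pev_minus)
  fix y assume "y \<in> ker X q"
  then show "b (v x) y = - b x (v y)" using v_skew x by (simp add: ker_def)
qed

end

section \<open>Dual pairs and Hensel lifting\<close>

text \<open>A Frobenius form on the residue ring modulo \<open>Q\<close>.\<close>

definition topc :: "'a::field poly \<Rightarrow> 'a poly \<Rightarrow> 'a" where
  "topc Q r = coeff (r mod Q) (degree Q - 1)"

lemma topc_add: "topc Q (r + s) = topc Q r + topc Q s" by (simp add: topc_def poly_mod_add_left)

lemma topc_dvd: "Q dvd r - s \<Longrightarrow> topc Q r = topc Q s"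
  unfolding topc_def by (metis mod_eq_dvd_iff)

lemma topc_smult: "topc Q ([:c:] * r) = c * topc Q r" by (simp add: topc_def mod_smult_left)

text \<open>A power of t lifts the leading term of a nonzero remainder to degree
  \<open>degree Q - 1\<close>, where \<open>topc\<close> reads it.\<close>

lemma topc_nondegenerate:
  assumes Q: "degree Q > 0" and z: "\<And>s. topc Q (s * q) = 0" shows "Q dvd q"
proof (rule ccontr)
  assume "\<not> Q dvd q"
  define r where "r = q mod Q"
  have r0: "r \<noteq> 0" unfolding r_def using \<open>\<not> Q dvd q\<close> by (simp add: dvd_eq_mod_eq_0)
  have "Q \<noteq> 0" using Q by auto
  then have dr: "degree r < degree Q" using degree_mod_less[of Q q] r0 unfolding r_def by blast
  define e where "e = degree Q - 1 - degree r"
  have "topc Q (monom 1 e * q) = topc Q (monom 1 e * r)"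
    by (rule topc_dvd) (simp add: r_def minus_mod_eq_div_mult flip: right_diff_distrib)
  also have "\<dots> = coeff (monom 1 e * r) (degree Q - 1)"
  proof -
    have "degree (monom 1 e * r) < degree Q"
      using degree_mult_le[of "monom 1 e" r] degree_monom_le[of "1::'a" e] dr unfolding e_def by linarith
    then show ?thesis by (simp add: topc_def mod_poly_less)
  qed
  also have "\<dots> = coeff (monom 1 e * r) (e + degree r)" using dr unfolding e_def by simp
  also have "\<dots> = lead_coeff r" by (subst coeff_monom_mult) simp
  finally show False using z r0 by simp
qed

lemma topc_negp:
  assumes Q: "negp Q = Polynomial.smult ((- 1) ^ degree Q) Q" "degree Q > 0"
  shows "topc Q (negp r) = (- 1) ^ (degree Q - 1) * topc Q r"
proof -
  have Q0: "Q \<noteq> 0" using Q by auto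
  define m where "m = r mod Q"
  have deg: "degree (negp m) < degree Q" unfolding degree_negp m_def
    using degree_mod_less[OF Q0, of r] Q(2) by auto
  have "r - m = Q * (r div Q)" unfolding m_def by (simp add: minus_mod_eq_mult_div)
  then have "negp r - negp m = negp Q * negp (r div Q)" by (metis negp_simps(4) negp_simps(6))
  then have "Q dvd negp r - negp m" unfolding Q(1) by (simp add: dvd_smult)
  then have "topc Q (negp r) = topc Q (negp m)" by (rule topc_dvd)
  also have "\<dots> = coeff (negp m) (degree Q - 1)" using deg by (simp add: topc_def mod_poly_less)
  finally show ?thesis by (simp add: coeff_negp topc_def m_def)
qed

context skew_space
begin

lemma good_cyc_sum:
  assumes X: "good X" "x \<in> X" "y \<in> X"
    and nd: "\<And>q r. (\<And>s. b (pev q x + pev r y) (pev s x) = 0) \<Longrightarrow>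
      (\<And>s. b (pev q x + pev r y) (pev s y) = 0) \<Longrightarrow> pev q x + pev r y = 0"
  shows "good (ssum (cyc x) (cyc y))" "ssum (cyc x) (cyc y) \<subseteq> X"
proof -
  let ?C = "ssum (cyc x) (cyc y)"
  show sub: "?C \<subseteq> X" by (rule ssum_least[OF goodD(2)[OF X(1)] cyc_sub[OF goodD(2,3)[OF X(1)] X(2)]
          cyc_sub[OF goodD(2,3)[OF X(1)] X(3)]])
  show "good ?C" unfolding good_def
  proof (intro conjI ballI impI)
    show "fd ?C" by (rule fd_mono[OF goodD(1)[OF X(1)] subspace_ssum[OF subspace_cyc subspace_cyc] sub])
    show "ustable ?C" by (rule ustable_ssum[OF ustable_cyc ustable_cyc])
    fix z assume z: "z \<in> ?C" "\<forall>w\<in>?C. b z w = 0"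
    then obtain q r where qr: "z = pev q x + pev r y" unfolding ssum_def cyc_def by blast
    have "pev s x \<in> ?C" "pev s y \<in> ?C" for s
      using ssum_upper(1)[OF subspace_cyc[of x] subspace_cyc[of y]]
        ssum_upper(2)[OF subspace_cyc[of x] subspace_cyc[of y]] cycI[of s x] cycI[of s y] by blast+
    have "b (pev q x + pev r y) w = 0" if "w \<in> ?C" for w using z(2) that unfolding qr by blast
    then have "b (pev q x + pev r y) (pev s x) = 0" "b (pev q x + pev r y) (pev s y) = 0" for s
      using \<open>pev s x \<in> ?C\<close> \<open>pev s y \<in> ?C\<close> by simp_all
    then show "z = 0" unfolding qr by (rule nd)
  qed
qed

text \<open>When \<open>negp Q\<close> is \<open>Q\<close> up to sign, this makes
  \<open>cyc x\<close> and \<open>cyc y\<close> copies of F[t]/(Q) in perfect duality, since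
  \<open>topc Q\<close> is a non-degenerate functional on that ring.\<close>

definition dual_pair :: "'a poly \<Rightarrow> 'b \<Rightarrow> 'b \<Rightarrow> bool" where
  "dual_pair Q x y \<longleftrightarrow> pev Q x = 0 \<and> pev Q y = 0 \<and> (\<forall>r. b x (pev r y) = topc Q r)"

text \<open>The wanted values prescribe a functional on \<open>cyc x\<close>; \<open>ann\<close>
  makes it well defined and \<open>nd\<close> lets a vector of Ker Q(u) represent it.\<close>

lemma dual_exists:
  assumes X: "good X" and Q: "negp Q = Polynomial.smult ((- 1) ^ degree Q) Q" "degree Q > 0"
    and x: "x \<in> X" "pev Q x = 0"
    and nd: "\<And>r. (\<And>w. w \<in> ker X Q \<Longrightarrow> b (pev r x) w = 0) \<Longrightarrow> pev r x = 0"
    and ann: "\<And>r. pev r x = 0 \<Longrightarrow> Q dvd r"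
  shows "\<exists>y\<in>X. dual_pair Q x y"
proof -
  have Qn: "Q dvd negp r" if d: "Q dvd r" for r
  proof -
    obtain t where "r = Q * t" using d by (rule dvdE)
    then show ?thesis using Q(1) by (simp add: dvd_smult)
  qed
  have cX: "cyc x \<subseteq> X" by (rule cyc_sub[OF goodD(2,3)[OF X] x(1)])
  have fc: "fd (cyc x)" by (rule fd_mono[OF goodD(1)[OF X] subspace_cyc cX])
  \<comment> \<open>\<open>negp\<close> appears because the polynomial acts on the left argument and
    has to be moved to the right. Two choices of \<open>r\<close> differ by a multiple of
    \<open>Q\<close>, on which \<open>topc\<close> vanishes.\<close>
  define f where "f z = topc Q (negp (SOME r. z = pev r x))" for z
  have f: "f (pev r x) = topc Q (negp r)" for r
  proof -
    define s where "s = (SOME s. pev r x = pev s x)"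
    have "pev r x = pev s x" unfolding s_def by (rule someI[of _ r]) (rule refl)
    then have "pev (s - r) x = 0" by (simp add: pev_diff)
    then have "Q dvd negp (s - r)" using ann Qn by blast
    then have "topc Q (negp s) = topc Q (negp r)" by (intro topc_dvd) simp
    then show ?thesis unfolding f_def s_def .
  qed
  have "\<exists>y\<in>ker X Q. \<forall>z\<in>cyc x. b z y = f z"
  proof (rule functional_rep[OF b_bil fc subspace_ker[OF goodD(2)[OF X]]])
    fix z assume "z \<in> cyc x" "\<forall>y\<in>ker X Q. b z y = 0"
    then show "z = 0" using nd by (auto elim!: cycE)
  next
    fix z w assume "z \<in> cyc x" "w \<in> cyc x"
    then obtain q r where qr: "z = pev q x" "w = pev r x" by (metis cycE)
    have "z + w = pev (q + r) x" using qr by (simp add: pev_add)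
    then show "f (z + w) = f z + f w" using qr by (simp add: f topc_add)
  next
    fix c z assume "z \<in> cyc x"
    then obtain q where q: "z = pev q x" by (rule cycE)
    have "c *s z = pev ([:c:] * q) x" using q by (simp only: pev_mult pev_const)
    then show "f (c *s z) = c * f z" using q by (simp only: f negp_simps topc_smult)
  qed
  then obtain y where y: "y \<in> ker X Q" "\<And>z. z \<in> cyc x \<Longrightarrow> b z y = f z" by blast
  have "b x (pev r y) = topc Q r" for r using y(2)[of "pev (negp r) x"] by (simp add: f pev_adj')
  then show ?thesis unfolding dual_pair_def using y(1) x kerD by blast
qed

lemma dual_pairD:
  assumes "dual_pair Q x y"
  shows "pev Q x = 0" "pev Q y = 0" "b (pev q x) (pev r y) = topc Q (negp q * r)"
    "b (pev r y) (pev q x) = topc Q (negp q * r)"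
proof -
  show "pev Q x = 0" "pev Q y = 0" using assms by (auto simp: dual_pair_def)
  show e: "b (pev q x) (pev r y) = topc Q (negp q * r)"
    using assms by (simp add: dual_pair_def pev_adj flip: pev_mult)
  then show "b (pev r y) (pev q x) = topc Q (negp q * r)" by (simp add: b_sym)
qed

lemma dual_nd:
  assumes Q: "negp Q = Polynomial.smult ((- 1) ^ degree Q) Q" "degree Q > 0" and d: "dual_pair Q x y"
  shows "(\<And>s. b (pev q x) (pev s y) = 0) \<Longrightarrow> Q dvd q" "(\<And>s. b (pev q y) (pev s x) = 0) \<Longrightarrow> Q dvd q"
proof -
  have n: "Q dvd q" if d: "Q dvd negp q" for q
  proof -
    obtain t where "negp q = Q * t" using d by (rule dvdE)
    then have "negp (negp q) = negp Q * negp t" by simp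
    then show ?thesis unfolding Q(1) by (simp add: dvd_smult)
  qed
  show "Q dvd q" if z: "\<And>s. b (pev q x) (pev s y) = 0"
  proof (rule n, rule topc_nondegenerate[OF Q(2)])
    show "topc Q (s * negp q) = 0" for s
      using z[of s] dual_pairD(3)[OF d, of q s] by (simp add: mult.commute)
  qed
  show "Q dvd q" if z: "\<And>s. b (pev q y) (pev s x) = 0"
  proof (rule topc_nondegenerate[OF Q(2)])
    show "topc Q (s * q) = 0" for s using z[of "negp s"] dual_pairD(4)[OF d, of q "negp s"] by simp
  qed
qed

text \<open>Completing the square: the quadratic form on \<open>cyc w\<close> is compensated along a dual vector.\<close>

lemma compensate:
  assumes X: "good X" and w: "w \<in> X"
    and nd: "\<And>q. (\<And>s. b (pev q w) (pev s w') = 0) \<Longrightarrow> pev q w = 0"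
  shows "\<exists>s. \<forall>q. b (pev q w) (pev s w') = - (b w (pev q w) / 2)"
proof -
  have cX: "cyc w \<subseteq> X" by (rule cyc_sub[OF goodD(2,3)[OF X] w])
  have fc: "fd (cyc w)" by (rule fd_mono[OF goodD(1)[OF X] subspace_cyc cX])
  have "\<exists>y\<in>cyc w'. \<forall>z\<in>cyc w. b z y = - (b w z / 2)"
  proof (rule functional_rep[OF b_bil fc subspace_cyc])
    fix z assume z: "z \<in> cyc w" "\<forall>y\<in>cyc w'. b z y = 0"
    then obtain q where q: "z = pev q w" by (metis cycE)
    show "z = 0" unfolding q by (rule nd) (use z q in auto)
  qed (simp_all add: bD add_divide_distrib)
  then obtain y where y: "y \<in> cyc w'" "\<forall>z\<in>cyc w. b z y = - (b w z / 2)" by blast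
  obtain s where s: "y = pev s w'" using y(1) by (rule cycE)
  have "b (pev q w) (pev s w') = - (b w (pev q w) / 2)" for q using y(2) cycI[of q w] unfolding s by blast
  then show ?thesis by blast
qed

text \<open>Each of the two cross terms equals minus half of b(w, q(u)w), so only the term quadratic
  in the correction survives. Its order is twice that of the correction, which is what makes the
  lifting converge.\<close>

lemma square_expand:
  assumes c: "\<And>q. b (pev q w) (pev s w') = - (b w (pev q w) / 2)"
  shows "b (w + pev s w') (pev q (w + pev s w')) = b (pev s w') (pev q (pev s w'))"
proof -
  have 1: "b w (pev q (pev s w')) = - (b w (pev q w) / 2)"
  proof -
    have "b w (pev q (pev s w')) = b (pev (negp q) w) (pev s w')" by (simp add: pev_adj)
    also have "\<dots> = - (b w (pev (negp q) w) / 2)" by (rule c)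
    also have "b w (pev (negp q) w) = b (pev q w) w" by (simp add: pev_adj)
    also have "\<dots> = b w (pev q w)" by (rule b_sym)
    finally show ?thesis .
  qed
  have 2: "b (pev s w') (pev q w) = - (b w (pev q w) / 2)" using c[of q] b_sym[of "pev s w'"] by simp
  have "b w (pev q w) - b w (pev q w) / 2 - b w (pev q w) / 2 = 0" using two by (simp add: field_simps)
  then show ?thesis by (simp add: pev_add_arg bD 1 2)
qed

text \<open>The square of \<open>y\<close> is completed along \<open>x\<close>; the surviving
  quadratic term lives on \<open>cyc x\<close> and vanishes there, and isotropy of
  \<open>cyc x\<close> keeps the pairing with \<open>x\<close> unchanged.\<close>

lemma dual_iso_exists:
  assumes X: "good X" and Q: "negp Q = Polynomial.smult ((- 1) ^ degree Q) Q" "degree Q > 0"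
    and xy: "x \<in> X" "y \<in> X" "dual_pair Q x y" and iso: "\<And>q. b x (pev q x) = 0"
  shows "\<exists>y\<in>X. dual_pair Q x y \<and> (\<forall>q. b y (pev q y) = 0)"
proof -
  have xx: "b (pev q x) (pev r x) = 0" for q r using iso by (simp add: pev_adj flip: pev_mult)
  have "pev q y = 0" if "\<And>s. b (pev q y) (pev s x) = 0" for q
    using dual_nd(2)[OF Q xy(3) that] pev_dvd_0 dual_pairD(2)[OF xy(3)] by blast
  then obtain s where s: "\<forall>q. b (pev q y) (pev s x) = - (b y (pev q y) / 2)"
    using compensate[OF X xy(2), of x] by blast
  let ?y = "y + pev s x"
  have "b ?y (pev q ?y) = 0" for q using square_expand[of y s x q] s xx by (simp flip: pev_mult)
  moreover have "dual_pair Q x ?y"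
  proof -
    have "pev Q (pev s x) = 0" using pev_commute[of Q s x] dual_pairD(1)[OF xy(3)] by simp
    moreover have "b x (pev r (pev s x)) = 0" for r using iso[of "r * s"] by (simp only: pev_mult)
    ultimately show ?thesis using xy(3) by (simp add: dual_pair_def pev_add_arg bD)
  qed
  moreover have "?y \<in> X" using xy pev_stable[OF goodD(2,3)[OF X]] subspace_add[OF goodD(2)[OF X]] by blast
  ultimately show ?thesis by blast
qed

text \<open>On a hyperbolic pair of cyclic modules v may act diagonally: v x = u x and v y =
  \<plusminus> u y, extended by anticommutation.\<close>

lemma dual_pair_good:
  assumes X: "good X" and Q: "negp Q = Polynomial.smult ((- 1) ^ degree Q) Q" "degree Q > 0"
    and xy: "x \<in> X" "y \<in> X" "dual_pair Q x y"
    and iso: "\<And>q. b x (pev q x) = 0" "\<And>q. b y (pev q y) = 0"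
  shows "good (ssum (cyc x) (cyc y))" "ssum (cyc x) (cyc y) \<subseteq> X" "pairable (ssum (cyc x) (cyc y))"
proof -
  let ?C = "ssum (cyc x) (cyc y)"
  have xx: "b (pev q x) (pev r x) = 0" for q r using iso(1) by (simp add: pev_adj flip: pev_mult)
  have yy: "b (pev q y) (pev r y) = 0" for q r using iso(2) by (simp add: pev_adj flip: pev_mult)
  have nd: "pev q x + pev r y = 0"
    if z: "\<And>s. b (pev q x + pev r y) (pev s x) = 0" "\<And>s. b (pev q x + pev r y) (pev s y) = 0" for q r
  proof -
    have "Q dvd q" by (rule dual_nd(1)[OF Q xy(3)]) (use z(2) yy in \<open>simp add: bD\<close>)
    moreover have "Q dvd r" by (rule dual_nd(2)[OF Q xy(3)]) (use z(1) xx in \<open>simp add: bD\<close>)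
    ultimately show ?thesis using pev_dvd_0 dual_pairD(1,2)[OF xy(3)] by simp
  qed
  show gC: "good ?C" and sub: "?C \<subseteq> X" by (rule good_cyc_sum[OF X xy(1,2) nd]; blast)+
  \<comment> \<open>The sign on \<open>y\<close> is forced by skewness against \<open>x\<close>:
    passing from r to \<open>negp r\<close> multiplies \<open>topc Q\<close> by (-1)^(degree Q - 1),
    which is -\<sigma>.\<close>
  define \<sigma> :: 'a where "\<sigma> = (- 1) ^ degree Q"
  have \<sigma>: "\<sigma> * \<sigma> = 1" unfolding \<sigma>_def by (simp flip: power_mult_distrib)
  have \<sigma>1: "(- 1) ^ (degree Q - 1) = - \<sigma>" unfolding \<sigma>_def using Q(2) by (cases "degree Q") simp_all
  have "u x \<in> cyc x" "u y \<in> cyc y" using ustable_cyc unfolding ustable_def by auto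
  then have mem: "u x \<in> ?C" "\<sigma> *s u y \<in> ?C"
    using ssum_upper(1)[OF subspace_cyc[of x] subspace_cyc[of y]]
      ssum_upper(2)[OF subspace_cyc[of x] subspace_cyc[of y]] subspace_scale[OF subspace_cyc] by blast+
  show "pairable ?C"
  proof (rule pairable_gen[OF gC refl mem])
    show "b (u x) (pev q x) = - b (pev q x) (u x)" for q
      using xx[of "[:0, 1:]" q] xx[of q "[:0, 1:]"] by simp
    show "b (\<sigma> *s u y) (pev q y) = - b (pev q y) (\<sigma> *s u y)" for q
      using yy[of "[:0, 1:]" q] yy[of q "[:0, 1:]"] by (simp add: bD)
    show "b (u x) (pev q y) = - b (pev q x) (\<sigma> *s u y)" for q
    proof -
      let ?X = "[:0, 1:] :: 'a poly"
      have "b (u x) (pev q y) = topc Q (negp ?X * q)" using dual_pairD(3)[OF xy(3), of ?X q] by (simp only: pev_X)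
      also have "negp ?X * q = negp (?X * negp q)" by (simp only: negp_simps negp_negp)
      also have "topc Q (negp (?X * negp q)) = - \<sigma> * topc Q (?X * negp q)"
        using topc_negp[OF Q] \<sigma>1 by simp
      also have "topc Q (?X * negp q) = b (pev q x) (u y)"
        using dual_pairD(3)[OF xy(3), of q ?X] by (simp only: pev_X mult.commute)
      finally show ?thesis by (simp add: bD)
    qed
    show "\<exists>q r. u x = pev q x + pev r y \<and> - u (u x) = pev (negp q) (u x) + pev (negp r) (\<sigma> *s u y)"
      by (rule exI[of _ "[:0, 1:]"], rule exI[of _ 0]) (simp only: negp_X pev_minus pev_X negp_simps pev_0 add_0_right)
    show "\<exists>q r. \<sigma> *s u y = pev q x + pev r y \<and> - u (u y) = pev (negp q) (u x) + pev (negp r) (\<sigma> *s u y)"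
    proof (rule exI[of _ 0], rule exI[of _ "[:\<sigma>:] * [:0, 1:]"], intro conjI)
      show "\<sigma> *s u y = pev 0 x + pev ([:\<sigma>:] * [:0, 1:]) y" by (simp only: pev_mult pev_const pev_X pev_0 add_0_left)
      have "pev (negp ([:\<sigma>:] * [:0, 1:])) (\<sigma> *s u y) = \<sigma> *s - u (\<sigma> *s u y)"
        by (simp only: negp_simps negp_X pev_mult pev_minus pev_const pev_X)
      also have "\<dots> = - (\<sigma> * \<sigma>) *s u (u y)" by (simp add: u_scale)
      finally show "- u (u y) = pev (negp 0) (u x) + pev (negp ([:\<sigma>:] * [:0, 1:])) (\<sigma> *s u y)"
        unfolding \<sigma> by simp
    qed
  qed
qed

text \<open>If p^i were the exact power of p dividing r for some i < k, Bezout would write p^(k-1)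
  as a combination of p^k and r and put p(u)^(k-1) x into \<open>W\<close>. \<open>W\<close> is kept
  general: zero gives the annihilator, an image gives the order modulo that image.\<close>

lemma ann_power:
  assumes p: "Factorial_Ring.irreducible p" and k: "k \<ge> 1" and W: "subspace W" "ustable W"
    and x: "pev (p ^ (k - 1)) x \<notin> W" "pev (p ^ k) x \<in> W" and r: "pev r x \<in> W"
  shows "p ^ k dvd r"
proof -
  have "p ^ i dvd r" if "i \<le> k" for i using that
  proof (induction i)
    case (Suc i)
    then obtain r' where r': "r = p ^ i * r'" by (auto elim: dvdE)
    have "p dvd r'"
    proof (rule ccontr)
      assume "\<not> p dvd r'"
      then obtain s t where st: "s * p + t * r' = 1" using irreducible_bezout[OF p] by blast
      have k1: "p ^ (k - 1) = p ^ (k - 1 - i) * p ^ i" "p ^ k = p ^ (k - 1) * p"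
        using Suc.prems by (simp_all flip: power_add power_Suc2)
      have e1: "p ^ (k - 1) * r' = p ^ (k - 1 - i) * r" by (simp only: k1(1) r' mult.assoc)
      have "p ^ (k - 1) = p ^ (k - 1) * (s * p + t * r')" using st by simp
      also have "\<dots> = s * (p ^ (k - 1) * p) + t * (p ^ (k - 1) * r')"
        by (simp only: distrib_left ac_simps)
      also have "\<dots> = s * p ^ k + (t * p ^ (k - 1 - i)) * r" by (simp only: e1 k1(2) mult.assoc)
      finally have e: "p ^ (k - 1) = s * p ^ k + (t * p ^ (k - 1 - i)) * r" .
      have "pev (p ^ (k - 1)) x = pev s (pev (p ^ k) x) + pev (t * p ^ (k - 1 - i)) (pev r x)"
        by (subst e) (simp only: pev_add pev_mult)
      then have "pev (p ^ (k - 1)) x \<in> W" using x(2) r pev_stable[OF W] subspace_add[OF W(1)] by metis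
      with x(1) show False by blast
    qed
    then show ?case using r' by (auto simp: mult_dvd_mono power_Suc2 simp del: power_Suc)
  qed simp
  then show ?thesis by blast
qed

lemma subspace_zero: "subspace {0}" by (simp add: subspace_single_0)
lemma ustable_zero: "ustable {0}" by (simp add: ustable_def)

text \<open>The last hypothesis on \<open>x\<close> says that its class in V_{p,k} is nonzero. If
  r(u)x is orthogonal to Ker p(u)^k, it lies in Im p(u)^k, so p^k divides r by
  \<open>ann_power\<close> and r(u)x = 0; this is the duality that \<open>dual_exists\<close> asks
  for.\<close>

lemma dual_exists_power:
  assumes X: "good X" and p: "Factorial_Ring.irreducible p" "negp p = Polynomial.smult ((- 1) ^ degree p) p" "degree p > 0"
    and k: "k \<ge> 1" and x: "x \<in> X" "pev (p ^ k) x = 0" "\<And>z. z \<in> X \<Longrightarrow> pev (p ^ (k - 1)) x \<noteq> pev (p ^ k) z"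
  shows "negp (p ^ k) = Polynomial.smult ((- 1) ^ degree (p ^ k)) (p ^ k)" "degree (p ^ k) > 0"
    "\<exists>y\<in>X. dual_pair (p ^ k) x y"
proof -
  have p0: "p \<noteq> 0" using p(3) by auto
  show Q: "negp (p ^ k) = Polynomial.smult ((- 1) ^ degree (p ^ k)) (p ^ k)" "degree (p ^ k) > 0"
    using p p0 k by (simp_all add: smult_power degree_power_eq power_mult[symmetric] mult.commute)
  let ?I = "pev (p ^ k) ` X"
  have I: "subspace ?I" "ustable ?I"
    using subspace_image_pev[OF goodD(2)[OF X]] ustable_image_pev[OF goodD(3)[OF X]] by blast+
  have x1: "pev (p ^ (k - 1)) x \<notin> ?I" using x(3) by blast
  have x2: "pev (p ^ k) x \<in> ?I" using x(2) subspace_0[OF I(1)] by simp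
  show "\<exists>y\<in>X. dual_pair (p ^ k) x y"
  proof (rule dual_exists[OF X Q x(1,2)])
    fix r assume "pev r x = 0"
    then show "p ^ k dvd r" using ann_power[OF p(1) k I x1 x2] subspace_0[OF I(1)] by metis
  next
    fix r assume w: "\<And>w. w \<in> ker X (p ^ k) \<Longrightarrow> b (pev r x) w = 0"
    have rX: "pev r x \<in> X" using pev_stable[OF goodD(2,3)[OF X] x(1)] .
    have h: "b (pev r x) w = 0" if "w \<in> X" "pev (p ^ k) w = 0" for w using w that by (simp add: ker_def)
    obtain z where z: "z \<in> X" "pev r x = pev (negp (p ^ k)) z" using perp_ker[OF X rX h] by blast
    then have "pev r x = pev (p ^ k) ((- 1) ^ degree (p ^ k) *s z)"
      using Q(1) pev_mult[of "[:(- 1) ^ degree (p ^ k):]" "p ^ k" z] by (simp add: pev_scale_arg)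
    then have "pev r x \<in> ?I" using z(1) subspace_scale[OF goodD(2)[OF X]] by blast
    then show "pev r x = 0" using ann_power[OF p(1) k I x1 x2] pev_dvd_0[OF x(2)] by blast
  qed
qed

text \<open>Hensel lifting: a vector isotropic at the top level can be modified into one generating a
  totally isotropic cyclic submodule.\<close>

lemma hensel_isotropic:
  assumes X: "good X" and p: "Factorial_Ring.irreducible p" "negp p = Polynomial.smult ((- 1) ^ degree p) p" "degree p > 0"
    and k: "k \<ge> 1"
    and x: "x \<in> X" "pev (p ^ k) x = 0" "\<And>z. z \<in> X \<Longrightarrow> pev (p ^ (k - 1)) x \<noteq> pev (p ^ k) z"
    and top: "\<And>q. b x (pev (p ^ (k - 1)) (pev q x)) = 0"
  shows "\<exists>x'\<in>X. pev (p ^ k) x' = 0 \<and> pev (p ^ (k - 1)) x' = pev (p ^ (k - 1)) x \<and> (\<forall>q. b x' (pev q x') = 0)"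
proof -
  have "\<exists>x'\<in>X. pev (p ^ k) x' = 0 \<and> pev (p ^ (k - 1)) x' = pev (p ^ (k - 1)) x \<and> (\<forall>q. b x' (pev q x') = 0)"
    if "j \<le> k - 1" and "x \<in> X" "pev (p ^ k) x = 0" "\<And>z. z \<in> X \<Longrightarrow> pev (p ^ (k - 1)) x \<noteq> pev (p ^ k) z"
      and "\<And>q. b x (pev (p ^ j) (pev q x)) = 0" for j x using that
  proof (induction j arbitrary: x)
    case 0
    then show ?case by (intro bexI[of _ x]) auto
  next
    case (Suc j)
    note x = Suc.prems(2-4)
    note Q = dual_exists_power(1,2)[OF X p k x]
    obtain y where y: "y \<in> X" "dual_pair (p ^ k) x y" using dual_exists_power(3)[OF X p k x] by blast
    note yD = dual_pairD[OF y(2)]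
    have "pev q x = 0" if "\<And>s. b (pev q x) (pev s y) = 0" for q
      using dual_nd(1)[OF Q y(2) that] pev_dvd_0 x(2) by blast
    then obtain s where s: "\<forall>q. b (pev q x) (pev s y) = - (b x (pev q x) / 2)"
      using compensate[OF X x(1), of y] by blast
    \<comment> \<open>The hypothesis at level \<open>Suc j\<close> kills the products of p(u)^(j+1)
      s(u) y with \<open>cyc x\<close>. Hence s is divisible by p^(k-j-1): the correction is
      small.\<close>
    have "p ^ k dvd p ^ Suc j * s"
    proof (rule dual_nd(2)[OF Q y(2)])
      fix q
      have "b (pev (p ^ Suc j * s) y) (pev q x) = b (pev (negp (p ^ Suc j) * q) x) (pev s y)"
      proof -
        have "b (pev (p ^ Suc j * s) y) (pev q x) = b (pev s y) (pev (negp (p ^ Suc j)) (pev q x))"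
          by (simp only: pev_mult pev_adj)
        also have "\<dots> = b (pev (negp (p ^ Suc j) * q) x) (pev s y)" by (simp only: pev_mult b_sym)
        finally show ?thesis .
      qed
      also have "\<dots> = - (b x (pev (negp (p ^ Suc j) * q) x) / 2)" using s by blast
      also have "b x (pev (negp (p ^ Suc j) * q) x) = 0"
      proof -
        have "negp (p ^ Suc j) * q = p ^ Suc j * ([:((- 1) ^ degree p) ^ Suc j:] * q)"
          unfolding negp_power p(2) smult_power by simp
        then show ?thesis using Suc.prems(5)[of "[:((- 1) ^ degree p) ^ Suc j:] * q"]
          by (simp only: pev_mult)
      qed
      finally show "b (pev (p ^ Suc j * s) y) (pev q x) = 0" by simp
    qed
    moreover have "p ^ k = p ^ Suc j * p ^ (k - Suc j)"
    proof -
      have "k = Suc j + (k - Suc j)" using Suc.prems(1) by linarith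
      then show ?thesis using power_add[of p "Suc j" "k - Suc j"] by (simp only:)
    qed
    ultimately have "p ^ Suc j * p ^ (k - Suc j) dvd p ^ Suc j * s" by (simp only:)
    moreover have "p ^ Suc j \<noteq> 0" using p(3) by auto
    ultimately have "p ^ (k - Suc j) dvd s" by (simp only: dvd_mult_cancel_left simp_thms)
    then obtain t where t: "s = p ^ (k - Suc j) * t" by (rule dvdE)
    let ?x = "x + pev s y"
    have xX: "?x \<in> X" using x y pev_stable[OF goodD(2,3)[OF X]] subspace_add[OF goodD(2)[OF X]] by blast
    have k0: "pev (p ^ k) ?x = 0" using x(2) yD(2) pev_commute[of "p ^ k" s y] by (simp add: pev_add_arg)
    have "p ^ k dvd p ^ (k - 1) * s"
    proof -
      have "p ^ (k - 1) * s = p ^ (k - 1 + (k - Suc j)) * t" unfolding t by (simp add: power_add mult.assoc)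
      moreover have "p ^ k dvd p ^ (k - 1 + (k - Suc j))" using Suc.prems(1) k by (intro le_imp_power_dvd) linarith
      ultimately show ?thesis by simp
    qed
    then have k1: "pev (p ^ (k - 1)) ?x = pev (p ^ (k - 1)) x"
      using pev_dvd_0[OF yD(2)] pev_mult[of "p ^ (k - 1)" s y] by (simp add: pev_add_arg)
    \<comment> \<open>After completing the square only the term with \<open>negp s\<close>, p^j and
      s remains. It is divisible by p^(2(k-j-1)+j), an exponent at least k because j + 1 is at most
      k - 1.\<close>
    have "b ?x (pev (p ^ j) (pev q ?x)) = 0" for q
    proof -
      have "b ?x (pev (p ^ j) (pev q ?x)) = b (pev s y) (pev (p ^ j * q) (pev s y))"
        using square_expand[of x s y "p ^ j * q"] s by (simp add: pev_mult)
      also have "\<dots> = b y (pev (negp s * (p ^ j * q) * s) y)" by (simp only: pev_adj pev_mult)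
      also have "pev (negp s * (p ^ j * q) * s) y = 0"
      proof (rule pev_dvd_0[OF yD(2)])
        have "negp s = p ^ (k - Suc j) * ([:((- 1) ^ degree p) ^ (k - Suc j):] * negp t)"
          unfolding t negp_simps negp_power p(2) smult_power by simp
        then have "negp s * (p ^ j * q) * s = p ^ ((k - Suc j) + j + (k - Suc j)) *
            ([:((- 1) ^ degree p) ^ (k - Suc j):] * negp t * q * t)"
          unfolding t power_add by (simp only: ac_simps)
        moreover have "p ^ k dvd p ^ ((k - Suc j) + j + (k - Suc j))"
          using Suc.prems(1) by (intro le_imp_power_dvd) linarith
        ultimately show "p ^ k dvd negp s * (p ^ j * q) * s" by (simp only: dvd_mult2)
      qed
      finally show ?thesis by (simp add: bD)
    qed
    then show ?case using Suc.IH[OF _ xX k0] Suc.prems(1,4) k1 by simp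
  qed
  from this[of "k - 1" x] show ?thesis using x top by blast
qed

text \<open>The lifted \<open>x'\<close> has the same top part as \<open>x\<close>, so it still
  represents a nonzero class and still admits a dual vector, which is then made isotropic in its
  turn.\<close>

lemma split_hyperbolic:
  assumes X: "good X" and p: "Factorial_Ring.irreducible p" "negp p = Polynomial.smult ((- 1) ^ degree p) p" "degree p > 0"
    and k: "k \<ge> 1"
    and x: "x \<in> X" "pev (p ^ k) x = 0" "\<And>z. z \<in> X \<Longrightarrow> pev (p ^ (k - 1)) x \<noteq> pev (p ^ k) z"
    and top: "\<And>q. b x (pev (p ^ (k - 1)) (pev q x)) = 0"
  shows "\<exists>x'\<in>X. \<exists>y\<in>X. pev (p ^ (k - 1)) x' = pev (p ^ (k - 1)) x \<and> dual_pair (p ^ k) x' y \<and>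
    (\<forall>q. b x' (pev q x') = 0) \<and> (\<forall>q. b y (pev q y) = 0) \<and>
    good (ssum (cyc x') (cyc y)) \<and> ssum (cyc x') (cyc y) \<subseteq> X \<and> pairable (ssum (cyc x') (cyc y)) \<and>
    negp (p ^ k) = Polynomial.smult ((- 1) ^ degree (p ^ k)) (p ^ k) \<and> degree (p ^ k) > 0"
proof -
  obtain x' where x': "x' \<in> X" "pev (p ^ k) x' = 0" "pev (p ^ (k - 1)) x' = pev (p ^ (k - 1)) x"
      "\<And>q. b x' (pev q x') = 0" using hensel_isotropic[OF assms] by blast
  have x3: "pev (p ^ (k - 1)) x' \<noteq> pev (p ^ k) z" if "z \<in> X" for z using x' x that by simp
  note Q = dual_exists_power(1,2)[OF X p k x'(1,2) x3]
  obtain y0 where y0: "y0 \<in> X" "dual_pair (p ^ k) x' y0"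
    using dual_exists_power(3)[OF X p k x'(1,2) x3] by blast
  obtain y where y: "y \<in> X" "dual_pair (p ^ k) x' y" "\<And>q. b y (pev q y) = 0"
    using dual_iso_exists[OF X Q x'(1) y0 x'(4)] by blast
  show ?thesis by (rule bexI[OF bexI[OF _ y(1)] x'(1)])
      (intro conjI allI x'(3,4) y(2,3) Q dual_pair_good[OF X Q x'(1) y(1,2) x'(4) y(3)])
qed

end

section \<open>Irreducible polynomials under the substitution of -t for t\<close>

lemma const_poly_unit: "c \<noteq> 0 \<Longrightarrow> [:c :: 'a::field:] dvd 1"
  by (rule dvdI[of _ _ "[:inverse c:]"]) simp

lemma unit_poly_degree: "(h :: 'a::field poly) dvd 1 \<Longrightarrow> degree h = 0"
  by (auto simp: is_unit_poly_iff)

lemma irreducible_X: "Factorial_Ring.irreducible [:0, 1 :: 'a::field:]"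
proof (rule irreducibleI)
  show "\<not> [:0, 1 :: 'a:] dvd 1" using unit_poly_degree[of "[:0, 1 :: 'a:]"] by auto
  fix a b :: "'a poly" assume ab: "[:0, 1:] = a * b"
  then have nz: "a \<noteq> 0" "b \<noteq> 0" by auto
  have "degree a + degree b = 1" using arg_cong[OF ab, of degree] nz by (simp add: degree_mult_eq)
  then consider "degree a = 0" | "degree b = 0" by linarith
  then show "a dvd 1 \<or> b dvd 1"
  proof cases
    case 1
    then obtain c where c: "a = [:c:]" by (rule degree_eq_zeroE)
    then have "c \<noteq> 0" using nz by auto
    then show ?thesis using c const_poly_unit by blast
  next
    case 2
    then obtain c where c: "b = [:c:]" by (rule degree_eq_zeroE)
    then have "c \<noteq> 0" using nz by auto
    then show ?thesis using c const_poly_unit by blast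
  qed
qed simp

lemma irreducible_degree: "Factorial_Ring.irreducible p \<Longrightarrow> degree p > 0" for p :: "'f::field poly"
proof (rule ccontr)
  assume p: "Factorial_Ring.irreducible p" "\<not> degree p > 0"
  then obtain c where c: "p = [:c:]" using degree_eq_zeroE[of p] by auto
  moreover have "p \<noteq> 0" "\<not> p dvd 1" using p by (auto simp: Irr_def irreducible_def)
  ultimately show False using const_poly_unit[of c] by auto
qed

lemma irr_degree: "p \<in> Irr \<Longrightarrow> degree p > 0" by (simp add: Irr_def irreducible_degree)

lemma irr0_negp: "p \<in> Irr0 \<Longrightarrow> negp p = p"
proof -
  assume "p \<in> Irr0"
  then obtain q where q: "p = pcompose q (monom 1 2)" by (auto simp: Irr0_def)
  have "negp (monom 1 2 :: 'a poly) = monom 1 2" by (simp add: poly_eq_iff coeff_negp)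
  then show ?thesis unfolding q negp_def by (simp add: pcompose_assoc[symmetric])
qed

lemma even_irr0:
  assumes p: "p \<in> Irr" "negp p = p" and two: "(2::'a::field) \<noteq> 0"
  shows "(p :: 'a poly) \<in> Irr0"
proof -
  define q where "q = (\<Sum>i\<le>degree p. monom (coeff p (2 * i)) i)"
  have m: "pcompose (monom c i) (monom 1 2) = monom c (2 * i)" for c :: 'a and i
  proof (induction i)
    case 0
    then show ?case by (simp add: monom_0)
  next
    case (Suc i)
    have "monom c (Suc i) = [:0, 1:] * monom c i" by (simp add: monom_Suc)
    then have "pcompose (monom c (Suc i)) (monom 1 2) = monom 1 2 * pcompose (monom c i) (monom 1 2)"
      by (simp only: pcompose_mult pcompose_pCons) simp
    then show ?case unfolding Suc.IH by (simp add: mult_monom)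
  qed
  have "pcompose q (monom 1 2) = (\<Sum>i\<le>degree p. monom (coeff p (2 * i)) (2 * i))"
    unfolding q_def by (simp add: pcompose_sum m)
  also have "\<dots> = p"
  proof (rule poly_eqI)
    fix n
    show "coeff (\<Sum>i\<le>degree p. monom (coeff p (2 * i)) (2 * i)) n = coeff p n"
    proof (cases "even n")
      case True
      then obtain k where n: "n = 2 * k" by (rule evenE)
      have "coeff (\<Sum>i\<le>degree p. monom (coeff p (2 * i)) (2 * i)) n
          = (\<Sum>i\<le>degree p. if i = k then coeff p n else 0)"
        unfolding coeff_sum by (intro sum.cong) (auto simp: n)
      then show ?thesis by (simp add: n coeff_eq_0)
    next
      case False
      have "- coeff p n = coeff p n" using coeff_negp[of p n] p(2) False by simp
      then have "2 * coeff p n = 0" unfolding mult_2 by (metis add.right_inverse)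
      then have "coeff p n = 0" using two by simp
      moreover have "coeff (\<Sum>i\<le>degree p. monom (coeff p (2 * i)) (2 * i)) n = 0"
        unfolding coeff_sum using False by (intro sum.neutral) auto
      ultimately show ?thesis by simp
    qed
  qed
  finally show ?thesis using p(1) unfolding Irr0_def by (metis IntI rangeI)
qed

lemma irr_coeff0:
  assumes p: "p \<in> Irr" "p \<noteq> [:0, 1:]" shows "coeff p 0 \<noteq> 0"
proof
  assume c: "coeff p 0 = 0"
  obtain h where h: "p = [:0, 1:] * h" using c by (cases p) auto
  have "\<not> [:0, 1 :: 'a:] dvd 1" using irreducible_X by (auto simp: irreducible_def)
  then have "h dvd 1" using irreducibleD[OF _ h] p(1) by (auto simp: Irr_def)
  then obtain a where "h = [:a:]" by (auto simp: is_unit_poly_iff)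
  then have "p = [:0, a:]" using h by simp
  moreover have "lead_coeff p = 1" using p(1) by (simp add: Irr_def)
  ultimately have "p = [:0, 1:]" by (cases "a = 0") auto
  with p(2) show False by blast
qed

lemma irr0_not_X:
  assumes two: "(2::'a::field) \<noteq> 0" shows "[:0, 1 :: 'a:] \<notin> Irr0"
proof
  assume "[:0, 1 :: 'a:] \<in> Irr0"
  then have "negp [:0, 1 :: 'a:] = [:0, 1:]" by (rule irr0_negp)
  then have "(1::'a) + 1 = 0" by (simp add: eq_neg_iff_add_eq_0[symmetric])
  then show False using two by simp
qed

text \<open>Equal degrees leave only negp p = c p with a constant c. The constant coefficient is
  unchanged by \<open>negp\<close> and nonzero since p differs from t, so c = 1; then p is even,
  hence in \<open>Irr0\<close>.\<close>

lemma irr_not_dvd_negp: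
  assumes p: "p \<in> Irr" "p \<notin> Irr0" "p \<noteq> [:0, 1:]" and two: "(2::'a::field) \<noteq> 0"
  shows "\<not> (p :: 'a poly) dvd negp p"
proof
  assume "p dvd negp p"
  then obtain h where h: "negp p = p * h" by (rule dvdE)
  have p0: "p \<noteq> 0" using irr_degree[OF p(1)] by auto
  have h0: "h \<noteq> 0" using h p0 by (metis mult_zero_right negp_negp negp_simps(1))
  have "degree p = degree p + degree h" using h degree_negp[of p] degree_mult_eq[OF p0 h0] by simp
  then obtain c where c: "h = [:c:]" using degree_eq_zeroE[of h] by auto
  have e: "coeff (negp p) i = c * coeff p i" for i unfolding h c by simp
  have "(- 1) ^ degree p = c" using e[of "degree p"] p(1) p0 by (simp add: coeff_negp Irr_def)
  moreover have "c = 1" using e[of 0] irr_coeff0[OF p(1,3)] by (simp add: coeff_negp)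
  ultimately have "negp p = p" using h c by simp
  then show False using even_irr0[OF p(1) _ two] p(2) by blast
qed

lemma even_poly_sign:
  assumes "negp p = p" "p \<noteq> 0" shows "p = Polynomial.smult ((- 1) ^ degree p) p"
proof -
  have "(- 1) ^ degree p * lead_coeff p = lead_coeff p" using coeff_negp[of p "degree p"] assms by simp
  then have "(- 1) ^ degree p = (1 :: 'a)" using assms(2) by (simp add: leading_coeff_0_iff)
  then show ?thesis by simp
qed

section \<open>Splitting off pairable pieces, and sufficiency when u is injective\<close>

context skew_space
begin

lemma pairable_obtain:
  assumes "good X" "pairable X" obtains v where "paired scale b u X v"
proof -
  obtain v where v: "\<And>x y. v (x + y) = v x + v y" "\<And>c x. v (c *s x) = c *s v x"
     "\<And>x. x \<in> X \<Longrightarrow> v x \<in> X \<and> v (u x) = - u (v x) \<and> v (v x) = - u (u x)"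
     "\<And>x y. x \<in> X \<Longrightarrow> y \<in> X \<Longrightarrow> b (v x) y = - b x (v y)"
    using assms(2) unfolding pairable_def by blast
  have "paired scale b u X v" by unfold_locales (use assms(1) v in auto)
  then show thesis by (rule that)
qed

lemma pairable_conds:
  assumes "good X" "pairable X"
  shows "negp p = p \<Longrightarrow> coeff p 0 \<noteq> 0 \<Longrightarrow> condI X p k"
    "Factorial_Ring.irreducible p \<Longrightarrow> coeff p 0 \<noteq> 0 \<Longrightarrow> degree p > 0 \<Longrightarrow> k \<ge> 1 \<Longrightarrow> condII X p k"
    "condN X k" "negp q = q \<or> negp q = - q \<Longrightarrow> pairable (ker X q)"
proof -
  obtain v where "paired scale b u X v" using pairable_obtain[OF assms] by blast
  then interpret paired scale b u X v .
  show "negp p = p \<Longrightarrow> coeff p 0 \<noteq> 0 \<Longrightarrow> condI X p k"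
    "Factorial_Ring.irreducible p \<Longrightarrow> coeff p 0 \<noteq> 0 \<Longrightarrow> degree p > 0 \<Longrightarrow> k \<ge> 1 \<Longrightarrow> condII X p k"
    "condN X k" "negp q = q \<or> negp q = - q \<Longrightarrow> pairable (ker X q)"
    by (rule condI_paired condII_paired condN_paired pairable_ker; assumption)+
qed

lemma pairable_trivial:
  assumes "subspace X" "\<And>x. x \<in> X \<Longrightarrow> u x = 0" shows "pairable X"
  unfolding pairable_def
  by (rule exI[of _ "\<lambda>x. 0"]) (use assms in \<open>auto simp: subspace_0 bD\<close>)

lemma split_pairable:
  assumes X: "good X" and C: "good C" "C \<subseteq> X" "pairable C" and D: "pairable (operp X C)"
  shows "pairable X"
proof (rule pairable_sum[OF X C(2,3) _ _ D])
  show "ustable C" "ustable (operp X C)" "subspace C" "subspace (operp X C)"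
    using goodD[OF C(1)] goodD[OF split_good(1)[OF X C(1,2)]] by auto
  show "operp X C \<subseteq> X" by (auto simp: operp_def)
  show "ssum C (operp X C) = X" by (rule split_good(2)[OF X C(1,2)])
  show "b c d = 0" if "c \<in> C" "d \<in> operp X C" for c d using operpD that by blast
qed

lemma split_mem:
  assumes X: "good X" and C: "good C" "C \<subseteq> X" and x: "x \<in> X"
  obtains c d where "c \<in> C" "d \<in> operp X C" "x = c + d"
  using split_good(2)[OF assms(1-3)] x unfolding ssum_def by blast

lemma split_zero:
  assumes X: "good X" and C: "good C" "C \<subseteq> X" and cd: "c \<in> C" "d \<in> operp X C" "c + d = 0"
  shows "c = 0" "d = 0"
proof -
  have "c = - d" using cd(3) by (simp add: eq_neg_iff_add_eq_0)
  then have "c \<in> operp X C" using cd(2) subspace_neg[OF goodD(2)[OF split_good(1)[OF X C]]] by simp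
  then show "c = 0" using cd(1) split_good(3)[OF X C] by blast
  then show "d = 0" using cd(3) by simp
qed

lemma split_dim:
  assumes X: "good X" and C: "good C" "C \<subseteq> X"
  shows "dim X = dim C + dim (operp X C)"
  using dim_ssum[OF goodD(1)[OF C(1)] goodD(1)[OF split_good(1)[OF X C]] split_good(3)[OF X C]]
    split_good(2)[OF X C] by simp

lemma split_dim_less:
  assumes X: "good X" and C: "good C" "C \<subseteq> X" and x: "x \<in> C" "x \<noteq> 0"
  shows "dim (operp X C) < dim X"
proof -
  have "fd {0}" by (rule fd_mono[OF goodD(1)[OF X] subspace_zero]) (use subspace_0[OF goodD(2)[OF X]] in simp)
  then have "dim (span (insert x {0})) = dim {0} + 1" using x(2) by (intro dim_insert_notin) auto
  moreover have "span (insert x {0}) \<subseteq> C"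
    using x(1) subspace_0[OF goodD(2)[OF C(1)]] by (intro span_minimal[OF _ goodD(2)[OF C(1)]]) auto
  then have "dim (span (insert x {0})) \<le> dim C" by (rule dim_mono_fd[OF goodD(1)[OF C(1)] subspace_span])
  ultimately show ?thesis using split_dim[OF X C] by simp
qed

lemma pev_split:
  assumes X: "good X" and C: "good C" "C \<subseteq> X" and cd: "c \<in> C" "d \<in> operp X C" "pev q (c + d) = 0"
  shows "pev q c = 0" "pev q d = 0" using split_zero[OF X C pev_stable[OF goodD(2,3)[OF C(1)] cd(1)]
      pev_stable[OF goodD(2,3)[OF split_good(1)[OF X C]] cd(2)]] cd(3) by (auto simp: pev_add_arg)

lemma ker_split:
  assumes X: "good X" and C: "good C" "C \<subseteq> X"
  shows "ker X q = ssum (ker C q) (ker (operp X C) q)"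
proof
  show "ssum (ker C q) (ker (operp X C) q) \<subseteq> ker X q"
    using C(2) subspace_ker[OF goodD(2)[OF X]] by (intro ssum_least) (auto simp: ker_def operp_def)
  show "ker X q \<subseteq> ssum (ker C q) (ker (operp X C) q)"
  proof
    fix x assume x: "x \<in> ker X q"
    obtain c d where cd: "c \<in> C" "d \<in> operp X C" "x = c + d" using split_mem[OF X C kerD(1)[OF x]] by blast
    then have "pev q c = 0" "pev q d = 0" using pev_split[OF X C cd(1,2)] kerD(2)[OF x] by simp_all
    then show "x \<in> ssum (ker C q) (ker (operp X C) q)"
      unfolding cd(3) using cd by (intro ssum_mem) (auto simp: ker_def)
  qed
qed

lemma jden_split:
  assumes X: "good X" and C: "good C" "C \<subseteq> X"
  shows "jden X p k = ssum (jden C p k) (jden (operp X C) p k)"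
proof
  show "ssum (jden C p k) (jden (operp X C) p k) \<subseteq> jden X p k"
    using C(2) subspace_jden[OF goodD(2)[OF X]] by (intro ssum_least) (auto simp: ker_def operp_def jden_def)
  show "jden X p k \<subseteq> ssum (jden C p k) (jden (operp X C) p k)"
  proof
    fix x assume x: "x \<in> jden X p k"
    let ?D = "operp X C"
    obtain z where z: "z \<in> X" "pev (p ^ (k - 1)) x = pev (p ^ k) z" and xk: "x \<in> ker X (p ^ k)"
      using x by (auto simp: jden_def)
    obtain c d where cd: "c \<in> C" "d \<in> ?D" "x = c + d" using split_mem[OF X C kerD(1)[OF xk]] by blast
    obtain e f where ef: "e \<in> C" "f \<in> ?D" "z = e + f" using split_mem[OF X C z(1)] by blast
    have k: "pev (p ^ k) c = 0" "pev (p ^ k) d = 0"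
      using pev_split[OF X C cd(1,2)] kerD(2)[OF xk] cd(3) by simp_all
    note stC = pev_stable[OF goodD(2,3)[OF C(1)]] and stD = pev_stable[OF goodD(2,3)[OF split_good(1)[OF X C]]]
    have h1: "pev (p ^ (k - 1)) c - pev (p ^ k) e \<in> C" 
      by (rule subspace_diff[OF goodD(2)[OF C(1)] stC[OF cd(1)] stC[OF ef(1)]])
    have h2: "pev (p ^ (k - 1)) d - pev (p ^ k) f \<in> ?D"
      by (rule subspace_diff[OF goodD(2)[OF split_good(1)[OF X C]] stD[OF cd(2)] stD[OF ef(2)]])
    have h3: "(pev (p ^ (k - 1)) c - pev (p ^ k) e) + (pev (p ^ (k - 1)) d - pev (p ^ k) f) = 0"
      using z(2) unfolding cd(3) ef(3) by (simp add: pev_add_arg algebra_simps)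
    have "pev (p ^ (k - 1)) c = pev (p ^ k) e" "pev (p ^ (k - 1)) d = pev (p ^ k) f"
      using split_zero[OF X C h1 h2 h3] by simp_all
    then have "c \<in> jden C p k" "d \<in> jden ?D p k" using cd ef k by (auto simp: jden_def ker_def)
    then show "x \<in> ssum (jden C p k) (jden ?D p k)" unfolding cd(3) by (rule ssum_mem)
  qed
qed

text \<open>Numerator and denominator of V_{p,k} both split along C and its orthogonal, so the
  Jordan numbers add and parity can be subtracted.\<close>

lemma condII_cancel:
  assumes X: "good X" and C: "good C" "C \<subseteq> X" and c: "condII X p k" "condII C p k"
  shows "condII (operp X C) p k"
proof -
  let ?D = "operp X C"
  note gD = split_good(1)[OF X C]
  obtain m where m: "dim (ker X (p ^ k)) = dim (jden X p k) + 2 * degree p * m" using c(1) unfolding condII_def by blast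
  obtain n where n: "dim (ker C (p ^ k)) = dim (jden C p k) + 2 * degree p * n" using c(2) unfolding condII_def by blast
  have int: "ker C q \<inter> ker ?D q = {0}" for q
  proof
    have "ker C q \<inter> ker ?D q \<subseteq> C \<inter> ?D" unfolding ker_def by blast
    then show "ker C q \<inter> ker ?D q \<subseteq> {0}" unfolding split_good(3)[OF X C] .
    show "{0} \<subseteq> ker C q \<inter> ker ?D q"
      using subspace_0[OF subspace_ker[OF goodD(2)[OF C(1)], of q]]
        subspace_0[OF subspace_ker[OF goodD(2)[OF gD], of q]] by simp
  qed
  have "jden C p k \<inter> jden ?D p k = {0}"
  proof
    have "jden C p k \<inter> jden ?D p k \<subseteq> ker C (p ^ k) \<inter> ker ?D (p ^ k)"
      by (rule Int_mono[OF jden_sub jden_sub])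
    then show "jden C p k \<inter> jden ?D p k \<subseteq> {0}" unfolding int .
    show "{0} \<subseteq> jden C p k \<inter> jden ?D p k"
      using subspace_0[OF subspace_jden[OF goodD(2)[OF C(1)], of p k]]
        subspace_0[OF subspace_jden[OF goodD(2)[OF gD], of p k]] by simp
  qed
  then have j: "dim (jden X p k) = dim (jden C p k) + dim (jden ?D p k)"
    using dim_ssum[OF fd_jden[OF goodD(1)[OF C(1)]] fd_jden[OF goodD(1)[OF gD]], of p k p k]
    unfolding jden_split[OF X C, of p k] by blast
  have k: "dim (ker X (p ^ k)) = dim (ker C (p ^ k)) + dim (ker ?D (p ^ k))"
    using dim_ssum[OF fd_ker[OF goodD(1)[OF C(1)]] fd_ker[OF goodD(1)[OF gD]] int[of "p ^ k"]]
    unfolding ker_split[OF X C, of "p ^ k"] .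
  have le: "dim (jden ?D p k) \<le> dim (ker ?D (p ^ k))"
    by (rule dim_mono_fd[OF fd_ker[OF goodD(1)[OF gD]] subspace_jden[OF goodD(2)[OF gD]] jden_sub])
  have e: "dim (ker ?D (p ^ k)) + 2 * degree p * n = dim (jden ?D p k) + 2 * degree p * m"
    using j k m n by simp
  have "2 * degree p * n \<le> 2 * degree p * m" using e le by linarith
  then have "dim (ker ?D (p ^ k)) = dim (jden ?D p k) + 2 * degree p * (m - n)"
    using e by (simp add: diff_mult_distrib2)
  then show ?thesis unfolding condII_def by blast
qed

text \<open>Lagrangian reduction for the form b(x, p(u)^(k-1) y) on Ker p(u)^k, by a Lagrangian
  \<open>S\<close> of the part in \<open>C\<close>. As p is even the form is symmetric, and
  stability under u passes to the reduced subspace.\<close>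

lemma condI_cancel:
  assumes X: "good X" and C: "good C" "C \<subseteq> X" and p: "negp p = p" and c: "condI X p k" "condI C p k"
  shows "condI (operp X C) p k"
proof -
  let ?D = "operp X C" and ?P = "p ^ (k - 1)"
  note gD = split_good(1)[OF X C]
  define \<beta> where "\<beta> x y = b x (pev ?P y)" for x y
  have bil: "bilform \<beta>" unfolding bilform_def \<beta>_def by (simp add: bD pev_add_arg pev_scale_arg)
  have sym: "\<beta> x y = \<beta> y x" for x y unfolding \<beta>_def using pev_adj[of ?P x y] p by (simp add: b_sym)
  obtain L where L: "subspace L" "ustable L" "L = {x\<in>ker X (p ^ k). \<forall>y\<in>L. \<beta> x y = 0}"
    using c(1) unfolding condI_def \<beta>_def by blast
  obtain S where S: "subspace S" "ustable S" "S = {x\<in>ker C (p ^ k). \<forall>y\<in>S. \<beta> x y = 0}"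
    using c(2) unfolding condI_def \<beta>_def by blast
  have SC: "x \<in> ker C (p ^ k)" "\<And>y. y \<in> S \<Longrightarrow> \<beta> x y = 0" if "x \<in> S" for x using S(3) that by blast+
  let ?L = "{x\<in>ker ?D (p ^ k). \<exists>c\<in>S. x + c \<in> L}"
  have kC: "ker C (p ^ k) \<subseteq> ker X (p ^ k)" using C(2) by (auto simp: ker_def)
  have kD: "ker ?D (p ^ k) \<subseteq> ker X (p ^ k)" by (auto simp: ker_def operp_def)
  have orth: "\<beta> x y = 0" if "x \<in> ?D" "y \<in> C" for x y
    unfolding \<beta>_def using operpD(2)[OF that(1)] pev_stable[OF goodD(2,3)[OF C(1)] that(2)] by blast
  have "?L = {x\<in>ker ?D (p ^ k). \<forall>y\<in>?L. \<beta> x y = 0}"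
  proof (rule neutral_cancel[OF bil sym fd_ker[OF goodD(1)[OF X]] L(1) L(3) S(1)])
    show "S \<subseteq> ker X (p ^ k)" using SC kC by blast
    show "\<beta> x y = 0" if "x \<in> S" "y \<in> S" for x y using SC that by blast
    show "ker ?D (p ^ k) \<subseteq> ker X (p ^ k)" by (rule kD)
    show "\<beta> x y = 0" if "x \<in> ker ?D (p ^ k)" "y \<in> S" for x y
      using orth[OF kerD(1)[OF that(1)]] SC(1)[OF that(2)] kerD by blast
    fix y assume y: "y \<in> ker X (p ^ k)" "\<And>c. c \<in> S \<Longrightarrow> \<beta> y c = 0"
    obtain c d where cd: "c \<in> ker C (p ^ k)" "d \<in> ker ?D (p ^ k)" "y = c + d"
      using y(1) ker_split[OF X C] unfolding ssum_def by blast
    have "\<beta> c s = 0" if "s \<in> S" for s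
    proof -
      have "\<beta> d s = 0" using orth[OF kerD(1)[OF cd(2)]] kerD(1)[OF SC(1)[OF that]] by blast
      then show ?thesis using y(2)[OF that] cd(3) by (simp add: bilformD[OF bil])
    qed
    then have "c \<in> S" using S(3) cd(1) by blast
    then show "\<exists>c\<in>S. \<exists>z\<in>ker ?D (p ^ k). y = c + z" using cd by blast
  qed
  moreover have "subspace ?L" unfolding subspace_def
  proof (intro conjI ballI allI)
    note sk = subspace_ker[OF goodD(2)[OF gD], of "p ^ k"]
    show "0 \<in> ?L" using subspace_0[OF sk] subspace_0[OF S(1)] subspace_0[OF L(1)] by (auto intro!: bexI[of _ 0])
    fix x y a assume x: "x \<in> ?L"
    then obtain c where c: "c \<in> S" "x + c \<in> L" by blast
    show "a *s x \<in> ?L" using x c subspace_scale[OF sk] subspace_scale[OF S(1), of c a] subspace_scale[OF L(1) c(2), of a]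
      by (auto simp: scale_right_distrib intro!: bexI[of _ "a *s c"])
    assume y: "y \<in> ?L"
    then obtain d where d: "d \<in> S" "y + d \<in> L" by blast
    have "(x + y) + (c + d) \<in> L" using subspace_add[OF L(1) c(2) d(2)] by (simp add: ac_simps)
    then show "x + y \<in> ?L" using x y subspace_add[OF sk] subspace_add[OF S(1) c(1) d(1)] by blast
  qed
  moreover have "ustable ?L" unfolding ustable_def
  proof
    fix x assume x: "x \<in> ?L"
    then obtain c where c: "c \<in> S" "x + c \<in> L" by blast
    then have "u c \<in> S" "u x + u c \<in> L" using S(2) L(2) by (auto simp: ustable_def simp flip: u_add)
    moreover have "u x \<in> ker ?D (p ^ k)" using x ustable_ker[OF goodD(3)[OF gD]] by (auto simp: ustable_def)
    ultimately show "u x \<in> ?L" by blast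
  qed
  ultimately show ?thesis unfolding condI_def \<beta>_def by blast
qed

text \<open>Without an annihilator, the iterates of \<open>x\<close> would be independent and their
  span would outgrow \<open>X\<close>.\<close>

lemma annihilator_exists:
  assumes X: "fd X" "ustable X" "x \<in> X" shows "\<exists>q. q \<noteq> 0 \<and> pev q x = 0"
proof (rule ccontr)
  assume no: "\<not> ?thesis"
  have s: "subspace X" using X fd_subspace by blast
  have f0: "fd {0}" by (rule fd_mono[OF X(1) subspace_zero]) (use subspace_0[OF s] in simp)
  have nin: "(u ^^ j) x \<notin> pspan {0} x j" for j
  proof
    assume "(u ^^ j) x \<in> pspan {0} x j"
    then obtain q where q: "(u ^^ j) x = pev q x" "\<forall>i\<ge>j. coeff q i = 0" unfolding pspan_def by auto
    have "pev (monom 1 j - q) x = 0" using q(1) by (simp add: pev_diff pev_monom)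
    moreover have "coeff (monom 1 j - q) j = 1" using q(2) by simp
    then have "monom 1 j - q \<noteq> 0" by (metis coeff_0 zero_neq_one)
    ultimately show False using no by blast
  qed
  have "pspan {0} x (Suc (dim X)) \<subseteq> X" unfolding pspan_def using pev_stable[OF s X(2,3)] by auto
  then have "dim (pspan {0} x (Suc (dim X))) \<le> dim X"
    using dim_mono_fd[OF X(1) pspan_dim(1)[OF f0 nin]] by blast
  then show False using pspan_dim(2)[OF f0 nin, of "Suc (dim X)"] by simp
qed

text \<open>Among all nonzero polynomials killing some nonzero vector of \<open>X\<close>, one of
  least degree is irreducible: of two factors, either the second kills the vector or the first kills
  the image under the second.\<close>

lemma irreducible_kernel_exists:
  assumes X: "fd X" "ustable X" "x \<in> X" "x \<noteq> 0"
  shows "\<exists>p\<in>Irr. \<exists>y\<in>X. y \<noteq> 0 \<and> pev p y = 0"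
proof -
  have s: "subspace X" using X fd_subspace by blast
  define P where "P q \<longleftrightarrow> q \<noteq> 0 \<and> (\<exists>y\<in>X. y \<noteq> 0 \<and> pev q y = 0)" for q
  obtain q0 where "P q0" using annihilator_exists[OF X(1-3)] X unfolding P_def by blast
  then obtain q where q: "P q" "\<And>r. P r \<Longrightarrow> degree q \<le> degree r"
    using ex_has_least_nat[of P q0 degree] by blast
  obtain y where y: "y \<in> X" "y \<noteq> 0" "pev q y = 0" and q0: "q \<noteq> 0" using q(1) unfolding P_def by blast
  have unit: "r dvd 1" if e: "q = r * t" and t: "P t" for r t
  proof -
    have "degree q = degree r + degree t" using e q0 by (simp add: degree_mult_eq)
    then have "degree r = 0" using q(2)[OF t] by simp
    then obtain c where c: "r = [:c:]" by (rule degree_eq_zeroE)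
    then have "c \<noteq> 0" using e q0 by auto
    then show ?thesis using c by (simp add: is_unit_const_poly_iff dvd_field_iff)
  qed
  have irr: "Factorial_Ring.irreducible q"
  proof (rule irreducibleI[OF q0])
    show "\<not> q dvd 1"
    proof
      assume "q dvd 1"
      then have "pev 1 y = 0" by (rule pev_dvd_0[OF y(3)])
      then show False using y by simp
    qed
    fix r t assume e: "q = r * t"
    show "r dvd 1 \<or> t dvd 1"
    proof (cases "pev t y = 0")
      case True
      then have "P t" unfolding P_def using y e q0 by auto
      then show ?thesis using unit[OF e] by blast
    next
      case False
      have "pev r (pev t y) = 0" using y(3) e by (simp add: pev_mult)
      then have "P r" unfolding P_def using False pev_stable[OF s X(2) y(1)] e q0 by auto
      then show ?thesis using unit[of t r] e by (simp add: mult.commute)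
    qed
  qed
  define c where "c = inverse (lead_coeff q)"
  have c0: "c \<noteq> 0" unfolding c_def using q0 by simp
  let ?p = "[:c:] * q"
  have "Factorial_Ring.irreducible ?p"
    using irr c0 by (subst irreducible_mult_unit_left) (auto simp: is_unit_const_poly_iff dvd_field_iff)
  moreover have "lead_coeff ?p = 1" unfolding c_def using q0 by (simp add: lead_coeff_smult)
  moreover have "pev ?p y = 0" using y by (simp only: pev_mult pev_zero_arg)
  ultimately show ?thesis using y unfolding Irr_def by blast
qed

text \<open>\<open>k\<close> is the first exponent at which the kernels of powers of p(u) stop
  growing, the largest block size. The second half of the conclusion says that Ker p(u)^k and Im
  p(u)^k meet only in 0.\<close>

lemma top_exponent:
  assumes X: "fd X" "ustable X" and x: "x \<in> X" "x \<noteq> 0" "pev p x = 0"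
  shows "\<exists>k\<ge>1. (\<exists>y\<in>X. pev (p ^ k) y = 0 \<and> pev (p ^ (k - 1)) y \<noteq> 0) \<and>
    (\<forall>z\<in>X. pev (p ^ k) (pev (p ^ k) z) = 0 \<longrightarrow> pev (p ^ k) z = 0)"
proof -
  have s: "subspace X" using X fd_subspace by blast
  have mono: "ker X (p ^ i) \<subseteq> ker X (p ^ Suc i)" for i by (auto simp: ker_def pev_mult)
  have "\<exists>k. ker X (p ^ Suc k) = ker X (p ^ k)"
  proof (rule ccontr)
    assume no: "\<not> ?thesis"
    have "dim (ker X (p ^ i)) \<ge> i" for i
    proof (induction i)
      case (Suc i)
      have "dim (ker X (p ^ i)) < dim (ker X (p ^ Suc i))"
        using dim_eq_fd[OF fd_ker[OF X(1)] subspace_ker[OF s] mono[of i]] no by (metis not_le)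
      then show ?case using Suc by simp
    qed simp
    then have "Suc (dim X) \<le> dim (ker X (p ^ Suc (dim X)))" by blast
    also have "\<dots> \<le> dim X" by (rule dim_mono_fd[OF X(1) subspace_ker[OF s]]) (auto simp: ker_def)
    finally show False by simp
  qed
  then obtain k where k: "ker X (p ^ Suc k) = ker X (p ^ k)" "\<And>i. i < k \<Longrightarrow> ker X (p ^ Suc i) \<noteq> ker X (p ^ i)"
    using exists_least_iff[of "\<lambda>k. ker X (p ^ Suc k) = ker X (p ^ k)"] by blast
  have "k \<noteq> 0"
  proof
    assume "k = 0"
    then have "x \<in> ker X (p ^ 0)" using k(1) x by (auto simp: ker_def)
    then show False using x by (simp add: ker_def)
  qed
  moreover have "\<exists>y\<in>X. pev (p ^ k) y = 0 \<and> pev (p ^ (k - 1)) y \<noteq> 0"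
  proof -
    have "ker X (p ^ Suc (k - 1)) \<noteq> ker X (p ^ (k - 1))" using k(2)[of "k - 1"] \<open>k \<noteq> 0\<close> by simp
    then obtain y where "y \<in> ker X (p ^ Suc (k - 1))" "y \<notin> ker X (p ^ (k - 1))" using mono[of "k - 1"] by blast
    then show ?thesis using \<open>k \<noteq> 0\<close> by (auto simp: ker_def simp del: power_Suc)
  qed
  moreover have "pev (p ^ k) z = 0" if "z \<in> X" "pev (p ^ k) (pev (p ^ k) z) = 0" for z
  proof -
    have "pev (p ^ k) w = 0" if "w \<in> X" "pev (p ^ (k + j)) w = 0" for w j using that
    proof (induction j arbitrary: w)
      case (Suc j)
      have "pev p w \<in> X" using pev_stable[OF s X(2)] Suc.prems(1) by blast
      moreover have "pev (p ^ (k + j)) (pev p w) = 0"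
        using Suc.prems(2) by (simp add: power_Suc2 pev_mult del: power_Suc)
      ultimately have "pev (p ^ k) (pev p w) = 0" by (rule Suc.IH)
      then have "pev (p ^ Suc k) w = 0" by (simp add: power_Suc2 pev_mult del: power_Suc)
      then show ?case using k(1) Suc.prems(1) by (auto simp: ker_def)
    qed simp
    from this[of z k] show ?thesis using that by (simp add: power_add pev_mult)
  qed
  ultimately show ?thesis by (intro exI[of _ k]) auto
qed

text \<open>As p and \<open>negp p\<close> are coprime, Ker p(u)^k and Ker p(-u)^k are each totally
  isotropic and are paired with one another. Evenness provides a second block of size k, generated
  by \<open>y\<close>; a vector \<open>w\<close> of Ker p(-u)^k is chosen orthogonal to
  \<open>cyc x\<close> but not to p(u)^(k-1) y. Then \<xi> = x + w generates an isotropic module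
  whose annihilator Q = p^k (negp p)^k is even, and the dual pair construction applies to
  \<xi>.\<close>

lemma split_coprime:
  assumes X: "good X" and p: "Factorial_Ring.irreducible p" "\<not> p dvd negp p" "degree p > 0" and k: "k \<ge> 1"
    and x: "x \<in> X" "pev (p ^ k) x = 0" "pev (p ^ (k - 1)) x \<noteq> 0"
    and stab: "\<And>z. z \<in> X \<Longrightarrow> pev (p ^ k) (pev (p ^ k) z) = 0 \<Longrightarrow> pev (p ^ k) z = 0"
    and c: "condII X p k"
  shows "\<exists>C w. good C \<and> C \<subseteq> X \<and> pairable C \<and> w \<in> C \<and> w \<noteq> 0"
proof -
  let ?p = "negp p" and ?K = "ker X (p ^ k)" and ?K1 = "ker X (p ^ (k - 1))"
  note sX = goodD(2)[OF X] and uX = goodD(3)[OF X]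
  note st = pev_stable[OF sX uX]
  have pk: "p ^ k = p ^ (k - 1) * p" using k by (cases k) (auto simp: mult.commute)
  \<comment> \<open>At the top exponent the image contributes nothing: Im p(u)^k meets Ker p(u)^k
    trivially by \<open>stab\<close>.\<close>
  have jd: "jden X p k = ?K1"
  proof
    show "jden X p k \<subseteq> ?K1"
    proof
      fix y assume "y \<in> jden X p k"
      then obtain z where z: "z \<in> X" "pev (p ^ (k - 1)) y = pev (p ^ k) z" "y \<in> ?K" by (auto simp: jden_def)
      have "pev (p ^ k) (pev (p ^ k) z) = 0"
        using z kerD(2)[OF z(3)] pev_commute[of "p ^ k" "p ^ (k - 1)" y] by simp
      then show "y \<in> ?K1" using stab[OF z(1)] z kerD(1)[OF z(3)] by (simp add: ker_def)
    qed
    show "?K1 \<subseteq> jden X p k"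
    proof
      fix y assume y: "y \<in> ?K1"
      have "pev (p ^ k) y = 0" using kerD(2)[OF y] pev_commute[of "p ^ (k - 1)" p y] by (simp add: pk pev_mult)
      then show "y \<in> jden X p k" using y subspace_0[OF sX] by (auto simp: jden_def ker_def intro!: bexI[of _ 0])
    qed
  qed
  obtain m where m: "dim ?K = dim ?K1 + 2 * degree p * m" using c jd unfolding condII_def by auto
  have sub1: "?K1 \<subseteq> ?K" using jd jden_sub by metis
  have fK1: "fd ?K1" and fK: "fd ?K" using fd_ker[OF goodD(1)[OF X]] by blast+
  have xK: "x \<in> ?K" "x \<notin> ?K1" using x by (auto simp: ker_def)
  have "m \<noteq> 0"
  proof
    assume "m = 0"
    then have "?K1 = ?K" using dim_eq_fd[OF fK fd_subspace[OF fK1] sub1] m by simp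
    with xK show False by blast
  qed
  let ?D = "ssum ?K1 (cyc x)"
  have px: "pev p x \<in> ?K1" using x(2) st[OF x(1)] by (simp add: ker_def pk pev_mult)
  have "dim ?D = dim ?K1 + degree p" by (rule step_dim[OF p(1) fK1 ustable_ker[OF uX] xK(2) px])
  \<comment> \<open>The only use of evenness: a nonzero even Jordan number is at least 2, so one
    cyclic module does not exhaust the kernel modulo Ker p(u)^(k-1).\<close>
  also have "\<dots> < dim ?K" using m \<open>m \<noteq> 0\<close> p(3) by (cases m) auto
  finally have "?D \<noteq> ?K" by auto
  moreover have "?D \<subseteq> ?K"
    using ssum_least[OF fd_subspace[OF fK] sub1 cyc_sub[OF fd_subspace[OF fK] ustable_ker[OF uX] xK(1)]] .
  ultimately obtain y where y: "y \<in> ?K" "y \<notin> ?D" by blast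
  have annx: "p ^ k dvd r" if "pev r x = 0" for r
    using ann_power[OF p(1) k subspace_zero ustable_zero, of x r] x that by simp
  define y0 where "y0 = pev (p ^ (k - 1)) y"
  have y0X: "y0 \<in> X" unfolding y0_def using st kerD(1)[OF y(1)] by blast
  have y0c: "y0 \<notin> cyc x"
  proof
    assume "y0 \<in> cyc x"
    then obtain q where q: "y0 = pev q x" by (rule cycE)
    have "pev p y0 = 0" unfolding y0_def
      using kerD(2)[OF y(1)] pev_commute[of p "p ^ (k - 1)" y] by (simp add: pk pev_mult)
    then have "p ^ k dvd p * q" using annx[of "p * q"] q by (simp add: pev_mult)
    then have "p * p ^ (k - 1) dvd p * q" by (simp add: pk mult.commute)
    moreover have "p \<noteq> 0" using p(3) by auto
    ultimately have "p ^ (k - 1) dvd q" by (simp only: dvd_mult_cancel_left simp_thms)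
    then obtain q' where "q = p ^ (k - 1) * q'" by (rule dvdE)
    then have "pev (p ^ (k - 1)) (y - pev q' x) = 0"
      using q unfolding y0_def by (simp add: pev_diff_arg pev_mult)
    then have "y - pev q' x \<in> ?K1"
      using kerD(1)[OF y(1)] st[OF x(1)] subspace_diff[OF sX] by (simp add: ker_def)
    then have "(y - pev q' x) + pev q' x \<in> ?D" using cycI by (rule ssum_mem)
    with y(2) show False by simp
  qed
  have cX: "cyc x \<subseteq> X" by (rule cyc_sub[OF sX uX x(1)])
  \<comment> \<open>Otherwise p(u)^(k-1) y would agree with some \<open>m\<close> of
    \<open>cyc x\<close> against Ker p(-u)^k. Their difference would lie in Im p(u)^k and in Ker
    p(u)^k, hence vanish, contrary to \<open>y0c\<close>.\<close>
  have "\<exists>w\<in>ker X (?p ^ k). (\<forall>m\<in>cyc x. b m w = 0) \<and> b y0 w \<noteq> 0"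
  proof (rule ccontr)
    assume no: "\<not> ?thesis"
    have h: "b y0 w = 0" if "w \<in> ker X (?p ^ k)" "\<forall>m\<in>cyc x. b m w = 0" for w using no that by blast
    obtain m where m: "m \<in> cyc x" "\<forall>w\<in>ker X (?p ^ k). b y0 w = b m w"
      using perp_perp[OF b_bil fd_mono[OF goodD(1)[OF X] subspace_cyc cX] subspace_ker[OF sX] h] by blast
    have mX: "m \<in> X" using m cX by blast
    have "b (y0 - m) w = 0" if "w \<in> X" "pev (?p ^ k) w = 0" for w
      using m(2) that by (auto simp: ker_def bD)
    then obtain z where z: "z \<in> X" "y0 - m = pev (negp (?p ^ k)) z"
      using perp_ker[OF X subspace_diff[OF sX y0X mX], of "?p ^ k"] by blast
    then have e: "y0 - m = pev (p ^ k) z" by simp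
    have "pev (p ^ k) y0 = 0" unfolding y0_def
      using kerD(2)[OF y(1)] pev_commute[of "p ^ k" "p ^ (k - 1)" y] by simp
    moreover have "pev (p ^ k) m = 0" using m(1) x(2) by (auto elim!: cycE simp: pev_commute[of "p ^ k"])
    ultimately have "pev (p ^ k) (y0 - m) = 0" by (simp add: pev_diff_arg)
    then have "y0 - m = 0" using stab[OF z(1)] e by simp
    then show False using y0c m(1) by simp
  qed
  then obtain w where w: "w \<in> ker X (?p ^ k)" "\<And>m. m \<in> cyc x \<Longrightarrow> b m w = 0" "b y0 w \<noteq> 0" by blast
  have wX: "w \<in> X" "pev (?p ^ k) w = 0" using w(1) kerD by auto
  obtain \<alpha> \<beta> where ab: "\<alpha> * p ^ k + \<beta> * ?p ^ k = 1"
    using bezout_power[OF irreducible_bezout[OF p(1,2)]] by blast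
  have iso: "b z z' = 0" if q: "s * q + t * negp q = 1" and z: "pev q z = 0" "pev q z' = 0" for s t q z z'
  proof -
    have "z = pev (s * q + t * negp q) z" using q by simp
    then have "z = pev (negp q) (pev t z)" using z(1) pev_commute[of t "negp q" z] by (simp add: pev_add pev_mult)
    then have "b z z' = b (pev (negp q) (pev t z)) z'" by simp
    also have "\<dots> = b (pev t z) (pev q z')" by (simp add: pev_adj)
    finally show ?thesis using z by (simp add: bD)
  qed
  have iso1: "b z z' = 0" if "pev (p ^ k) z = 0" "pev (p ^ k) z' = 0" for z z'
    using iso[of \<alpha> "p ^ k" \<beta>] ab that by simp
  have iso2: "b z z' = 0" if "pev (?p ^ k) z = 0" "pev (?p ^ k) z' = 0" for z z'
    using iso[of \<beta> "?p ^ k" \<alpha>] ab that by (simp add: add.commute)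
  have kx: "pev (p ^ k) (pev r x) = 0" for r using x(2) pev_commute[of "p ^ k" r x] by simp
  have kw: "pev (?p ^ k) (pev r w) = 0" for r using wX(2) pev_commute[of "?p ^ k" r w] by simp
  define Q where "Q = p ^ k * ?p ^ k"
  have Qn: "negp Q = Q" unfolding Q_def by (simp add: mult.commute)
  have Q0: "Q \<noteq> 0" and Qd: "degree Q > 0"
  proof -
    have p0: "p \<noteq> 0" using p(3) by auto
    then have "?p \<noteq> 0" using degree_negp[of p] p(3) by (metis degree_0 less_irrefl)
    then show "Q \<noteq> 0" "degree Q > 0" unfolding Q_def using p0 p(3) k
      by (auto simp: degree_mult_eq degree_power_eq)
  qed
  have Qs: "negp Q = Polynomial.smult ((- 1) ^ degree Q) Q" using even_poly_sign[OF Qn Q0] Qn by simp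
  define \<xi> where "\<xi> = x + w"
  have \<xi>X: "\<xi> \<in> X" unfolding \<xi>_def using x(1) wX subspace_add[OF sX] by blast
  have Q\<xi>: "pev Q \<xi> = 0" unfolding Q_def \<xi>_def
    using kw[of 1] kx[of "?p ^ k"] x(2) pev_commute[of "p ^ k" "?p ^ k"] by (simp add: pev_mult pev_add_arg)
  have w0: "b (pev r x) (pev s w) = 0" for r s
    using w(2)[OF cycI, of "negp s * r"] by (simp only: pev_adj' pev_mult)
  have \<xi>iso: "b \<xi> (pev q \<xi>) = 0" for q
  proof -
    have "b x (pev q x) = 0" using iso1[OF x(2) kx] .
    moreover have "b w (pev q w) = 0" using iso2[OF wX(2) kw] .
    moreover have "b x (pev q w) = 0" using w0[of 1 q] by simp
    moreover have "b w (pev q x) = 0" using w0[of q 1] by (simp add: b_sym)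
    ultimately show ?thesis unfolding \<xi>_def by (simp add: pev_add_arg bD)
  qed
  have annw: "?p ^ k dvd r" if r: "pev r w = 0" for r
  proof -
    have irr: "Factorial_Ring.irreducible ?p"
    proof (rule irreducibleI)
      show "?p \<noteq> 0" using degree_negp[of p] p(3) by (metis degree_0 less_irrefl)
      show "\<not> ?p dvd 1" using degree_negp[of p] p(3) unit_poly_degree[of ?p] by auto
      fix s t assume "?p = s * t"
      then have "p = negp s * negp t" by (metis negp_negp negp_simps(4))
      then have "negp s dvd 1 \<or> negp t dvd 1" using irreducibleD[OF p(1)] by blast
      moreover have "s dvd 1" if n: "negp s dvd 1" for s
      proof -
        obtain f where "1 = negp s * f" using n by (rule dvdE)
        then have "1 = s * negp f" by (metis negp_negp negp_simps(2,4))
        then show ?thesis by (rule dvdI)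
      qed
      ultimately show "s dvd 1 \<or> t dvd 1" by blast
    qed
    have "pev (?p ^ (k - 1)) w \<noteq> 0"
    proof
      assume "pev (?p ^ (k - 1)) w = 0"
      then have "b y (pev (?p ^ (k - 1)) w) = 0" by (simp add: bD)
      then show False using w(3) unfolding y0_def by (simp add: pev_adj)
    qed
    then show ?thesis using ann_power[OF irr k subspace_zero ustable_zero, of w r] wX r by simp
  qed
  have sep: "r1 = pev (\<beta> * ?p ^ k) (r1 + r2)" "r2 = pev (\<alpha> * p ^ k) (r1 + r2)"
    if r: "pev (p ^ k) r1 = 0" "pev (?p ^ k) r2 = 0" for r1 r2
  proof -
    have "r1 = pev (\<alpha> * p ^ k + \<beta> * ?p ^ k) r1" "r2 = pev (\<alpha> * p ^ k + \<beta> * ?p ^ k) r2" using ab by simp_all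
    then show "r1 = pev (\<beta> * ?p ^ k) (r1 + r2)" "r2 = pev (\<alpha> * p ^ k) (r1 + r2)"
      using r by (simp_all add: pev_add pev_mult pev_add_arg)
  qed
  have ann: "Q dvd r" if r: "pev r \<xi> = 0" for r
  proof -
    have e: "pev r x + pev r w = 0" using r unfolding \<xi>_def by (simp add: pev_add_arg)
    have "pev r x = 0" using sep(1)[OF kx kw, of r r] e by simp
    moreover have "pev r w = 0" using sep(2)[OF kx kw, of r r] e by simp
    ultimately obtain f g where "r = p ^ k * f" "r = ?p ^ k * g" using annx annw by (metis dvdE)
    then have "r = Q * (\<alpha> * g + \<beta> * f)"
    proof -
      have "r = \<alpha> * p ^ k * r + \<beta> * ?p ^ k * r" using ab by (metis distrib_right mult_1)
      also have "\<alpha> * p ^ k * r = Q * (\<alpha> * g)" by (subst \<open>r = ?p ^ k * g\<close>) (simp add: Q_def ac_simps)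
      also have "\<beta> * ?p ^ k * r = Q * (\<beta> * f)" by (subst \<open>r = p ^ k * f\<close>) (simp add: Q_def ac_simps)
      finally show ?thesis by (simp only: distrib_left)
    qed
    then show ?thesis by simp
  qed
  have nd: "pev r \<xi> = 0" if r: "\<And>z. z \<in> ker X Q \<Longrightarrow> b (pev r \<xi>) z = 0" for r
  proof -
    have "pev r x = 0"
    proof -
      have "b (pev r x) z = 0" if z: "z \<in> X" "pev (?p ^ k) z = 0" for z
      proof -
        have "z \<in> ker X Q" using z pev_mult[of "p ^ k" "?p ^ k" z] by (simp add: ker_def Q_def)
        moreover have "b (pev r w) z = 0" using iso2[OF kw z(2)] .
        ultimately show ?thesis using r[of z] unfolding \<xi>_def by (simp add: pev_add_arg bD)
      qed
      then obtain z where z: "z \<in> X" "pev r x = pev (negp (?p ^ k)) z"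
        using perp_ker[OF X st[OF x(1)], of "?p ^ k"] by blast
      then have "pev r x = pev (p ^ k) z" by simp
      then show ?thesis using stab[OF z(1)] kx[of r] by simp
    qed
    moreover have "pev r w = 0"
    proof -
      have yz: "b (pev r w) (pev q y) = 0" for q
      proof -
        have yq: "pev (p ^ k) (pev q y) = 0" using kerD(2)[OF y(1)] pev_commute[of "p ^ k" q y] by simp
        have yX: "pev q y \<in> X" using st[OF kerD(1)[OF y(1)]] .
        have "pev q y \<in> ker X Q" using yq yX pev_commute[of "p ^ k" "?p ^ k"] by (simp add: ker_def Q_def pev_mult)
        moreover have "b (pev r x) (pev q y) = 0" using iso1[OF kx yq] .
        ultimately show ?thesis using r[of "pev q y"] unfolding \<xi>_def by (simp add: pev_add_arg bD)
      qed
      \<comment> \<open>Annihilators are computed modulo the vectors orthogonal to all of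
        \<open>cyc w\<close>: there \<open>y\<close> has order exactly p^k by the choice of
        \<open>w\<close>, while \<open>yz\<close> says that \<open>negp r\<close> kills it.\<close>
      have "p ^ k dvd negp r"
      proof (rule ccontr)
        assume nd: "\<not> p ^ k dvd negp r"
        have sW: "subspace {z. \<forall>q. b w (pev q z) = 0}" "ustable {z. \<forall>q. b w (pev q z) = 0}"
          unfolding subspace_def ustable_def
          using pev_mult[of _ "[:0, 1:]"] by (auto simp: bD pev_add_arg pev_scale_arg) (metis pev_X)
        have "pev (p ^ (k - 1)) y \<notin> {z. \<forall>q. b w (pev q z) = 0}"
          using w(3) unfolding y0_def by (auto simp: b_sym[of w] intro!: exI[of _ 1])
        moreover have "pev (p ^ k) y \<in> {z. \<forall>q. b w (pev q z) = 0}" using kerD(2)[OF y(1)] by (simp add: bD)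
        moreover have "pev (negp r) y \<in> {z. \<forall>q. b w (pev q z) = 0}"
          using yz by (simp add: pev_adj pev_commute[of "negp r"])
        ultimately show False using ann_power[OF p(1) k sW] nd by blast
      qed
      then obtain f where "negp r = p ^ k * f" by (rule dvdE)
      then have "r = ?p ^ k * negp f" by (metis negp_negp negp_simps(4) negp_power)
      then show ?thesis using kw[of "negp f"] by (simp add: pev_mult)
    qed
    ultimately show ?thesis unfolding \<xi>_def by (simp add: pev_add_arg)
  qed
  obtain \<eta>0 where \<eta>0: "\<eta>0 \<in> X" "dual_pair Q \<xi> \<eta>0" using dual_exists[OF X Qs Qd \<xi>X Q\<xi> nd ann] by blast
  obtain \<eta> where \<eta>: "\<eta> \<in> X" "dual_pair Q \<xi> \<eta>" "\<And>q. b \<eta> (pev q \<eta>) = 0"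
    using dual_iso_exists[OF X Qs Qd \<xi>X \<eta>0 \<xi>iso] by blast
  note C = dual_pair_good[OF X Qs Qd \<xi>X \<eta>(1,2) \<xi>iso \<eta>(3)]
  have "\<xi> \<noteq> 0"
  proof
    assume "\<xi> = 0"
    then have "Q dvd 1" by (intro ann) simp
    then show False using Qd by (auto simp: is_unit_poly_iff)
  qed
  moreover have "\<xi> \<in> ssum (cyc \<xi>) (cyc \<eta>)"
    using ssum_upper(1)[OF subspace_cyc[of \<xi>] subspace_cyc[of \<eta>]] cyc_self[of \<xi>] by blast
  ultimately show ?thesis using C by blast
qed

text \<open>Injectivity of u excludes p = t, so every irreducible factor falls under one of the two
  conditions. Each provides a nonzero pairable piece, and the piece, being pairable, satisfies the
  conditions itself, so that they cancel.\<close>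

lemma pairable_invertible:
  assumes "good X" "\<And>x. x \<in> X \<Longrightarrow> u x = 0 \<Longrightarrow> x = 0"
    and "\<forall>p\<in>Irr0. \<forall>k\<ge>1. condI X p k" "\<forall>p\<in>Irr - (Irr0 \<union> {[:0, 1:]}). \<forall>k\<ge>1. condII X p k"
  shows "pairable X" using assms
proof (induction "dim X" arbitrary: X rule: less_induct)
  case less
  note X = less.prems(1) and inj = less.prems(2)
  show ?case
  proof (cases "\<exists>x\<in>X. x \<noteq> 0")
    case False
    then show ?thesis by (intro pairable_trivial[OF goodD(2)[OF X]]) auto
  next
    case True
    then obtain p x0 where p: "p \<in> Irr" and x0: "x0 \<in> X" "x0 \<noteq> 0" "pev p x0 = 0"
      using irreducible_kernel_exists[OF goodD(1,3)[OF X]] by blast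
    have pX: "p \<noteq> [:0, 1:]" using inj x0 by auto
    have irr: "Factorial_Ring.irreducible p" using p by (simp add: Irr_def)
    note deg = irr_degree[OF p]
    obtain k x where k: "k \<ge> 1" and x: "x \<in> X" "pev (p ^ k) x = 0" "pev (p ^ (k - 1)) x \<noteq> 0"
      and stab: "\<And>z. z \<in> X \<Longrightarrow> pev (p ^ k) (pev (p ^ k) z) = 0 \<Longrightarrow> pev (p ^ k) z = 0"
      using top_exponent[OF goodD(1,3)[OF X] x0] by blast
    have "\<exists>C w. good C \<and> C \<subseteq> X \<and> pairable C \<and> w \<in> C \<and> w \<noteq> 0"
    proof (cases "p \<in> Irr0")
      case False
      then have "condII X p k" using less.prems(4) p pX k by blast
      then show ?thesis
        using split_coprime[OF X irr irr_not_dvd_negp[OF p False pX two] deg k x stab] by blast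
    next
      case True
      then have "condI X p k" using less.prems(3) k by blast
      then obtain M where M: "subspace M" "ustable M"
          "M = {x\<in>ker X (p ^ k). \<forall>y\<in>M. b x (pev (p ^ (k - 1)) y) = 0}" unfolding condI_def by blast
      have MD: "z \<in> ker X (p ^ k)" "\<And>y. y \<in> M \<Longrightarrow> b z (pev (p ^ (k - 1)) y) = 0" if "z \<in> M" for z
        using M(3) that by blast+
      \<comment> \<open>If p(u)^(k-1) killed \<open>M\<close>, everything in Ker p(u)^k would be
        orthogonal to \<open>M\<close> and hence in \<open>M\<close>, including \<open>x\<close>. So
        \<open>M\<close> contains a vector of full height, and it is isotropic at the top level
        together with its multiples.\<close>
      have "\<exists>z\<in>M. pev (p ^ (k - 1)) z \<noteq> 0"
      proof (rule ccontr)
        assume no: "\<not> ?thesis"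
        then have "b x (pev (p ^ (k - 1)) y) = 0" if "y \<in> M" for y using that by (simp add: bD)
        then have "x \<in> M" by (subst M(3)) (use x(1,2) in \<open>simp add: ker_def\<close>)
        then show False using no x(3) by blast
      qed
      then obtain z where z: "z \<in> M" "pev (p ^ (k - 1)) z \<noteq> 0" by blast
      have zX: "z \<in> X" "pev (p ^ k) z = 0" using MD(1)[OF z(1)] by (auto simp: ker_def)
      have z3: "pev (p ^ (k - 1)) z \<noteq> pev (p ^ k) w" if "w \<in> X" for w
        using stab[OF that] z(2) zX(2) pev_commute[of "p ^ k" "p ^ (k - 1)" z] by auto
      have top: "b z (pev (p ^ (k - 1)) (pev q z)) = 0" for q
        using MD(2)[OF z(1) pev_stable[OF M(1,2) z(1)]] .
      have np: "negp p = Polynomial.smult ((- 1) ^ degree p) p"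
      proof -
        have "p \<noteq> 0" using deg by auto
        show ?thesis by (rule trans[OF irr0_negp[OF True] even_poly_sign[OF irr0_negp[OF True] \<open>p \<noteq> 0\<close>]])
      qed
      obtain x' y where xy: "x' \<in> X" "y \<in> X" "pev (p ^ (k - 1)) x' = pev (p ^ (k - 1)) z"
          "good (ssum (cyc x') (cyc y))" "ssum (cyc x') (cyc y) \<subseteq> X" "pairable (ssum (cyc x') (cyc y))"
        using split_hyperbolic[OF X irr np deg k zX z3 top] by blast
      have "x' \<noteq> 0" using xy(3) z(2) by auto
      moreover have "x' \<in> ssum (cyc x') (cyc y)"
        using ssum_upper(1)[OF subspace_cyc[of x'] subspace_cyc[of y]] cyc_self[of x'] by blast
      ultimately show ?thesis using xy by blast
    qed
    then obtain C w where C: "good C" "C \<subseteq> X" "pairable C" and w: "w \<in> C" "w \<noteq> 0" by blast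
    note gD = split_good(1)[OF X C(1,2)]
    have "pairable (operp X C)"
    proof (rule less.hyps[OF split_dim_less[OF X C(1,2) w] gD])
      show "x = 0" if "x \<in> operp X C" "u x = 0" for x using inj operpD(3)[OF that(1)] that(2) by blast
      show "\<forall>p\<in>Irr0. \<forall>k\<ge>1. condI (operp X C) p k"
      proof (intro ballI allI impI)
        fix p :: "'a poly" and k assume p: "p \<in> Irr0" and "(k::nat) \<ge> 1"
        have "p \<noteq> [:0, 1:]" using p irr0_not_X[OF two] by blast
        moreover have "p \<in> Irr" using p by (simp add: Irr0_def)
        ultimately show "condI (operp X C) p k"
          using condI_cancel[OF X C(1,2) irr0_negp[OF p]] less.prems(3) p \<open>k \<ge> 1\<close>
            pairable_conds(1)[OF C(1,3) irr0_negp[OF p] irr_coeff0] by blast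
      qed
      show "\<forall>p\<in>Irr - (Irr0 \<union> {[:0, 1:]}). \<forall>k\<ge>1. condII (operp X C) p k"
      proof (intro ballI allI impI)
        fix p :: "'a poly" and k assume p: "p \<in> Irr - (Irr0 \<union> {[:0, 1:]})" and k: "(k::nat) \<ge> 1"
        have "condII C p k"
          using pairable_conds(2)[OF C(1,3)] p k irr_coeff0[of p] irr_degree[of p] by (auto simp: Irr_def)
        then show "condII (operp X C) p k" using condII_cancel[OF X C(1,2)] less.prems(4) p k by blast
      qed
    qed
    then show ?thesis by (rule split_pairable[OF X C])
  qed
qed

section \<open>Sufficiency when u is nilpotent\<close>

lemma upow_pev: "(u ^^ n) x = pev ([:0, 1:] ^ n) x" by (simp only: pev_X_power)

lemma upow_in: "subspace S \<Longrightarrow> ustable S \<Longrightarrow> x \<in> S \<Longrightarrow> (u ^^ n) x \<in> S"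
  unfolding upow_pev by (rule pev_stable)

lemma upow_0 [simp]: "(u ^^ n) 0 = 0" unfolding upow_pev by simp

lemma upow_diff: "(u ^^ n) (x - y) = (u ^^ n) x - (u ^^ n) y" unfolding upow_pev by (rule pev_diff_arg)

lemma upow_pev_commute: "(u ^^ n) (pev q x) = pev q ((u ^^ n) x)" unfolding upow_pev by (rule pev_commute)

lemma upow_upow: "(u ^^ m) ((u ^^ n) x) = (u ^^ (m + n)) x" by (simp add: funpow_add)

lemma upow_zero_mono: "(u ^^ m) x = 0 \<Longrightarrow> m \<le> n \<Longrightarrow> (u ^^ n) x = 0"
  using upow_upow[of "n - m" m x] by simp

lemma upow_adj': "b x ((u ^^ n) y) = (- 1) ^ n * b ((u ^^ n) x) y"
proof -
  have "(- 1) ^ n * ((- 1) ^ n * b x ((u ^^ n) y)) = b x ((u ^^ n) y)"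
    by (simp flip: power_mult_distrib mult.assoc)
  then show ?thesis unfolding upow_adj by simp
qed

lemma subspace_upow_image: "subspace S \<Longrightarrow> subspace ((u ^^ k) ` S)"
  using subspace_image_pev[of S "[:0, 1:] ^ k"] unfolding upow_pev by simp

lemma upow_image_sub: "subspace S \<Longrightarrow> ustable S \<Longrightarrow> (u ^^ k) ` S \<subseteq> S"
  using upow_in by blast

lemma upow_image_antimono:
  assumes "subspace S" "ustable S" "k \<le> l" shows "(u ^^ l) ` S \<subseteq> (u ^^ k) ` S"
proof
  fix x assume "x \<in> (u ^^ l) ` S"
  then obtain y where y: "y \<in> S" "x = (u ^^ l) y" by blast
  then have "x = (u ^^ k) ((u ^^ (l - k)) y)" using assms(3) by (simp add: upow_upow)
  then show "x \<in> (u ^^ k) ` S" using upow_in[OF assms(1,2) y(1)] by blast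
qed

text \<open>An odd power of u is skew, so anisotropic vectors of top height occur only for odd
  heights. This is why (iii) involves the blocks of odd size alone.\<close>

lemma skew_odd: "odd n \<Longrightarrow> b x ((u ^^ n) x) = 0"
proof -
  assume "odd n"
  then have "b x ((u ^^ n) x) = - b x ((u ^^ n) x)" using upow_adj'[of x n x] b_sym[of "(u ^^ n) x" x] by simp
  then have "2 * b x ((u ^^ n) x) = 0" unfolding mult_2 using eq_neg_iff_add_eq_0 by blast
  then show ?thesis using two by simp
qed

text \<open>Im u^k is orthogonal to Ker u^k, so their intersection is totally isotropic; it contains
  Im u^(k+1) by the bound on nilpotency and serves as both \<open>E\<close> and
  \<open>L\<close>.\<close>

lemma condN_trivial:
  assumes X: "subspace X" "ustable X" and z: "\<And>x. x \<in> X \<Longrightarrow> (u ^^ (2 * k + 1)) x = 0"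
  shows "condN X k"
proof -
  let ?E = "{x\<in>(u ^^ k) ` X. (u ^^ k) x = 0}"
  have "subspace ?E" using subspace_upow_image[OF X(1), of k]
    unfolding subspace_def by (auto simp: upow_add upow_scale)
  moreover have "(u ^^ Suc k) ` X \<subseteq> ?E"
  proof
    fix x assume "x \<in> (u ^^ Suc k) ` X"
    then obtain y where y: "y \<in> X" "x = (u ^^ Suc k) y" by blast
    have "(u ^^ k) x = (u ^^ (2 * k + 1)) y" unfolding y(2) upow_upow by (simp add: mult_2)
    moreover have "x \<in> (u ^^ k) ` X" using y upow_image_antimono[OF X, of k "Suc k"] by auto
    ultimately show "x \<in> ?E" using z[OF y(1)] by simp
  qed
  moreover have "b x y = 0" if "x \<in> ?E" "y \<in> ?E" for x y
    using that upow_adj[of k _ y] by (auto simp: bD)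
  ultimately show ?thesis unfolding condN_def by (intro exI[of _ ?E]) blast
qed

text \<open>Lagrangian reduction by a Lagrangian \<open>S\<close> of \<open>C\<close>. It only works
  inside \<open>E\<close>, so \<open>S\<close> has to be contained in \<open>E\<close>; for this
  reason a piece that is split off always comes with a suitable \<open>S\<close>.\<close>

lemma condN_split:
  assumes X: "good X" and C: "good C" "C \<subseteq> X"
    and S: "subspace S" "S \<subseteq> C" "\<And>z. z \<in> C \<Longrightarrow> (\<And>s. s \<in> S \<Longrightarrow> b z s = 0) \<Longrightarrow> z \<in> S"
      "\<And>x y. x \<in> S \<Longrightarrow> y \<in> S \<Longrightarrow> b x y = 0"
    and E: "subspace E" "subspace L" "(u ^^ Suc k) ` X \<subseteq> E" "E \<subseteq> (u ^^ k) ` X"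
      "L = {x\<in>E. \<forall>y\<in>L. b x y = 0}" "S \<subseteq> E"
  shows "condN (operp X C) k"
proof -
  let ?D = "operp X C"
  let ?E = "E \<inter> ?D"
  let ?L = "{x\<in>?E. \<exists>c\<in>S. x + c \<in> L}"
  note gD = split_good(1)[OF X C]
  have EX: "E \<subseteq> X" using E(4) upow_image_sub[OF goodD(2,3)[OF X]] by blast
  have fE: "fd E" by (rule fd_mono[OF goodD(1)[OF X] E(1) EX])
  have DX: "?D \<subseteq> X" by (auto simp: operp_def)
  have "?L = {x\<in>?E. \<forall>y\<in>?L. b x y = 0}"
  proof (rule neutral_cancel[OF b_bil b_sym fE E(2,5) S(1) E(6) S(4)])
    show "?E \<subseteq> E" by blast
    show "b x y = 0" if "x \<in> ?E" "y \<in> S" for x y using that operpD(2) S(2) by blast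
    fix y assume y: "y \<in> E" "\<And>c. c \<in> S \<Longrightarrow> b y c = 0"
    obtain c d where cd: "c \<in> C" "d \<in> ?D" "y = c + d" using split_mem[OF X C] y(1) EX by blast
    have "b c s = 0" if "s \<in> S" for s
      using y(2)[OF that] operpD(2)[OF cd(2)] S(2) that cd(3) by (auto simp: bD)
    then have c: "c \<in> S" using S(3)[OF cd(1)] by blast
    then have "y - c \<in> E" using y(1) E(1,6) subspace_diff by blast
    then have "d \<in> ?E" using cd by simp
    then show "\<exists>c\<in>S. \<exists>z\<in>?E. y = c + z" using c cd(3) by blast
  qed
  moreover have "subspace ?E" using subspace_inter[OF E(1) goodD(2)[OF gD]] .
  moreover have "subspace ?L" unfolding subspace_def
  proof (intro conjI ballI allI)
    note sE = subspace_inter[OF E(1) goodD(2)[OF gD]]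
    show "0 \<in> ?L" using subspace_0[OF sE] subspace_0[OF S(1)] subspace_0[OF E(2)] by (auto intro!: bexI[of _ 0])
    fix x y a assume x: "x \<in> ?L"
    then obtain c where c: "c \<in> S" "x + c \<in> L" by blast
    have "a *s x + a *s c \<in> L" using subspace_scale[OF E(2) c(2), of a] by (simp add: scale_right_distrib)
    then show "a *s x \<in> ?L" using x subspace_scale[OF sE] subspace_scale[OF S(1) c(1), of a] by blast
    assume y: "y \<in> ?L"
    then obtain d where d: "d \<in> S" "y + d \<in> L" by blast
    have "(x + y) + (c + d) \<in> L" using subspace_add[OF E(2) c(2) d(2)] by (simp add: ac_simps)
    then show "x + y \<in> ?L" using x y subspace_add[OF sE] subspace_add[OF S(1) c(1) d(1)] by blast
  qed
  moreover have "(u ^^ Suc k) ` ?D \<subseteq> ?E"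
    using E(3) DX upow_image_sub[OF goodD(2,3)[OF gD], of "Suc k"] by blast
  moreover have "?E \<subseteq> (u ^^ k) ` ?D"
  proof
    fix x assume x: "x \<in> ?E"
    then obtain y where y: "y \<in> X" "x = (u ^^ k) y" using E(4) by blast
    obtain c d where cd: "c \<in> C" "d \<in> ?D" "y = c + d" using split_mem[OF X C y(1)] by blast
    have "(u ^^ k) c + ((u ^^ k) d - x) = 0" using y cd by (simp add: upow_add)
    then have "(u ^^ k) d - x = 0" using split_zero(2)[OF X C upow_in[OF goodD(2,3)[OF C(1)] cd(1)]
          subspace_diff[OF goodD(2)[OF gD] upow_in[OF goodD(2,3)[OF gD] cd(2)]]] x by blast
    then have "x = (u ^^ k) d" by simp
    then show "x \<in> (u ^^ k) ` ?D" using cd(2) by blast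
  qed
  ultimately show ?thesis unfolding condN_def by - (rule exI[of _ ?E], rule exI[of _ ?L], intro conjI)
qed

lemma X_facts:
  "Factorial_Ring.irreducible [:0, 1 :: 'a:]"
  "negp [:0, 1 :: 'a:] = Polynomial.smult ((- 1) ^ degree [:0, 1 :: 'a:]) [:0, 1:]" "degree [:0, 1 :: 'a:] > 0"
  using irreducible_X by simp_all

text \<open>An anti-isometric partner, one level below, of a vector of maximal odd height.\<close>

lemma partner_exists:
  assumes X: "good X" and K: "K \<ge> 1" and nil: "\<And>x. x \<in> X \<Longrightarrow> (u ^^ (2 * K + 1)) x = 0"
    and anis: "\<And>x. x \<in> X \<Longrightarrow> b ((u ^^ K) x) ((u ^^ K) x) = 0 \<Longrightarrow> (u ^^ (2 * K)) x = 0"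
    and E: "subspace E" "subspace L" "(u ^^ K) ` X \<subseteq> E" "E \<subseteq> (u ^^ (K - 1)) ` X"
      "L = {x\<in>E. \<forall>y\<in>L. b x y = 0}"
    and x: "x \<in> X"
  shows "\<exists>y\<in>X. (u ^^ (2 * K - 1)) y = 0 \<and> (u ^^ (K - 1)) y \<in> E \<and>
    b ((u ^^ (K - 1)) y) ((u ^^ (K - 1)) y) = - b ((u ^^ K) x) ((u ^^ K) x)"
proof -
  note sX = goodD(2)[OF X] and uX = goodD(3)[OF X]
  let ?U = "(u ^^ K) ` X"
  let ?S = "{z\<in>?U. (u ^^ K) z = 0}"
  have sU: "subspace ?U" by (rule subspace_upow_image[OF sX])
  have UX: "?U \<subseteq> X" by (rule upow_image_sub[OF sX uX])
  have EX: "E \<subseteq> X" using E(4) upow_image_sub[OF sX uX] by blast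
  have fE: "fd E" by (rule fd_mono[OF goodD(1)[OF X] E(1) EX])
  have fU: "fd ?U" by (rule fd_mono[OF goodD(1)[OF X] sU UX])
  have sS: "subspace ?S" using sU unfolding subspace_def by (auto simp: upow_add upow_scale)
  have SU: "?S \<subseteq> ?U" by blast
  have LE: "z \<in> E" "\<And>y. y \<in> L \<Longrightarrow> b z y = 0" if "z \<in> L" for z using E(5) that by blast+
  have rad: "b w s = 0" if "w \<in> ?U" "(u ^^ K) s = 0" for w s
    using that upow_adj[of K] by (auto simp: bD)
  have rad_conv: "(u ^^ K) w = 0" if w: "w \<in> ?U" "\<And>z. z \<in> ?U \<Longrightarrow> b z w = 0" for w
  proof (rule goodD(4)[OF X])
    show "(u ^^ K) w \<in> X" using w(1) UX upow_in[OF sX uX] by blast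
    show "b ((u ^^ K) w) y = 0" if "y \<in> X" for y
      using w(2)[of "(u ^^ K) y"] that upow_adj[of K w y] b_sym[of w] by auto
  qed
  define LS where "LS = ssum L ?S"
  have sLS: "subspace LS" unfolding LS_def by (rule subspace_ssum[OF E(2) sS])
  have LSE: "LS \<subseteq> E" unfolding LS_def
  proof (rule ssum_least[OF E(1)])
    show "L \<subseteq> E" using LE(1) by blast
    show "?S \<subseteq> E" by (rule order_trans[OF SU E(3)])
  qed
  have fLS: "fd LS" by (rule fd_mono[OF fE sLS LSE])
  \<comment> \<open>The \<open>U\<close>-parts of those members of \<open>L\<close> that split as a
    vector of \<open>U\<close> plus a vector of \<open>E\<close> orthogonal to \<open>U\<close>. The
    aim is to see that \<open>A\<close> and the radical \<open>?S\<close> represent every functional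
    that a vector of \<open>U\<close> induces on \<open>U\<close>.\<close>
  define A where "A = {a\<in>?U. \<exists>c\<in>E. (\<forall>w\<in>?U. b c w = 0) \<and> a + c \<in> L}"
  have AI: "a \<in> A" if "a \<in> ?U" "c \<in> E" "\<forall>w\<in>?U. b c w = 0" "a + c \<in> L" for a c
    using that unfolding A_def by blast
  have sA: "subspace A" unfolding subspace_def
  proof (intro conjI ballI allI)
    show "0 \<in> A" by (rule AI[OF subspace_0[OF sU] subspace_0[OF E(1)]])
        (simp_all add: bD subspace_0[OF E(2)])
    fix a a' k assume "a \<in> A"
    then obtain c where c: "a \<in> ?U" "c \<in> E" "\<forall>w\<in>?U. b c w = 0" "a + c \<in> L" unfolding A_def by blast
    have "k *s a + k *s c \<in> L" using subspace_scale[OF E(2) c(4), of k] by (simp add: scale_right_distrib)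
    moreover have "\<forall>w\<in>?U. b (k *s c) w = 0" using c(3) by (simp add: bD)
    ultimately show "k *s a \<in> A"
      using AI[OF subspace_scale[OF sU c(1), of k] subspace_scale[OF E(1) c(2), of k]] by blast
    assume "a' \<in> A"
    then obtain c' where c': "a' \<in> ?U" "c' \<in> E" "\<forall>w\<in>?U. b c' w = 0" "a' + c' \<in> L" unfolding A_def by blast
    have "(a + a') + (c + c') \<in> L" using subspace_add[OF E(2) c(4) c'(4)] by (simp add: ac_simps)
    moreover have "\<forall>w\<in>?U. b (c + c') w = 0" using c(3) c'(3) by (simp add: bD)
    ultimately show "a + a' \<in> A"
      using AI[OF subspace_add[OF sU c(1) c'(1)] subspace_add[OF E(1) c(2) c'(2)]] by blast
  qed
  have AU: "A \<subseteq> ?U" unfolding A_def by blast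
  have sAS: "subspace (ssum A ?S)" by (rule subspace_ssum[OF sA sS])
  have fAS: "fd (ssum A ?S)" by (rule fd_mono[OF fU sAS ssum_least[OF sU AU SU]])
  \<comment> \<open>Double orthogonality in \<open>E\<close> shows that \<open>z\<close> is a member
    of \<open>L\<close> up to a vector of \<open>?S\<close>. That member lies in \<open>U\<close>
    and is isotropic, so \<open>anis\<close> puts it into the radical.\<close>
  have key: "(u ^^ K) z = 0" if z: "z \<in> ?U" "\<forall>m\<in>ssum A ?S. b m z = 0" for z
  proof -
    have zA: "b z a = 0" if "a \<in> A" for a using z(2) ssum_upper(1)[OF sA sS] that b_sym[of z a] by auto
    have zE: "z \<in> E" using z(1) E(3) by blast
    have "b z y = 0" if y: "y \<in> E" "\<forall>m\<in>LS. b m y = 0" for y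
    proof -
      have "\<forall>m\<in>L. b y m = 0"
        using y(2) ssum_upper(1)[OF E(2) sS] b_sym[of y] unfolding LS_def by auto
      then have yL: "y \<in> L" using E(5) y(1) by blast
      have yS: "b y s = 0" if "s \<in> ?S" for s
        using y(2) ssum_upper(2)[OF E(2) sS] that b_sym[of y s] unfolding LS_def by auto
      have "\<exists>a\<in>?U. \<forall>w\<in>?U. b y w = b a w"
      proof (rule perp_perp[OF b_bil fU sU])
        fix w assume w: "w \<in> ?U" "\<forall>m\<in>?U. b m w = 0"
        then have "w \<in> ?S" using rad_conv[OF w(1)] by blast
        then show "b y w = 0" by (rule yS)
      qed
      then obtain a where a: "a \<in> ?U" "\<forall>w\<in>?U. b y w = b a w" by blast
      have c: "y - a \<in> E" "\<forall>w\<in>?U. b (y - a) w = 0" "a + (y - a) \<in> L"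
        using a y(1) E(1,3) subspace_diff yL by (auto simp: bD)
      then have "a \<in> A" unfolding A_def using a(1) by blast
      then have "b z a = 0" by (rule zA)
      moreover have "b z (y - a) = 0" using c(2) z(1) b_sym[of z] by auto
      ultimately show ?thesis by (simp add: bD)
    qed
    then obtain m where m: "m \<in> LS" "\<forall>y\<in>E. b z y = b m y"
      using perp_perp[OF b_bil fLS E(1), of z] by blast
    have "z - m \<in> E" using zE m(1) LSE subspace_diff[OF E(1)] by blast
    moreover have "\<forall>y\<in>L. b (z - m) y = 0" using m(2) LE(1) by (simp add: bD)
    ultimately have zm: "z - m \<in> L" using E(5) by blast
    obtain l s where ls: "l \<in> L" "s \<in> ?S" "m = l + s" using m(1) unfolding LS_def ssum_def by blast
    have "z - m + l \<in> L" using zm ls(1) subspace_add[OF E(2)] by blast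
    then have zsL: "z - s \<in> L" using ls(3) by simp
    have "z - s \<in> ?U" using z(1) ls(2) subspace_diff[OF sU] by blast
    then obtain g where g: "g \<in> X" "z - s = (u ^^ K) g" by blast
    have "b ((u ^^ K) g) ((u ^^ K) g) = 0" using LE(2)[OF zsL zsL] g(2) by simp
    then have "(u ^^ (2 * K)) g = 0" using anis g(1) by blast
    then have "(u ^^ K) (z - s) = 0" unfolding g(2) upow_upow by (simp add: mult_2)
    then show ?thesis using ls(2) by (simp add: upow_diff)
  qed
  let ?x = "(u ^^ K) x"
  have xU: "?x \<in> ?U" using x by blast
  have "\<exists>m\<in>ssum A ?S. \<forall>w\<in>?U. b ?x w = b m w"
  proof (rule perp_perp[OF b_bil fAS sU])
    fix z assume "z \<in> ?U" "\<forall>m\<in>ssum A ?S. b m z = 0"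
    then show "b ?x z = 0" using key rad[OF xU] by blast
  qed
  then obtain a s where as: "a \<in> A" "s \<in> ?S" "\<forall>w\<in>?U. b ?x w = b (a + s) w" unfolding ssum_def by blast
  have aU: "a \<in> ?U" using as(1) AU by blast
  have xa: "b ?x w = b a w" if "w \<in> ?U" for w
    using as(3) that rad[OF that, of s] as(2) b_sym[of s w] by (auto simp: bD)
  obtain c where c: "c \<in> E" "\<forall>w\<in>?U. b c w = 0" "a + c \<in> L" using as(1) unfolding A_def by blast
  have "b ?x ?x = b a ?x" using xa[OF xU] .
  also have "\<dots> = b a a" using xa[OF aU] b_sym[of a ?x] by simp
  finally have xx: "b ?x ?x = b a a" .
  have "b (a + c) (a + c) = 0" using LE(2)[OF c(3) c(3)] .
  moreover have "b c a = 0" "b a c = 0" using c(2) aU b_sym[of a c] by auto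
  \<comment> \<open>\<open>a\<close> and the vector u^K x have the same norm, since they induce the
    same functional on \<open>U\<close>; as a + c is isotropic, \<open>c\<close> carries the
    opposite norm.\<close>
  ultimately have cc: "b c c = - b ?x ?x" unfolding xx by (simp add: bD eq_neg_iff_add_eq_0 add.commute)
  obtain y where y: "y \<in> X" "c = (u ^^ (K - 1)) y" using c(1) E(4) by blast
  \<comment> \<open>\<open>c\<close> is u^(K-1) y and is orthogonal to Im u^K; moving u^K across b
    gives exponent 2K - 1.\<close>
  have "(u ^^ (2 * K - 1)) y = 0"
  proof (rule goodD(4)[OF X upow_in[OF sX uX y(1)]])
    fix w assume w: "w \<in> X"
    have "(u ^^ K) w \<in> ?U" using w by blast
    then have "b c ((u ^^ K) w) = 0" using c(2) by blast
    moreover have "b c ((u ^^ K) w) = (- 1) ^ K * b ((u ^^ (2 * K - 1)) y) w"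
    proof -
      have "K + (K - 1) = 2 * K - 1" using K by simp
      then have "(u ^^ K) c = (u ^^ (2 * K - 1)) y" unfolding y(2) upow_upow by simp
      then show ?thesis using upow_adj'[of c K w] by simp
    qed
    ultimately show "b ((u ^^ (2 * K - 1)) y) w = 0" by simp
  qed
  then show ?thesis using y c(1) cc by blast
qed

text \<open>The vector generates a non-degenerate cyclic block of dimension m + 1: the lowest
  nonzero coefficient of q is detected by the complementary power of u, as all higher terms exceed
  the height of x.\<close>

lemma block_nd:
  assumes m: "b x ((u ^^ m) x) \<noteq> 0" "(u ^^ Suc m) x = 0" and z: "\<And>s. b (pev q x) (pev s x) = 0"
  shows "[:0, 1:] ^ Suc m dvd q"
proof -
  have "[:0, 1:] ^ i dvd q" if "i \<le> Suc m" for i using that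
  proof (induction i)
    case (Suc i)
    then obtain r where r: "q = [:0, 1:] ^ i * r" by (auto elim: dvdE)
    obtain a h where ah: "r = pCons a h" by (cases r)
    have "pev ([:0, 1:] ^ (m - i)) x = (u ^^ (m - i)) x" by (rule pev_X_power)
    then have "0 = b (pev q x) ((u ^^ (m - i)) x)" using z[of "[:0, 1:] ^ (m - i)"] by simp
    also have "\<dots> = (- 1) ^ (m - i) * b ((u ^^ (m - i)) (pev q x)) x" by (rule upow_adj')
    also have "(u ^^ (m - i)) (pev q x) = (u ^^ m) (pev r x)"
      unfolding r pev_mult pev_X_power upow_upow using Suc.prems by simp
    also have "\<dots> = a *s (u ^^ m) x + pev h ((u ^^ Suc m) x)"
    proof -
      have "(u ^^ m) (u (pev h x)) = (u ^^ Suc m) (pev h x)" by (simp add: funpow_swap1)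
      also have "\<dots> = pev h ((u ^^ Suc m) x)" by (rule upow_pev_commute)
      finally show ?thesis unfolding ah by (simp only: pev_pCons upow_add upow_scale)
    qed
    finally have "a * b ((u ^^ m) x) x = 0" using m(2) by (simp add: bD)
    then have "a = 0" using m(1) b_sym[of x] by simp
    then have "r = [:0, 1:] * h" using ah by simp
    then have "q = [:0, 1:] ^ Suc i * h" using r by (simp only: power_Suc2 mult.assoc)
    then show ?case by (rule dvdI)
  qed simp
  then show ?thesis by blast
qed

lemma pev_zero_const:
  assumes "(u ^^ Suc m) x = 0" shows "pev s ((u ^^ m) x) = coeff s 0 *s (u ^^ m) x"
proof -
  obtain a h where "s = pCons a h" by (cases s)
  then have "pev s ((u ^^ m) x) = a *s (u ^^ m) x + pev h ((u ^^ Suc m) x)" by (simp add: pev_pCons pev_u)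
  then show ?thesis using assms \<open>s = pCons a h\<close> by simp
qed

text \<open>The partner is corrected to be orthogonal to \<open>cyc x\<close> and then, by Hensel lifting from the top
  level downwards, to carry exactly the form of \<open>u x\<close>.\<close>

lemma exact_partner_exists:
  assumes X: "good X" and K: "K \<ge> 1" and nil: "\<And>x. x \<in> X \<Longrightarrow> (u ^^ (2 * K + 1)) x = 0"
    and E: "subspace E" "(u ^^ K) ` X \<subseteq> E"
    and x: "x \<in> X" "b x ((u ^^ (2 * K)) x) \<noteq> 0"
    and y: "y \<in> X" "(u ^^ (2 * K - 1)) y = 0" "(u ^^ (K - 1)) y \<in> E"
      "b ((u ^^ (K - 1)) y) ((u ^^ (K - 1)) y) = - b ((u ^^ K) x) ((u ^^ K) x)"
  shows "\<exists>y\<in>X. (u ^^ (2 * K - 1)) y = 0 \<and> (u ^^ (K - 1)) y \<in> E \<and> (\<forall>z\<in>cyc x. b z y = 0) \<and>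
    (\<forall>i. b y ((u ^^ i) y) = b x ((u ^^ (i + 2)) x))"
proof -
  note sX = goodD(2)[OF X] and uX = goodD(3)[OF X]
  note st = pev_stable[OF sX uX] and su = upow_in[OF sX uX]
  let ?a = "b x ((u ^^ (2 * K)) x)"
  have nil': "(u ^^ n) z = 0" if "z \<in> X" "2 * K < n" for n z
    using upow_zero_mono[OF nil[OF that(1)], of n] that(2) by simp
  have xnil: "(u ^^ Suc (2 * K)) x = 0" using nil[OF x(1)] by simp
  have cX: "cyc x \<subseteq> X" by (rule cyc_sub[OF sX uX x(1)])
  have KK: "K - 1 + (K - 1) = 2 * K - 2" "K + K = 2 * K" using K by auto
  have K2: "2 * K - 2 + 2 = 2 * K" "2 + (2 * K - 2) = 2 * K" using K by auto
  have sgn: "(- 1 :: 'a) ^ K = - ((- 1) ^ (K - 1))" using K by (cases K) auto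
  have ytop: "b y ((u ^^ (2 * K - 2)) y) = ?a"
  proof -
    have "(- 1) ^ (K - 1) * b y ((u ^^ (2 * K - 2)) y) = - ((- 1) ^ K * ?a)"
      using y(4) unfolding upow_adj upow_upow KK .
    then have "(- 1) ^ (K - 1) * ((- 1) ^ (K - 1) * b y ((u ^^ (2 * K - 2)) y)) = (- 1) ^ (K - 1) * ((- 1) ^ (K - 1) * ?a)"
      unfolding sgn by simp
    then show ?thesis by (simp flip: power_mult_distrib mult.assoc)
  qed
  have nd: "pev q x = 0" if "\<And>s. b (pev q x) (pev s x) = 0" for q
  proof -
    have "[:0, 1:] ^ Suc (2 * K) dvd q" by (rule block_nd[OF x(2) xnil that])
    moreover have "pev ([:0, 1:] ^ Suc (2 * K)) x = 0" using xnil unfolding pev_X_power .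
    ultimately show ?thesis using pev_dvd_0 by blast
  qed
  have fc: "fd (cyc x)" by (rule fd_mono[OF goodD(1)[OF X] subspace_cyc cX])
  have "\<exists>c\<in>cyc x. \<forall>z\<in>cyc x. b z c = b z y"
  proof (rule functional_rep[OF b_bil fc subspace_cyc])
    fix z assume z: "z \<in> cyc x" "\<forall>w\<in>cyc x. b z w = 0"
    then obtain q where q: "z = pev q x" by (metis cycE)
    show "z = 0" unfolding q by (rule nd) (use z(2) q in auto)
  qed (simp_all add: bD)
  then obtain g where g: "\<forall>z\<in>cyc x. b z (pev g x) = b z y" by (metis cycE)
  have ux: "(u ^^ n) (pev s x) \<in> cyc x" for n s
    unfolding upow_pev using cycI[of "[:0, 1:] ^ n * s" x] by (simp only: pev_mult)
  \<comment> \<open>The projection g(u)x of \<open>y\<close> to \<open>cyc x\<close> inherits the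
    height bound 2K - 1 from \<open>y\<close>, while \<open>x\<close> has height 2K + 1; so t^2
    divides g. Hence removing the projection keeps u^(K-1) y in \<open>E\<close> and does not alter
    its top value.\<close>
  have "pev ([:0, 1:] ^ (2 * K - 1) * g) x = 0"
  proof (rule nd)
    fix s
    have "b (pev ([:0, 1:] ^ (2 * K - 1) * g) x) (pev s x) = (- 1) ^ (2 * K - 1) * b (pev g x) ((u ^^ (2 * K - 1)) (pev s x))"
      unfolding pev_mult pev_X_power by (rule upow_adj)
    also have "b (pev g x) ((u ^^ (2 * K - 1)) (pev s x)) = b y ((u ^^ (2 * K - 1)) (pev s x))"
      using g ux[of "2 * K - 1" s] b_sym by metis
    also have "\<dots> = (- 1) ^ (2 * K - 1) * b ((u ^^ (2 * K - 1)) y) (pev s x)" by (rule upow_adj')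
    finally show "b (pev ([:0, 1:] ^ (2 * K - 1) * g) x) (pev s x) = 0" using y(2) by (simp add: bD)
  qed
  then have "[:0, 1:] ^ Suc (2 * K) dvd [:0, 1:] ^ (2 * K - 1) * g"
    using block_nd[OF x(2) xnil, of "[:0, 1:] ^ (2 * K - 1) * g"] by (simp add: bD)
  moreover have "Suc (2 * K) = (2 * K - 1) + 2" using K by simp
  ultimately have "[:0, 1:] ^ (2 * K - 1) * [:0, 1:] ^ 2 dvd [:0, 1:] ^ (2 * K - 1) * g" by (simp only: power_add)
  moreover have "[:0, 1 :: 'a:] ^ (2 * K - 1) \<noteq> 0" by simp
  ultimately have "[:0, 1:] ^ 2 dvd g" by (simp only: dvd_mult_cancel_left simp_thms)
  then obtain h where h: "g = [:0, 1:] ^ 2 * h" by (rule dvdE)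
  define w where "w = pev h x"
  have wX: "w \<in> X" unfolding w_def using st x(1) by blast
  have gw: "pev g x = (u ^^ 2) w" unfolding h w_def pev_mult pev_X_power ..
  let ?y1 = "y - (u ^^ 2) w"
  have y1X: "?y1 \<in> X" using y(1) su[OF wX] subspace_diff[OF sX] by blast
  have y1_nil: "(u ^^ (2 * K - 1)) ?y1 = 0"
    using y(2) nil'[OF wX, of "2 * K - 1 + 2"] K by (simp add: upow_diff upow_upow del: funpow.simps)
  have y1_E: "(u ^^ (K - 1)) ?y1 \<in> E"
  proof -
    have "(u ^^ (K - 1)) ((u ^^ 2) w) = (u ^^ K) (u w)"
      unfolding upow_upow using K by (cases K) (simp_all add: funpow_swap1 numeral_2_eq_2)
    moreover have "u w \<in> X" using su[OF wX, of 1] by simp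
    ultimately have "(u ^^ (K - 1)) ((u ^^ 2) w) \<in> E" using E(2) by auto
    then show ?thesis unfolding upow_diff using y(3) subspace_diff[OF E(1)] by blast
  qed
  have y1_perp: "b z ?y1 = 0" if "z \<in> cyc x" for z using g that unfolding gw by (simp add: bD)
  have y1_top: "b ?y1 ((u ^^ (2 * K - 2)) ?y1) = ?a"
  proof -
    have 1: "(u ^^ (2 * K - 2)) ((u ^^ 2) w) = (u ^^ (2 * K)) w" by (simp only: upow_upow K2)
    have 2: "b y ((u ^^ (2 * K)) w) = 0"
      using upow_zero_mono[OF y(2), of "2 * K"] upow_adj'[of y "2 * K" w] by (simp add: bD)
    have 3: "b ((u ^^ 2) w) ((u ^^ (2 * K - 2)) y) = 0"
    proof -
      have "b ((u ^^ 2) w) ((u ^^ (2 * K - 2)) y) = (- 1) ^ 2 * b w ((u ^^ (2 * K)) y)"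
        by (simp only: upow_adj upow_upow K2)
      then show ?thesis using upow_zero_mono[OF y(2), of "2 * K"] by (simp add: bD)
    qed
    have 4: "b ((u ^^ 2) w) ((u ^^ (2 * K)) w) = 0"
      unfolding upow_adj upow_upow using nil'[OF wX, of "2 + 2 * K"] by (simp add: bD del: funpow.simps)
    show ?thesis using ytop by (simp add: upow_diff bD 1 2 3 4)
  qed
  \<comment> \<open>Stage \<open>j\<close> asks for the right values at the even exponents 2i with i
    >= K - 1 - j; odd exponents take care of themselves by \<open>skew_odd\<close>.\<close>
  have "\<exists>y\<in>X. (u ^^ (2 * K - 1)) y = 0 \<and> (u ^^ (K - 1)) y \<in> E \<and> (\<forall>z\<in>cyc x. b z y = 0) \<and>
    b y ((u ^^ (2 * K - 2)) y) = ?a \<and> (\<forall>i\<ge>K - 1 - j. b y ((u ^^ (2 * i)) y) = b x ((u ^^ (2 * i + 2)) x))"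
    if "j \<le> K - 1" for j using that
  proof (induction j)
    case 0
    have "b ?y1 ((u ^^ (2 * i)) ?y1) = b x ((u ^^ (2 * i + 2)) x)" if "i \<ge> K - 1" for i
    proof (cases "i = K - 1")
      case True
      then have "2 * i = 2 * K - 2" "2 * i + 2 = 2 * K" using K by auto
      then show ?thesis using y1_top by simp
    next
      case False
      then have "i \<ge> K" using that by simp
      then have "(u ^^ (2 * i)) ?y1 = 0" "(u ^^ (2 * i + 2)) x = 0"
        using upow_zero_mono[OF y1_nil, of "2 * i"] nil'[OF x(1), of "2 * i + 2"] by auto
      then show ?thesis by (simp add: bD)
    qed
    then show ?case using y1X y1_nil y1_E y1_perp y1_top by (intro bexI[of _ ?y1]) auto
  next
    case (Suc j)
    then obtain z where z: "z \<in> X" "(u ^^ (2 * K - 1)) z = 0" "(u ^^ (K - 1)) z \<in> E" "\<forall>w\<in>cyc x. b w z = 0"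
      "b z ((u ^^ (2 * K - 2)) z) = ?a" "\<forall>i\<ge>K - 1 - j. b z ((u ^^ (2 * i)) z) = b x ((u ^^ (2 * i + 2)) x)"
      by auto
    define l where "l = Suc j"
    define i0 where "i0 = K - 1 - l"
    have il: "i0 + l = K - 1" "l \<ge> 1" using Suc.prems unfolding i0_def l_def by auto
    \<comment> \<open>Adding c u^(2l) z changes the value at index \<open>i0\<close> by 2c times the
      top value, and changes nothing at higher indices, where the exponents exceed the height. So a
      linear equation for c suffices, solvable because the top value and 2 are nonzero.\<close>
    define c where "c = (b x ((u ^^ (2 * i0 + 2)) x) - b z ((u ^^ (2 * i0)) z)) / (2 * ?a)"
    let ?z = "z + c *s (u ^^ (2 * l)) z"
    have zn: "(u ^^ n) z = 0" if "n \<ge> 2 * K - 1" for n using upow_zero_mono[OF z(2) that] .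
    have expand: "b ?z ((u ^^ (2 * i)) ?z) = b z ((u ^^ (2 * i)) z) + 2 * c * b z ((u ^^ (2 * i + 2 * l)) z)"
      if "i \<ge> i0" for i
    proof -
      have e1: "b ((u ^^ (2 * l)) z) v = b z ((u ^^ (2 * l)) v)" for v using upow_adj[of "2 * l" z v] by simp
      have z0: "(u ^^ (2 * l + (2 * i + 2 * l))) z = 0" by (rule zn) (use that il in linarith)
      have e3: "b ((u ^^ (2 * l)) z) ((u ^^ (2 * i)) z) = b z ((u ^^ (2 * i + 2 * l)) z)"
        unfolding e1 upow_upow by (simp only: add.commute)
      have e4: "b ((u ^^ (2 * l)) z) ((u ^^ (2 * i + 2 * l)) z) = 0"
        unfolding e1 upow_upow z0 by (simp add: bD)
      show ?thesis by (simp only: upow_add upow_scale upow_upow bD e3 e4) (simp add: algebra_simps)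
    qed
    have f1: "b ?z ((u ^^ (2 * i)) ?z) = b x ((u ^^ (2 * i + 2)) x)" if i: "i \<ge> i0" for i
    proof (cases "i = i0")
      case True
      have "2 * i0 + 2 * l = 2 * K - 2" using il by simp
      then show ?thesis using expand[of i0] z(5) x(2) two True by (simp add: c_def field_simps)
    next
      case False
      then have "(u ^^ (2 * i + 2 * l)) z = 0" using i il by (intro zn) linarith
      moreover have "i \<ge> K - 1 - j" using False i il Suc.prems unfolding i0_def l_def by linarith
      ultimately show ?thesis using expand[OF i] z(6) by (simp add: bD)
    qed
    have f2: "?z \<in> X" using z(1) su subspace_add[OF sX] subspace_scale[OF sX] by blast
    have f3: "(u ^^ (2 * K - 1)) ?z = 0" using z(2) zn[of "2 * K - 1 + 2 * l"] by (simp add: upow_add upow_scale upow_upow)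
    have f4: "(u ^^ (K - 1)) ?z \<in> E"
    proof -
      have "(u ^^ (K - 1)) ((u ^^ (2 * l)) z) = (u ^^ K) ((u ^^ (2 * l - 1)) z)"
        unfolding upow_upow using K il by (intro arg_cong[of _ _ "\<lambda>n. (u ^^ n) z"]) linarith
      then have "(u ^^ (K - 1)) ((u ^^ (2 * l)) z) \<in> E" using E(2) su[OF z(1)] by auto
      then show ?thesis unfolding upow_add upow_scale
        using z(3) subspace_add[OF E(1)] subspace_scale[OF E(1)] by blast
    qed
    have f5: "\<forall>w\<in>cyc x. b w ?z = 0"
    proof
      fix w assume w: "w \<in> cyc x"
      then obtain q where q: "w = pev q x" by (rule cycE)
      have "b w ((u ^^ (2 * l)) z) = b ((u ^^ (2 * l)) w) z" using upow_adj'[of w "2 * l" z] by simp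
      also have "\<dots> = 0" using z(4) ux unfolding q by blast
      finally show "b w ?z = 0" using z(4) w by (simp add: bD)
    qed
    have f6: "b ?z ((u ^^ (2 * K - 2)) ?z) = ?a"
    proof -
      have "2 * (K - 1) = 2 * K - 2" by simp
      moreover have "(u ^^ (2 * (K - 1) + 2 * l)) z = 0" using il by (intro zn) linarith
      ultimately show ?thesis using expand[of "K - 1"] il z(5) by (simp add: bD)
    qed
    have i0e: "K - 1 - Suc j = i0" by (simp add: i0_def l_def)
    show ?case unfolding i0e by (rule bexI[of _ ?z, OF _ f2]) (intro conjI allI impI f1 f3 f4 f5 f6)
  qed
  from this[of "K - 1"] obtain z where z: "z \<in> X" "(u ^^ (2 * K - 1)) z = 0" "(u ^^ (K - 1)) z \<in> E"
      "\<forall>w\<in>cyc x. b w z = 0" "\<forall>i. b z ((u ^^ (2 * i)) z) = b x ((u ^^ (2 * i + 2)) x)" by auto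
  have "b z ((u ^^ i) z) = b x ((u ^^ (i + 2)) x)" for i
  proof (cases "even i")
    case True
    then obtain k where "i = 2 * k" by (rule evenE)
    then show ?thesis using z(5) by simp
  next
    case False
    then show ?thesis using skew_odd[of i z] skew_odd[of "i + 2" x] by simp
  qed
  then show ?thesis using z by (intro bexI[of _ z]) auto
qed

text \<open>On the two blocks put v x = y and v y = -u^2 x. This is skew exactly because
  \<open>y\<close> carries the form of u x up to sign, that is b(y, u^i y) = b(x, u^(i+2)
  x).\<close>

lemma partner_split:
  assumes X: "good X" and K: "K \<ge> 1" and nil: "\<And>x. x \<in> X \<Longrightarrow> (u ^^ (2 * K + 1)) x = 0"
    and E: "subspace E" "(u ^^ K) ` X \<subseteq> E"
    and x: "x \<in> X" "b x ((u ^^ (2 * K)) x) \<noteq> 0"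
    and y: "y \<in> X" "(u ^^ (2 * K - 1)) y = 0" "(u ^^ (K - 1)) y \<in> E"
      "\<forall>z\<in>cyc x. b z y = 0" "\<forall>i. b y ((u ^^ i) y) = b x ((u ^^ (i + 2)) x)"
  shows "\<exists>C S. good C \<and> C \<subseteq> X \<and> pairable C \<and> x \<in> C \<and> subspace S \<and> S \<subseteq> C \<and> S \<subseteq> E \<and> S \<subseteq> (u ^^ (K - 1)) ` X \<and>
    (\<forall>z\<in>C. (\<forall>s\<in>S. b z s = 0) \<longrightarrow> z \<in> S) \<and> (\<forall>s\<in>S. \<forall>t\<in>S. b s t = 0)"
proof -
  note sX = goodD(2)[OF X] and uX = goodD(3)[OF X]
  note st = pev_stable[OF sX uX] and su = upow_in[OF sX uX]
  let ?a = "b x ((u ^^ (2 * K)) x)" and ?C = "ssum (cyc x) (cyc y)"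
  have xnil: "(u ^^ Suc (2 * K)) x = 0" using nil[OF x(1)] by simp
  have yS: "Suc (2 * K - 2) = 2 * K - 1" using K by simp
  have ynil: "(u ^^ Suc (2 * K - 2)) y = 0" unfolding yS by (rule y(2))
  have ya: "b y ((u ^^ (2 * K - 2)) y) = ?a" 
  proof -
    have "2 * K - 2 + 2 = 2 * K" using K by simp
    then show ?thesis using y(5)[rule_format, of "2 * K - 2"] by (simp only:)
  qed
  have ya0: "b y ((u ^^ (2 * K - 2)) y) \<noteq> 0" unfolding ya by (rule x(2))
  have orth: "b (pev q x) (pev r y) = 0" for q r
    using y(4) cycI[of "negp r * q" x] by (simp only: pev_adj' pev_mult)
  then have orth': "b (pev r y) (pev q x) = 0" for q r by (simp add: b_sym)
  have Xx: "pev ([:0, 1:] ^ Suc (2 * K)) x = 0" unfolding pev_X_power by (rule xnil)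
  have Xy: "pev ([:0, 1:] ^ Suc (2 * K - 2)) y = 0" unfolding pev_X_power by (rule ynil)
  have gC: "good ?C" and CX: "?C \<subseteq> X"
  proof -
    have nd: "pev q x + pev r y = 0" if z: "\<And>s. b (pev q x + pev r y) (pev s x) = 0"
        "\<And>s. b (pev q x + pev r y) (pev s y) = 0" for q r
    proof -
      have "[:0, 1:] ^ Suc (2 * K) dvd q"
        by (rule block_nd[OF x(2) xnil]) (use z(1) orth' in \<open>simp add: bD\<close>)
      moreover have "[:0, 1:] ^ Suc (2 * K - 2) dvd r"
        by (rule block_nd[OF ya0 ynil]) (use z(2) orth in \<open>simp add: bD\<close>)
      ultimately show ?thesis using pev_dvd_0[OF Xx] pev_dvd_0[OF Xy] by simp
    qed
    show "good ?C" "?C \<subseteq> X" by (rule good_cyc_sum[OF X x(1) y(1) nd]; blast)+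
  qed
  have byq: "b y (pev q y) = b x (pev q (u (u x)))" for q
  proof -
    have s: "b z (\<Sum>i\<in>A. g i) = (\<Sum>i\<in>A. b z (g i))" for z g and A :: "nat set"
      by (induction A rule: infinite_finite_induct) (auto simp: bD)
    have "(u ^^ i) (u (u x)) = (u ^^ (i + 2)) x" for i by (simp add: funpow_swap1 numeral_2_eq_2)
    then show ?thesis unfolding pev_def s using y(5) by (simp add: bD)
  qed
  have xC: "pev q x \<in> ?C" for q using ssum_upper(1)[OF subspace_cyc[of x] subspace_cyc[of y]] cycI[of q x] by blast
  have yC: "pev q y \<in> ?C" for q using ssum_upper(2)[OF subspace_cyc[of x] subspace_cyc[of y]] cycI[of q y] by blast
  have uux: "pev (- ([:0, 1:] * [:0, 1:])) z = - u (u z)" for z by (simp only: pev_minus pev_mult pev_X)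
  have nuu: "negp (- ([:0, 1:] * [:0, 1:])) = - ([:0, 1 :: 'a:] * [:0, 1:])" by (simp only: negp_simps negp_X) simp
  have pC: "pairable ?C"
  proof (rule pairable_gen[OF gC refl])
    show "y \<in> ?C" using yC[of 1] by simp
    show "- u (u x) \<in> ?C" using xC[of "- ([:0, 1:] * [:0, 1:])"] unfolding uux .
    show "b y (pev q x) = - b (pev q x) y" for q using orth'[of 1 q] orth[of q 1] by simp
    show "b (- u (u x)) (pev q y) = - b (pev q y) (- u (u x))" for q
      using orth[of "- ([:0, 1:] * [:0, 1:])" q] orth'[of q "- ([:0, 1:] * [:0, 1:])"] unfolding uux by simp
    show "b y (pev q y) = - b (pev q x) (- u (u x))" for q
    proof -
      have "b y (pev q y) = b (pev q y) y" by (rule b_sym)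
      also have "\<dots> = b y (pev (negp q) y)" by (rule pev_adj)
      also have "\<dots> = b x (pev (negp q) (u (u x)))" by (rule byq)
      also have "\<dots> = b (pev q x) (u (u x))" by (simp add: pev_adj)
      finally show ?thesis by (simp add: bD)
    qed
    show "\<exists>q r. y = pev q x + pev r y \<and> - u (u x) = pev (negp q) y + pev (negp r) (- u (u x))"
      by (rule exI[of _ 0], rule exI[of _ 1]) simp
    show "\<exists>q r. - u (u x) = pev q x + pev r y \<and> - u (u y) = pev (negp q) y + pev (negp r) (- u (u x))"
      by (rule exI[of _ "- ([:0, 1:] * [:0, 1:])"], rule exI[of _ 0])
        (simp only: uux nuu pev_0 negp_simps(1) add_0_right)
  qed
  \<comment> \<open>All vectors beyond the middle of either block, together with the diagonal of the
    two middle vectors u^K x and u^(K-1) y, whose norms are opposite. The diagonal stays in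
    \<open>E\<close> because both middle vectors do.\<close>
  define S where "S = {pev q ((u ^^ K) x) + pev r ((u ^^ (K - 1)) y) |q r. coeff q 0 = coeff r 0}"
  have SI: "pev q ((u ^^ K) x) + pev r ((u ^^ (K - 1)) y) \<in> S" if "coeff q 0 = coeff r 0" for q r
    using that unfolding S_def by blast
  have S_sub: "subspace S" unfolding subspace_def
  proof (intro conjI ballI allI)
    show "0 \<in> S" using SI[of 0 0] by simp
    fix s t c assume "s \<in> S"
    then obtain q r where 1: "s = pev q ((u ^^ K) x) + pev r ((u ^^ (K - 1)) y)" "coeff q 0 = coeff r 0"
      unfolding S_def by blast
    have "c *s s = pev ([:c:] * q) ((u ^^ K) x) + pev ([:c:] * r) ((u ^^ (K - 1)) y)"
      unfolding 1 by (simp only: pev_mult pev_const scale_right_distrib)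
    then show "c *s s \<in> S" using SI[of "[:c:] * q" "[:c:] * r"] 1(2) by simp
    assume "t \<in> S"
    then obtain q' r' where 2: "t = pev q' ((u ^^ K) x) + pev r' ((u ^^ (K - 1)) y)" "coeff q' 0 = coeff r' 0"
      unfolding S_def by blast
    have "s + t = pev (q + q') ((u ^^ K) x) + pev (r + r') ((u ^^ (K - 1)) y)"
      unfolding 1 2 by (simp add: pev_add)
    then show "s + t \<in> S" using SI[of "q + q'" "r + r'"] 1(2) 2(2) by simp
  qed
  have SC: "S \<subseteq> ?C"
  proof
    fix s assume "s \<in> S"
    then obtain q r where s: "s = pev q ((u ^^ K) x) + pev r ((u ^^ (K - 1)) y)" unfolding S_def by blast
    have "s = pev (q * [:0, 1:] ^ K) x + pev (r * [:0, 1:] ^ (K - 1)) y" unfolding s pev_mult pev_X_power ..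
    then show "s \<in> ?C" using ssum_mem[OF cycI cycI] by simp
  qed
  have K1: "(u ^^ K) z = (u ^^ (K - 1)) (u z)" for z using K by (cases K) (simp_all add: funpow_swap1)
  have SK: "S \<subseteq> (u ^^ (K - 1)) ` X"
  proof
    fix s assume "s \<in> S"
    then obtain q r where s: "s = pev q ((u ^^ K) x) + pev r ((u ^^ (K - 1)) y)" unfolding S_def by blast
    have "s = (u ^^ (K - 1)) (pev q (u x) + pev r y)"
      unfolding s K1 by (simp only: upow_add upow_pev_commute)
    moreover have "u x \<in> X" using su[OF x(1), of 1] by simp
    ultimately show "s \<in> (u ^^ (K - 1)) ` X" using st y(1) subspace_add[OF sX] by blast
  qed
  have SE: "S \<subseteq> E"
  proof
    fix s assume "s \<in> S"
    then obtain q r where s: "s = pev q ((u ^^ K) x) + pev r ((u ^^ (K - 1)) y)" unfolding S_def by blast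
    obtain a h where r: "r = pCons a h" by (cases r)
    have "s = (u ^^ K) (pev q x + pev h y) + a *s (u ^^ (K - 1)) y"
    proof -
      have "u (pev h ((u ^^ (K - 1)) y)) = (u ^^ K) (pev h y)"
      proof -
        have "u ((u ^^ (K - 1)) y) = (u ^^ K) y" using K by (cases K) simp_all
        then have "u (pev h ((u ^^ (K - 1)) y)) = pev h ((u ^^ K) y)" by (simp flip: pev_u)
        then show ?thesis by (simp only: upow_pev_commute)
      qed
      then show ?thesis unfolding s r by (simp add: pev_pCons upow_add upow_pev_commute)
    qed
    moreover have "pev q x + pev h y \<in> X" using st x(1) y(1) subspace_add[OF sX] by blast
    ultimately show "s \<in> E" using E y(3) subspace_add[OF E(1)] subspace_scale[OF E(1)] by auto
  qed
  have px: "b (pev q ((u ^^ K) x)) (pev r ((u ^^ K) x)) = (- 1) ^ K * (coeff q 0 * coeff r 0 * ?a)" for q r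
  proof -
    have "b (pev q ((u ^^ K) x)) (pev r ((u ^^ K) x)) = b ((u ^^ K) x) ((u ^^ K) (pev (negp q * r) x))"
      by (simp add: pev_adj pev_mult upow_pev_commute)
    also have "\<dots> = (- 1) ^ K * b x (pev (negp q * r) ((u ^^ (2 * K)) x))"
      unfolding upow_adj upow_upow by (simp add: mult_2 upow_pev_commute)
    also have "pev (negp q * r) ((u ^^ (2 * K)) x) = coeff (negp q * r) 0 *s (u ^^ (2 * K)) x"
      by (rule pev_zero_const[OF xnil])
    finally show ?thesis by (simp add: bD coeff_mult_0 coeff_negp)
  qed
  have py: "b (pev q ((u ^^ (K - 1)) y)) (pev r ((u ^^ (K - 1)) y)) = - ((- 1) ^ K * (coeff q 0 * coeff r 0 * ?a))" for q r
  proof -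
    have KK: "K - 1 + (K - 1) = 2 * K - 2" by simp
    have sgn: "(- 1 :: 'a) ^ K = - ((- 1) ^ (K - 1))" using K by (cases K) auto
    have "b (pev q ((u ^^ (K - 1)) y)) (pev r ((u ^^ (K - 1)) y)) = b ((u ^^ (K - 1)) y) ((u ^^ (K - 1)) (pev (negp q * r) y))"
      by (simp add: pev_adj pev_mult upow_pev_commute)
    also have "\<dots> = (- 1) ^ (K - 1) * b y (pev (negp q * r) ((u ^^ (2 * K - 2)) y))"
      unfolding upow_adj upow_upow KK by (simp add: upow_pev_commute)
    also have "pev (negp q * r) ((u ^^ (2 * K - 2)) y) = coeff (negp q * r) 0 *s (u ^^ (2 * K - 2)) y"
      by (rule pev_zero_const[OF ynil])
    finally show ?thesis unfolding sgn by (simp add: bD coeff_mult_0 coeff_negp ya)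
  qed
  have xpy: "b (pev q ((u ^^ K) x)) (pev r ((u ^^ (K - 1)) y)) = 0" "b (pev r ((u ^^ (K - 1)) y)) (pev q ((u ^^ K) x)) = 0" for q r
    using orth[of "q * [:0, 1:] ^ K" "r * [:0, 1:] ^ (K - 1)"] orth'[of "r * [:0, 1:] ^ (K - 1)" "q * [:0, 1:] ^ K"]
    by (simp_all only: pev_mult pev_X_power)
  have iso: "b s t = 0" if sS: "s \<in> S" and tS: "t \<in> S" for s t
  proof -
    obtain q r where 1: "s = pev q ((u ^^ K) x) + pev r ((u ^^ (K - 1)) y)" "coeff q 0 = coeff r 0"
      using sS unfolding S_def by blast
    obtain q' r' where 2: "t = pev q' ((u ^^ K) x) + pev r' ((u ^^ (K - 1)) y)" "coeff q' 0 = coeff r' 0"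
      using tS unfolding S_def by blast
    show ?thesis unfolding 1(1) 2(1) bD px py xpy using 1(2) 2(2) by simp
  qed
  have self: "z \<in> S" if z: "z \<in> ?C" "\<And>s. s \<in> S \<Longrightarrow> b z s = 0" for z
  proof -
    obtain q r where qr: "z = pev q x + pev r y" using z(1) unfolding ssum_def cyc_def by blast
    have q: "[:0, 1:] ^ K dvd q"
    proof -
      have "[:0, 1:] ^ Suc (2 * K) dvd [:0, 1:] ^ Suc K * q"
      proof (rule block_nd[OF x(2) xnil])
        fix s
        have "pev ([:0, 1:] * s) ((u ^^ K) x) + pev 0 ((u ^^ (K - 1)) y) \<in> S" by (rule SI) simp
        then have "b z (pev ([:0, 1:] * s) ((u ^^ K) x)) = 0" using z(2) by simp
        moreover have "pev ([:0, 1:] * s) ((u ^^ K) x) = (u ^^ Suc K) (pev s x)"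
          by (simp only: pev_mult pev_X funpow.simps o_apply upow_pev_commute)
        ultimately have "b (pev q x) ((u ^^ Suc K) (pev s x)) = 0"
          using orth'[of r "[:0, 1:] ^ Suc K * s"] unfolding qr by (simp only: pev_mult pev_X_power bD add_0_right)
        then show "b (pev ([:0, 1:] ^ Suc K * q) x) (pev s x) = 0"
          unfolding pev_mult pev_X_power upow_adj by simp
      qed
      moreover have "Suc (2 * K) = Suc K + K" by simp
      ultimately have "[:0, 1:] ^ Suc K * [:0, 1:] ^ K dvd [:0, 1:] ^ Suc K * q" by (simp only: power_add)
      moreover have "[:0, 1 :: 'a:] ^ Suc K \<noteq> 0" by simp
      ultimately show ?thesis by (simp only: dvd_mult_cancel_left simp_thms)
    qed
    have r: "[:0, 1:] ^ (K - 1) dvd r"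
    proof -
      have "[:0, 1:] ^ Suc (2 * K - 2) dvd [:0, 1:] ^ K * r"
      proof (rule block_nd[OF ya0 ynil])
        fix s
        have "pev 0 ((u ^^ K) x) + pev ([:0, 1:] * s) ((u ^^ (K - 1)) y) \<in> S" by (rule SI) simp
        then have "b z (pev ([:0, 1:] * s) ((u ^^ (K - 1)) y)) = 0" using z(2) by simp
        moreover have "pev ([:0, 1:] * s) ((u ^^ (K - 1)) y) = (u ^^ K) (pev s y)"
        proof -
          have "u ((u ^^ (K - 1)) w) = (u ^^ K) w" for w using K by (cases K) simp_all
          moreover have "pev ([:0, 1:] * s) ((u ^^ (K - 1)) y) = u (pev s ((u ^^ (K - 1)) y))"
            by (simp only: pev_mult pev_X)
          ultimately show ?thesis by (simp only: upow_pev_commute[of "K - 1" s y, symmetric])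
        qed
        ultimately have "b (pev r y) ((u ^^ K) (pev s y)) = 0"
          using orth[of q "[:0, 1:] ^ K * s"] unfolding qr by (simp only: pev_mult pev_X_power bD add_0_left)
        then show "b (pev ([:0, 1:] ^ K * r) y) (pev s y) = 0"
          unfolding pev_mult pev_X_power upow_adj by simp
      qed
      moreover have "Suc (2 * K - 2) = K + (K - 1)" using K by simp
      ultimately have "[:0, 1:] ^ K * [:0, 1:] ^ (K - 1) dvd [:0, 1:] ^ K * r" by (simp only: power_add)
      moreover have "[:0, 1 :: 'a:] ^ K \<noteq> 0" by simp
      ultimately show ?thesis by (simp only: dvd_mult_cancel_left simp_thms)
    qed
    obtain q1 where q1: "q = [:0, 1:] ^ K * q1" using q by (rule dvdE)
    obtain r1 where r1: "r = [:0, 1:] ^ (K - 1) * r1" using r by (rule dvdE)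
    have ze: "z = pev q1 ((u ^^ K) x) + pev r1 ((u ^^ (K - 1)) y)"
      unfolding qr q1 r1 pev_mult pev_X_power by (simp only: upow_pev_commute)
    \<comment> \<open>Orthogonality to the vectors beyond the middle has made \<open>z\<close> a
      combination from the middle on; the diagonal vector now forces equal coefficients
      there.\<close>
    have "pev 1 ((u ^^ K) x) + pev 1 ((u ^^ (K - 1)) y) \<in> S" by (rule SI) simp
    then have "b z (pev 1 ((u ^^ K) x) + pev 1 ((u ^^ (K - 1)) y)) = 0" by (rule z(2))
    then have "(- 1) ^ K * (coeff q1 0 * 1 * ?a) - (- 1) ^ K * (coeff r1 0 * 1 * ?a) = 0"
      unfolding ze bD px py xpy by simp
    then have "(- 1) ^ K * ((coeff q1 0 - coeff r1 0) * ?a) = 0" by (simp add: algebra_simps)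
    then have "coeff q1 0 = coeff r1 0" using x(2) by simp
    then show ?thesis unfolding ze by (rule SI)
  qed
  have "x \<in> ?C" using xC[of 1] by simp
  moreover have "\<forall>z\<in>?C. (\<forall>s\<in>S. b z s = 0) \<longrightarrow> z \<in> S" using self by blast
  moreover have "\<forall>s\<in>S. \<forall>t\<in>S. b s t = 0" using iso by blast
  ultimately show ?thesis by - (rule exI[of _ ?C], rule exI[of _ S], intro conjI gC CX pC S_sub SC SE SK)
qed

text \<open>The Lagrangian t^a \<open>cyc x\<close> + t^(n-a) \<open>cyc y\<close> with a = n div 2
  lies as deep in the images of u as possible. It is then inside Im u^(k+1), hence inside every
  admissible \<open>E\<close>, for all k with 2k + 1 < n.\<close>

lemma dual_pair_lagrangian:
  assumes X: "good X" "x \<in> X" "y \<in> X" and d: "dual_pair ([:0, 1:] ^ n) x y" and n: "n \<ge> 1"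
    and iso: "\<And>q. b x (pev q x) = 0" "\<And>q. b y (pev q y) = 0"
  shows "\<exists>S. subspace S \<and> S \<subseteq> ssum (cyc x) (cyc y) \<and> S \<subseteq> (u ^^ (n div 2)) ` X \<and>
    (\<forall>z\<in>ssum (cyc x) (cyc y). (\<forall>s\<in>S. b z s = 0) \<longrightarrow> z \<in> S) \<and> (\<forall>s\<in>S. \<forall>t\<in>S. b s t = 0)"
proof -
  note sX = goodD(2)[OF X(1)] and uX = goodD(3)[OF X(1)]
  note st = pev_stable[OF sX uX] and su = upow_in[OF sX uX]
  define a where "a = n div 2"
  define c where "c = n - a"
  have ac: "a + c = n" "a \<le> c" unfolding a_def c_def by auto
  let ?X = "[:0, 1 :: 'a:]"
  have Q: "negp (?X ^ n) = Polynomial.smult ((- 1) ^ degree (?X ^ n)) (?X ^ n)" "degree (?X ^ n) > 0"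
    using n by (simp_all add: degree_power_eq smult_power[symmetric])
  have xn: "(u ^^ n) x = 0" and yn: "(u ^^ n) y = 0" using dual_pairD(1,2)[OF d] unfolding pev_X_power by auto
  have xx: "b (pev q x) (pev r x) = 0" for q r using iso(1) by (simp add: pev_adj flip: pev_mult)
  have yy: "b (pev q y) (pev r y) = 0" for q r using iso(2) by (simp add: pev_adj flip: pev_mult)
  define S where "S = {pev (?X ^ a * q) x + pev (?X ^ c * r) y |q r. True}"
  have SI: "pev (?X ^ a * q) x + pev (?X ^ c * r) y \<in> S" for q r unfolding S_def by blast
  have S_sub: "subspace S" unfolding subspace_def
  proof (intro conjI ballI allI)
    show "0 \<in> S" using SI[of 0 0] by simp
    fix s t k assume "s \<in> S"
    then obtain q r where 1: "s = pev (?X ^ a * q) x + pev (?X ^ c * r) y" unfolding S_def by blast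
    have "k *s s = pev (?X ^ a * ([:k:] * q)) x + pev (?X ^ c * ([:k:] * r)) y"
      unfolding 1 by (simp only: pev_mult pev_const pev_scale_arg scale_right_distrib)
    then show "k *s s \<in> S" using SI[of "[:k:] * q" "[:k:] * r"] by (simp only:)
    assume "t \<in> S"
    then obtain q' r' where 2: "t = pev (?X ^ a * q') x + pev (?X ^ c * r') y" unfolding S_def by blast
    have "s + t = pev (?X ^ a * (q + q')) x + pev (?X ^ c * (r + r')) y"
      unfolding 1 2 by (simp only: distrib_left pev_add add_ac)
    then show "s + t \<in> S" using SI[of "q + q'" "r + r'"] by (simp only:)
  qed
  have SC: "S \<subseteq> ssum (cyc x) (cyc y)" unfolding S_def using ssum_mem[OF cycI cycI] by auto
  have SX: "S \<subseteq> (u ^^ a) ` X"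
  proof
    fix s assume "s \<in> S"
    then obtain q r where s: "s = pev (?X ^ a * q) x + pev (?X ^ c * r) y" unfolding S_def by blast
    have "?X ^ c = ?X ^ a * ?X ^ (c - a)" using ac(2) by (simp flip: power_add)
    then have "s = (u ^^ a) (pev q x + pev (?X ^ (c - a) * r) y)"
      unfolding s by (simp only: mult.assoc pev_mult[of "?X ^ a"] pev_X_power upow_add)
    then show "s \<in> (u ^^ a) ` X" using st X(2,3) subspace_add[OF sX] by blast
  qed
  have cross: "b (pev (?X ^ a * q) x) (pev (?X ^ c * r) y) = 0" for q r
  proof -
    have "b (pev (?X ^ a * q) x) (pev (?X ^ c * r) y) = (- 1) ^ a * b (pev q x) ((u ^^ a) ((u ^^ c) (pev r y)))"
      unfolding pev_mult pev_X_power by (rule upow_adj)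
    also have "(u ^^ a) ((u ^^ c) (pev r y)) = 0" unfolding upow_upow ac upow_pev_commute yn by simp
    finally show ?thesis by (simp add: bD)
  qed
  have iso': "b s t = 0" if sS: "s \<in> S" and tS: "t \<in> S" for s t
  proof -
    obtain q r where 1: "s = pev (?X ^ a * q) x + pev (?X ^ c * r) y" using sS unfolding S_def by blast
    obtain q' r' where 2: "t = pev (?X ^ a * q') x + pev (?X ^ c * r') y" using tS unfolding S_def by blast
    have "b (pev (?X ^ c * r) y) (pev (?X ^ a * q') x) = 0" using cross[of q' r] by (simp only: b_sym)
    then show ?thesis unfolding 1 2 bD xx yy cross by simp
  qed
  have self: "z \<in> S" if z: "z \<in> ssum (cyc x) (cyc y)" "\<And>s. s \<in> S \<Longrightarrow> b z s = 0" for z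
  proof -
    obtain q r where qr: "z = pev q x + pev r y" using z(1) unfolding ssum_def cyc_def by blast
    have "?X ^ n dvd ?X ^ c * q"
    proof (rule dual_nd(1)[OF Q d])
      fix s
      have "b z (pev (?X ^ c * s) y) = 0" using z(2)[OF SI[of 0 s]] by simp
      then have "b (pev q x) ((u ^^ c) (pev s y)) = 0"
        using yy[of r "?X ^ c * s"] unfolding qr by (simp only: bD add_0_right pev_mult pev_X_power)
      then show "b (pev (?X ^ c * q) x) (pev s y) = 0" unfolding pev_mult pev_X_power upow_adj by simp
    qed
    then have "?X ^ c * ?X ^ a dvd ?X ^ c * q" using ac by (simp only: power_add[symmetric] add.commute)
    moreover have "?X ^ c \<noteq> 0" by simp
    ultimately have q: "?X ^ a dvd q" by (simp only: dvd_mult_cancel_left simp_thms)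
    have "?X ^ n dvd ?X ^ a * r"
    proof (rule dual_nd(2)[OF Q d])
      fix s
      have "b z (pev (?X ^ a * s) x) = 0" using z(2)[OF SI[of s 0]] by simp
      then have "b (pev r y) ((u ^^ a) (pev s x)) = 0"
        using xx[of q "?X ^ a * s"] unfolding qr by (simp only: bD add_0_left pev_mult pev_X_power)
      then show "b (pev (?X ^ a * r) y) (pev s x) = 0" unfolding pev_mult pev_X_power upow_adj by simp
    qed
    then have "?X ^ a * ?X ^ c dvd ?X ^ a * r" using ac by (simp only: power_add[symmetric])
    moreover have "?X ^ a \<noteq> 0" by simp
    ultimately have r: "?X ^ c dvd r" by (simp only: dvd_mult_cancel_left simp_thms)
    obtain q1 where "q = ?X ^ a * q1" using q by (rule dvdE)
    moreover obtain r1 where "r = ?X ^ c * r1" using r by (rule dvdE)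
    ultimately show ?thesis unfolding qr using SI by (simp only:)
  qed
  have "\<forall>z\<in>ssum (cyc x) (cyc y). (\<forall>s\<in>S. b z s = 0) \<longrightarrow> z \<in> S" using self by blast
  moreover have "\<forall>s\<in>S. \<forall>t\<in>S. b s t = 0" using iso' by blast
  ultimately show ?thesis unfolding a_def[symmetric] by - (rule exI[of _ S], intro conjI S_sub SC SX)
qed

text \<open>Induction on dimension, with \<open>n\<close> the nilpotency index. An isotropic vector
  of top height yields a hyperbolic pair; without one, every vector of top height is anisotropic and
  needs a partner one level below. Only indices k with 2k + 1 < n impose anything on the
  complement.\<close>

lemma pairable_nilpotent:
  assumes "good X" "\<exists>n. \<forall>x\<in>X. (u ^^ n) x = 0" "\<And>k. condN X k"
  shows "pairable X" using assms
proof (induction "dim X" arbitrary: X rule: less_induct)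
  case less
  note X = less.prems(1)
  note sX = goodD(2)[OF X] and uX = goodD(3)[OF X]
  define n where "n = (LEAST n. \<forall>x\<in>X. (u ^^ n) x = 0)"
  have n: "\<forall>x\<in>X. (u ^^ n) x = 0" unfolding n_def using less.prems(2) by (rule LeastI_ex)
  have nmin: "\<exists>x\<in>X. (u ^^ m) x \<noteq> 0" if "m < n" for m
    using not_less_Least[of m "\<lambda>n. \<forall>x\<in>X. (u ^^ n) x = 0"] that unfolding n_def by blast
  show ?case
  proof (cases "n \<le> 1")
    case True
    have "u x = 0" if "x \<in> X" for x using upow_zero_mono[of n x 1] n that True by simp
    then show ?thesis by (rule pairable_trivial[OF sX])
  next
    case False
    then obtain x0 where x0: "x0 \<in> X" "(u ^^ (n - 1)) x0 \<noteq> 0" using nmin[of "n - 1"] by auto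
    \<comment> \<open>Besides the piece \<open>C\<close>, a Lagrangian \<open>S\<close> of it is
      recorded, independent of k, together with an admissible \<open>E\<close> containing it for
      each relevant k; this is what \<open>condN_split\<close> consumes.\<close>
    have "\<exists>C S w. good C \<and> C \<subseteq> X \<and> pairable C \<and> w \<in> C \<and> w \<noteq> 0 \<and> subspace S \<and> S \<subseteq> C \<and>
      (\<forall>z\<in>C. (\<forall>s\<in>S. b z s = 0) \<longrightarrow> z \<in> S) \<and> (\<forall>s\<in>S. \<forall>t\<in>S. b s t = 0) \<and>
      (\<forall>k. 2 * k + 1 < n \<longrightarrow> (\<exists>E L. subspace E \<and> subspace L \<and> (u ^^ Suc k) ` X \<subseteq> E \<and> E \<subseteq> (u ^^ k) ` X \<and>
         L = {x\<in>E. \<forall>y\<in>L. b x y = 0} \<and> S \<subseteq> E))"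
    proof (cases "\<exists>x\<in>X. (u ^^ (n - 1)) x \<noteq> 0 \<and> b x ((u ^^ (n - 1)) x) = 0")
      case True
      then obtain x where x: "x \<in> X" "(u ^^ (n - 1)) x \<noteq> 0" "b x ((u ^^ (n - 1)) x) = 0" by blast
      have n1: "n \<ge> 1" using False by simp
      have xn: "pev ([:0, 1:] ^ n) x = 0" using n x(1) unfolding pev_X_power by blast
      have h3: "pev ([:0, 1:] ^ (n - 1)) x \<noteq> pev ([:0, 1:] ^ n) z" if "z \<in> X" for z
        using n x(2) that unfolding pev_X_power by simp
      have top: "b x (pev ([:0, 1:] ^ (n - 1)) (pev q x)) = 0" for q
      proof -
        have "(u ^^ Suc (n - 1)) x = 0" using n x(1) n1 by simp
        then have "pev q ((u ^^ (n - 1)) x) = coeff q 0 *s (u ^^ (n - 1)) x" by (rule pev_zero_const)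
        then show ?thesis unfolding pev_X_power upow_pev_commute using x(3) by (simp add: bD)
      qed
      obtain x' y where xy: "x' \<in> X" "y \<in> X" "pev ([:0, 1:] ^ (n - 1)) x' = pev ([:0, 1:] ^ (n - 1)) x"
          "dual_pair ([:0, 1:] ^ n) x' y" "\<forall>q. b x' (pev q x') = 0" "\<forall>q. b y (pev q y) = 0"
          "good (ssum (cyc x') (cyc y))" "ssum (cyc x') (cyc y) \<subseteq> X" "pairable (ssum (cyc x') (cyc y))"
        using split_hyperbolic[OF X X_facts n1 x(1) xn h3 top] by blast
      let ?C = "ssum (cyc x') (cyc y)"
      obtain S where S: "subspace S" "S \<subseteq> ?C" "S \<subseteq> (u ^^ (n div 2)) ` X"
          "\<forall>z\<in>?C. (\<forall>s\<in>S. b z s = 0) \<longrightarrow> z \<in> S" "\<forall>s\<in>S. \<forall>t\<in>S. b s t = 0"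
        using dual_pair_lagrangian[OF X xy(1,2,4) n1] xy(5,6) by blast
      have w: "x' \<in> ?C" "x' \<noteq> 0"
      proof -
        show "x' \<in> ?C" using ssum_upper(1)[OF subspace_cyc[of x'] subspace_cyc[of y]] cyc_self[of x'] by blast
        show "x' \<noteq> 0" using xy(3) x(2) unfolding pev_X_power by auto
      qed
      have EL: "\<exists>E L. subspace E \<and> subspace L \<and> (u ^^ Suc k) ` X \<subseteq> E \<and> E \<subseteq> (u ^^ k) ` X \<and>
         L = {x\<in>E. \<forall>y\<in>L. b x y = 0} \<and> S \<subseteq> E" if k: "2 * k + 1 < n" for k
      proof -
        obtain E L where E: "subspace E" "subspace L" "(u ^^ Suc k) ` X \<subseteq> E" "E \<subseteq> (u ^^ k) ` X"
          "L = {x\<in>E. \<forall>y\<in>L. b x y = 0}" using less.prems(3)[of k] unfolding condN_def by blast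
        have "Suc k \<le> n div 2" using k by linarith
        then have "S \<subseteq> E" using S(3) E(3) upow_image_antimono[OF sX uX, of "Suc k" "n div 2"] by blast
        then show ?thesis by - (rule exI[of _ E], rule exI[of _ L], intro conjI E)
      qed
      show ?thesis
        by (rule exI[of _ ?C], rule exI[of _ S], rule exI[of _ x'], intro conjI xy w S allI impI EL)
    next
      case no: False
      have "odd n"
      proof (rule ccontr)
        assume "\<not> odd n"
        then have "odd (n - 1)" using False by simp
        then show False using no x0 skew_odd[of "n - 1" x0] by blast
      qed
      then obtain K where K: "n = 2 * K + 1" by (rule oddE)
      have K1: "K \<ge> 1" using K False by simp
      have nil: "(u ^^ (2 * K + 1)) x = 0" if "x \<in> X" for x using n that K by blast
      have anis: "(u ^^ (2 * K)) x = 0" if "x \<in> X" "b ((u ^^ K) x) ((u ^^ K) x) = 0" for x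
      proof -
        have "b x ((u ^^ (2 * K)) x) = 0" using that(2) unfolding upow_adj upow_upow by (simp add: mult_2)
        then show ?thesis using no that(1) K by auto
      qed
      have x0': "b x0 ((u ^^ (2 * K)) x0) \<noteq> 0" using no x0 K by auto
      obtain E L where E: "subspace E" "subspace L" "(u ^^ K) ` X \<subseteq> E" "E \<subseteq> (u ^^ (K - 1)) ` X"
          "L = {x\<in>E. \<forall>y\<in>L. b x y = 0}"
      proof -
        have "Suc (K - 1) = K" using K1 by simp
        then show thesis using less.prems(3)[of "K - 1"] that unfolding condN_def by auto
      qed
      obtain y0 where y0: "y0 \<in> X" "(u ^^ (2 * K - 1)) y0 = 0" "(u ^^ (K - 1)) y0 \<in> E"
          "b ((u ^^ (K - 1)) y0) ((u ^^ (K - 1)) y0) = - b ((u ^^ K) x0) ((u ^^ K) x0)"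
        using partner_exists[OF X K1 nil anis E x0(1)] by blast
      obtain y where y: "y \<in> X" "(u ^^ (2 * K - 1)) y = 0" "(u ^^ (K - 1)) y \<in> E" "\<forall>z\<in>cyc x0. b z y = 0"
          "\<forall>i. b y ((u ^^ i) y) = b x0 ((u ^^ (i + 2)) x0)"
        using exact_partner_exists[OF X K1 nil E(1,3) x0(1) x0' y0] by blast
      obtain C S where C: "good C" "C \<subseteq> X" "pairable C" "x0 \<in> C" and S: "subspace S" "S \<subseteq> C" "S \<subseteq> E"
          "S \<subseteq> (u ^^ (K - 1)) ` X" "\<forall>z\<in>C. (\<forall>s\<in>S. b z s = 0) \<longrightarrow> z \<in> S" "\<forall>s\<in>S. \<forall>t\<in>S. b s t = 0"
        using partner_split[OF X K1 nil E(1,3) x0(1) x0' y] by blast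
      have x00: "x0 \<noteq> 0" using x0(2) by auto
      \<comment> \<open>At k = K - 1 the very space \<open>E\<close> that produced the partner must
        be kept, since the diagonal of \<open>S\<close> need not lie in Im u^K. For smaller k,
        \<open>S\<close> lies in Im u^(k+1) and any admissible space will do.\<close>
      have EL: "\<exists>E L. subspace E \<and> subspace L \<and> (u ^^ Suc k) ` X \<subseteq> E \<and> E \<subseteq> (u ^^ k) ` X \<and>
         L = {x\<in>E. \<forall>y\<in>L. b x y = 0} \<and> S \<subseteq> E" if k: "2 * k + 1 < n" for k
      proof (cases "k = K - 1")
        case True
        then have "Suc k = K" using K1 by simp
        then show ?thesis using True by - (rule exI[of _ E], rule exI[of _ L], simp only:, intro conjI E S)
      next
        case False
        obtain E L where E: "subspace E" "subspace L" "(u ^^ Suc k) ` X \<subseteq> E" "E \<subseteq> (u ^^ k) ` X"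
          "L = {x\<in>E. \<forall>y\<in>L. b x y = 0}" using less.prems(3)[of k] unfolding condN_def by blast
        have "Suc k \<le> K - 1" using k False K by linarith
        then have "S \<subseteq> E" using S(4) E(3) upow_image_antimono[OF sX uX, of "Suc k" "K - 1"] by blast
        then show ?thesis by - (rule exI[of _ E], rule exI[of _ L], intro conjI E)
      qed
      show ?thesis
        by (rule exI[of _ C], rule exI[of _ S], rule exI[of _ x0], intro conjI C x00 S allI impI EL)
    qed
    then obtain C S w where C: "good C" "C \<subseteq> X" "pairable C" "w \<in> C" "w \<noteq> 0" and S: "subspace S" "S \<subseteq> C"
      "\<forall>z\<in>C. (\<forall>s\<in>S. b z s = 0) \<longrightarrow> z \<in> S" "\<forall>s\<in>S. \<forall>t\<in>S. b s t = 0"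
      and EL: "\<forall>k. 2 * k + 1 < n \<longrightarrow> (\<exists>E L. subspace E \<and> subspace L \<and> (u ^^ Suc k) ` X \<subseteq> E \<and> E \<subseteq> (u ^^ k) ` X \<and>
         L = {x\<in>E. \<forall>y\<in>L. b x y = 0} \<and> S \<subseteq> E)" by (elim exE conjE) (rule that)
    note gD = split_good(1)[OF X C(1,2)]
    have DX: "x \<in> X" if "x \<in> operp X C" for x using that by (simp add: operp_def)
    have "pairable (operp X C)"
    proof (rule less.hyps[OF split_dim_less[OF X C(1,2,4,5)] gD])
      show "\<exists>n. \<forall>x\<in>operp X C. (u ^^ n) x = 0" using n DX by blast
      fix k
      show "condN (operp X C) k"
      proof (cases "2 * k + 1 < n")
        case True
        obtain E L where E: "subspace E" "subspace L" "(u ^^ Suc k) ` X \<subseteq> E" "E \<subseteq> (u ^^ k) ` X"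
          "L = {x\<in>E. \<forall>y\<in>L. b x y = 0}" "S \<subseteq> E"
          using EL[rule_format, OF True] by (elim exE conjE) (rule that)
        have S3: "z \<in> S" if "z \<in> C" "\<And>s. s \<in> S \<Longrightarrow> b z s = 0" for z using S(3) that by blast
        have S4: "b s t = 0" if "s \<in> S" "t \<in> S" for s t using S(4) that by blast
        show ?thesis using condN_split[OF X C(1,2) S(1,2) S3 S4 E] .
      next
        case False
        then show ?thesis
          using upow_zero_mono[of n] n DX by (intro condN_trivial[OF goodD(2,3)[OF gD]]) (meson not_less)
      qed
    qed
    then show ?thesis by (rule split_pairable[OF X C(1-3)])
  qed
qed

section \<open>Fitting decomposition and the criterion for a non-degenerate stable subspace\<close>

definition nilp :: "'b set \<Rightarrow> 'b set" where
  "nilp X = {x\<in>X. \<exists>n. (u ^^ n) x = 0}"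

text \<open>The kernels of the powers of u stabilize; from that exponent on the kernel is the
  Fitting null component and meets the image trivially.\<close>

lemma nilp_exponent:
  assumes X: "fd X" "ustable X"
  obtains N where "nilp X = ker X ([:0, 1:] ^ N)"
    "\<And>z. z \<in> X \<Longrightarrow> (u ^^ N) ((u ^^ N) z) = 0 \<Longrightarrow> (u ^^ N) z = 0"
proof -
  have s: "subspace X" using X fd_subspace by blast
  have mono: "{x\<in>X. (u ^^ i) x = 0} \<subseteq> {x\<in>X. (u ^^ j) x = 0}" if "i \<le> j" for i j
    using upow_zero_mono that by blast
  have sub: "subspace {x\<in>X. (u ^^ i) x = 0}" for i using subspace_ker_pev[OF s, of "[:0, 1:] ^ i"] by (simp only: pev_X_power)
  let ?P = "\<lambda>S. \<exists>i. S = {x\<in>X. (u ^^ i) x = 0}"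
  have "\<exists>M. ?P M \<and> (\<forall>M'. ?P M' \<longrightarrow> M \<subseteq> M' \<longrightarrow> M' = M) \<and> (\<forall>M'. ?P M' \<longrightarrow> dim M' \<le> dim M)"
  proof (rule max_dim_exists[OF X(1)])
    show "?P {x\<in>X. (u ^^ 0) x = 0}" by blast
    show "subspace S \<and> S \<subseteq> X" if "?P S" for S using that sub by auto
  qed
  then obtain N where N: "\<And>M'. ?P M' \<Longrightarrow> {x\<in>X. (u ^^ N) x = 0} \<subseteq> M' \<Longrightarrow> M' = {x\<in>X. (u ^^ N) x = 0}" by blast
  have st: "(u ^^ N) x = 0" if "x \<in> X" "(u ^^ m) x = 0" for x m
  proof -
    have "{x\<in>X. (u ^^ (max N m)) x = 0} = {x\<in>X. (u ^^ N) x = 0}" 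
    proof (rule N)
      show "\<exists>i. {x\<in>X. (u ^^ (max N m)) x = 0} = {x\<in>X. (u ^^ i) x = 0}" by (rule exI) (rule refl)
      show "{x\<in>X. (u ^^ N) x = 0} \<subseteq> {x\<in>X. (u ^^ (max N m)) x = 0}" by (rule mono) simp
    qed
    moreover have "(u ^^ (max N m)) x = 0" using upow_zero_mono[OF that(2)] by simp
    ultimately show ?thesis using that(1) by blast
  qed
  show thesis
  proof (rule that[of N])
    show "nilp X = ker X ([:0, 1:] ^ N)" unfolding nilp_def ker_def pev_X_power using st by blast
    show "(u ^^ N) z = 0" if "z \<in> X" "(u ^^ N) ((u ^^ N) z) = 0" for z
      using st[OF that(1), of "N + N"] that(2) by (simp add: upow_upow)
  qed
qed

text \<open>The orthogonal of Ker u^N is Im u^N, since u^N is its own adjoint up to sign, and at the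
  stable exponent the two meet in 0.\<close>

lemma good_nilp:
  assumes X: "good X" shows "good (nilp X)"
proof -
  obtain N where N: "nilp X = ker X ([:0, 1:] ^ N)"
    "\<And>z. z \<in> X \<Longrightarrow> (u ^^ N) ((u ^^ N) z) = 0 \<Longrightarrow> (u ^^ N) z = 0"
    using nilp_exponent[OF goodD(1,3)[OF X]] by blast
  show ?thesis unfolding good_def N(1)
  proof (intro conjI ballI impI)
    show "fd (ker X ([:0, 1:] ^ N))" "ustable (ker X ([:0, 1:] ^ N))"
      by (rule fd_ker[OF goodD(1)[OF X]]) (rule ustable_ker[OF goodD(3)[OF X]])
    fix x assume x: "x \<in> ker X ([:0, 1:] ^ N)" "\<forall>y\<in>ker X ([:0, 1:] ^ N). b x y = 0"
    have h: "b x y = 0" if "y \<in> X" "pev ([:0, 1:] ^ N) y = 0" for y using x(2) that by (simp add: ker_def)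
    obtain w where w: "w \<in> X" "x = pev (negp ([:0, 1:] ^ N)) w" using perp_ker[OF X kerD(1)[OF x(1)] h] by blast
    have "negp ([:0, 1 :: 'a:] ^ N) = [:(- 1) ^ N:] * [:0, 1:] ^ N"
    proof -
      have "negp [:0, 1 :: 'a:] = Polynomial.smult (- 1) [:0, 1:]" by simp
      then show ?thesis unfolding negp_power by (simp only: smult_power) simp
    qed
    then have e: "x = (u ^^ N) ((- 1) ^ N *s w)"
      using w(2) by (simp only: pev_mult pev_const pev_X_power upow_scale)
    have "(u ^^ N) x = 0" using kerD(2)[OF x(1)] by (simp only: pev_X_power)
    then show "x = 0" using N(2)[OF subspace_scale[OF goodD(2)[OF X] w(1)]] e by metis
  qed
qed

text \<open>For necessity v is restricted to the null component. For sufficiency that component is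
  made pairable first: it then satisfies (i) and (ii) by necessity, so these cancel to its
  orthogonal, on which u is injective.\<close>

theorem pairable_iff:
  assumes X: "good X"
  shows "pairable X \<longleftrightarrow> (\<forall>p\<in>Irr0. \<forall>k\<ge>1. condI X p k) \<and>
    (\<forall>p\<in>Irr - (Irr0 \<union> {[:0, 1:]}). \<forall>k\<ge>1. condII X p k) \<and> (\<forall>k. condN (nilp X) k)"
proof
  have I: "condI Y p k" if "good Y" "pairable Y" "p \<in> Irr0" for Y p k
  proof -
    have "p \<noteq> [:0, 1:]" using that(3) irr0_not_X[OF two] by blast
    moreover have "p \<in> Irr" using that(3) by (simp add: Irr0_def)
    ultimately show ?thesis using pairable_conds(1)[OF that(1,2) irr0_negp[OF that(3)] irr_coeff0] by blast
  qed
  have II: "condII Y p k" if "good Y" "pairable Y" "p \<in> Irr - (Irr0 \<union> {[:0, 1:]})" "k \<ge> 1" for Y p k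
    using pairable_conds(2)[OF that(1,2) _ irr_coeff0 irr_degree that(4)] that(3) by (auto simp: Irr_def)
  obtain N where N: "nilp X = ker X ([:0, 1:] ^ N)" by (rule nilp_exponent[OF goodD(1,3)[OF X]])
  have CX: "nilp X \<subseteq> X" by (auto simp: nilp_def)
  note gC = good_nilp[OF X]
  {
    assume p: "pairable X"
    have "negp ([:0, 1 :: 'a:] ^ N) = [:0, 1:] ^ N \<or> negp ([:0, 1 :: 'a:] ^ N) = - ([:0, 1:] ^ N)"
      unfolding negp_power negp_X by (cases "even N") (simp_all only: power_minus_even power_minus_odd simp_thms)
    then have "pairable (nilp X)" unfolding N by (rule pairable_conds(4)[OF X p])
    then have "condN (nilp X) k" for k using pairable_conds(3)[OF gC] by blast
    then show "(\<forall>p\<in>Irr0. \<forall>k\<ge>1. condI X p k) \<and>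
      (\<forall>p\<in>Irr - (Irr0 \<union> {[:0, 1:]}). \<forall>k\<ge>1. condII X p k) \<and> (\<forall>k. condN (nilp X) k)"
      using I[OF X p] II[OF X p] by blast
  }
  {
    assume c: "(\<forall>p\<in>Irr0. \<forall>k\<ge>1. condI X p k) \<and>
      (\<forall>p\<in>Irr - (Irr0 \<union> {[:0, 1:]}). \<forall>k\<ge>1. condII X p k) \<and> (\<forall>k. condN (nilp X) k)"
    have "\<exists>n. \<forall>x\<in>nilp X. (u ^^ n) x = 0" unfolding N ker_def pev_X_power by blast
    then have pC: "pairable (nilp X)" using pairable_nilpotent[OF gC] c by blast
    let ?D = "operp X (nilp X)"
    note gD = split_good(1)[OF X gC CX]
    have "pairable ?D"
    proof (rule pairable_invertible[OF gD])
      fix x assume x: "x \<in> ?D" "u x = 0"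
      have "x \<in> nilp X" unfolding nilp_def using x operpD(3)[OF x(1)] by (auto intro: exI[of _ 1])
      then show "x = 0" using x(1) split_good(3)[OF X gC CX] by blast
    next
      show "\<forall>p\<in>Irr0. \<forall>k\<ge>1. condI ?D p k"
        using c I[OF gC pC] condI_cancel[OF X gC CX irr0_negp] by blast
      show "\<forall>p\<in>Irr - (Irr0 \<union> {[:0, 1:]}). \<forall>k\<ge>1. condII ?D p k"
        using c II[OF gC pC] condII_cancel[OF X gC CX] by blast
    qed
    then show "pairable X" by (rule split_pairable[OF X gC CX pC])
  }
qed

end

section \<open>Vector spaces presented as quotients\<close>

lemma (in abelian_group) a_lcancel:
  assumes "x \<oplus> y = x \<oplus> z" "x \<in> carrier G" "y \<in> carrier G" "z \<in> carrier G" shows "y = z"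
  using r_neg1[OF assms(2,3)] r_neg1[OF assms(2,4)] unfolding assms(1) by (rule trans[OF sym])

lemma (in vectorspace) span_insert_eq:
  assumes A: "A \<subseteq> carrier V" and a: "a \<in> carrier V"
  shows "span (A \<union> {a}) = {s \<odot>\<^bsub>V\<^esub> a \<oplus>\<^bsub>V\<^esub> w |s w. s \<in> carrier K \<and> w \<in> span A}" (is "_ = ?N")
proof -
  have 1: "span {a} = {s \<odot>\<^bsub>V\<^esub> a |s. s \<in> carrier K}"
  proof (intro equalityI subsetI)
    fix x assume "x \<in> {s \<odot>\<^bsub>V\<^esub> a |s. s \<in> carrier K}"
    then obtain s where "s \<in> carrier K" "x = s \<odot>\<^bsub>V\<^esub> a" by blast
    then have "x = lincomb (\<lambda>_. s) {a}" using a by (simp add: lincomb_def)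
    then show "x \<in> span {a}" using \<open>s \<in> carrier K\<close> a by (auto simp: finite_span)
  qed (use a in \<open>auto simp: finite_span lincomb_def\<close>)
  have 2: "span (A \<union> {a}) = submodule_sum (span A) (span {a})"
    using a by (intro span_union_is_sum[OF A]) simp
  have "w \<oplus>\<^bsub>V\<^esub> s \<odot>\<^bsub>V\<^esub> a = s \<odot>\<^bsub>V\<^esub> a \<oplus>\<^bsub>V\<^esub> w"
    if "w \<in> span A" "s \<in> carrier K" for w s
    using that a span_is_subset2[OF A] by (intro M.a_comm) auto
  then show ?thesis unfolding 2 submodule_sum_def 1 by (force simp: image_iff)
qed

text \<open>A vector space \<open>X\<close> presented as a quotient modulo \<open>D\<close>, where
  \<open>act\<close> represents the scalar action only up to \<open>D\<close>.\<close>

locale presentation = lin_space scale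
  for scale :: "'a::field \<Rightarrow> 'b::ab_group_add \<Rightarrow> 'b"  (infixr \<open>*s\<close> 75) +
  fixes L :: "('k, 'm) ring_scheme" and X :: "('k, 'w, 'n) module_scheme"
    and K0 D :: "'b set" and cl :: "'b \<Rightarrow> 'w" and act :: "'k \<Rightarrow> 'b \<Rightarrow> 'b" and d :: nat
  assumes fieldL: "field L"
    and fdK: "fd K0"
    and d0: "d > 0"
    and carr: "carrier X = cl ` K0"
    and cl_add: "x \<in> K0 \<Longrightarrow> y \<in> K0 \<Longrightarrow> cl (x + y) = cl x \<oplus>\<^bsub>X\<^esub> cl y"
    and cl0: "\<zero>\<^bsub>X\<^esub> = cl 0"
    and cl_D: "D = {x\<in>K0. cl x = \<zero>\<^bsub>X\<^esub>}"
    and actK: "s \<in> carrier L \<Longrightarrow> x \<in> K0 \<Longrightarrow> act s x \<in> K0"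
    and cl_act: "s \<in> carrier L \<Longrightarrow> x \<in> K0 \<Longrightarrow> s \<odot>\<^bsub>X\<^esub> cl x = cl (act s x)"
    and act_add: "s \<in> carrier L \<Longrightarrow> x \<in> K0 \<Longrightarrow> y \<in> K0 \<Longrightarrow> act s (x + y) = act s x + act s y"
    and add_act: "s \<in> carrier L \<Longrightarrow> t \<in> carrier L \<Longrightarrow> x \<in> K0 \<Longrightarrow>
      cl (act (s \<oplus>\<^bsub>L\<^esub> t) x) = cl (act s x + act t x)"
    and mult_act: "s \<in> carrier L \<Longrightarrow> t \<in> carrier L \<Longrightarrow> x \<in> K0 \<Longrightarrow>
      cl (act (s \<otimes>\<^bsub>L\<^esub> t) x) = cl (act s (act t x))"
    and one_act: "x \<in> K0 \<Longrightarrow> cl (act \<one>\<^bsub>L\<^esub> x) = cl x"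
    and scal: "\<exists>s\<in>carrier L. \<forall>x\<in>K0. cl (c *s x) = cl (act s x)"
    and step: "subspace P \<Longrightarrow> D \<subseteq> P \<Longrightarrow> P \<subseteq> K0 \<Longrightarrow>
      (\<And>s y. s \<in> carrier L \<Longrightarrow> y \<in> P \<Longrightarrow> act s y \<in> P) \<Longrightarrow> x \<in> K0 \<Longrightarrow> x \<notin> P \<Longrightarrow>
      dim {act s x + y |s y. s \<in> carrier L \<and> y \<in> P} = dim P + d"
begin

lemma subK: "subspace K0" by (rule fd_subspace[OF fdK])

lemma vsX: "vectorspace L X"
proof (rule vs_criteria[OF fieldL])
  have K0: "0 \<in> K0" "\<And>x y. x \<in> K0 \<Longrightarrow> y \<in> K0 \<Longrightarrow> x + y \<in> K0" "\<And>x. x \<in> K0 \<Longrightarrow> - x \<in> K0"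
    using subK by (auto simp: subspace_0 subspace_add subspace_neg)
  interpret L: field L by (rule fieldL)
  show "\<zero>\<^bsub>X\<^esub> \<in> carrier X" using K0 by (simp add: carr cl0)
  show "\<forall>v w. v \<in> carrier X \<and> w \<in> carrier X \<longrightarrow> v \<oplus>\<^bsub>X\<^esub> w \<in> carrier X"
    by (auto simp: carr cl_add[symmetric] K0)
  show "\<forall>v\<in>carrier X. \<exists>neg_v\<in>carrier X. v \<oplus>\<^bsub>X\<^esub> neg_v = \<zero>\<^bsub>X\<^esub>"
  proof
    fix v assume "v \<in> carrier X"
    then obtain x where x: "x \<in> K0" "v = cl x" by (auto simp: carr)
    then have "v \<oplus>\<^bsub>X\<^esub> cl (- x) = \<zero>\<^bsub>X\<^esub>" using K0 by (simp add: cl_add[symmetric] cl0)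
    then show "\<exists>neg_v\<in>carrier X. v \<oplus>\<^bsub>X\<^esub> neg_v = \<zero>\<^bsub>X\<^esub>" using x K0 by (auto simp: carr)
  qed
  show "\<forall>c v. c \<in> carrier L \<and> v \<in> carrier X \<longrightarrow> c \<odot>\<^bsub>X\<^esub> v \<in> carrier X"
    by (auto simp: carr cl_act actK)
  show "\<forall>v w. v \<in> carrier X \<and> w \<in> carrier X \<longrightarrow> v \<oplus>\<^bsub>X\<^esub> w = w \<oplus>\<^bsub>X\<^esub> v"
    by (auto simp: carr cl_add[symmetric] K0 add.commute)
  show "\<forall>v w x. v \<in> carrier X \<and> w \<in> carrier X \<and> x \<in> carrier X \<longrightarrow>
    v \<oplus>\<^bsub>X\<^esub> w \<oplus>\<^bsub>X\<^esub> x = v \<oplus>\<^bsub>X\<^esub> (w \<oplus>\<^bsub>X\<^esub> x)"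
    by (auto simp: carr cl_add[symmetric] K0 add.assoc)
  show "\<forall>v\<in>carrier X. v \<oplus>\<^bsub>X\<^esub> \<zero>\<^bsub>X\<^esub> = v" by (auto simp: carr cl0 cl_add[symmetric] K0)
  show "\<forall>a b v. a \<in> carrier L \<and> b \<in> carrier L \<and> v \<in> carrier X \<longrightarrow>
    (a \<otimes>\<^bsub>L\<^esub> b) \<odot>\<^bsub>X\<^esub> v = a \<odot>\<^bsub>X\<^esub> (b \<odot>\<^bsub>X\<^esub> v)"
    by (auto simp: carr cl_act actK mult_act)
  show "\<forall>v\<in>carrier X. \<one>\<^bsub>L\<^esub> \<odot>\<^bsub>X\<^esub> v = v" by (auto simp: carr cl_act one_act)
  show "\<forall>a b v. a \<in> carrier L \<and> b \<in> carrier L \<and> v \<in> carrier X \<longrightarrow>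
    (a \<oplus>\<^bsub>L\<^esub> b) \<odot>\<^bsub>X\<^esub> v = a \<odot>\<^bsub>X\<^esub> v \<oplus>\<^bsub>X\<^esub> b \<odot>\<^bsub>X\<^esub> v"
    by (auto simp: carr cl_act actK cl_add[symmetric] add_act)
  show "\<forall>a v w. a \<in> carrier L \<and> v \<in> carrier X \<and> w \<in> carrier X \<longrightarrow>
    a \<odot>\<^bsub>X\<^esub> (v \<oplus>\<^bsub>X\<^esub> w) = a \<odot>\<^bsub>X\<^esub> v \<oplus>\<^bsub>X\<^esub> a \<odot>\<^bsub>X\<^esub> w"
    by (auto simp: carr cl_add[symmetric] K0 cl_act actK act_add)
qed

sublocale X: vectorspace L X by (rule vsX)

definition pre :: "'w set \<Rightarrow> 'b set" where "pre W = {x\<in>K0. cl x \<in> W}"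

lemma pre_submodule:
  assumes "submodule L W X"
  shows "subspace (pre W)" "D \<subseteq> pre W" "pre W \<subseteq> K0"
    "\<And>s y. s \<in> carrier L \<Longrightarrow> y \<in> pre W \<Longrightarrow> act s y \<in> pre W" "cl ` pre W = W"
proof -
  have W: "\<zero>\<^bsub>X\<^esub> \<in> W" "\<And>x y. x \<in> W \<Longrightarrow> y \<in> W \<Longrightarrow> x \<oplus>\<^bsub>X\<^esub> y \<in> W"
    "\<And>c x. c \<in> carrier L \<Longrightarrow> x \<in> W \<Longrightarrow> c \<odot>\<^bsub>X\<^esub> x \<in> W" "W \<subseteq> carrier X"
    using assms unfolding submodule_def by auto
  show "D \<subseteq> pre W" using W by (auto simp: pre_def cl_D)
  show "pre W \<subseteq> K0" by (auto simp: pre_def)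
  show st: "act s y \<in> pre W" if "s \<in> carrier L" "y \<in> pre W" for s y
    using that W(3)[of s "cl y"] by (auto simp: pre_def cl_act actK)
  show "subspace (pre W)"
  proof (rule subspaceI)
    show "0 \<in> pre W" using W subK by (simp add: pre_def cl0[symmetric] subspace_0)
    show "x + y \<in> pre W" if "x \<in> pre W" "y \<in> pre W" for x y
      using that W subK by (simp add: pre_def cl_add subspace_add)
    show "c *s x \<in> pre W" if x: "x \<in> pre W" for c x
    proof -
      obtain s where "s \<in> carrier L" "\<forall>x\<in>K0. cl (c *s x) = cl (act s x)" using scal[of c] by blast
      then show ?thesis using st[of s x] x subK by (simp add: pre_def subspace_scale)
    qed
  qed
  show "cl ` pre W = W" using W(4) by (auto simp: pre_def carr)
qed

lemma pre_zero: "pre {\<zero>\<^bsub>X\<^esub>} = D" by (auto simp: pre_def cl_D)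

text \<open>The link between the two kinds of dimension: each vector independent over
  \<open>L\<close> enlarges the preimage by \<open>d\<close> base-field dimensions, by
  \<open>step\<close>.\<close>

lemma dim_pre_span:
  assumes "finite A" "A \<subseteq> carrier X" "X.lin_indpt A"
  shows "dim (pre (X.span A)) = dim D + card A * d" using assms
proof (induction A rule: finite_induct)
  case empty
  have "X.span {} = {\<zero>\<^bsub>X\<^esub>}" by (auto simp: X.span_def X.lincomb_def)
  then show ?case by (simp add: pre_zero)
next
  case (insert a A)
  have A: "A \<subseteq> carrier X" and a: "a \<in> carrier X" using insert.prems by auto
  have li: "X.lin_indpt A" by (rule X.subset_li_is_li[OF insert.prems(2)]) auto
  have "a \<notin> X.span A" using X.lin_dep_iff_in_span[OF A li a insert.hyps(2)] insert.prems by simp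
  have sm: "submodule L (X.span A) X" by (rule X.span_is_submodule[OF A])
  obtain x where x: "x \<in> K0" "a = cl x" using a by (auto simp: carr)
  have nx: "x \<notin> pre (X.span A)" using x \<open>a \<notin> X.span A\<close> by (simp add: pre_def)
  note pr = pre_submodule[OF sm]
  have "pre (X.span (A \<union> {a})) = {act s x + y |s y. s \<in> carrier L \<and> y \<in> pre (X.span A)}"
    (is "_ = ?R")
  proof (intro Set.set_eqI iffI)
    fix z assume z: "z \<in> pre (X.span (A \<union> {a}))"
    then have zK: "z \<in> K0" by (simp add: pre_def)
    obtain s w where h: "s \<in> carrier L" "w \<in> X.span A" "cl z = s \<odot>\<^bsub>X\<^esub> a \<oplus>\<^bsub>X\<^esub> w"
      using z unfolding pre_def X.span_insert_eq[OF A a] by auto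
    have wX: "w \<in> carrier X" using h sm unfolding submodule_def by auto
    have aK: "act s x \<in> K0" by (rule actK[OF h(1) x(1)])
    have zm: "z - act s x \<in> K0" by (rule subspace_diff[OF subK zK aK])
    have c1: "cl (act s x) \<in> carrier X" using aK by (simp add: carr)
    have c2: "cl (z - act s x) \<in> carrier X" using zm by (simp add: carr)
    have "cl (act s x) \<oplus>\<^bsub>X\<^esub> cl (z - act s x) = cl z" using cl_add[OF aK zm] by simp
    also have "\<dots> = cl (act s x) \<oplus>\<^bsub>X\<^esub> w" using h x by (simp add: cl_act)
    finally have "cl (z - act s x) = w" by (rule X.a_lcancel[OF _ c1 c2 wX])
    then have "z - act s x \<in> pre (X.span A)" using zm h by (simp add: pre_def)
    then show "z \<in> ?R" using h by (intro CollectI exI[of _ s] exI[of _ "z - act s x"]) simp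
  next
    fix z assume "z \<in> ?R"
    then obtain s y where h: "s \<in> carrier L" "y \<in> pre (X.span A)" "z = act s x + y" by blast
    then have y: "y \<in> K0" "cl y \<in> X.span A" by (auto simp: pre_def)
    have "z \<in> K0" using h y actK[OF h(1) x(1)] subK by (simp add: subspace_add)
    moreover have "cl z = s \<odot>\<^bsub>X\<^esub> a \<oplus>\<^bsub>X\<^esub> cl y"
      using h y x actK[OF h(1) x(1)] by (simp add: cl_add cl_act)
    ultimately show "z \<in> pre (X.span (A \<union> {a}))"
      unfolding pre_def X.span_insert_eq[OF A a] using h y by blast
  qed
  then have "dim (pre (X.span (A \<union> {a}))) = dim (pre (X.span A)) + d"
    using step[OF pr(1-4) x(1) nx] by simp
  then show ?case using insert.IH[OF A li] insert.hyps by simp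
qed

text \<open>Finite dimension over \<open>L\<close> is part of the conclusion: preimages of spans
  bound the size of independent sets, and a maximal such set is a basis.\<close>

lemma X_dim: "X.fin_dim" "X.dim * d + dim D = dim K0"
proof -
  have bd: "finite A \<and> card A \<le> dim K0" if A: "A \<subseteq> carrier X \<and> X.lin_indpt A" for A
  proof -
    have b1: "card B \<le> dim K0" if B: "finite B" "B \<subseteq> A" for B
    proof -
      have BX: "B \<subseteq> carrier X" using A B by auto
      have li: "X.lin_indpt B" by (rule X.subset_li_is_li[OF conjunct2[OF A] B(2)])
      note pr = pre_submodule[OF X.span_is_submodule[OF BX]]
      have "card B \<le> card B * d" using d0 by simp
      also have "\<dots> \<le> dim (pre (X.span B))" using dim_pre_span[OF B(1) BX li] by simp
      also have "\<dots> \<le> dim K0" by (rule dim_mono_fd[OF fdK pr(1) pr(3)])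
      finally show ?thesis .
    qed
    have "finite A"
    proof (rule ccontr)
      assume "infinite A"
      then obtain B where "B \<subseteq> A" "finite B" "card B = Suc (dim K0)"
        using infinite_arbitrarily_large by blast
      then show False using b1[of B] by simp
    qed
    then show ?thesis using b1[of A] by simp
  qed
  have "{} \<subseteq> carrier X \<and> X.lin_indpt {}" by (auto simp: X.lin_dep_def)
  then have "\<exists>A. finite A \<and> maximal A (\<lambda>S. S \<subseteq> carrier X \<and> X.lin_indpt S)"
    using bd by (intro maximal_exists[of "\<lambda>S. S \<subseteq> carrier X \<and> X.lin_indpt S" "dim K0" "{}"])
  then obtain A where A: "finite A" "maximal A (\<lambda>S. S \<subseteq> carrier X \<and> X.lin_indpt S)" by blast
  have bas: "X.basis A" by (rule X.max_li_is_basis[OF A(2)])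
  then have B: "A \<subseteq> carrier X" "X.lin_indpt A" "X.span A = carrier X"
    unfolding X.basis_def by auto
  show "X.fin_dim" unfolding X.fin_dim_def using A B by auto
  have "pre (carrier X) = K0" by (auto simp: pre_def carr)
  then show "X.dim * d + dim D = dim K0"
    using dim_pre_span[OF A(1) B(1,2)] B(3) X.dim_basis[OF A(1) bas] by simp
qed

text \<open>A subspace is itself presented, by its preimage and the same denominator, so the
  dimension formula applies to it verbatim.\<close>

lemma sub_dim:
  assumes W: "VectorSpace.subspace L W X"
  shows "vectorspace.fin_dim L (X\<lparr>carrier := W\<rparr>)"
    "vectorspace.dim L (X\<lparr>carrier := W\<rparr>) * d + dim D = dim (pre W)"
proof -
  have sm: "submodule L W X" using W unfolding subspace_def by simp
  note pr = pre_submodule[OF sm]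
  have preK: "\<And>x. x \<in> pre W \<Longrightarrow> x \<in> K0" using pr(3) by auto
  have "presentation scale L (X\<lparr>carrier := W\<rparr>) (pre W) D cl act d"
  proof (intro presentation.intro presentation_axioms.intro lin_space_axioms fieldL d0)
    show "fd (pre W)" by (rule fd_mono[OF fdK pr(1) pr(3)])
    show "carrier (X\<lparr>carrier := W\<rparr>) = cl ` pre W" using pr(5) by simp
    show "D = {x \<in> pre W. cl x = \<zero>\<^bsub>X\<lparr>carrier := W\<rparr>\<^esub>}" using pr(2,3) cl_D by auto
    show "\<exists>s\<in>carrier L. \<forall>x\<in>pre W. cl (c *s x) = cl (act s x)" for c
      using scal[of c] preK by blast
    show "dim {act s x + y |s y. s \<in> carrier L \<and> y \<in> P} = dim P + d"
      if "subspace P" "D \<subseteq> P" "P \<subseteq> pre W"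
        "\<And>s y. s \<in> carrier L \<Longrightarrow> y \<in> P \<Longrightarrow> act s y \<in> P" "x \<in> pre W" "x \<notin> P" for P x
      using that(1,2) order_trans[OF that(3) pr(3)] that(4) preK[OF that(5)] that(6) by (rule step)
  qed (use pr(4) in \<open>simp_all add: preK cl_add cl0 cl_act act_add add_act mult_act one_act\<close>)
  then interpret Y: presentation scale L "X\<lparr>carrier := W\<rparr>" "pre W" D cl act d .
  show "vectorspace.fin_dim L (X\<lparr>carrier := W\<rparr>)" by (rule Y.X_dim(1))
  show "vectorspace.dim L (X\<lparr>carrier := W\<rparr>) * d + dim D = dim (pre W)" by (rule Y.X_dim(2))
qed

text \<open>The correspondence theorem: subspaces of the quotient match the stable subspaces between
  \<open>D\<close> and \<open>K0\<close>.\<close>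

lemma image_subspace:
  assumes P: "subspace P" "D \<subseteq> P" "P \<subseteq> K0"
    and st: "\<And>s y. s \<in> carrier L \<Longrightarrow> y \<in> P \<Longrightarrow> act s y \<in> P"
  shows "VectorSpace.subspace L (cl ` P) X" "pre (cl ` P) = P"
proof -
  show "VectorSpace.subspace L (cl ` P) X"
  proof (rule VectorSpace.subspace.intro[OF vsX], rule submodule.intro)
    show "module L X" by unfold_locales
    show "cl ` P \<subseteq> carrier X" using P by (auto simp: carr)
    show "\<zero>\<^bsub>X\<^esub> \<in> cl ` P" using P by (simp add: cl0 subspace_0)
    show "v \<oplus>\<^bsub>X\<^esub> w \<in> cl ` P" if vw: "v \<in> cl ` P" "w \<in> cl ` P" for v w
    proof -
      obtain x y where h: "x \<in> P" "v = cl x" "y \<in> P" "w = cl y" using vw by auto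
      then have "v \<oplus>\<^bsub>X\<^esub> w = cl (x + y)" using P(3) by (simp add: cl_add subset_eq)
      then show ?thesis using h P by (simp add: subspace_add)
    qed
    show "c \<odot>\<^bsub>X\<^esub> v \<in> cl ` P" if cv: "c \<in> carrier L" "v \<in> cl ` P" for c v
    proof -
      obtain x where h: "x \<in> P" "v = cl x" using cv by auto
      then have "c \<odot>\<^bsub>X\<^esub> v = cl (act c x)" using P cv by (auto simp: cl_act)
      then show ?thesis using h st cv by simp
    qed
  qed
  show "pre (cl ` P) = P"
  proof
    show "P \<subseteq> pre (cl ` P)" using P by (auto simp: pre_def)
    show "pre (cl ` P) \<subseteq> P"
    proof
      fix x assume "x \<in> pre (cl ` P)"
      then obtain y where h: "x \<in> K0" "y \<in> P" "cl x = cl y" by (auto simp: pre_def)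
      have yK: "y \<in> K0" using h P by auto
      have m: "x - y \<in> K0" by (rule subspace_diff[OF subK h(1) yK])
      have cc: "cl y \<in> carrier X" "cl (x - y) \<in> carrier X" using yK m by (auto simp: carr)
      have "cl y \<oplus>\<^bsub>X\<^esub> cl (x - y) = cl y \<oplus>\<^bsub>X\<^esub> \<zero>\<^bsub>X\<^esub>" using cl_add[OF yK m] h cc by simp
      then have "cl (x - y) = \<zero>\<^bsub>X\<^esub>" by (rule X.a_lcancel[OF _ cc X.zero_closed])
      then have "x - y \<in> P" using m P by (auto simp: cl_D)
      then have "x - y + y \<in> P" using h P by (simp only: subspace_add)
      then show "x \<in> P" by simp
    qed
  qed
qed

end

section \<open>Arithmetic of the residue field\<close>

abbreviation res :: "'f::field poly \<Rightarrow> 'f poly \<Rightarrow> 'f poly set" where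
  "res p q \<equiv> PIdl\<^bsub>class_ring\<^esub> p +>\<^bsub>class_ring\<^esub> q"

lemma res_mem: "r \<in> res p q \<longleftrightarrow> p dvd (r - q)" for p :: "'f::field poly"
proof -
  have "r \<in> res p q \<longleftrightarrow> (\<exists>s. r = s * p + q)"
    by (auto simp: cgenideal_def a_r_coset_def')
  also have "\<dots> \<longleftrightarrow> (\<exists>s. r - q = p * s)" by (auto simp: mult.commute eq_diff_eq algebra_simps)
  finally show ?thesis by (simp add: dvd_def)
qed

lemma res_eq: "res p q = res p r \<longleftrightarrow> p dvd (q - r)" for p :: "'f::field poly"
proof
  assume "res p q = res p r"
  then show "p dvd (q - r)" using res_mem[of q p q] res_mem[of q p r] by simp
next
  assume d: "p dvd (q - r)"
  have "s \<in> res p q \<longleftrightarrow> s \<in> res p r" for s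
    unfolding res_mem using dvd_add_right_iff[OF d, of "s - q"] by simp
  then show "res p q = res p r" by blast
qed

lemma residue_field_simps:
  fixes p :: "'f::field poly"
  shows residue_carrier: "carrier (residue_field p) = range (res p)"
    and residue_add: "res p q \<oplus>\<^bsub>residue_field p\<^esub> res p r = res p (q + r)"
    and residue_mult: "res p q \<otimes>\<^bsub>residue_field p\<^esub> res p r = res p (q * r)"
    and residue_one: "\<one>\<^bsub>residue_field p\<^esub> = res p 1"
    and residue_zero: "\<zero>\<^bsub>residue_field p\<^esub> = res p 0"
    and residue_cring: "cring (residue_field p)"
proof -
  interpret I: ideal "PIdl\<^bsub>class_ring\<^esub> p" "class_ring"
    by (rule cring.cgenideal_ideal[OF class_cring.cring_axioms]) simp
  show car: "carrier (residue_field p) = range (res p)"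
    by (auto simp: residue_field_def FactRing_def A_RCOSETS_def')
  interpret h: ring_hom_ring class_ring "residue_field p" "res p"
    unfolding residue_field_def by (rule I.rcos_ring_hom_ring)
  show "res p q \<oplus>\<^bsub>residue_field p\<^esub> res p r = res p (q + r)" using h.hom_add[of q r] by simp
  show "res p q \<otimes>\<^bsub>residue_field p\<^esub> res p r = res p (q * r)" using h.hom_mult[of q r] by simp
  show "\<one>\<^bsub>residue_field p\<^esub> = res p 1" using h.hom_one by simp
  show "\<zero>\<^bsub>residue_field p\<^esub> = res p 0" using h.hom_zero by simp
  show "cring (residue_field p)" unfolding residue_field_def
    by (rule I.quotient_is_cring) (rule class_cring.cring_axioms)
qed

lemma residue_field_field:
  fixes p :: "'f::field poly"
  assumes p: "Factorial_Ring.irreducible p" shows "field (residue_field p)"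
proof -
  interpret R: cring "residue_field p" by (rule residue_cring)
  show ?thesis
  proof (rule R.cring_fieldI2)
    show "\<zero>\<^bsub>residue_field p\<^esub> \<noteq> \<one>\<^bsub>residue_field p\<^esub>"
      unfolding residue_zero residue_one res_eq using p by (auto simp: Factorial_Ring.irreducible_def)
    fix a assume "a \<in> carrier (residue_field p)" "a \<noteq> \<zero>\<^bsub>residue_field p\<^esub>"
    then obtain q where aq: "a = res p q" "res p q \<noteq> res p 0" unfolding residue_carrier residue_zero by blast
    have q: "a = res p q" "\<not> p dvd q" using aq unfolding res_eq by simp_all
    obtain r s where "r * p + s * q = 1" using irreducible_bezout[OF p q(2)] by blast
    then have "q * s - 1 = p * (- r)" by (simp add: algebra_simps)
    then have "a \<otimes>\<^bsub>residue_field p\<^esub> res p s = \<one>\<^bsub>residue_field p\<^esub>"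
      unfolding q residue_mult residue_one res_eq by simp
    then show "\<exists>b\<in>carrier (residue_field p). a \<otimes>\<^bsub>residue_field p\<^esub> b = \<one>\<^bsub>residue_field p\<^esub>"
      by (auto simp: residue_carrier)
  qed
qed

section \<open>Passing from the given space to a type of vectors\<close>

text \<open>The given space is a carrier set, while the preceding theory needs a type of vectors.
  \<open>g\<close> identifies a subspace \<open>V0\<close> of such a type with the carrier of
  \<open>V\<close>, compatibly with form and endomorphism.\<close>

locale realization = skew_space scale b0 u0
  for scale :: "'f::field \<Rightarrow> 'b::ab_group_add \<Rightarrow> 'b"  (infixr \<open>*s\<close> 75)
    and b0 :: "'b \<Rightarrow> 'b \<Rightarrow> 'f" and u0 :: "'b \<Rightarrow> 'b" +
  fixes V :: "('f, 'v) module" and b :: "'v \<Rightarrow> 'v \<Rightarrow> 'f" and u :: "'v \<Rightarrow> 'v"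
    and V0 :: "'b set" and g :: "'b \<Rightarrow> 'v"
  assumes goodV: "good V0"
    and vsV: "vectorspace class_ring V"
    and g_bij: "bij_betw g V0 (carrier V)"
    and g_add: "x \<in> V0 \<Longrightarrow> y \<in> V0 \<Longrightarrow> g (x + y) = g x \<oplus>\<^bsub>V\<^esub> g y"
    and g_scale: "x \<in> V0 \<Longrightarrow> g (c *s x) = c \<odot>\<^bsub>V\<^esub> g x"
    and g_u: "x \<in> V0 \<Longrightarrow> u (g x) = g (u0 x)"
    and g_b: "x \<in> V0 \<Longrightarrow> y \<in> V0 \<Longrightarrow> b (g x) (g y) = b0 x y"
begin

sublocale V: vectorspace class_ring V by (rule vsV)

lemma fV: "fd V0" and sV: "subspace V0" and uV: "ustable V0" using goodD[OF goodV] by auto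

lemma V0_cl [simp]: "0 \<in> V0" "x \<in> V0 \<Longrightarrow> y \<in> V0 \<Longrightarrow> x + y \<in> V0" "x \<in> V0 \<Longrightarrow> c *s x \<in> V0"
  "x \<in> V0 \<Longrightarrow> - x \<in> V0" "x \<in> V0 \<Longrightarrow> y \<in> V0 \<Longrightarrow> x - y \<in> V0" "x \<in> V0 \<Longrightarrow> u0 x \<in> V0"
  "x \<in> V0 \<Longrightarrow> pev q x \<in> V0" "x \<in> V0 \<Longrightarrow> (u0 ^^ n) x \<in> V0"
  using sV uV pev_stable[OF sV uV, of x] pev_X_power[of n x]
    pev_stable[OF sV uV, of x "[:0, 1:] ^ n"]
  by (auto simp: subspace_0 subspace_add subspace_scale subspace_neg subspace_diff ustable_def)

lemma g_im: "carrier V = g ` V0" using g_bij by (simp add: bij_betw_def)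
lemma g_car [simp]: "x \<in> V0 \<Longrightarrow> g x \<in> carrier V" by (simp add: g_im)
lemma g_inj: "x \<in> V0 \<Longrightarrow> y \<in> V0 \<Longrightarrow> g x = g y \<longleftrightarrow> x = y"
  using g_bij by (auto simp: bij_betw_def inj_on_def)

lemma g_0: "g 0 = \<zero>\<^bsub>V\<^esub>"
proof -
  have "g 0 \<oplus>\<^bsub>V\<^esub> g 0 = g 0 \<oplus>\<^bsub>V\<^esub> \<zero>\<^bsub>V\<^esub>" using g_add[of 0 0] by simp
  then show ?thesis by (rule V.a_lcancel) auto
qed

lemma g_eq0: "x \<in> V0 \<Longrightarrow> g x = \<zero>\<^bsub>V\<^esub> \<longleftrightarrow> x = 0" using g_inj[of x 0] by (simp add: g_0)

lemma sum_V0: "(\<And>i. i \<in> A \<Longrightarrow> f i \<in> V0) \<Longrightarrow> (\<Sum>i\<in>A. f i) \<in> V0" by (rule subspace_sum[OF sV])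

lemma g_sum: "finite A \<Longrightarrow> (\<And>i. i \<in> A \<Longrightarrow> f i \<in> V0) \<Longrightarrow> (\<Oplus>\<^bsub>V\<^esub>i\<in>A. g (f i)) = g (\<Sum>i\<in>A. f i)"
proof (induction A rule: finite_induct)
  case (insert a A)
  have "(\<Oplus>\<^bsub>V\<^esub>i\<in>insert a A. g (f i)) = g (f a) \<oplus>\<^bsub>V\<^esub> (\<Oplus>\<^bsub>V\<^esub>i\<in>A. g (f i))"
    using insert by (intro V.finsum_insert) auto
  also have "(\<Oplus>\<^bsub>V\<^esub>i\<in>A. g (f i)) = g (\<Sum>i\<in>A. f i)" using insert by simp
  finally show ?case using insert sum_V0[of A f] by (simp add: g_add)
qed (simp add: g_0)

lemma g_upow: "x \<in> V0 \<Longrightarrow> (u ^^ n) (g x) = g ((u0 ^^ n) x)"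
  by (induction n) (simp_all add: g_u)

lemma g_poly: "x \<in> V0 \<Longrightarrow> poly_map V u q (g x) = g (pev q x)"
  using g_sum[of "{..degree q}" "\<lambda>i. coeff q i *s (u0 ^^ i) x"]
  by (simp add: poly_map_def pev_def g_upow g_scale)

lemma g_poly_pow: "x \<in> V0 \<Longrightarrow> (poly_map V u p ^^ k) (g x) = g (pev (p ^ k) x)"
  by (induction k) (simp_all add: g_poly pev_mult)

lemma ker_V0: "x \<in> ker V0 q \<Longrightarrow> x \<in> V0" by (simp add: ker_def)

lemma numerator: "jordan_numerator V u p k = g ` ker V0 (p ^ k)"
  by (auto simp: jordan_numerator_def a_kernel_def' g_im ker_def g_poly_pow g_eq0)

lemma jden_V0: "x \<in> jden V0 p k \<Longrightarrow> x \<in> V0" by (simp add: jden_def ker_def)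

text \<open>The splitting x = (x - p(u)z) + p(u)z turns the one condition of \<open>jden\<close>
  into the sum of the two subspaces; positivity of k makes the exponents k - 1 and k differ by
  one.\<close>

lemma denominator:
  assumes k: "k \<ge> 1" shows "jordan_denominator V u p k = g ` jden V0 p k"
proof -
  have pk: "pev (p ^ k) x = pev (p ^ (k - 1)) (pev p x)" "pev (p ^ k) x = pev p (pev (p ^ (k - 1)) x)" for x
    using k by (simp_all flip: pev_mult power_Suc power_Suc2)
  show ?thesis
  proof (intro Set.set_eqI iffI)
    fix y assume "y \<in> jordan_denominator V u p k"
    then obtain c d where cd: "y = c \<oplus>\<^bsub>V\<^esub> d" "c \<in> a_kernel V V (poly_map V u p ^^ (k - 1))"
      "d \<in> a_kernel V V (poly_map V u p ^^ k)" "d \<in> poly_map V u p ` carrier V"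
      unfolding jordan_denominator_def set_add_def' by blast
    obtain x where x: "x \<in> V0" "c = g x" "pev (p ^ (k - 1)) x = 0"
      using cd(2) by (auto simp: a_kernel_def' g_im g_poly_pow g_eq0)
    obtain z where z: "z \<in> V0" "d = g (pev p z)" using cd(4) by (auto simp: g_im g_poly)
    have z0: "pev (p ^ k) (pev p z) = 0" using cd(3) z by (auto simp: a_kernel_def' g_poly_pow g_eq0)
    have "y = g (x + pev p z)" using cd x z by (simp add: g_add)
    moreover have "x + pev p z \<in> jden V0 p k" unfolding jden_def ker_def using x z z0
      by (auto simp: pev_add_arg pk(1)[of z, symmetric] pk(2)[of x] simp del: One_nat_def intro!: bexI[of _ z])
    ultimately show "y \<in> g ` jden V0 p k" by blast
  next
    fix y assume "y \<in> g ` jden V0 p k"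
    then obtain x z where x: "y = g x" "x \<in> V0" "pev (p ^ k) x = 0" "z \<in> V0"
      "pev (p ^ (k - 1)) x = pev (p ^ k) z" by (auto simp: jden_def ker_def)
    have "pev (p ^ (k - 1)) (x - pev p z) = 0" using x(5) by (simp add: pev_diff_arg pk(1)[symmetric] del: One_nat_def)
    then have 1: "g (x - pev p z) \<in> a_kernel V V (poly_map V u p ^^ (k - 1))"
      using x by (simp add: a_kernel_def' g_poly_pow g_eq0)
    have "pev (p ^ k) (pev p z) = pev p (pev (p ^ (k - 1)) x)" using x(5) by (simp add: pev_commute)
    then have "pev (p ^ k) (pev p z) = 0" using x(3) pk(2)[of x] by simp
    then have 2: "g (pev p z) \<in> a_kernel V V (poly_map V u p ^^ k)"
      using x by (simp add: a_kernel_def' g_poly_pow g_eq0)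
    have 3: "g (pev p z) \<in> poly_map V u p ` carrier V"
      using x by (intro image_eqI[of _ _ "g z"]) (auto simp: g_poly)
    have "y = g (x - pev p z) \<oplus>\<^bsub>V\<^esub> g (pev p z)" using x by (simp flip: g_add)
    then show "y \<in> jordan_denominator V u p k"
      unfolding jordan_denominator_def set_add_def' using 1 2 3 by blast
  qed
qed

text \<open>The coset of \<open>g x\<close> modulo the denominator, written through representatives
  in \<open>V0\<close>.\<close>

definition cl :: "'f poly \<Rightarrow> nat \<Rightarrow> 'b \<Rightarrow> 'v set" where
  "cl p k x = g ` {y\<in>V0. y - x \<in> jden V0 p k}"

lemma sD: "subspace (jden V0 p k)" by (rule subspace_jden[OF sV])

lemma cl_rcos: "k \<ge> 1 \<Longrightarrow> x \<in> V0 \<Longrightarrow> jordan_denominator V u p k +>\<^bsub>V\<^esub> g x = cl p k x"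
proof (intro Set.set_eqI iffI)
  fix y assume k: "k \<ge> 1" and x: "x \<in> V0"
  { assume "y \<in> jordan_denominator V u p k +>\<^bsub>V\<^esub> g x"
    then obtain d where d: "d \<in> jden V0 p k" "y = g d \<oplus>\<^bsub>V\<^esub> g x"
      unfolding a_r_coset_def' denominator[OF k] by blast
    then show "y \<in> cl p k x" unfolding cl_def using x jden_V0[OF d(1)]
      by (intro image_eqI[of _ _ "d + x"]) (auto simp: g_add) }
  { assume "y \<in> cl p k x"
    then obtain z where z: "z \<in> V0" "y = g z" "z - x \<in> jden V0 p k" unfolding cl_def by blast
    then have "y = g (z - x) \<oplus>\<^bsub>V\<^esub> g x" using x by (simp flip: g_add)
    then show "y \<in> jordan_denominator V u p k +>\<^bsub>V\<^esub> g x"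
      unfolding a_r_coset_def' denominator[OF k] using z by blast }
qed

lemma cl_eq: "x \<in> V0 \<Longrightarrow> y \<in> V0 \<Longrightarrow> cl p k x = cl p k y \<longleftrightarrow> x - y \<in> jden V0 p k"
proof
  assume x: "x \<in> V0" and y: "y \<in> V0"
  { assume e: "cl p k x = cl p k y"
    have "g x \<in> cl p k x" unfolding cl_def using x subspace_0[OF sD] by auto
    then have "g x \<in> cl p k y" by (simp only: e)
    then show "x - y \<in> jden V0 p k" unfolding cl_def using x by (auto simp: g_inj) }
  { assume d: "x - y \<in> jden V0 p k"
    have "z - x \<in> jden V0 p k \<longleftrightarrow> z - y \<in> jden V0 p k" for z
      using subspace_add[OF sD d, of "z - x"] subspace_diff[OF sD _ d, of "z - y"] by auto
    then show "cl p k x = cl p k y" unfolding cl_def by simp }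
qed

lemma cl_add: "x \<in> V0 \<Longrightarrow> y \<in> V0 \<Longrightarrow> cl p k x <+>\<^bsub>V\<^esub> cl p k y = cl p k (x + y)"
proof (intro Set.set_eqI iffI)
  fix z assume x: "x \<in> V0" and y: "y \<in> V0"
  { assume "z \<in> cl p k x <+>\<^bsub>V\<^esub> cl p k y"
    then obtain x' y' where h: "x' \<in> V0" "y' \<in> V0" "x' - x \<in> jden V0 p k" "y' - y \<in> jden V0 p k"
      "z = g x' \<oplus>\<^bsub>V\<^esub> g y'" unfolding cl_def set_add_def' by blast
    have "x' + y' - (x + y) = (x' - x) + (y' - y)" by simp
    then have "x' + y' - (x + y) \<in> jden V0 p k" using subspace_add[OF sD h(3,4)] by (simp only:)
    then show "z \<in> cl p k (x + y)" using h unfolding cl_def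
      by (intro image_eqI[of _ _ "x' + y'"]) (auto simp: g_add) }
  { assume "z \<in> cl p k (x + y)"
    then obtain w where w: "w \<in> V0" "z = g w" "w - (x + y) \<in> jden V0 p k" unfolding cl_def by blast
    have "z = g (w - y) \<oplus>\<^bsub>V\<^esub> g y" using w y by (simp flip: g_add)
    moreover have "g (w - y) \<in> cl p k x" unfolding cl_def using w y by (auto simp: algebra_simps)
    moreover have "g y \<in> cl p k y" unfolding cl_def using y subspace_0[OF sD] by auto
    ultimately show "z \<in> cl p k x <+>\<^bsub>V\<^esub> cl p k y" unfolding set_add_def' by blast }
qed

lemma cl_carrier: "k \<ge> 1 \<Longrightarrow> a_rcosets\<^bsub>V\<lparr>carrier := jordan_numerator V u p k\<rparr>\<^esub>
    (jordan_denominator V u p k) = cl p k ` ker V0 (p ^ k)"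
proof -
  assume k: "k \<ge> 1"
  have "jordan_denominator V u p k +>\<^bsub>V\<lparr>carrier := N\<rparr>\<^esub> g x = cl p k x" if "x \<in> V0" for x N
    using cl_rcos[OF k that, of p] by (simp add: a_r_coset_def')
  then show ?thesis by (auto simp: A_RCOSETS_def' numerator ker_V0)
qed

lemma cl_zero: "k \<ge> 1 \<Longrightarrow> jordan_denominator V u p k = cl p k 0"
  by (auto simp: denominator cl_def jden_V0)

lemma cl_scale:
  assumes k: "k \<ge> 1" and x: "x \<in> V0"
  shows "(\<Union>y\<in>cl p k x. jordan_denominator V u p k +>\<^bsub>V\<^esub> (c \<odot>\<^bsub>V\<^esub> y)) = cl p k (c *s x)"
proof -
  have "jordan_denominator V u p k +>\<^bsub>V\<^esub> (c \<odot>\<^bsub>V\<^esub> y) = cl p k (c *s x)" if yc: "y \<in> cl p k x" for y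
  proof -
    obtain z where z: "z \<in> V0" "y = g z" "z - x \<in> jden V0 p k" using yc unfolding cl_def by blast
    have "c *s z - c *s x \<in> jden V0 p k" using subspace_scale[OF sD z(3), of c] by (simp add: scale_right_diff_distrib)
    then show ?thesis using z x k by (simp add: g_scale[symmetric] cl_rcos cl_eq)
  qed
  moreover have "g x \<in> cl p k x" unfolding cl_def using x subspace_0[OF sD] by auto
  ultimately show ?thesis by blast
qed

lemma pev_jden: "d \<in> jden V0 p k \<Longrightarrow> pev q d \<in> jden V0 p k"
  by (rule pev_stable[OF sD ustable_jden[OF uV]])

lemma pev_ker: "d \<in> ker V0 r \<Longrightarrow> pev q d \<in> ker V0 r"
  by (rule pev_stable[OF subspace_ker[OF sV] ustable_ker[OF uV]])

lemma p_jden: "k \<ge> 1 \<Longrightarrow> x \<in> ker V0 (p ^ k) \<Longrightarrow> pev p x \<in> jden V0 p k"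
  unfolding jden_def using pev_ker[of x "p ^ k" p] ker_V0[of x "p ^ k"]
  by (auto intro!: bexI[of _ x] simp flip: pev_mult power_Suc2)

lemma dvd_jden:
  assumes "k \<ge> 1" "x \<in> ker V0 (p ^ k)" "p dvd q" shows "pev q x \<in> jden V0 p k"
proof -
  obtain r where "q = r * p" using assms(3) by (metis dvdE mult.commute)
  then show ?thesis using pev_jden[OF p_jden[OF assms(1,2)], of r] by (simp add: pev_mult)
qed

text \<open>All cosets in the union coincide: changing the polynomial by a multiple of p changes the
  result by p(u) of a numerator vector, which is in the denominator.\<close>

lemma cl_residue:
  assumes k: "k \<ge> 1" and x: "x \<in> ker V0 (p ^ k)"
  shows "(\<Union>q\<in>res p r. \<Union>y\<in>cl p k x. jordan_denominator V u p k +>\<^bsub>V\<^esub> poly_map V u q y) = cl p k (pev r x)"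
proof -
  have xV: "x \<in> V0" by (rule ker_V0[OF x])
  have *: "jordan_denominator V u p k +>\<^bsub>V\<^esub> poly_map V u q y = cl p k (pev r x)"
    if q: "q \<in> res p r" and yc: "y \<in> cl p k x" for q y
  proof -
    obtain z where z: "z \<in> V0" "y = g z" "z - x \<in> jden V0 p k" using yc unfolding cl_def by blast
    have "pev q z - pev r x = pev q (z - x) + pev (q - r) x" by (simp add: pev_diff_arg pev_diff)
    moreover have "pev (q - r) x \<in> jden V0 p k" using q dvd_jden[OF k x] by (simp add: res_mem)
    ultimately have "pev q z - pev r x \<in> jden V0 p k"
      using pev_jden[OF z(3), of q] subspace_add[OF sD] by simp
    then show ?thesis using z xV k by (simp add: g_poly cl_rcos cl_eq)
  qed
  moreover have "g x \<in> cl p k x" unfolding cl_def using xV subspace_0[OF sD] by auto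
  moreover have "r \<in> res p r" by (simp add: res_mem)
  ultimately show ?thesis by blast
qed

text \<open>Covers both the even polynomials of \<open>Irr0\<close> and the odd polynomial t, so
  that one treatment of the induced form serves (i) and (iii).\<close>

definition epol :: "'f poly \<Rightarrow> bool" where "epol p \<longleftrightarrow> negp p = p \<or> negp p = - p"

lemma epol_pow: "epol p \<Longrightarrow> negp (p ^ k) = p ^ k \<or> negp (p ^ k) = - (p ^ k)"
  unfolding epol_def negp_power by (cases "even k") auto

lemma epol_adj: "epol p \<Longrightarrow> b0 (pev (p ^ k) x) y = b0 x (pev (p ^ k) y) \<or> b0 (pev (p ^ k) x) y = - b0 x (pev (p ^ k) y)"
  using epol_pow[of p k] by (auto simp: pev_adj pev_minus bD)

text \<open>Moving p(u)^k to the other side, possibly with a sign, annihilates the denominator; this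
  makes the induced form well defined.\<close>

lemma jden_perp:
  assumes p: "epol p" and d: "d \<in> jden V0 p k" and x: "x \<in> ker V0 (p ^ k)"
  shows "b0 x (pev (p ^ (k - 1)) d) = 0" "b0 d (pev (p ^ (k - 1)) x) = 0"
proof -
  obtain z where z: "pev (p ^ (k - 1)) d = pev (p ^ k) z" using d by (auto simp: jden_def)
  have x0: "pev (p ^ k) x = 0" using x by (simp add: ker_def)
  show 1: "b0 x (pev (p ^ (k - 1)) d) = 0" unfolding z using epol_adj[OF p, of k x z] x0 by (auto simp: bD)
  have "b0 d (pev (p ^ (k - 1)) x) = b0 (pev (p ^ (k - 1)) x) d" by (rule b_sym)
  then show "b0 d (pev (p ^ (k - 1)) x) = 0" using epol_adj[OF p, of "k - 1" x d] 1 by auto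
qed

lemma induced:
  assumes p: "epol p" and x: "x \<in> ker V0 (p ^ k)" and y: "y \<in> ker V0 (p ^ k)"
  shows "induced_form V b u p k (cl p k x) (cl p k y) = b0 x (pev (p ^ (k - 1)) y)"
proof -
  have val: "b x' ((poly_map V u p ^^ (k - 1)) y') = b0 x (pev (p ^ (k - 1)) y)"
    if xy: "x' \<in> cl p k x" "y' \<in> cl p k y" for x' y'
  proof -
    obtain z where z: "z \<in> V0" "x' = g z" "z - x \<in> jden V0 p k" using xy unfolding cl_def by blast
    obtain w where w: "w \<in> V0" "y' = g w" "w - y \<in> jden V0 p k" using xy unfolding cl_def by blast
    have wk: "w \<in> ker V0 (p ^ k)"
      using subspace_add[OF subspace_ker[OF sV] subsetD[OF jden_sub w(3)] y] by simp
    have "b0 (z - x) (pev (p ^ (k - 1)) w) = 0" by (rule jden_perp(2)[OF p z(3) wk])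
    moreover have "b0 x (pev (p ^ (k - 1)) (w - y)) = 0" by (rule jden_perp(1)[OF p w(3) x])
    ultimately show ?thesis using z w by (simp add: g_poly_pow g_b bD pev_diff_arg)
  qed
  have ne: "g x \<in> cl p k x" "g y \<in> cl p k y"
    unfolding cl_def using ker_V0[OF x] ker_V0[OF y] subspace_0[OF sD] by auto
  show ?thesis unfolding induced_form_def
  proof (rule the_equality)
    show "\<forall>x'\<in>cl p k x. \<forall>y'\<in>cl p k y. b x' ((poly_map V u p ^^ (k - 1)) y') = b0 x (pev (p ^ (k - 1)) y)"
      using val by blast
    show "c = b0 x (pev (p ^ (k - 1)) y)"
      if "\<forall>x'\<in>cl p k x. \<forall>y'\<in>cl p k y. b x' ((poly_map V u p ^^ (k - 1)) y') = c" for c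
      using that ne val[OF ne] by metis
  qed
qed

text \<open>The passage between the summands a, a' and v = a - a'. In one direction the summands are
  pulled back to \<open>V0\<close>, in the other (u + v)/2 and (u - v)/2 are pushed forward.\<close>

lemma pairable_link: "sum_of_two_skew_square_zero V b u \<longleftrightarrow> pairable V0"
proof
  assume "sum_of_two_skew_square_zero V b u"
  then obtain a1 a2 where a: "skew_selfadjoint V b a1" "square_zero V a1" "skew_selfadjoint V b a2"
    "square_zero V a2" "\<And>x. x \<in> carrier V \<Longrightarrow> u x = a1 x \<oplus>\<^bsub>V\<^esub> a2 x"
    unfolding sum_of_two_skew_square_zero_def by blast
  define h where "h = inv_into V0 g"
  have hg [simp]: "h (g x) = x" if "x \<in> V0" for x using that g_bij by (simp add: h_def bij_betw_def)
  have gh [simp]: "g (h y) = y" "h y \<in> V0" if "y \<in> carrier V" for y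
    using that by (auto simp: h_def g_im f_inv_into_f inv_into_into)
  have lift: "\<exists>c. (\<forall>x\<in>V0. c x \<in> V0 \<and> g (c x) = a (g x)) \<and> (\<forall>x\<in>V0. \<forall>y\<in>V0. c (x + y) = c x + c y) \<and>
      (\<forall>r. \<forall>x\<in>V0. c (r *s x) = r *s c x) \<and> (\<forall>x\<in>V0. \<forall>y\<in>V0. b0 (c x) y = - b0 x (c y)) \<and>
      (\<forall>x\<in>V0. c (c x) = 0)"
    if sa: "skew_selfadjoint V b a" and sq: "square_zero V a" for a
  proof -
    interpret A: linear_map class_ring V V a using sa by (simp add: skew_selfadjoint_def)
    have sk: "\<And>x y. x \<in> carrier V \<Longrightarrow> y \<in> carrier V \<Longrightarrow> b (a x) y = - b x (a y)"
      using sa by (simp add: skew_selfadjoint_def)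
    define c where "c x = h (a (g x))" for x
    have ac: "a y \<in> carrier V" if "y \<in> carrier V" for y using that A.f_im by blast
    have c: "c x \<in> V0" "g (c x) = a (g x)" if "x \<in> V0" for x using that ac by (simp_all add: c_def)
    have cI: "c x = y" if "x \<in> V0" "y \<in> V0" "a (g x) = g y" for x y using that by (simp add: c_def)
    have "c (x + y) = c x + c y" if "x \<in> V0" "y \<in> V0" for x y
      using that c A.f_add by (intro cI) (simp_all add: g_add)
    moreover have "c (r *s x) = r *s c x" if "x \<in> V0" for r x
      using that c A.f_smult[of r "g x"] by (intro cI) (simp_all add: g_scale)
    moreover have "b0 (c x) y = - b0 x (c y)" if "x \<in> V0" "y \<in> V0" for x y
      using that c sk[of "g x" "g y"] by (simp flip: g_b)
    moreover have "c (c x) = 0" if "x \<in> V0" for x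
      using that c sq by (intro cI) (simp_all add: square_zero_def g_0)
    ultimately show ?thesis using c by (intro exI[of _ c] conjI ballI allI) simp_all
  qed
  obtain c1 where c1: "\<forall>x\<in>V0. c1 x \<in> V0 \<and> g (c1 x) = a1 (g x)" "\<forall>x\<in>V0. \<forall>y\<in>V0. c1 (x + y) = c1 x + c1 y"
    "\<forall>r. \<forall>x\<in>V0. c1 (r *s x) = r *s c1 x" "\<forall>x\<in>V0. \<forall>y\<in>V0. b0 (c1 x) y = - b0 x (c1 y)" "\<forall>x\<in>V0. c1 (c1 x) = 0"
    using lift[OF a(1,2)] by (elim exE conjE) (rule that)
  obtain c2 where c2: "\<forall>x\<in>V0. c2 x \<in> V0 \<and> g (c2 x) = a2 (g x)" "\<forall>x\<in>V0. \<forall>y\<in>V0. c2 (x + y) = c2 x + c2 y"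
    "\<forall>r. \<forall>x\<in>V0. c2 (r *s x) = r *s c2 x" "\<forall>x\<in>V0. \<forall>y\<in>V0. b0 (c2 x) y = - b0 x (c2 y)" "\<forall>x\<in>V0. c2 (c2 x) = 0"
    using lift[OF a(3,4)] by (elim exE conjE) (rule that)
  have u12: "u0 x = c1 x + c2 x" if x: "x \<in> V0" for x
  proof -
    have "g (u0 x) = g (c1 x + c2 x)" using a(5)[of "g x"] x c1(1) c2(1) by (simp add: g_u g_add)
    then show ?thesis using x c1(1) c2(1) by (simp add: g_inj)
  qed
  have c_diff: "c1 (x - y) = c1 x - c1 y" "c2 (x - y) = c2 x - c2 y" if "x \<in> V0" "y \<in> V0" for x y
  proof -
    have *: "x - y = x + (- 1) *s y" by simp
    have "c1 (x + (- 1) *s y) = c1 x + (- 1) *s c1 y" "c2 (x + (- 1) *s y) = c2 x + (- 1) *s c2 y"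
      using c1(2,3) c2(2,3) that by (simp_all del: scale_minus_left)
    then show "c1 (x - y) = c1 x - c1 y" "c2 (x - y) = c2 x - c2 y" by simp_all
  qed
  \<comment> \<open>The pulled-back maps are known to be linear on \<open>V0\<close> only, so their
    difference is extended from a basis of \<open>V0\<close> to the whole type.\<close>
  have "\<exists>v. (\<forall>x\<in>V0. v x = c1 x - c2 x) \<and> (\<forall>x y. v (x + y) = v x + v y) \<and> (\<forall>c x. v (c *s x) = c *s v x)"
  proof -
    obtain B where B: "B \<subseteq> V0" "independent B" "V0 \<subseteq> span B" by (rule maximal_independent_subset)
    interpret vp: vector_space_pair scale scale by unfold_locales
    obtain v where v: "Vector_Spaces.linear scale scale v" "\<forall>x\<in>B. v x = c1 x - c2 x"
      using vp.linear_independent_extend[OF B(2), of "\<lambda>x. c1 x - c2 x"] by (elim exE conjE) (rule that)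
    interpret v: Vector_Spaces.linear scale scale v by (rule v(1))
    have "x \<in> V0 \<and> v x = c1 x - c2 x" if "x \<in> span B" for x using that
    proof (induction rule: span_induct_alt)
      case base
      then show ?case using c1(2) c2(2) c_diff[of 0 0] by (simp add: v.zero)
    next
      case (step r x y)
      have xV: "x \<in> V0" using step B by auto
      have e1: "c1 (r *s x + y) = r *s c1 x + c1 y" and e2: "c2 (r *s x + y) = r *s c2 x + c2 y"
        using c1(2,3) c2(2,3) xV step by simp_all
      show ?case unfolding e1 e2 v.add v.scale using step xV v(2) by (simp add: scale_right_diff_distrib)
    qed
    then show ?thesis using B(3) v.add v.scale by (intro exI[of _ v]) blast
  qed
  then obtain v where v: "\<forall>x\<in>V0. v x = c1 x - c2 x" "\<forall>x y. v (x + y) = v x + v y" "\<forall>c x. v (c *s x) = c *s v x"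
    by blast
  have A: "v x \<in> V0 \<and> v (u0 x) = - u0 (v x) \<and> v (v x) = - u0 (u0 x)" if x: "x \<in> V0" for x
  proof -
    have m: "c1 x \<in> V0" "c2 x \<in> V0" using x c1(1) c2(1) by auto
    then have m2: "c1 (c2 x) \<in> V0" "c2 (c1 x) \<in> V0" using c1(1) c2(1) by auto
    have z: "c1 (c1 x) = 0" "c2 (c2 x) = 0" using x c1(5) c2(5) by auto
    have add: "c1 (c1 x + c2 x) = c1 (c2 x)" "c2 (c1 x + c2 x) = c2 (c1 x)"
      using m c1(2) c2(2) z by simp_all
    have df: "c1 (c1 x - c2 x) = - c1 (c2 x)" "c2 (c1 x - c2 x) = c2 (c1 x)" using m c_diff z by simp_all
    show ?thesis using x m m2 v(1) by (simp add: u12 add df)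
  qed
  have "b0 (v x) y = - b0 x (v y)" if "x \<in> V0" "y \<in> V0" for x y
    using that v(1) c1(4) c2(4) by (simp add: bD)
  then show "pairable V0" unfolding pairable_def using v(2,3) A by (intro exI[of _ v]) blast
next
  assume "pairable V0"
  then obtain v where v: "\<forall>x y. v (x + y) = v x + v y" "\<forall>c x. v (c *s x) = c *s v x"
    "\<forall>x\<in>V0. v x \<in> V0 \<and> v (u0 x) = - u0 (v x) \<and> v (v x) = - u0 (u0 x)"
    "\<forall>x\<in>V0. \<forall>y\<in>V0. b0 (v x) y = - b0 x (v y)"
    unfolding pairable_def by (elim exE conjE) (rule that)
  define h where "h = inv_into V0 g"
  have hg [simp]: "h (g x) = x" if "x \<in> V0" for x using that g_bij by (simp add: h_def bij_betw_def)
  have push: "skew_selfadjoint V b (\<lambda>y. g (c (h y))) \<and> square_zero V (\<lambda>y. g (c (h y)))"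
    if ca: "\<And>x y. c (x + y) = c x + c y" and cs: "\<And>r x. c (r *s x) = r *s c x"
      and cV: "\<And>x. x \<in> V0 \<Longrightarrow> c x \<in> V0" and cb: "\<And>x y. x \<in> V0 \<Longrightarrow> y \<in> V0 \<Longrightarrow> b0 (c x) y = - b0 x (c y)"
      and cc: "\<And>x. x \<in> V0 \<Longrightarrow> c (c x) = 0" for c
  proof -
    have "linear_map class_ring V V (\<lambda>y. g (c (h y)))"
    proof (intro linear_map.intro mod_hom.intro mod_hom_axioms.intro vsV V.module_axioms)
      have "g (c (h y)) \<in> carrier V" if yc: "y \<in> carrier V" for y
      proof -
        obtain x where "x \<in> V0" "y = g x" using yc by (auto simp: g_im)
        then show ?thesis using cV by simp
      qed
      moreover have "g (c (h (y \<oplus>\<^bsub>V\<^esub> z))) = g (c (h y)) \<oplus>\<^bsub>V\<^esub> g (c (h z))"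
        if yc: "y \<in> carrier V" "z \<in> carrier V" for y z
      proof -
        obtain x where "x \<in> V0" "y = g x" using yc by (auto simp: g_im)
        moreover obtain x' where "x' \<in> V0" "z = g x'" using yc by (auto simp: g_im)
        ultimately show ?thesis using cV by (simp add: ca flip: g_add)
      qed
      moreover have "g (c (h (r \<odot>\<^bsub>V\<^esub> y))) = r \<odot>\<^bsub>V\<^esub> g (c (h y))" if yc: "y \<in> carrier V" for r y
      proof -
        obtain x where "x \<in> V0" "y = g x" using yc by (auto simp: g_im)
        then show ?thesis using cV by (simp add: cs flip: g_scale)
      qed
      ultimately show "(\<lambda>y. g (c (h y))) \<in> LinearCombinations.module_hom class_ring V V"
        unfolding LinearCombinations.module_hom_def by simp
    qed
    then show ?thesis using cV cb cc by (auto simp: skew_selfadjoint_def square_zero_def g_im g_b g_0)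
  qed
  define e where "e = (inverse 2 :: 'f)"
  have e2: "e + e = 1" using two by (simp add: e_def flip: mult_2)
  have v_diff: "v (x - y) = v x - v y" for x y
  proof -
    have "v (x - y) = v (x + (- 1) *s y)" by simp
    then show ?thesis unfolding v(1)[rule_format] v(2)[rule_format] by simp
  qed
  define c1 where "c1 x = e *s (u0 x + v x)" for x
  define c2 where "c2 x = e *s (u0 x - v x)" for x
  have P1: "skew_selfadjoint V b (\<lambda>y. g (c1 (h y))) \<and> square_zero V (\<lambda>y. g (c1 (h y)))"
  proof (rule push)
    show "c1 (x + y) = c1 x + c1 y" for x y by (simp add: c1_def u_add v(1) scale_right_distrib add_ac)
    show "c1 (r *s x) = r *s c1 x" for r x
      by (simp add: c1_def u_scale v(2) scale_right_distrib[symmetric] mult.commute)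
    show "c1 x \<in> V0" if "x \<in> V0" for x using that v(3) by (simp add: c1_def)
    show "b0 (c1 x) y = - b0 x (c1 y)" if "x \<in> V0" "y \<in> V0" for x y
      using that v(4) by (simp add: c1_def bD b_skew algebra_simps)
    show "c1 (c1 x) = 0" if "x \<in> V0" for x
      using that v(3) by (simp add: c1_def u_add u_scale v(1,2) flip: scale_right_distrib)
  qed
  have P2: "skew_selfadjoint V b (\<lambda>y. g (c2 (h y))) \<and> square_zero V (\<lambda>y. g (c2 (h y)))"
  proof (rule push)
    show "c2 (x + y) = c2 x + c2 y" for x y by (simp add: c2_def u_add v(1) scale_right_distrib[symmetric])
    show "c2 (r *s x) = r *s c2 x" for r x
      by (simp add: c2_def u_scale v(2) scale_right_diff_distrib[symmetric] mult.commute)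
    show "c2 x \<in> V0" if "x \<in> V0" for x using that v(3) by (simp add: c2_def)
    show "b0 (c2 x) y = - b0 x (c2 y)" if "x \<in> V0" "y \<in> V0" for x y
      using that v(4) by (simp add: c2_def bD b_skew algebra_simps)
    show "c2 (c2 x) = 0" if "x \<in> V0" for x
      using that v(3) by (simp add: c2_def u_diff u_scale v(2) v_diff flip: scale_right_diff_distrib)
  qed
  have "u y = g (c1 (h y)) \<oplus>\<^bsub>V\<^esub> g (c2 (h y))" if yc: "y \<in> carrier V" for y
  proof -
    obtain x where x: "x \<in> V0" "y = g x" using yc by (auto simp: g_im)
    have "c1 x + c2 x = e *s (u0 x + u0 x)" by (simp add: c1_def c2_def flip: scale_right_distrib)
    also have "\<dots> = (e + e) *s u0 x" by (simp only: scale_right_distrib scale_left_distrib)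
    finally have "u0 x = c1 x + c2 x" by (simp add: e2)
    moreover have "c1 x \<in> V0" "c2 x \<in> V0" using x v(3) by (simp_all add: c1_def c2_def)
    ultimately show ?thesis using x by (simp add: g_u g_add)
  qed
  then show "sum_of_two_skew_square_zero V b u" unfolding sum_of_two_skew_square_zero_def using P1 P2
    by - (rule exI[of _ "\<lambda>y. g (c1 (h y))"], rule exI[of _ "\<lambda>y. g (c2 (h y))"], simp)
qed

end

text \<open>The trace-like form (q, a) \<mapsto> e_p(q a) is non-degenerate, because a nonzero class
  has an inverse and e_p(1) = 1. So every functional on F[t]/(p) is e_p of a multiple, which is the
  existence of the Hermitian invariant.\<close>

lemma functional_residue:
  fixes p :: "'f::field poly" and F :: "'f poly \<Rightarrow> 'f"
  assumes p: "Factorial_Ring.irreducible p"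
    and add: "\<And>q r. F (q + r) = F q + F r" and sc: "\<And>c q. F (Polynomial.smult c q) = c * F q"
    and van: "\<And>q. p dvd q \<Longrightarrow> F q = 0"
  shows "\<exists>a. \<forall>q. F q = coeff ((q * a) mod p) 0"
proof -
  interpret P: lin_space "Polynomial.smult :: 'f \<Rightarrow> 'f poly \<Rightarrow> 'f poly"
    by unfold_locales (simp_all add: smult_add_right smult_add_left)
  define \<beta> where "\<beta> q a = coeff ((q * a) mod p) 0" for q a :: "'f poly"
  have dp: "degree p > 0" using p by (rule irreducible_degree)
  define X where "X = {q::'f poly. degree q < degree p}"
  have bil: "P.bilform \<beta>"
    by (simp add: P.bilform_def \<beta>_def poly_mod_add_left mod_smult_left distrib_left distrib_right)
  have X: "P.fd X" unfolding P.fd_def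
  proof (intro conjI exI[of _ "monom 1 ` {..degree p}"] subsetI)
    show "P.subspace X" unfolding P.subspace_def X_def using dp
      by (auto intro: degree_add_less le_less_trans[OF degree_smult_le])
    fix q assume "q \<in> X"
    then have "degree q \<le> degree p" by (simp add: X_def)
    then have "q = (\<Sum>i\<le>degree p. monom (coeff q i) i)" by (simp add: poly_as_sum_of_monoms')
    also have "\<dots> = (\<Sum>i\<le>degree p. Polynomial.smult (coeff q i) (monom 1 i))" by (simp add: smult_monom)
    also have "\<dots> \<in> P.span (monom 1 ` {..degree p})"
      by (intro P.span_sum P.span_scale P.span_base) auto
    finally show "q \<in> P.span (monom 1 ` {..degree p})" .
  qed simp
  have nd: "q = 0" if q: "q \<in> X" "\<forall>a\<in>UNIV. \<beta> q a = 0" for q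
  proof (rule ccontr)
    assume "q \<noteq> 0"
    then have "\<not> p dvd q" using q(1) dvd_imp_degree_le[of p q] by (auto simp: X_def)
    then obtain r s where rs: "r * p + s * q = 1" using irreducible_bezout[OF p] by blast
    have "q * s mod p = (r * p + s * q) mod p" by (simp add: mult.commute)
    also have "\<dots> = 1" unfolding rs using dp by (simp add: mod_poly_less)
    finally have "\<beta> q s = 1" by (simp add: \<beta>_def)
    then show False using q(2) by simp
  qed
  have "\<exists>a\<in>UNIV. \<forall>q\<in>X. \<beta> q a = F q"
    by (rule P.functional_rep[OF bil X P.subspace_UNIV nd]) (simp_all add: add sc)
  then obtain a where a: "\<And>q. q \<in> X \<Longrightarrow> \<beta> q a = F q" by blast
  have "F q = coeff ((q * a) mod p) 0" for q
  proof -
    have "q mod p \<in> X" using dp degree_mod_less[of p q] by (cases "p = 0"; cases "q mod p = 0") (auto simp: X_def)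
    then have "F (q mod p) = coeff ((q mod p * a) mod p) 0" using a by (simp add: \<beta>_def)
    also have "(q mod p * a) mod p = (q * a) mod p" by (simp add: mod_mult_left_eq)
    also have "F (q mod p) = F q"
      using add[of "q mod p" "q div p * p"] van[of "q div p * p"] by (simp add: add.commute)
    finally show ?thesis .
  qed
  then show ?thesis by blast
qed

section \<open>Conditions (i) and (ii) for the given space\<close>

context realization
begin

text \<open>Chosen representatives are additive and multiplicative only modulo p, so they act
  correctly only modulo the denominator; the laws of \<open>presentation\<close> are stated up to
  \<open>D\<close> for this reason.\<close>

definition rp :: "'f poly \<Rightarrow> 'f poly set \<Rightarrow> 'f poly" where "rp p s = (SOME q. s = res p q)"

lemma rp: "s \<in> carrier (residue_field p) \<Longrightarrow> res p (rp p s) = s"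
proof -
  assume "s \<in> carrier (residue_field p)"
  then obtain q where "s = res p q" unfolding residue_carrier by (rule imageE)
  then have "s = res p (rp p s)" unfolding rp_def by (rule someI[of "\<lambda>q. s = res p q"])
  then show "res p (rp p s) = s" by (rule sym)
qed

lemma cl_cong:
  assumes "k \<ge> 1" "x \<in> ker V0 (p ^ k)" "res p q = res p r"
  shows "cl p k (pev q x) = cl p k (pev r x)"
  using dvd_jden[OF assms(1,2), of "q - r"] assms(3) ker_V0[OF assms(2)]
  by (simp add: res_eq cl_eq pev_diff)

lemma residue_pres:
  assumes p: "Factorial_Ring.irreducible p" and k: "k \<ge> 1"
  shows "presentation scale (residue_field p) (jordan_residue_space V u p k) (ker V0 (p ^ k))
    (jden V0 p k) (cl p k) (\<lambda>s. pev (rp p s)) (degree p)"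
proof (intro presentation.intro presentation_axioms.intro lin_space_axioms)
  let ?K = "ker V0 (p ^ k)" and ?L = "residue_field p"
  note cong = cl_cong[OF k]
  interpret L: field ?L by (rule residue_field_field[OF p])
  have resc: "res p q \<in> carrier ?L" for q by (simp add: residue_carrier)
  show "field ?L" by (rule residue_field_field[OF p])
  show "fd ?K" by (rule fd_ker[OF fV])
  show "0 < degree p" using p by (rule irreducible_degree)
  show "carrier (jordan_residue_space V u p k) = cl p k ` ?K"
    by (simp add: jordan_residue_space_def cl_carrier[OF k])
  show "cl p k (x + y) = cl p k x \<oplus>\<^bsub>jordan_residue_space V u p k\<^esub> cl p k y" if "x \<in> ?K" "y \<in> ?K" for x y
    using that by (simp add: jordan_residue_space_def cl_add ker_V0)
  show z: "\<zero>\<^bsub>jordan_residue_space V u p k\<^esub> = cl p k 0"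
    by (simp add: jordan_residue_space_def cl_zero[OF k])
  show "jden V0 p k = {x \<in> ?K. cl p k x = \<zero>\<^bsub>jordan_residue_space V u p k\<^esub>}"
  proof -
    have "cl p k x = cl p k 0 \<longleftrightarrow> x \<in> jden V0 p k" if "x \<in> ?K" for x
      using that by (simp add: cl_eq ker_V0)
    then show ?thesis unfolding z using jden_sub[of V0 p k] by (intro Set.set_eqI) (simp only: mem_Collect_eq, blast)
  qed
  show "pev (rp p s) x \<in> ?K" if "x \<in> ?K" for s x using that by (rule pev_ker)
  show "s \<odot>\<^bsub>jordan_residue_space V u p k\<^esub> cl p k x = cl p k (pev (rp p s) x)"
    if "s \<in> carrier ?L" "x \<in> ?K" for s x
    using cl_residue[OF k that(2), of "rp p s"] unfolding rp[OF that(1)] by (simp add: jordan_residue_space_def)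
  show "pev (rp p s) (x + y) = pev (rp p s) x + pev (rp p s) y" for s x y by (rule pev_add_arg)
  show "cl p k (pev (rp p (s \<oplus>\<^bsub>?L\<^esub> t)) x) = cl p k (pev (rp p s) x + pev (rp p t) x)"
    if st: "s \<in> carrier ?L" "t \<in> carrier ?L" and x: "x \<in> ?K" for s t x
  proof -
    have "res p (rp p (s \<oplus>\<^bsub>?L\<^esub> t)) = res p (rp p s + rp p t)"
      unfolding residue_add[symmetric] rp[OF st(1)] rp[OF st(2)] using st by (intro rp L.a_closed)
    then show ?thesis unfolding pev_add[symmetric] by (rule cong[OF x])
  qed
  show "cl p k (pev (rp p (s \<otimes>\<^bsub>?L\<^esub> t)) x) = cl p k (pev (rp p s) (pev (rp p t) x))"
    if st: "s \<in> carrier ?L" "t \<in> carrier ?L" and x: "x \<in> ?K" for s t x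
  proof -
    have "res p (rp p (s \<otimes>\<^bsub>?L\<^esub> t)) = res p (rp p s * rp p t)"
      unfolding residue_mult[symmetric] rp[OF st(1)] rp[OF st(2)] using st by (intro rp L.m_closed)
    then show ?thesis unfolding pev_mult[symmetric] by (rule cong[OF x])
  qed
  show "cl p k (pev (rp p \<one>\<^bsub>?L\<^esub>) x) = cl p k x" if x: "x \<in> ?K" for x
    using cong[OF x, of "rp p \<one>\<^bsub>?L\<^esub>" 1] rp[OF resc[of 1]] by (simp add: residue_one)
  show "\<exists>s\<in>carrier ?L. \<forall>x\<in>?K. cl p k (c *s x) = cl p k (pev (rp p s) x)" for c
  proof (intro bexI[of _ "res p [:c:]"] ballI)
    fix x assume x: "x \<in> ?K"
    show "cl p k (c *s x) = cl p k (pev (rp p (res p [:c:])) x)"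
      using cong[OF x, of "rp p (res p [:c:])" "[:c:]"] rp[OF resc[of "[:c:]"]] by simp
  qed (rule resc)
  show "dim {pev (rp p s) x + y |s y. s \<in> carrier ?L \<and> y \<in> P} = dim P + degree p"
    if P: "subspace P" "jden V0 p k \<subseteq> P" "P \<subseteq> ?K"
      and st: "\<And>s y. s \<in> carrier ?L \<Longrightarrow> y \<in> P \<Longrightarrow> pev (rp p s) y \<in> P" and x: "x \<in> ?K" "x \<notin> P" for P x
  proof -
    \<comment> \<open>A polynomial and the chosen representative of its class differ by a multiple
      of p, which sends the numerator into \<open>jden V0 p k\<close> and thus into
      \<open>P\<close>. So stability under representatives is stability under all
      polynomials.\<close>
    have near: "pev q y - pev (rp p (res p q)) y \<in> jden V0 p k" if "y \<in> ?K" for q y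
      using dvd_jden[OF k that, of "q - rp p (res p q)"] rp[OF resc[of q], symmetric]
      unfolding pev_diff res_eq .
    have stP: "pev q y \<in> P" if y: "y \<in> P" for q y
    proof -
      have "pev (rp p (res p q)) y + (pev q y - pev (rp p (res p q)) y) \<in> P"
        by (rule subspace_add[OF P(1) st[OF resc y] subsetD[OF P(2) near]]) (use y P in blast)
      then show ?thesis by simp
    qed
    have "ustable P" unfolding ustable_def using stP[of _ "[:0, 1:]"] by simp
    have "{pev (rp p s) x + y |s y. s \<in> carrier ?L \<and> y \<in> P} = ssum P (cyc x)"
    proof (intro Set.set_eqI iffI)
      fix z assume "z \<in> {pev (rp p s) x + y |s y. s \<in> carrier ?L \<and> y \<in> P}"
      then obtain s y where "z = y + pev (rp p s) x" "y \<in> P" by (auto simp: add.commute)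
      then show "z \<in> ssum P (cyc x)" by (auto intro: ssum_mem)
    next
      fix z assume "z \<in> ssum P (cyc x)"
      then obtain y q where h: "z = y + pev q x" "y \<in> P" unfolding ssum_def cyc_def by blast
      have "z = pev (rp p (res p q)) x + (y + (pev q x - pev (rp p (res p q)) x))" using h by simp
      moreover have "y + (pev q x - pev (rp p (res p q)) x) \<in> P"
        by (rule subspace_add[OF P(1) h(2) subsetD[OF P(2) near[OF x(1)]]])
      ultimately show "z \<in> {pev (rp p s) x + y |s y. s \<in> carrier ?L \<and> y \<in> P}" using resc by blast
    qed
    then show ?thesis
      using step_dim[OF p fd_mono[OF fd_ker[OF fV] P(1,3)] \<open>ustable P\<close> x(2)] P(2) p_jden[OF k x(1)]
      by auto
  qed
qed

lemma condII_link:
  assumes p: "Factorial_Ring.irreducible p" and k: "k \<ge> 1"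
  shows "even (jordan_number V u p k) \<longleftrightarrow> condII V0 p k"
proof -
  interpret R: presentation scale "residue_field p" "jordan_residue_space V u p k" "ker V0 (p ^ k)"
    "jden V0 p k" "cl p k" "\<lambda>s. pev (rp p s)" "degree p" by (rule residue_pres[OF p k])
  have d: "jordan_number V u p k * degree p + dim (jden V0 p k) = dim (ker V0 (p ^ k))"
    unfolding jordan_number_def by (rule R.X_dim(2))
  show ?thesis
  proof
    assume "even (jordan_number V u p k)"
    then obtain m where "jordan_number V u p k = 2 * m" by blast
    then show "condII V0 p k" unfolding condII_def d[symmetric] by (intro exI[of _ m]) simp
  next
    assume "condII V0 p k"
    then obtain m where "dim (ker V0 (p ^ k)) = dim (jden V0 p k) + 2 * degree p * m"
      unfolding condII_def by blast
    then have "jordan_number V u p k * degree p = (2 * m) * degree p" using d by auto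
    then have "jordan_number V u p k = 2 * m" using irreducible_degree[OF p] by simp
    then show "even (jordan_number V u p k)" by simp
  qed
qed

text \<open>Hyperbolicity only asks where the Hermitian form vanishes, and e_p detects this on the
  whole line over the residue field spanned by the second argument. The equivalence replaces any
  computation with values of the form.\<close>

lemma hermitian_zero:
  assumes p: "p \<in> Irr0" and k: "k \<ge> 1" and x: "x \<in> ker V0 (p ^ k)" and y: "y \<in> ker V0 (p ^ k)"
  shows "hermitian_invariant V b u p k (cl p k x) (cl p k y) = \<zero>\<^bsub>residue_field p\<^esub> \<longleftrightarrow>
    (\<forall>q. b0 x (pev (p ^ (k - 1)) (pev q y)) = 0)"
proof -
  have irr: "Factorial_Ring.irreducible p" using p by (auto simp: Irr0_def Irr_def)
  have ep: "epol p" using irr0_negp[OF p] by (auto simp: epol_def)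
  have dp: "degree p > 0" using irr by (rule irreducible_degree)
  define F where "F q = b0 x (pev (p ^ (k - 1)) (pev q y))" for q
  have ind: "induced_form V b u p k (cl p k x) (res p q \<odot>\<^bsub>jordan_residue_space V u p k\<^esub> cl p k y) = F q" for q
    using cl_residue[OF k y, of q] induced[OF ep x pev_ker[OF y, of q]]
    by (simp add: jordan_residue_space_def F_def)
  have "\<exists>a. \<forall>q. F q = coeff ((q * a) mod p) 0"
  proof (rule functional_residue[OF irr])
    show "F (q + r) = F q + F r" for q r by (simp add: F_def pev_add pev_add_arg bD)
    show "F (Polynomial.smult c q) = c * F q" for c q
      using pev_mult[of "[:c:]" q y] by (simp add: F_def pev_scale_arg bD)
    show "F q = 0" if "p dvd q" for q unfolding F_def by (rule jden_perp(1)[OF ep dvd_jden[OF k y that] x])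
  qed
  then obtain a where a: "\<And>q. F q = coeff ((q * a) mod p) 0" by blast
  let ?P = "\<lambda>z. z \<in> carrier (residue_field p) \<and> (\<forall>c\<in>carrier (residue_field p).
    induced_form V b u p k (cl p k x) (c \<odot>\<^bsub>jordan_residue_space V u p k\<^esub> cl p k y) =
    e_form p (c \<otimes>\<^bsub>residue_field p\<^esub> z))"
  have P: "?P (res p r) \<longleftrightarrow> (\<forall>q. F q = coeff ((q * r) mod p) 0)" for r
    by (simp add: residue_carrier residue_mult ind e_form_coset[OF dp])
  \<comment> \<open>Uniqueness for the definite description: if r - r' were nonzero modulo p,
    multiplying by its inverse would give the class of 1, on which e_p is 1.\<close>
  have uniq: "res p r = res p r'"
    if r: "\<And>q. coeff ((q * r) mod p) 0 = coeff ((q * r') mod p) 0" for r r'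
  proof (rule ccontr)
    assume "res p r \<noteq> res p r'"
    then have "\<not> p dvd (r - r')" by (simp only: res_eq not_False_eq_True)
    then obtain c s where rs: "c * p + s * (r - r') = 1" using irreducible_bezout[OF irr] by blast
    have "coeff ((s * (r - r')) mod p) 0 = 0"
      using r[of s] by (simp add: right_diff_distrib poly_mod_diff_left)
    moreover have "(s * (r - r')) mod p = (c * p + s * (r - r')) mod p" by simp
    ultimately show False unfolding rs using dp by (simp add: mod_poly_less)
  qed
  have H: "hermitian_invariant V b u p k (cl p k x) (cl p k y) = res p a" unfolding hermitian_invariant_def
  proof (rule the_equality)
    show "?P (res p a)" unfolding P using a by blast
    show "z = res p a" if z: "?P z" for z
    proof -
      obtain r where r: "z = res p r" using z by (auto simp: residue_carrier)
      have "\<forall>q. F q = coeff ((q * r) mod p) 0" using z unfolding r P .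
      then show ?thesis unfolding r using a by (intro uniq) metis
    qed
  qed
  show ?thesis
  proof
    assume "hermitian_invariant V b u p k (cl p k x) (cl p k y) = \<zero>\<^bsub>residue_field p\<^esub>"
    then have "p dvd a" unfolding H residue_zero res_eq by simp
    then have "F q = 0" for q unfolding a by (simp add: dvd_imp_mod_0)
    then show "\<forall>q. b0 x (pev (p ^ (k - 1)) (pev q y)) = 0" by (simp add: F_def)
  next
    assume "\<forall>q. b0 x (pev (p ^ (k - 1)) (pev q y)) = 0"
    then have "F q = 0" for q by (simp add: F_def)
    then have "res p a = res p 0" using a by (intro uniq) simp
    then show "hermitian_invariant V b u p k (cl p k x) (cl p k y) = \<zero>\<^bsub>residue_field p\<^esub>"
      unfolding H residue_zero .
  qed
qed

text \<open>The rank formula applied to the form b(x, p(u)^(k-1) y), whose radical on Ker p(u)^k is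
  \<open>jden V0 p k\<close>.\<close>

lemma dim_kperp:
  assumes ep: "epol p" and M: "subspace M" "jden V0 p k \<subseteq> M" "M \<subseteq> ker V0 (p ^ k)"
  shows "dim {x \<in> ker V0 (p ^ k). \<forall>y\<in>M. b0 x (pev (p ^ (k - 1)) y) = 0} + dim M =
    dim (ker V0 (p ^ k)) + dim (jden V0 p k)"
proof -
  let ?K = "ker V0 (p ^ k)"
  define \<beta> where "\<beta> y x = b0 x (pev (p ^ (k - 1)) y)" for x y
  have bil: "bilform \<beta>" by (simp add: bilform_def \<beta>_def bD pev_add_arg pev_scale_arg)
  have "{m \<in> M. \<forall>x\<in>?K. \<beta> m x = 0} = jden V0 p k"
  proof (intro Set.set_eqI iffI)
    fix m assume m: "m \<in> {m \<in> M. \<forall>x\<in>?K. \<beta> m x = 0}"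
    then have mK: "m \<in> ?K" using M by auto
    have "\<exists>w\<in>V0. pev (p ^ (k - 1)) m = pev (negp (p ^ k)) w"
    proof (rule perp_ker[OF goodV])
      show "pev (p ^ (k - 1)) m \<in> V0" using ker_V0[OF mK] by simp
      show "b0 (pev (p ^ (k - 1)) m) x = 0" if "x \<in> V0" "pev (p ^ k) x = 0" for x
        using m that b_sym[of x "pev (p ^ (k - 1)) m"] by (simp add: \<beta>_def ker_def)
    qed
    then obtain w where w: "w \<in> V0" "pev (p ^ (k - 1)) m = pev (negp (p ^ k)) w" by blast
    have "\<exists>z\<in>V0. pev (p ^ (k - 1)) m = pev (p ^ k) z" using epol_pow[OF ep, of k] w
      by (elim disjE) (auto simp: pev_minus pev_minus_arg[symmetric] intro: bexI[of _ w] bexI[of _ "- w"])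
    then show "m \<in> jden V0 p k" using mK by (simp add: jden_def)
  next
    fix m assume m: "m \<in> jden V0 p k"
    then show "m \<in> {m \<in> M. \<forall>x\<in>?K. \<beta> m x = 0}"
      using M(2) jden_perp(1)[OF ep m] by (auto simp: \<beta>_def)
  qed
  then show ?thesis using dim_perp[OF bil fd_ker[OF fV] M(1,3)] by (simp add: \<beta>_def)
qed

text \<open>By \<open>dim_kperp\<close>, an isotropic subspace between denominator and numerator has
  half dimension in the quotient exactly when it is its own orthogonal.\<close>

lemma condI_link:
  assumes p: "p \<in> Irr0" and k: "k \<ge> 1"
  shows "hyperbolic (residue_field p) (jordan_residue_space V u p k) (hermitian_invariant V b u p k)
    \<longleftrightarrow> condI V0 p k"
proof -
  have irr: "Factorial_Ring.irreducible p" using p by (auto simp: Irr0_def Irr_def)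
  have ep: "epol p" using irr0_negp[OF p] by (auto simp: epol_def)
  have dp: "degree p > 0" using irr by (rule irreducible_degree)
  let ?K = "ker V0 (p ^ k)" and ?D = "jden V0 p k" and ?X = "jordan_residue_space V u p k"
  let ?L = "residue_field p" and ?perp = "\<lambda>M. {x \<in> ker V0 (p ^ k). \<forall>y\<in>M. b0 x (pev (p ^ (k - 1)) y) = 0}"
  interpret R: presentation scale ?L ?X ?K ?D "cl p k" "\<lambda>s. pev (rp p s)" "degree p"
    by (rule residue_pres[OF irr k])
  have sK: "subspace ?K" by (rule subspace_ker[OF sV])
  show ?thesis
  proof
    assume "hyperbolic ?L ?X (hermitian_invariant V b u p k)"
    then obtain m W where h: "vectorspace.dim ?L ?X = 2 * m"
      "totally_isotropic ?L ?X (hermitian_invariant V b u p k) W"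
      "vectorspace.dim ?L (?X\<lparr>carrier := W\<rparr>) = m" unfolding hyperbolic_def by blast
    have W: "VectorSpace.subspace ?L W ?X"
      "\<And>x y. x \<in> W \<Longrightarrow> y \<in> W \<Longrightarrow> hermitian_invariant V b u p k x y = \<zero>\<^bsub>?L\<^esub>"
      using h(2) by (auto simp: totally_isotropic_def)
    have sm: "submodule ?L W ?X" using W(1) by (simp add: VectorSpace.subspace_def)
    define M where "M = R.pre W"
    note M = R.pre_submodule[OF sm, folded M_def]
    have MW: "x \<in> ?K" "cl p k x \<in> W" if "x \<in> M" for x using that by (auto simp: M_def R.pre_def)
    have dM: "m * degree p + dim ?D = dim M" using R.sub_dim(2)[OF W(1)] h(3) by (simp add: M_def)
    have dK: "2 * m * degree p + dim ?D = dim ?K" using R.X_dim(2) h(1) by simp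
    have iso: "b0 x (pev (p ^ (k - 1)) (pev q y)) = 0" if "x \<in> M" "y \<in> M" for x y q
      using hermitian_zero[OF p k MW(1)[OF that(1)] MW(1)[OF that(2)]] W(2) MW(2) that by blast
    have sub: "M \<subseteq> ?perp M" using iso[of _ _ 1] MW(1) by auto
    have sP: "subspace (?perp M)" using sK unfolding subspace_def by (auto simp: bD)
    have "dim (?perp M) = dim M" using dim_kperp[OF ep M(1-3)] dM dK by simp
    then have "M = ?perp M" using dim_eq_fd[OF fd_mono[OF fd_ker[OF fV] sP] M(1) sub] by auto
    \<comment> \<open>Vanishing of the Hermitian form covers all polynomial multiples, so u x is
      orthogonal to \<open>M\<close> as well and returns to \<open>M\<close>.\<close>
    moreover have "u0 x \<in> M" if x: "x \<in> M" for x
    proof -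
      have "u0 x \<in> ?perp M"
      proof (intro CollectI conjI ballI)
        show "u0 x \<in> ?K" using pev_ker[OF MW(1)[OF x], of "[:0, 1:]"] by simp
        fix y assume "y \<in> M"
        then have "b0 x (pev (p ^ (k - 1)) (u0 y)) = 0" using iso[OF x, of y "[:0, 1:]"] by simp
        then show "b0 (u0 x) (pev (p ^ (k - 1)) y) = 0" by (simp add: b_skew pev_u)
      qed
      then show ?thesis using equalityD2[OF \<open>M = ?perp M\<close>] by blast
    qed
    ultimately show "condI V0 p k" unfolding condI_def ustable_def using M(1)
      by - (rule exI[of _ M], intro conjI ballI)
  next
    assume "condI V0 p k"
    then obtain M where M: "subspace M" "ustable M" "M = ?perp M"
      unfolding condI_def by (elim exE conjE) (rule that)
    have MK: "M \<subseteq> ?K" using M(3) by blast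
    have iso: "b0 x (pev (p ^ (k - 1)) y) = 0" if "x \<in> M" "y \<in> M" for x y using that M(3) by blast
    \<comment> \<open>A subspace equal to its own orthogonal contains the radical, so it is the full
      preimage of its image in the quotient.\<close>
    have DM: "?D \<subseteq> M"
    proof
      fix d assume d: "d \<in> ?D"
      have "d \<in> ?perp M" using subsetD[OF jden_sub d] jden_perp(2)[OF ep d] MK by auto
      then show "d \<in> M" using equalityD2[OF M(3)] by blast
    qed
    have st: "pev q y \<in> M" if "y \<in> M" for q y using pev_stable[OF M(1,2) that] .
    note W = R.image_subspace[OF M(1) DM MK st]
    have "dim (?perp M) + dim M = dim ?K + dim ?D" by (rule dim_kperp[OF ep M(1) DM MK])
    then have d1: "dim M + dim M = dim ?K + dim ?D" using M(3) by simp
    define m where "m = vectorspace.dim ?L (?X\<lparr>carrier := cl p k ` M\<rparr>)"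
    have d2: "m * degree p + dim ?D = dim M" using R.sub_dim(2)[OF W(1)] W(2) by (simp add: m_def)
    have "vectorspace.dim ?L ?X * degree p + dim ?D = dim ?K" by (rule R.X_dim(2))
    then have "vectorspace.dim ?L ?X * degree p = (2 * m) * degree p"
      using d1 d2 unfolding mult.assoc by linarith
    then have "vectorspace.dim ?L ?X = 2 * m" using dp by simp
    moreover have "totally_isotropic ?L ?X (hermitian_invariant V b u p k) (cl p k ` M)"
      unfolding totally_isotropic_def
    proof (intro conjI ballI W(1))
      fix X Y assume "X \<in> cl p k ` M" "Y \<in> cl p k ` M"
      then obtain x y where xy: "x \<in> M" "y \<in> M" "X = cl p k x" "Y = cl p k y" by blast
      have "\<forall>q. b0 x (pev (p ^ (k - 1)) (pev q y)) = 0" using iso[OF xy(1) st[OF xy(2)]] by blast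
      then show "hermitian_invariant V b u p k X Y = \<zero>\<^bsub>?L\<^esub>"
        unfolding xy using hermitian_zero[OF p k] MK xy by blast
    qed
    ultimately show "hyperbolic ?L ?X (hermitian_invariant V b u p k)"
      unfolding hyperbolic_def m_def by blast
  qed
qed

end

section \<open>Condition (iii): the form on the image of a power of a nilpotent u\<close>

context skew_space
begin

text \<open>Numerator of V_{t,2i+1}; \<open>denodd\<close> is the corresponding denominator, the
  instance of \<open>jden\<close> for p = t with the powers of u written out.\<close>

definition kerodd :: "'b set \<Rightarrow> nat \<Rightarrow> 'b set" where
  "kerodd N i = {x\<in>N. (u ^^ (2 * i + 1)) x = 0}"

definition denodd :: "'b set \<Rightarrow> nat \<Rightarrow> 'b set" where
  "denodd N i = {x\<in>kerodd N i. \<exists>z\<in>N. (u ^^ (2 * i)) x = (u ^^ (2 * i + 1)) z}"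

text \<open>Im u^i \<inter> Ker u^i, which is the radical of the restriction of b to Im u^i when
  \<open>N\<close> is non-degenerate.\<close>

definition imker :: "'b set \<Rightarrow> nat \<Rightarrow> 'b set" where
  "imker N i = {x\<in>N. (u ^^ i) x = 0 \<and> (\<exists>z\<in>N. x = (u ^^ i) z)}"

lemma subspace_kerodd: "subspace N \<Longrightarrow> subspace (kerodd N i)"
  unfolding subspace_def kerodd_def by (auto simp: upow_add upow_scale simp del: funpow.simps)

lemma subspace_imker:
  assumes N: "subspace N" shows "subspace (imker N i)"
proof -
  have "imker N i = {x\<in>N. pev ([:0, 1:] ^ i) x = 0} \<inter> (N \<inter> (u ^^ i) ` N)"
    unfolding imker_def upow_pev by auto
  then show ?thesis
    using subspace_inter[OF subspace_ker_pev[OF N] subspace_inter[OF N subspace_upow_image[OF N]]] by simp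
qed

text \<open>The orthogonal of Ker u^(2i+1) is Im u^(2i+1), so a radical vector satisfies the
  defining condition of the denominator.\<close>

lemma denodd_radical:
  assumes N: "good N" and x: "x \<in> kerodd N i" and h: "\<And>y. y \<in> kerodd N i \<Longrightarrow> b x ((u ^^ (2 * i)) y) = 0"
  shows "x \<in> denodd N i"
proof -
  let ?q = "[:0, 1:] ^ (2 * i + 1) :: 'a poly"
  have xN: "x \<in> N" using x by (simp add: kerodd_def)
  have "\<exists>w\<in>N. (u ^^ (2 * i)) x = pev (negp ?q) w"
  proof (rule perp_ker[OF N])
    show "(u ^^ (2 * i)) x \<in> N" using upow_in[OF goodD(2,3)[OF N] xN] .
    fix y assume y: "y \<in> N" "pev ?q y = 0"
    then have "y \<in> kerodd N i" unfolding kerodd_def by (simp only: pev_X_power mem_Collect_eq)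
    then show "b ((u ^^ (2 * i)) x) y = 0" using h unfolding upow_adj by simp
  qed
  then obtain w where w: "w \<in> N" "(u ^^ (2 * i)) x = pev (negp ?q) w" by blast
  have "negp ?q = - ?q" unfolding negp_power negp_X by (subst power_minus_odd) simp_all
  then have "(u ^^ (2 * i)) x = (u ^^ (2 * i + 1)) (- w)"
    unfolding w(2) by (simp only: pev_minus pev_minus_arg pev_X_power[symmetric])
  then show ?thesis unfolding denodd_def using x subspace_neg[OF goodD(2)[OF N] w(1)] by blast
qed

end

text \<open>\<open>C i\<close> is a complement of the denominator in the numerator and so a concrete
  model of V_{t,2i+1}; these models replace a Jordan basis.\<close>

locale nil_space = skew_space scale b u
  for scale :: "'a::field \<Rightarrow> 'b::ab_group_add \<Rightarrow> 'b"  (infixr \<open>*s\<close> 75)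
    and b :: "'b \<Rightarrow> 'b \<Rightarrow> 'a" and u :: "'b \<Rightarrow> 'b" +
  fixes N :: "'b set" and n :: nat and C :: "nat \<Rightarrow> 'b set"
  assumes goodN: "good N" and nil: "x \<in> N \<Longrightarrow> (u ^^ n) x = 0"
    and C_sub: "subspace (C i)" and C_ker: "C i \<subseteq> kerodd N i" and C_den: "C i \<inter> denodd N i = {0}"
    and C_sum: "ssum (C i) (denodd N i) = kerodd N i"
begin

abbreviation "Kn \<equiv> kerodd N"
abbreviation "Jn \<equiv> imker N"

lemma fN: "fd N" and sN: "subspace N" and uN: "ustable N" using goodD[OF goodN] by auto

lemma upN: "x \<in> N \<Longrightarrow> (u ^^ i) x \<in> N" by (rule upow_in[OF sN uN])

lemma Kn_N: "x \<in> Kn i \<Longrightarrow> x \<in> N" and Kn_0: "x \<in> Kn i \<Longrightarrow> 2 * i + 1 \<le> j \<Longrightarrow> (u ^^ j) x = 0"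
  using upow_zero_mono[of "2 * i + 1" x j] unfolding kerodd_def by (simp_all del: funpow.simps)

lemma C_K: "x \<in> C i \<Longrightarrow> x \<in> Kn i" using C_ker by blast

lemma Jn_im: "x \<in> Jn i \<Longrightarrow> i \<le> j \<Longrightarrow> b x ((u ^^ j) y) = 0"
  unfolding upow_adj' using upow_zero_mono[of i x j] by (simp add: imker_def bD)

lemma Jn_K: "x \<in> Jn i \<Longrightarrow> y \<in> Kn j \<Longrightarrow> b x ((u ^^ j) y) = 0"
proof (cases "i \<le> j")
  case False
  assume "x \<in> Jn i" and y: "y \<in> Kn j"
  then obtain z where "x = (u ^^ i) z" by (auto simp: imker_def)
  moreover have "(u ^^ (i + j)) y = 0" by (rule Kn_0[OF y]) (use False in simp)
  ultimately show ?thesis by (simp add: upow_adj upow_upow bD)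
qed (rule Jn_im)

lemma Jn_Jn: "x \<in> Jn i \<Longrightarrow> y \<in> Jn j \<Longrightarrow> b x y = 0"
proof -
  have *: "b x y = 0" if "x \<in> Jn i" "y \<in> Jn j" "i \<le> j" for x y i j
    using that Jn_im[OF that(1,3)] by (auto simp: imker_def)
  assume "x \<in> Jn i" "y \<in> Jn j"
  then show ?thesis using *[of x i y j] *[of y j x i] b_sym[of x y] by (cases "i \<le> j") auto
qed

lemma Kn_Kn: "x \<in> Kn i \<Longrightarrow> y \<in> Kn j \<Longrightarrow> i \<noteq> j \<Longrightarrow> b ((u ^^ i) x) ((u ^^ j) y) = 0"
proof -
  have *: "b ((u ^^ i) x) ((u ^^ j) y) = 0" if h: "x \<in> Kn i" "y \<in> Kn j" "i < j" for x y i j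
  proof -
    have "(u ^^ (j + i)) x = 0" by (rule Kn_0[OF h(1)]) (use h in simp)
    then show ?thesis by (simp add: upow_adj' upow_upow bD)
  qed
  assume "x \<in> Kn i" "y \<in> Kn j" "i \<noteq> j"
  then show ?thesis
    using *[of x i y j] *[of y j x i] b_sym[of "(u ^^ i) x" "(u ^^ j) y"] by (cases "i < j") auto
qed

lemma Kn_Kn_same: "b ((u ^^ i) x) ((u ^^ i) y) = (- 1) ^ i * b x ((u ^^ (2 * i)) y)"
  by (simp add: upow_adj upow_upow mult_2)

definition gs :: "(nat \<Rightarrow> 'b set) \<Rightarrow> nat \<Rightarrow> 'b set" where
  "gs F m = {\<Sum>i\<in>{m..<n}. f i |f. \<forall>i. f i \<in> F i}"

lemma gs_sub:
  assumes F: "\<And>i. subspace (F i)" shows "subspace (gs F m)"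
proof (rule subspaceI)
  show "0 \<in> gs F m" unfolding gs_def
    by (intro CollectI exI[of _ "\<lambda>_. 0"]) (simp add: subspace_0[OF F])
  fix x assume "x \<in> gs F m"
  then obtain f where f: "x = (\<Sum>i\<in>{m..<n}. f i)" "\<forall>i. f i \<in> F i" unfolding gs_def by blast
  show "c *s x \<in> gs F m" for c unfolding gs_def
    by (intro CollectI exI[of _ "\<lambda>i. c *s f i"]) (simp add: f scale_sum_right subspace_scale[OF F])
  fix y assume "y \<in> gs F m"
  then obtain h where h: "y = (\<Sum>i\<in>{m..<n}. h i)" "\<forall>i. h i \<in> F i" unfolding gs_def by blast
  show "x + y \<in> gs F m" unfolding gs_def
    by (intro CollectI exI[of _ "\<lambda>i. f i + h i"]) (simp add: f h sum.distrib subspace_add[OF F])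
qed

lemma gs_mem:
  assumes F: "\<And>i. subspace (F i)" and x: "x \<in> F i" "m \<le> i" "i < n" shows "x \<in> gs F m"
  unfolding gs_def
proof (intro CollectI exI[of _ "\<lambda>j. if j = i then x else 0"] conjI allI)
  show "x = (\<Sum>j\<in>{m..<n}. if j = i then x else 0)" using x by simp
  show "(if j = i then x else 0) \<in> F j" for j using x by (simp add: subspace_0[OF F])
qed

lemma gs_least: "subspace Y \<Longrightarrow> (\<And>i. m \<le> i \<Longrightarrow> i < n \<Longrightarrow> F i \<subseteq> Y) \<Longrightarrow> gs F m \<subseteq> Y"
  unfolding gs_def by (auto intro!: subspace_sum) blast

lemma b_sum_left: "b (\<Sum>i\<in>A. f i) y = (\<Sum>i\<in>A. b (f i) y)"
  by (induction A rule: infinite_finite_induct) (simp_all add: bD)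

lemma b_sum_right: "b y (\<Sum>i\<in>A. f i) = (\<Sum>i\<in>A. b y (f i))"
  by (induction A rule: infinite_finite_induct) (simp_all add: bD)

lemma gs_perp: "x \<in> gs F m \<Longrightarrow> (\<And>i z. m \<le> i \<Longrightarrow> z \<in> F i \<Longrightarrow> b z y = 0) \<Longrightarrow> b x y = 0"
  unfolding gs_def by (auto simp: b_sum_left intro!: sum.neutral)

text \<open>All three collect indices from m on. \<open>Sn\<close> gathers radicals and is totally
  isotropic; \<open>Pn\<close> is orthogonal to it and carries the orthogonal sum of the forms
  (-1)^i (b,u)_{t,2i+1}; \<open>Tn\<close> lies in their sum by \<open>Tn_dec\<close>.\<close>

definition "Sn = gs Jn"
definition "Pn = gs (\<lambda>i. (u ^^ i) ` C i)"
definition "Tn = gs (\<lambda>i. (u ^^ i) ` Kn i)"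

lemma sub_Sn: "subspace (Sn m)" unfolding Sn_def by (rule gs_sub) (rule subspace_imker[OF sN])
lemma sub_Pn: "subspace (Pn m)" unfolding Pn_def by (rule gs_sub) (rule subspace_upow_image[OF C_sub])
lemma sub_Tn: "subspace (Tn m)" unfolding Tn_def
  by (rule gs_sub) (rule subspace_upow_image[OF subspace_kerodd[OF sN]])

lemma Pn_im: "Pn m \<subseteq> (u ^^ m) ` N"
proof -
  have "(u ^^ i) ` C i \<subseteq> (u ^^ m) ` N" if "m \<le> i" for i
  proof
    fix y assume "y \<in> (u ^^ i) ` C i"
    then obtain x where x: "x \<in> C i" "y = (u ^^ i) x" by blast
    have "y = (u ^^ m) ((u ^^ (i - m)) x)" using x that by (simp add: upow_upow)
    then show "y \<in> (u ^^ m) ` N" using upN[OF Kn_N[OF C_K[OF x(1)]]] by blast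
  qed
  then show ?thesis unfolding Pn_def by (intro gs_least subspace_upow_image[OF sN]) auto
qed

lemma Sn_im: "Sn m \<subseteq> (u ^^ m) ` N"
proof -
  have "Jn i \<subseteq> (u ^^ m) ` N" if "m \<le> i" for i
  proof
    fix y assume "y \<in> Jn i"
    then obtain x where x: "x \<in> N" "y = (u ^^ i) x" by (auto simp: imker_def)
    have "y = (u ^^ m) ((u ^^ (i - m)) x)" using x that by (simp add: upow_upow)
    then show "y \<in> (u ^^ m) ` N" using upN[OF x(1)] by blast
  qed
  then show ?thesis unfolding Sn_def by (intro gs_least subspace_upow_image[OF sN]) auto
qed

lemma fd_Pn: "fd (Pn m)" using fd_mono[OF fN sub_Pn] order_trans[OF Pn_im upow_image_sub[OF sN uN]] by blast

lemma Sn_Sn: "x \<in> Sn m \<Longrightarrow> y \<in> Sn m' \<Longrightarrow> b x y = 0" unfolding Sn_def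
proof (erule gs_perp)
  fix i z assume y: "y \<in> gs Jn m'" and z: "z \<in> Jn i"
  have "b y z = 0" by (rule gs_perp[OF y]) (rule Jn_Jn[OF _ z])
  then show "b z y = 0" by (simp add: b_sym)
qed

lemma Sn_K: "x \<in> Sn m \<Longrightarrow> y \<in> Kn j \<Longrightarrow> b x ((u ^^ j) y) = 0"
  unfolding Sn_def by (erule gs_perp) (rule Jn_K)

lemma Sn_Pn: "x \<in> Sn m \<Longrightarrow> y \<in> Pn m' \<Longrightarrow> b x y = 0" unfolding Pn_def
proof -
  assume x: "x \<in> Sn m" and y: "y \<in> gs (\<lambda>i. (u ^^ i) ` C i) m'"
  have "b y x = 0"
  proof (rule gs_perp[OF y])
    fix i z assume "z \<in> (u ^^ i) ` C i"
    then show "b z x = 0" using Sn_K[OF x C_K] b_sym[of z x] by auto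
  qed
  then show "b x y = 0" by (simp add: b_sym)
qed

lemma Jn_Sn: "x \<in> Jn i \<Longrightarrow> m \<le> i \<Longrightarrow> x \<in> Sn m"
proof (cases "i < n")
  case True
  assume "x \<in> Jn i" "m \<le> i"
  then show ?thesis unfolding Sn_def by (rule gs_mem[OF subspace_imker[OF sN] _ _ True])
next
  case False
  assume "x \<in> Jn i"
  then obtain z where "z \<in> N" "x = (u ^^ i) z" by (auto simp: imker_def)
  then have "x = 0" using nil upow_zero_mono[of n z i] False by simp
  then show ?thesis by (simp add: subspace_0[OF sub_Sn])
qed

text \<open>With z from the definition of the denominator, u^i x = u^i (x - u z) + u^(i+1) z, and
  the two terms lie in the radicals of index i and i + 1.\<close>

lemma den_Sn:
  assumes x: "x \<in> denodd N i" and m: "m \<le> i" shows "(u ^^ i) x \<in> Sn m"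
proof -
  obtain z where z: "z \<in> N" "(u ^^ (2 * i)) x = (u ^^ (2 * i + 1)) z" and xK: "x \<in> Kn i"
    using x unfolding denodd_def by blast
  have xN: "x \<in> N" by (rule Kn_N[OF xK])
  have uz: "u z \<in> N" using z uN by (simp add: ustable_def)
  have d: "x - u z \<in> N" by (rule subspace_diff[OF sN xN uz])
  have us: "(u ^^ j) (u z) = (u ^^ (j + 1)) z" for j using upow_upow[of j 1 z] by simp
  have uu: "(u ^^ i) ((u ^^ i) y) = (u ^^ (2 * i)) y" for y by (simp add: upow_upow mult_2)
  have "(u ^^ i) ((u ^^ i) (x - u z)) = 0" unfolding uu unfolding upow_diff unfolding us z(2) by simp
  then have 1: "(u ^^ i) (x - u z) \<in> Jn i" using d upN[OF d] by (auto simp: imker_def)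
  have "i + 1 + (i + 1) = Suc (2 * i + 1)" by simp
  have "(u ^^ (i + 1)) ((u ^^ (i + 1)) z) = u ((u ^^ (2 * i + 1)) z)"
    unfolding upow_upow \<open>i + 1 + (i + 1) = Suc (2 * i + 1)\<close> by (simp only: funpow.simps o_apply)
  also have "\<dots> = (u ^^ (2 * i + 1)) x" unfolding z(2)[symmetric] by simp
  also have "\<dots> = 0" by (rule Kn_0[OF xK]) simp
  finally have 2: "(u ^^ (i + 1)) z \<in> Jn (i + 1)" using z upN[OF z(1), of "i + 1"]
    by (auto simp only: imker_def)
  have "(u ^^ i) x = (u ^^ i) (x - u z) + (u ^^ (i + 1)) z" unfolding upow_diff us by simp
  then show ?thesis using subspace_add[OF sub_Sn Jn_Sn[OF 1 m] Jn_Sn[OF 2, of m]] m by simp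
qed

lemma Kn_split: "x \<in> Kn i \<Longrightarrow> \<exists>c\<in>C i. \<exists>d\<in>denodd N i. x = c + d"
  using C_sum[of i] unfolding ssum_def by blast

lemma Tn_dec: "x \<in> Tn m \<Longrightarrow> \<exists>p\<in>Pn m. \<exists>s\<in>Sn m. x = p + s"
proof -
  have "Tn m \<subseteq> ssum (Pn m) (Sn m)" unfolding Tn_def
  proof (rule gs_least[OF subspace_ssum[OF sub_Pn sub_Sn]], rule subsetI)
    fix i y assume i: "m \<le> i" "i < n" and "y \<in> (u ^^ i) ` Kn i"
    then obtain x where x: "x \<in> Kn i" "y = (u ^^ i) x" by blast
    obtain c d where cd: "c \<in> C i" "d \<in> denodd N i" "x = c + d" using Kn_split[OF x(1)] by blast
    have "(u ^^ i) c \<in> Pn m" unfolding Pn_def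
      by (rule gs_mem[where F = "\<lambda>i. (u ^^ i) ` C i", OF subspace_upow_image[OF C_sub] imageI[OF cd(1)] i])
    moreover have "(u ^^ i) d \<in> Sn m" by (rule den_Sn[OF cd(2) i(1)])
    ultimately show "y \<in> ssum (Pn m) (Sn m)" unfolding x(2) cd(3) upow_add by (rule ssum_mem)
  qed
  moreover assume "x \<in> Tn m"
  ultimately show ?thesis unfolding ssum_def by blast
qed

text \<open>The structure of Im u^m, obtained by peeling off one level at a time: modulo Im u^(m+1),
  a vector orthogonal to the radicals is u^m of a vector of Ker u^(2m+1). The induction runs upwards
  in m, to the nilpotency bound.\<close>

lemma key_Tn:
  assumes "g \<in> (u ^^ m) ` N" "\<And>i x. m \<le> i \<Longrightarrow> x \<in> Jn i \<Longrightarrow> b g x = 0"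
  shows "g \<in> Tn m" using assms
proof (induction "n - m" arbitrary: m g)
  case 0
  then have "g = 0" using nil upow_zero_mono[of n _ m] by auto
  then show ?case by (simp add: subspace_0[OF sub_Tn])
next
  case (Suc l)
  let ?I = "(u ^^ Suc m) ` N"
  have sI: "subspace ?I" by (rule subspace_upow_image[OF sN])
  have fI: "fd ?I" by (rule fd_mono[OF fN sI upow_image_sub[OF sN uN]])
  \<comment> \<open>Possible because \<open>g\<close> is orthogonal to the radical of index m + 1.
    Then g - c is orthogonal to Im u^(m+1), which gives u^(m+1) (g - c) = 0.\<close>
  have "\<exists>c\<in>?I. \<forall>y\<in>?I. b g y = b c y"
  proof (rule perp_perp[OF b_bil fI sI])
    fix y assume y: "y \<in> ?I" "\<forall>c\<in>?I. b c y = 0"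
    then obtain z where z: "z \<in> N" "y = (u ^^ Suc m) z" by blast
    have yN: "y \<in> N" unfolding z(2) by (rule upN[OF z(1)])
    have "(u ^^ Suc m) y = 0"
    proof (rule goodD(4)[OF goodN upN[OF yN]])
      fix w assume "w \<in> N"
      then have "b ((u ^^ Suc m) w) y = 0" using y(2) by blast
      then show "b ((u ^^ Suc m) y) w = 0" using upow_adj[of "Suc m" y w] b_sym[of y] by simp
    qed
    then have "y \<in> Jn (Suc m)" using z yN unfolding imker_def by blast
    then show "b g y = 0" by (intro Suc.prems(2)[of "Suc m"]) auto
  qed
  then obtain c where c: "c \<in> ?I" "\<And>y. y \<in> ?I \<Longrightarrow> b g y = b c y" by blast
  obtain z where z: "z \<in> N" "g = (u ^^ m) z" using Suc.prems(1) by blast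
  obtain w where w: "w \<in> N" "c = (u ^^ Suc m) w" using c(1) by blast
  have uw: "u w \<in> N" using w uN by (simp add: ustable_def)
  have wm: "(u ^^ Suc m) w = (u ^^ m) (u w)" by (simp only: funpow_Suc_right o_apply)
  have gc: "g - c = (u ^^ m) (z - u w)" unfolding z(2) w(2) upow_diff wm by simp
  have zw: "z - u w \<in> N" by (rule subspace_diff[OF sN z(1) uw])
  have gN: "g - c \<in> N" unfolding gc by (rule upN[OF zw])
  have "(u ^^ Suc m) (g - c) = 0"
  proof (rule goodD(4)[OF goodN upN[OF gN]])
    fix y assume "y \<in> N"
    then have "b (g - c) ((u ^^ Suc m) y) = 0" using c(2) by (simp add: bD del: funpow.simps)
    then show "b ((u ^^ Suc m) (g - c)) y = 0" unfolding upow_adj by simp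
  qed
  then have "(u ^^ (2 * m + 1)) (z - u w) = 0" unfolding gc upow_upow by (simp add: mult_2)
  then have zK: "z - u w \<in> Kn m" using zw unfolding kerodd_def by blast
  have mn: "m < n" using Suc.hyps(2) by simp
  have 1: "g - c \<in> Tn m" unfolding gc Tn_def
    by (rule gs_mem[where F = "\<lambda>i. (u ^^ i) ` Kn i", OF subspace_upow_image[OF subspace_kerodd[OF sN]] imageI[OF zK] order.refl mn])
  have "c \<in> Tn (Suc m)"
  proof (rule Suc.hyps(1))
    show "l = n - Suc m" using Suc.hyps(2) by simp
    show "c \<in> ?I" by (rule c(1))
    fix i x assume i: "Suc m \<le> i" and x: "x \<in> Jn i"
    have "b (g - c) x = 0" using Jn_K[OF x zK] b_sym[of "g - c" x] unfolding gc by simp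
    then show "b c x = 0" using Suc.prems(2)[OF _ x] i by (simp add: bD)
  qed
  moreover have "Tn (Suc m) \<subseteq> Tn m" unfolding Tn_def
    by (rule gs_least[OF sub_Tn[unfolded Tn_def]])
       (auto intro!: gs_mem[OF subspace_upow_image[OF subspace_kerodd[OF sN]]])
  ultimately have "(g - c) + c \<in> Tn m" by (intro subspace_add[OF sub_Tn 1]) auto
  then show ?case by simp
qed

text \<open>Different levels are orthogonal, and moving u^i across b produces the sign (-1)^i; these
  are the signs in condition (iii).\<close>

lemma Pn_form:
  assumes G: "\<And>i. G i \<in> C i" and H: "\<And>i. H i \<in> C i"
  shows "b (\<Sum>i\<in>{m..<n}. (u ^^ i) (G i)) (\<Sum>i\<in>{m..<n}. (u ^^ i) (H i)) =
    (\<Sum>i\<in>{m..<n}. (- 1) ^ i * b (G i) ((u ^^ (2 * i)) (H i)))"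
proof -
  have "b (\<Sum>i\<in>{m..<n}. (u ^^ i) (G i)) (\<Sum>i\<in>{m..<n}. (u ^^ i) (H i)) =
    (\<Sum>i\<in>{m..<n}. \<Sum>j\<in>{m..<n}. b ((u ^^ i) (G i)) ((u ^^ j) (H j)))"
    unfolding b_sum_left unfolding b_sum_right ..
  also have "\<dots> = (\<Sum>i\<in>{m..<n}. \<Sum>j\<in>{m..<n}. if i = j then b ((u ^^ i) (G i)) ((u ^^ j) (H j)) else 0)"
    by (intro sum.cong refl) (auto intro: Kn_Kn C_K G H)
  also have "\<dots> = (\<Sum>i\<in>{m..<n}. b ((u ^^ i) (G i)) ((u ^^ i) (H i)))" by simp
  finally show ?thesis unfolding Kn_Kn_same .
qed

lemma C_nd:
  assumes c: "c \<in> C i" and h: "\<And>y. y \<in> C i \<Longrightarrow> b c ((u ^^ (2 * i)) y) = 0" shows "c = 0"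
proof -
  have "c \<in> denodd N i"
  proof (rule denodd_radical[OF goodN C_K[OF c]])
    fix y assume "y \<in> Kn i"
    then obtain c' d where cd: "c' \<in> C i" "d \<in> denodd N i" "y = c' + d" using Kn_split by blast
    obtain z where z: "(u ^^ (2 * i)) d = (u ^^ (2 * i + 1)) z" using cd(2) unfolding denodd_def by blast
    have "(u ^^ (2 * i + 1)) c = 0" by (rule Kn_0[OF C_K[OF c]]) simp
    then have "b c ((u ^^ (2 * i)) d) = 0" unfolding z upow_adj' by (simp only: bD mult_zero_right)
    then show "b c ((u ^^ (2 * i)) y) = 0" unfolding cd(3) upow_add using h[OF cd(1)] by (simp add: bD)
  qed
  then show ?thesis using C_den[of i] c by blast
qed

text \<open>Testing against u^j of \<open>C j\<close> isolates the component of index j, and the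
  form on \<open>C j\<close> is non-degenerate. So the sum defining \<open>Pn\<close> is
  direct.\<close>

lemma Pn_inj:
  assumes G: "\<And>i. G i \<in> C i" and h: "\<And>y. y \<in> Pn m \<Longrightarrow> b (\<Sum>i\<in>{m..<n}. (u ^^ i) (G i)) y = 0"
    and j: "j \<in> {m..<n}"
  shows "G j = 0"
proof (rule C_nd[OF G])
  fix y assume y: "y \<in> C j"
  have "(u ^^ j) y \<in> Pn m" unfolding Pn_def
    by (rule gs_mem[where F = "\<lambda>i. (u ^^ i) ` C i", OF subspace_upow_image[OF C_sub] imageI[OF y]]) (use j in auto)
  then have "0 = (\<Sum>i\<in>{m..<n}. b ((u ^^ i) (G i)) ((u ^^ j) y))" using h by (simp flip: b_sum_left)
  also have "\<dots> = (\<Sum>i\<in>{m..<n}. if i = j then b ((u ^^ i) (G i)) ((u ^^ j) y) else 0)"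
    by (intro sum.cong refl) (auto intro: Kn_Kn C_K G y)
  also have "\<dots> = b ((u ^^ j) (G j)) ((u ^^ j) y)" using j by simp
  finally show "b (G j) ((u ^^ (2 * j)) y) = 0" unfolding Kn_Kn_same by simp
qed

lemma Pn_E: "x \<in> Pn m \<Longrightarrow> \<exists>G. (\<forall>i. G i \<in> C i) \<and> x = (\<Sum>i\<in>{m..<n}. (u ^^ i) (G i))"
proof -
  assume "x \<in> Pn m"
  then obtain f where f: "x = (\<Sum>i\<in>{m..<n}. f i)" "\<forall>i. f i \<in> (u ^^ i) ` C i"
    unfolding Pn_def gs_def by blast
  have "\<forall>i. \<exists>c. c \<in> C i \<and> f i = (u ^^ i) c" using f(2) by blast
  then obtain G where "\<forall>i. G i \<in> C i \<and> f i = (u ^^ i) (G i)" by (rule choice[THEN exE])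
  then show ?thesis using f(1) by (intro exI[of _ G]) simp
qed

lemma Pn_nd: "x \<in> Pn m \<Longrightarrow> (\<And>y. y \<in> Pn m \<Longrightarrow> b x y = 0) \<Longrightarrow> x = 0"
  using Pn_E[of x m] Pn_inj[of _ m] by (metis (no_types, lifting) sum.neutral upow_0)

lemma uC_Pn: "c \<in> C k \<Longrightarrow> y \<in> Pn (Suc k) \<Longrightarrow> b ((u ^^ k) c) y = 0"
proof -
  assume c: "c \<in> C k" and y: "y \<in> Pn (Suc k)"
  have "b y ((u ^^ k) c) = 0" using y unfolding Pn_def
  proof (rule gs_perp)
    fix i z assume "Suc k \<le> i" "z \<in> (u ^^ i) ` C i"
    then show "b z ((u ^^ k) c) = 0" using C_K[OF c] by (auto intro!: Kn_Kn C_K)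
  qed
  then show ?thesis by (simp add: b_sym)
qed

text \<open>\<open>W\<close> is a nonisotropic part of the forms above k, \<open>M\<close> a
  Lagrangian of the hyperbolic rest, and \<phi> embeds \<open>W\<close> anti-isometrically into the
  form of index k.\<close>

lemma condN_of_section:
  assumes W: "subspace W" "W \<subseteq> Pn (Suc k)" and M: "subspace M" "M \<subseteq> Pn (Suc k)"
    and iso: "\<And>x y. x \<in> M \<Longrightarrow> y \<in> M \<Longrightarrow> b x y = 0" and MW: "\<And>x y. x \<in> M \<Longrightarrow> y \<in> W \<Longrightarrow> b x y = 0"
    and an: "\<And>x. x \<in> W \<Longrightarrow> b x x = 0 \<Longrightarrow> x = 0"
    and perp: "\<And>x. x \<in> Pn (Suc k) \<Longrightarrow> (\<And>y. y \<in> M \<Longrightarrow> b x y = 0) \<Longrightarrow> \<exists>m\<in>M. \<exists>w\<in>W. x = m + w"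
    and \<phi>: "\<And>w. w \<in> W \<Longrightarrow> \<phi> w \<in> C k" "\<And>x y. x \<in> W \<Longrightarrow> y \<in> W \<Longrightarrow> \<phi> (x + y) = \<phi> x + \<phi> y"
      "\<And>c x. x \<in> W \<Longrightarrow> \<phi> (c *s x) = c *s \<phi> x"
      "\<And>x y. x \<in> W \<Longrightarrow> y \<in> W \<Longrightarrow> (- 1) ^ k * b (\<phi> x) ((u ^^ (2 * k)) (\<phi> y)) = - b x y"
  shows "condN N k"
proof -
  define r where "r w = (u ^^ k) (\<phi> w)" for w
  define S where "S = Sn (Suc k)"
  let ?I = "(u ^^ Suc k) ` N"
  have sI: "subspace ?I" by (rule subspace_upow_image[OF sN])
  have SI: "S \<subseteq> ?I" unfolding S_def by (rule Sn_im)
  have PI: "Pn (Suc k) \<subseteq> ?I" by (rule Pn_im)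
  have rr: "b (r x) (r y) = - b x y" if "x \<in> W" "y \<in> W" for x y
    unfolding r_def Kn_Kn_same using \<phi>(4)[OF that] .
  have r_add: "r (x + y) = r x + r y" if "x \<in> W" "y \<in> W" for x y by (simp add: r_def \<phi>(2) that upow_add)
  have r_scale: "r (c *s x) = c *s r x" if "x \<in> W" for c x by (simp add: r_def \<phi>(3) that upow_scale)
  have r_im: "r w \<in> (u ^^ k) ` N" if "w \<in> W" for w
    unfolding r_def using Kn_N[OF C_K[OF \<phi>(1)[OF that]]] by blast
  have rP: "b (r w) y = 0" "b y (r w) = 0" if "w \<in> W" "y \<in> Pn (Suc k)" for w y
    using uC_Pn[OF \<phi>(1)[OF that(1)] that(2)] b_sym[of y] by (simp_all add: r_def)
  have Sr: "b s (r w) = 0" "b (r w) s = 0" if "s \<in> S" "w \<in> W" for s w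
    using Sn_K[OF that(1)[unfolded S_def] C_K[OF \<phi>(1)[OF that(2)]]] b_sym[of s] by (simp_all add: r_def)
  have SP: "b s y = 0" "b y s = 0" if "s \<in> S" "y \<in> Pn (Suc k)" for s y
    using Sn_Pn[OF that(1)[unfolded S_def] that(2)] b_sym[of s] by simp_all
  have SS: "b s t = 0" if "s \<in> S" "t \<in> S" for s t using Sn_Sn that unfolding S_def by blast
  have MW': "b y x = 0" if "x \<in> M" "y \<in> W" for x y using MW[OF that] b_sym[of x] by simp
  define E where "E = {y + r w |y w. y \<in> ?I \<and> w \<in> W}"
  \<comment> \<open>The radicals, the Lagrangian of the hyperbolic rest, and the graph of the
    anti-isometry \<open>r\<close>: on w + r w the two norms cancel. Accordingly \<open>E\<close>
    enlarges Im u^(k+1) by the image of \<open>r\<close> only.\<close>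
  define L where "L = {s + m + (w + r w) |s m w. s \<in> S \<and> m \<in> M \<and> w \<in> W}"
  have r0: "r 0 = 0" using r_scale[OF subspace_0[OF W(1)], of 0] by simp
  have E: "subspace E"
  proof (rule subspaceI)
    show "0 \<in> E" unfolding E_def using subspace_0[OF sI] subspace_0[OF W(1)] r0
      by (intro CollectI exI[of _ 0]) simp
    fix x assume "x \<in> E"
    then obtain y w where x: "x = y + r w" "y \<in> ?I" "w \<in> W" unfolding E_def by blast
    show "c *s x \<in> E" for c unfolding E_def x(1)
      by (-, rule CollectI, rule exI[of _ "c *s y"], rule exI[of _ "c *s w"], intro conjI subspace_scale[OF sI] subspace_scale[OF W(1)] x)
         (simp add: r_scale x scale_right_distrib)
    fix x' assume "x' \<in> E"
    then obtain y' w' where x': "x' = y' + r w'" "y' \<in> ?I" "w' \<in> W" unfolding E_def by blast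
    show "x + x' \<in> E" unfolding E_def x(1) x'(1)
      by (-, rule CollectI, rule exI[of _ "y + y'"], rule exI[of _ "w + w'"], intro conjI subspace_add[OF sI] subspace_add[OF W(1)] x x')
         (simp add: r_add x x' add_ac)
  qed
  have sS: "subspace S" unfolding S_def by (rule sub_Sn)
  have L: "subspace L"
  proof (rule subspaceI)
    show "0 \<in> L" unfolding L_def using subspace_0[OF sS] subspace_0[OF W(1)] subspace_0[OF M(1)] r0
      by (intro CollectI exI[of _ 0]) simp
    fix x assume "x \<in> L"
    then obtain s m w where x: "x = s + m + (w + r w)" "s \<in> S" "m \<in> M" "w \<in> W" unfolding L_def by blast
    show "c *s x \<in> L" for c unfolding L_def x(1)
      by (-, rule CollectI, rule exI[of _ "c *s s"], rule exI[of _ "c *s m"], rule exI[of _ "c *s w"], intro conjI subspace_scale[OF sS]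
          subspace_scale[OF M(1)] subspace_scale[OF W(1)] x) (simp add: r_scale x scale_right_distrib)
    fix x' assume "x' \<in> L"
    then obtain s' m' w' where x': "x' = s' + m' + (w' + r w')" "s' \<in> S" "m' \<in> M" "w' \<in> W"
      unfolding L_def by blast
    show "x + x' \<in> L" unfolding L_def x(1) x'(1)
      by (-, rule CollectI, rule exI[of _ "s + s'"], rule exI[of _ "m + m'"], rule exI[of _ "w + w'"], intro conjI subspace_add[OF sS]
          subspace_add[OF M(1)] subspace_add[OF W(1)] x x') (simp add: r_add x x' add_ac)
  qed
  have IE: "?I \<subseteq> E" unfolding E_def using subspace_0[OF W(1)] r0 by force
  have EI: "E \<subseteq> (u ^^ k) ` N"
  proof
    fix x assume "x \<in> E"
    then obtain y w where x: "x = y + r w" "y \<in> ?I" "w \<in> W" unfolding E_def by blast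
    have "?I \<subseteq> (u ^^ k) ` N" by (rule upow_image_antimono[OF sN uN]) simp
    then show "x \<in> (u ^^ k) ` N"
      unfolding x(1) using x(2) r_im[OF x(3)] by (intro subspace_add[OF subspace_upow_image[OF sN]]) auto
  qed
  have LE: "L \<subseteq> E"
  proof
    fix x assume "x \<in> L"
    then obtain s m w where x: "x = s + m + (w + r w)" "s \<in> S" "m \<in> M" "w \<in> W" unfolding L_def by blast
    have "s + m + w \<in> ?I" using x SI PI M(2) W(2) by (intro subspace_add[OF sI]) auto
    then show "x \<in> E" unfolding E_def x(1) using x(4)
      by - (rule CollectI, rule exI[of _ "s + m + w"], rule exI[of _ w], simp add: add_ac)
  qed
  have LL: "b x x' = 0" if xx: "x \<in> L" "x' \<in> L" for x x'
  proof -
    obtain s m w where x: "x = s + m + (w + r w)" "s \<in> S" "m \<in> M" "w \<in> W"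
      using xx(1) unfolding L_def by blast
    obtain s' m' w' where x': "x' = s' + m' + (w' + r w')" "s' \<in> S" "m' \<in> M" "w' \<in> W"
      using xx(2) unfolding L_def by blast
    have P: "m \<in> Pn (Suc k)" "m' \<in> Pn (Suc k)" "w \<in> Pn (Suc k)" "w' \<in> Pn (Suc k)"
      using x x' M W by auto
    show ?thesis unfolding x(1) x'(1) using x(2-) x'(2-) P by (simp add: bD SS SP Sr rP rr iso MW MW')
  qed
  have "L = {x\<in>E. \<forall>y\<in>L. b x y = 0}"
  proof (intro Set.equalityI subsetI CollectI conjI ballI)
    fix x assume "x \<in> {x\<in>E. \<forall>y\<in>L. b x y = 0}"
    then have xE: "x \<in> E" and xL: "\<And>y. y \<in> L \<Longrightarrow> b x y = 0" by auto
    then obtain y w where x: "x = y + r w" "y \<in> ?I" "w \<in> W" unfolding E_def by blast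
    have wL: "w + r w \<in> L" unfolding L_def using x(3) subspace_0[OF sS] subspace_0[OF M(1)]
      by - (rule CollectI, rule exI[of _ 0], rule exI[of _ 0], rule exI[of _ w], simp)
    define x' where "x' = y - w"
    have xx: "x = x' + (w + r w)" by (simp add: x'_def x(1))
    have x'I: "x' \<in> ?I" unfolding x'_def using x W(2) PI by (intro subspace_diff[OF sI]) auto
    have x'L: "b x' z = 0" if "z \<in> L" for z
      using xL[OF that] LL[OF wL that] unfolding xx by (simp add: bD)
    have SL: "s \<in> L" if "s \<in> S" for s
      unfolding L_def using that subspace_0[OF M(1)] subspace_0[OF W(1)] r0
      by - (rule CollectI, rule exI[of _ s], rule exI[of _ 0], rule exI[of _ 0], simp)
    have mL: "m \<in> L" if "m \<in> M" for m
      unfolding L_def using that subspace_0[OF sS] subspace_0[OF W(1)] r0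
      by - (rule CollectI, rule exI[of _ 0], rule exI[of _ m], rule exI[of _ 0], simp)
    have wL': "w + r w \<in> L" if "w \<in> W" for w unfolding L_def using that subspace_0[OF sS] subspace_0[OF M(1)]
      by - (rule CollectI, rule exI[of _ 0], rule exI[of _ 0], rule exI[of _ w], simp)
    have "x' \<in> Tn (Suc k)"
    proof (rule key_Tn[OF x'I])
      show "b x' z = 0" if "Suc k \<le> i" "z \<in> Jn i" for i z
        using x'L[OF SL] Jn_Sn[OF that(2,1)] unfolding S_def by blast
    qed
    then obtain p s where ps: "p \<in> Pn (Suc k)" "s \<in> S" "x' = p + s" unfolding S_def using Tn_dec by blast
    have "b p m = 0" if m: "m \<in> M" for m
      using x'L[OF mL[OF m]] SP(1)[OF ps(2), of m] m M(2) unfolding ps(3) by (auto simp: bD)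
    then obtain m w1 where mw: "m \<in> M" "w1 \<in> W" "p = m + w1" using perp[OF ps(1)] by blast
    have w1P: "w1 \<in> Pn (Suc k)" using mw W by auto
    \<comment> \<open>The graph vector over \<open>w1\<close> sees only the component
      \<open>w1\<close> of \<open>x'\<close>, so its norm vanishes and \<open>w1\<close> is 0 by
      anisotropy.\<close>
    have "b x' (w1 + r w1) = 0" by (rule x'L[OF wL'[OF mw(2)]])
    then have "b w1 w1 = 0" unfolding ps(3) mw(3)
      using MW[OF mw(1,2)] SP(1)[OF ps(2) w1P] Sr(1)[OF ps(2) mw(2)] rP(2)[OF mw(2) w1P]
        rP(2)[OF mw(2) subsetD[OF M(2) mw(1)]] by (simp add: bD)
    then have "w1 = 0" by (rule an[OF mw(2)])
    then show "x \<in> L" unfolding xx ps(3) mw(3) L_def using mw(1) ps(2) x(3)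
      by - (rule CollectI, rule exI[of _ s], rule exI[of _ m], rule exI[of _ w], simp add: add_ac)
  qed (use LE LL in auto)
  then show ?thesis unfolding condN_def
    using E L IE EI by - (rule exI[of _ E], rule exI[of _ L], intro conjI)
qed

text \<open>The given \<open>L\<close> is first replaced by one containing the radicals and
  \<open>M\<close>. Its members then relate each vector of \<open>W\<close> to vectors of
  \<open>C k\<close>, and isotropy of \<open>L\<close> makes this relation anti-isometric.\<close>

lemma section_of_condN:
  assumes cN: "condN N k"
    and W: "subspace W" and H: "subspace H" and HW: "ssum H W = Pn (Suc k)"
    and orth: "\<And>x y. x \<in> H \<Longrightarrow> y \<in> W \<Longrightarrow> b x y = 0"
    and M: "subspace M" "M \<subseteq> H" and iso: "\<And>x y. x \<in> M \<Longrightarrow> y \<in> M \<Longrightarrow> b x y = 0"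
    and dimH: "dim H = 2 * dim M" and an: "\<And>x. x \<in> W \<Longrightarrow> b x x = 0 \<Longrightarrow> x = 0"
  shows "\<exists>\<phi>. (\<forall>x y. \<phi> (x + y) = \<phi> x + \<phi> y) \<and> (\<forall>c x. \<phi> (c *s x) = c *s \<phi> x) \<and> (\<forall>w\<in>W. \<phi> w \<in> C k) \<and>
    (\<forall>x\<in>W. \<forall>y\<in>W. (- 1) ^ k * b (\<phi> x) ((u ^^ (2 * k)) (\<phi> y)) = - b x y)"
proof -
  let ?I = "(u ^^ Suc k) ` N" and ?P = "Pn (Suc k)" and ?S = "Sn (Suc k)"
  obtain E L where EL: "subspace E" "subspace L" "?I \<subseteq> E" "E \<subseteq> (u ^^ k) ` N"
    "L = {x\<in>E. \<forall>y\<in>L. b x y = 0}" using cN unfolding condN_def by (elim exE conjE) (rule that)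
  have WP: "W \<subseteq> ?P" "H \<subseteq> ?P" using ssum_upper[OF H W] HW by auto
  have MP: "M \<subseteq> ?P" using M WP by auto
  have PE: "?P \<subseteq> E" "?S \<subseteq> E" using Pn_im[of "Suc k"] Sn_im[of "Suc k"] EL(3) by auto
  have LD: "\<And>x. x \<in> L \<Longrightarrow> x \<in> E" "\<And>x y. x \<in> L \<Longrightarrow> y \<in> L \<Longrightarrow> b x y = 0"
    and LI: "\<And>x. x \<in> E \<Longrightarrow> \<forall>y\<in>L. b x y = 0 \<Longrightarrow> x \<in> L" using EL(5) by auto
  have uk: "(u ^^ k) ` N \<subseteq> N" by (rule upow_image_sub[OF sN uN])
  have EN: "E \<subseteq> N" using EL(4) uk by auto
  have fdE: "fd Y" if "subspace Y" "Y \<subseteq> E" for Y by (rule fd_mono[OF fN that(1) order_trans[OF that(2) EN]])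
  have fdP: "fd Y" if "subspace Y" "Y \<subseteq> ?P" for Y by (rule fd_mono[OF fd_Pn that])
  have HM: "h \<in> M" if h: "h \<in> H" "\<And>m. m \<in> M \<Longrightarrow> b h m = 0" for h
  proof -
    have "m = 0" if m: "m \<in> M" "\<forall>x\<in>H. b m x = 0" for m
    proof (rule Pn_nd[of m "Suc k"])
      show "m \<in> ?P" using m MP by auto
      fix y assume "y \<in> ?P"
      then obtain h w where "h \<in> H" "w \<in> W" "y = h + w" unfolding HW[symmetric] ssum_def by blast
      then show "b m y = 0" using m M orth by (auto simp: bD)
    qed
    then have "{m\<in>M. \<forall>x\<in>H. b m x = 0} = {0}" using subspace_0[OF M(1)] by (auto simp: bD)
    then have d: "dim {x\<in>H. \<forall>m\<in>M. b m x = 0} = dim M"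
      using dim_perp[OF b_bil fdP[OF H WP(2)] M] dimH by (simp add: dim_zero)
    have sM: "subspace {x\<in>H. \<forall>m\<in>M. b m x = 0}" using H unfolding subspace_def by (auto simp: bD)
    have "M = {x\<in>H. \<forall>m\<in>M. b m x = 0}"
      by (rule dim_eq_fd[OF fd_mono[OF fdP[OF H WP(2)] sM] M(1)]) (use M iso d in auto)
    moreover have "h \<in> {x\<in>H. \<forall>m\<in>M. b m x = 0}" using h by (auto simp: b_sym[of _ h])
    ultimately show ?thesis by blast
  qed
  define T where "T = ssum ?S M"
  have sT: "subspace T" unfolding T_def by (rule subspace_ssum[OF sub_Sn M(1)])
  have ST: "?S \<subseteq> T" "M \<subseteq> T" unfolding T_def by (rule ssum_upper[OF sub_Sn M(1)])+
  have TE: "T \<subseteq> E" unfolding T_def by (rule ssum_least[OF EL(1)]) (use PE MP in auto)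
  have SPs: "b y s = 0" if "s \<in> Sn m" "y \<in> ?P" for s y m using Sn_Pn[OF that] b_sym[of y] by simp
  have TT: "b x y = 0" if xy: "x \<in> T" "y \<in> T" for x y
  proof -
    obtain s m where x: "x = s + m" "s \<in> ?S" "m \<in> M" using xy(1) unfolding T_def ssum_def by blast
    obtain s' m' where y: "y = s' + m'" "s' \<in> ?S" "m' \<in> M" using xy(2) unfolding T_def ssum_def by blast
    have "m \<in> ?P" "m' \<in> ?P" using x y MP by auto
    then show ?thesis unfolding x(1) y(1) using x(2,3) y(2,3) by (simp add: bD Sn_Sn iso Sn_Pn SPs)
  qed
  \<comment> \<open>The standard exchange: the part of \<open>L\<close> orthogonal to the isotropic
    \<open>T\<close>, plus \<open>T\<close>, is again its own orthogonal in \<open>E\<close>, and it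
    contains \<open>T\<close>.\<close>
  define La where "La = {x\<in>L. \<forall>s\<in>T. b x s = 0}"
  define L' where "L' = ssum La T"
  have sLa: "subspace La" unfolding La_def using EL(2) unfolding subspace_def by (auto simp: bD)
  have sL': "subspace L'" unfolding L'_def by (rule subspace_ssum[OF sLa sT])
  have LaL': "La \<subseteq> L'" "T \<subseteq> L'" unfolding L'_def by (rule ssum_upper[OF sLa sT])+
  have L'E: "L' \<subseteq> E" unfolding L'_def by (rule ssum_least[OF EL(1) _ TE]) (use LD in \<open>auto simp: La_def\<close>)
  have L'L': "b x y = 0" if xy: "x \<in> L'" "y \<in> L'" for x y
  proof -
    obtain a t where x: "x = a + t" "a \<in> La" "t \<in> T" using xy(1) unfolding L'_def ssum_def by blast
    obtain a' t' where y: "y = a' + t'" "a' \<in> La" "t' \<in> T" using xy(2) unfolding L'_def ssum_def by blast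
    have "b a a' = 0" "b a t' = 0" "b t a' = 0" using x y LD(2) b_sym[of t a'] unfolding La_def by auto
    then show ?thesis unfolding x(1) y(1) using TT[OF x(3) y(3)] by (simp add: bD)
  qed
  have L'I: "x \<in> L'" if x: "x \<in> E" "\<And>l. l \<in> L' \<Longrightarrow> b x l = 0" for x
  proof -
    have "\<exists>t\<in>T. \<forall>y\<in>L. b x y = b t y"
    proof (rule perp_perp[OF b_bil fdE[OF sT TE] EL(2)])
      fix y assume y: "y \<in> L" "\<forall>m\<in>T. b m y = 0"
      then have "y \<in> La" unfolding La_def by (auto simp: b_sym[of y])
      then show "b x y = 0" using x(2) LaL' by auto
    qed
    then obtain t where t: "t \<in> T" "\<forall>y\<in>L. b x y = b t y" by blast
    have "x - t \<in> L" using t TE x(1) by (intro LI subspace_diff[OF EL(1)]) (auto simp: bD)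
    moreover have "b (x - t) s = 0" if "s \<in> T" for s
      using x(2)[of s] that LaL' TT[OF t(1) that] by (auto simp: bD)
    ultimately have "x - t \<in> La" unfolding La_def by simp
    then have "(x - t) + t \<in> L'" unfolding L'_def by (rule ssum_mem[OF _ t(1)])
    then show ?thesis by simp
  qed
  \<comment> \<open>The hyperbolic component is orthogonal to \<open>M\<close>, hence in
    \<open>M\<close> by \<open>HM\<close>; what carries information is the pair of components in
    \<open>C k\<close> and \<open>W\<close>.\<close>
  have dec: "\<exists>c\<in>C k. \<exists>h\<in>M. \<exists>w\<in>W. \<exists>s\<in>Sn k. l = (u ^^ k) c + h + w + s" if l: "l \<in> L'" for l
  proof -
    have lT: "b l t = 0" if "t \<in> T" for t using L'L'[OF l] LaL'(2) that by blast
    have lk: "l \<in> (u ^^ k) ` N" using l L'E EL(4) by auto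
    have "l \<in> Tn k"
    proof (rule key_Tn[OF lk])
      fix i x assume i: "k \<le> i" and x: "x \<in> Jn i"
      show "b l x = 0"
      proof (cases "i = k")
        case True
        then show ?thesis using lk Jn_im[OF x, of k] by (auto simp: b_sym[of _ x])
      next
        case False
        then show ?thesis using lT[OF subsetD[OF ST(1) Jn_Sn[OF x]]] i by simp
      qed
    qed
    then obtain p s where ps: "p \<in> Pn k" "s \<in> Sn k" "l = p + s" using Tn_dec by blast
    have "gs (\<lambda>i. (u ^^ i) ` C i) k \<subseteq> ssum ((u ^^ k) ` C k) ?P"
    proof (rule gs_least)
      show "subspace (ssum ((u ^^ k) ` C k) ?P)"
        by (rule subspace_ssum[OF subspace_upow_image[OF C_sub] sub_Pn])
      fix i assume i: "k \<le> i" "i < n"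
      show "(u ^^ i) ` C i \<subseteq> ssum ((u ^^ k) ` C k) ?P"
      proof (cases "i = k")
        case True
        then show ?thesis using ssum_upper(1)[OF subspace_upow_image[OF C_sub] sub_Pn] by simp
      next
        case False
        have "y \<in> ?P" if "y \<in> (u ^^ i) ` C i" for y unfolding Pn_def
          by (rule gs_mem[where F = "\<lambda>i. (u ^^ i) ` C i", OF subspace_upow_image[OF C_sub] that _ i(2)])
             (use False i in simp)
        then show ?thesis using ssum_upper(2)[OF subspace_upow_image[OF C_sub] sub_Pn] by blast
      qed
    qed
    then obtain c q where cq: "c \<in> C k" "q \<in> ?P" "p = (u ^^ k) c + q"
      using ps(1) unfolding fun_cong[OF Pn_def, of k] ssum_def by blast
    obtain h w where hw: "h \<in> H" "w \<in> W" "q = h + w" using cq(2) unfolding HW[symmetric] ssum_def by blast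
    have "b h m = 0" if m: "m \<in> M" for m
    proof -
      have mP: "m \<in> ?P" using m MP by auto
      have "b l m = 0" using lT m ST by auto
      moreover have "b w m = 0" using orth[of m w] m M hw b_sym[of w] by auto
      ultimately show ?thesis
        unfolding ps(3) cq(3) hw(3) using uC_Pn[OF cq(1) mP] Sn_Pn[OF ps(2) mP] by (simp add: bD)
    qed
    then have "h \<in> M" by (rule HM[OF hw(1)])
    moreover have "l = (u ^^ k) c + h + w + s" using ps cq hw by (simp add: add_ac)
    ultimately show ?thesis using cq(1) hw(2) ps(2) by blast
  qed
  define R where "R w c \<longleftrightarrow> w \<in> W \<and> c \<in> C k \<and> (\<exists>h\<in>M. \<exists>s\<in>Sn k. (u ^^ k) c + h + w + s \<in> L')" for w c
  have R_add: "R (w + w') (c + c')" if r: "R w c" "R w' c'" for w w' c c'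
  proof -
    obtain h s where h: "h \<in> M" "s \<in> Sn k" "(u ^^ k) c + h + w + s \<in> L'" using r(1) R_def by blast
    obtain h' s' where h': "h' \<in> M" "s' \<in> Sn k" "(u ^^ k) c' + h' + w' + s' \<in> L'" using r(2) R_def by blast
    have "(u ^^ k) (c + c') + (h + h') + (w + w') + (s + s') \<in> L'"
      using subspace_add[OF sL' h(3) h'(3)] by (simp add: upow_add add_ac)
    then show ?thesis unfolding R_def
      using r subspace_add[OF M(1) h(1) h'(1)] subspace_add[OF sub_Sn h(2) h'(2)]
        subspace_add[OF W] subspace_add[OF C_sub] unfolding R_def by blast
  qed
  have R_scale: "R (a *s w) (a *s c)" if r: "R w c" for w c a
  proof -
    obtain h s where h: "h \<in> M" "s \<in> Sn k" "(u ^^ k) c + h + w + s \<in> L'" using r R_def by blast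
    have "(u ^^ k) (a *s c) + a *s h + a *s w + a *s s \<in> L'"
      using subspace_scale[OF sL' h(3), of a] by (simp add: upow_scale scale_right_distrib)
    then show ?thesis unfolding R_def using r subspace_scale[OF M(1) h(1)] subspace_scale[OF sub_Sn h(2)]
        subspace_scale[OF W] subspace_scale[OF C_sub] unfolding R_def by blast
  qed
  have R_form: "(- 1) ^ k * b c ((u ^^ (2 * k)) c') = - b w w'" if r: "R w c" "R w' c'" for w w' c c'
  proof -
    obtain h s where h: "h \<in> M" "s \<in> Sn k" "(u ^^ k) c + h + w + s \<in> L'" using r(1) R_def by blast
    obtain h' s' where h': "h' \<in> M" "s' \<in> Sn k" "(u ^^ k) c' + h' + w' + s' \<in> L'" using r(2) R_def by blast
    have c: "c \<in> C k" "w \<in> W" "c' \<in> C k" "w' \<in> W" using r R_def by auto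
    have P: "h \<in> ?P" "h' \<in> ?P" "w \<in> ?P" "w' \<in> ?P" using c h h' MP WP by auto
    have wc: "b y ((u ^^ k) d) = 0" if "d \<in> C k" "y \<in> ?P" for y d using uC_Pn[OF that] b_sym[of y] by simp
    have sc: "b ((u ^^ k) d) y = 0" if "y \<in> Sn k" "d \<in> C k" for y d
      using Sn_K[OF that(1) C_K[OF that(2)]] b_sym[of y] by simp
    have hw: "b x y = 0" "b y x = 0" if "x \<in> M" "y \<in> W" for x y
      using orth[of x y] that M b_sym[of x] by auto
    have "b ((u ^^ k) c) ((u ^^ k) c') + b w w' = b ((u ^^ k) c + h + w + s) ((u ^^ k) c' + h' + w' + s')"
      using c h(1,2) h'(1,2) P by (simp add: bD uC_Pn wc Sn_K C_K sc iso hw Sn_Pn SPs Sn_Sn)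
    also have "\<dots> = 0" by (rule L'L'[OF h(3) h'(3)])
    finally show ?thesis unfolding Kn_Kn_same by (simp add: eq_neg_iff_add_eq_0)
  qed
  have R_W: "R y 0" if y: "y \<in> W" "y \<in> L'" for y
    unfolding R_def using y subspace_0[OF C_sub] subspace_0[OF M(1)] subspace_0[OF sub_Sn]
    by (intro conjI bexI[of _ 0]) auto
  have total: "\<exists>c. R w c" if w: "w \<in> W" for w
  proof -
    define A where "A = {w\<in>W. \<exists>c. R w c}"
    have R00: "R 0 0" by (rule R_W[OF subspace_0[OF W] subspace_0[OF sL']])
    have sA: "subspace A"
    proof (rule subspaceI)
      show "0 \<in> A" unfolding A_def using R00 subspace_0[OF W] by blast
      show "x + y \<in> A" if "x \<in> A" "y \<in> A" for x y
        using that R_add subspace_add[OF W] unfolding A_def by blast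
      show "c *s x \<in> A" if "x \<in> A" for c x
        using that R_scale subspace_scale[OF W] unfolding A_def by blast
    qed
    have AW: "A \<subseteq> W" unfolding A_def by blast
    have fA: "fd A" by (rule fdP[OF sA order_trans[OF AW WP(1)]])
    \<comment> \<open>A vector of \<open>W\<close> orthogonal to the domain \<open>A\<close> is
      orthogonal to all of \<open>L'\<close>, as only the \<open>W\<close>-components pair with it.
      It then lies in \<open>L'\<close> and in \<open>A\<close>, is isotropic, and vanishes; so
      \<open>A\<close> represents every functional and equals \<open>W\<close>.\<close>
    have "\<exists>a\<in>A. \<forall>y\<in>W. b w y = b a y"
    proof (rule perp_perp[OF b_bil fA W])
      fix y assume y: "y \<in> W" "\<forall>a\<in>A. b a y = 0"
      have yP: "y \<in> ?P" using y WP by auto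
      have "y \<in> L'"
      proof (rule L'I)
        show "y \<in> E" using yP PE by auto
        fix l assume l: "l \<in> L'"
        then obtain c h w1 s where d: "c \<in> C k" "h \<in> M" "w1 \<in> W" "s \<in> Sn k"
          "l = (u ^^ k) c + h + w1 + s" using dec by blast
        have "R w1 c" unfolding R_def using d l by blast
        then have "w1 \<in> A" using d unfolding A_def by blast
        then have "b y w1 = 0" using y(2) b_sym[of y] by simp
        then show "b y l = 0" unfolding d(5)
          using uC_Pn[OF d(1) yP] b_sym[of y "(u ^^ k) c"] orth[of h y] M d(2) y(1) b_sym[of y h] SPs[OF d(4) yP]
          by (auto simp: bD)
      qed
      then have "y \<in> A" unfolding A_def using R_W y(1) by blast
      then have "y = 0" using y an by blast
      then show "b w y = 0" by (simp add: bD)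
    qed
    then obtain a where a: "a \<in> A" "\<forall>y\<in>W. b w y = b a y" by blast
    have aW: "a \<in> W" using a AW by auto
    have "w - a \<in> W" by (rule subspace_diff[OF W w aW])
    moreover have "b w w = b a w" "b w a = b a a" using a(2) w aW by auto
    ultimately have "w - a = 0" by (intro an) (simp_all add: bD)
    then show ?thesis using a(1) unfolding A_def by simp
  qed
  obtain B where B: "finite B" "independent B" "B \<subseteq> W" "span B = W"
    using fd_basis[OF fdP[OF W WP(1)]] by metis
  interpret vp: vector_space_pair scale scale by unfold_locales
  \<comment> \<open>The relation is linear but may be multivalued, so values are chosen on a basis
    only and extended linearly; closure of \<open>R\<close> keeps the extension inside it.\<close>
  have "\<forall>w. \<exists>c. w \<in> W \<longrightarrow> R w c" using total by blast
  then obtain f where f: "\<forall>w. w \<in> W \<longrightarrow> R w (f w)" by (rule choice[THEN exE])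
  obtain \<phi> where \<phi>: "\<forall>x\<in>B. \<phi> x = f x" "Vector_Spaces.linear scale scale \<phi>"
    using vp.linear_independent_extend[OF B(2), of f] by (elim exE conjE) (rule that)
  interpret \<phi>: Vector_Spaces.linear scale scale \<phi> by (rule \<phi>(2))
  have R\<phi>: "R x (\<phi> x)" if "x \<in> W" for x using that unfolding B(4)[symmetric]
  proof (induction rule: span_induct_alt)
    case base
    then show ?case using R_W[OF subspace_0[OF W] subspace_0[OF sL']] by (simp add: \<phi>.zero)
  next
    case (step c x y)
    have "R x (\<phi> x)" using step f \<phi>(1) B(3) by auto
    then show ?case unfolding \<phi>.add \<phi>.scale using step by (intro R_add R_scale)
  qed
  show ?thesis using \<phi>.add \<phi>.scale R\<phi> R_form by (intro exI[of _ \<phi>]) (auto simp: R_def)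
qed

end

section \<open>Nonisotropic parts and Witt-simplification for presented spaces\<close>

lemma (in lin_space) linear_presentation:
  fixes X :: "('a, 'w, 'm) module_scheme"
  assumes K0: "fd K0" and car: "carrier X = cl ` K0"
    and add: "\<And>x y. x \<in> K0 \<Longrightarrow> y \<in> K0 \<Longrightarrow> cl (x + y) = cl x \<oplus>\<^bsub>X\<^esub> cl y"
    and zero: "\<zero>\<^bsub>X\<^esub> = cl 0" and sc: "\<And>c x. x \<in> K0 \<Longrightarrow> c \<odot>\<^bsub>X\<^esub> cl x = cl (c *s x)"
    and inj: "\<And>x. x \<in> K0 \<Longrightarrow> cl x = cl 0 \<Longrightarrow> x = 0"
  shows "presentation scale class_ring X K0 {0} cl scale 1"
proof (intro presentation.intro presentation_axioms.intro lin_space_axioms)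
  have s: "subspace K0" by (rule fd_subspace[OF K0])
  show "field (class_ring :: 'a ring)" by (rule class_field.field_axioms)
  show "{0} = {x \<in> K0. cl x = \<zero>\<^bsub>X\<^esub>}" using inj zero subspace_0[OF s] by auto
  show "\<exists>s\<in>carrier class_ring. \<forall>x\<in>K0. cl (c *s x) = cl (s *s x)" for c by (intro bexI[of _ c]) simp_all
  show "dim {s *s x + y |s y. s \<in> carrier class_ring \<and> y \<in> P} = dim P + 1"
    if P: "subspace P" "P \<subseteq> K0" and x: "x \<notin> P" for P x
  proof -
    have "{s *s x + y |s y. s \<in> carrier class_ring \<and> y \<in> P} = span (insert x P)"
      using mem_span_insert[OF P(1), of _ x] by (intro Set.set_eqI) auto
    then show ?thesis using dim_insert_notin[OF fd_mono[OF K0 P] x] by simp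
  qed
qed (use assms fd_subspace[OF K0] in \<open>simp_all add: subspace_scale scale_right_distrib scale_left_distrib\<close>)

lemma (in presentation) cl_inj:
  assumes "D = {0}" "x \<in> K0" "y \<in> K0" "cl x = cl y" shows "x = y"
proof -
  have m: "x - y \<in> K0" by (rule subspace_diff[OF subK assms(2,3)])
  have cc: "cl y \<in> carrier X" "cl (x - y) \<in> carrier X" using assms m by (simp_all add: carr)
  have "cl y \<oplus>\<^bsub>X\<^esub> cl (x - y) = cl y \<oplus>\<^bsub>X\<^esub> \<zero>\<^bsub>X\<^esub>" using cl_add[OF assms(3) m] assms(4) cc by simp
  then have "cl (x - y) = \<zero>\<^bsub>X\<^esub>" by (rule X.a_lcancel[OF _ cc X.zero_closed])
  then have "x - y \<in> D" using m cl_D by auto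
  then show ?thesis using assms(1) by simp
qed

text \<open>Both quotient-type spaces are presented without denominator: \<open>P0\<close> models
  the one to be simplified, with the form \<open>b\<close> itself, and \<open>Q0\<close> the
  simplifying one, with the form \<open>\<beta>\<close>.\<close>

locale witt_pair = skew_space scale b u + P: presentation scale class_ring X P0 "{0}" \<psi> scale 1 +
    Q: presentation scale class_ring Y Q0 "{0}" \<chi> scale 1
  for scale :: "'a::field \<Rightarrow> 'b::ab_group_add \<Rightarrow> 'b"  (infixr \<open>*s\<close> 75)
    and b :: "'b \<Rightarrow> 'b \<Rightarrow> 'a" and u :: "'b \<Rightarrow> 'b"
    and X :: "('a, 'w) module" and P0 \<psi> and Y :: "('a, 'y) module" and Q0 \<chi> +
  fixes BX :: "'w \<Rightarrow> 'w \<Rightarrow> 'a" and BY :: "'y \<Rightarrow> 'y \<Rightarrow> 'a" and \<beta> :: "'b \<Rightarrow> 'b \<Rightarrow> 'a"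
  assumes BX: "x \<in> P0 \<Longrightarrow> y \<in> P0 \<Longrightarrow> BX (\<psi> x) (\<psi> y) = b x y"
    and BY: "x \<in> Q0 \<Longrightarrow> y \<in> Q0 \<Longrightarrow> BY (\<chi> x) (\<chi> y) = \<beta> x y"
begin

lemmas \<psi>_inj = P.cl_inj[OF refl] and \<chi>_inj = Q.cl_inj[OF refl]

lemma preP:
  assumes W: "VectorSpace.subspace class_ring W X"
  shows "subspace (P.pre W)" "P.pre W \<subseteq> P0" "\<psi> ` P.pre W = W"
    "vectorspace.dim class_ring (X\<lparr>carrier := W\<rparr>) = dim (P.pre W)"
proof -
  have sm: "submodule class_ring W X" using W by (simp add: VectorSpace.subspace_def)
  show "subspace (P.pre W)" "P.pre W \<subseteq> P0" "\<psi> ` P.pre W = W" using P.pre_submodule[OF sm] by auto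
  show "vectorspace.dim class_ring (X\<lparr>carrier := W\<rparr>) = dim (P.pre W)"
    using P.sub_dim(2)[OF W] by (simp add: dim_zero)
qed

lemma imP:
  assumes "subspace W" "W \<subseteq> P0"
  shows "VectorSpace.subspace class_ring (\<psi> ` W) X" "P.pre (\<psi> ` W) = W"
    "vectorspace.dim class_ring (X\<lparr>carrier := \<psi> ` W\<rparr>) = dim W"
proof -
  have 0: "{0} \<subseteq> W" using subspace_0[OF assms(1)] by simp
  note I = P.image_subspace[OF assms(1) 0 assms(2) subspace_scale[OF assms(1)]]
  show "VectorSpace.subspace class_ring (\<psi> ` W) X" "P.pre (\<psi> ` W) = W" using I by auto
  then show "vectorspace.dim class_ring (X\<lparr>carrier := \<psi> ` W\<rparr>) = dim W" using preP(4) by simp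
qed

text \<open>An arbitrary nonisotropic part is pulled back to \<open>P0\<close>, where its hyperbolic
  complement acquires a Lagrangian \<open>M\<close>; the map \<phi> obtained there is pushed forward
  to the required equivalence.\<close>

lemma witt_simplifiesI:
  assumes ex: "\<And>W H M. subspace W \<Longrightarrow> subspace H \<Longrightarrow> ssum H W = P0 \<Longrightarrow>
    (\<And>x y. x \<in> H \<Longrightarrow> y \<in> W \<Longrightarrow> b x y = 0) \<Longrightarrow> subspace M \<Longrightarrow> M \<subseteq> H \<Longrightarrow>
    (\<And>x y. x \<in> M \<Longrightarrow> y \<in> M \<Longrightarrow> b x y = 0) \<Longrightarrow> dim H = 2 * dim M \<Longrightarrow> (\<And>x. x \<in> W \<Longrightarrow> b x x = 0 \<Longrightarrow> x = 0) \<Longrightarrow>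
    \<exists>\<phi>. (\<forall>x y. \<phi> (x + y) = \<phi> x + \<phi> y) \<and> (\<forall>c x. \<phi> (c *s x) = c *s \<phi> x) \<and> (\<forall>w\<in>W. \<phi> w \<in> Q0) \<and>
      (\<forall>x\<in>W. \<forall>y\<in>W. \<beta> (\<phi> x) (\<phi> y) = - b x y)"
  shows "witt_simplifies class_ring Y BY X BX" unfolding witt_simplifies_def
proof (intro allI impI)
  fix W' assume np: "nonisotropic_part class_ring X BX W'"
  obtain H' where W': "VectorSpace.subspace class_ring W' X"
    and ni: "nonisotropic class_ring (X\<lparr>carrier := W'\<rparr>) BX"
    and H': "VectorSpace.subspace class_ring H' X" "H' <+>\<^bsub>X\<^esub> W' = carrier X"
      "\<forall>x\<in>H'. \<forall>y\<in>W'. BX x y = \<zero>\<^bsub>class_ring\<^esub>" "hyperbolic class_ring (X\<lparr>carrier := H'\<rparr>) BX"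
    using np unfolding nonisotropic_part_def by (elim exE conjE) (rule that)
  obtain m M' where M': "vectorspace.dim class_ring (X\<lparr>carrier := H'\<rparr>) = 2 * m"
    "totally_isotropic class_ring (X\<lparr>carrier := H'\<rparr>) BX M'"
    "vectorspace.dim class_ring (X\<lparr>carrier := H'\<rparr>\<lparr>carrier := M'\<rparr>) = m"
    using H'(4) unfolding hyperbolic_def by (elim exE conjE) (rule that)
  have smM: "submodule class_ring M' (X\<lparr>carrier := H'\<rparr>)" and isoM: "\<forall>x\<in>M'. \<forall>y\<in>M'. BX x y = 0"
    using M'(2) unfolding totally_isotropic_def VectorSpace.subspace_def by auto
  have H'X: "H' \<subseteq> carrier X" using H'(1) unfolding VectorSpace.subspace_def submodule_def by simp
  have M'H: "M' \<subseteq> H'" using smM unfolding submodule_def by simp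
  have M's: "VectorSpace.subspace class_ring M' X"
    using smM H'X P.vsX unfolding VectorSpace.subspace_def submodule_def by (auto simp: vectorspace_def)
  define W H M where "W = P.pre W'" and "H = P.pre H'" and "M = P.pre M'"
  note W = preP[OF W', folded W_def] and H = preP[OF H'(1), folded H_def] and M = preP[OF M's, folded M_def]
  have mem: "x \<in> P0" "\<psi> x \<in> W'" if "x \<in> W" for x using that by (auto simp: W_def P.pre_def)
  have memH: "x \<in> P0" "\<psi> x \<in> H'" if "x \<in> H" for x using that by (auto simp: H_def P.pre_def)
  have memM: "x \<in> P0" "\<psi> x \<in> M'" if "x \<in> M" for x using that by (auto simp: M_def P.pre_def)
  have an: "x = 0" if x: "x \<in> W" "b x x = 0" for x
  proof -
    have "\<psi> x = \<zero>\<^bsub>X\<^esub>" using ni x mem[OF x(1)] unfolding nonisotropic_def by (simp add: BX)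
    then show ?thesis using mem(1)[OF x(1)] P.cl_D by auto
  qed
  have "\<exists>\<phi>. (\<forall>x y. \<phi> (x + y) = \<phi> x + \<phi> y) \<and> (\<forall>c x. \<phi> (c *s x) = c *s \<phi> x) \<and> (\<forall>w\<in>W. \<phi> w \<in> Q0) \<and>
      (\<forall>x\<in>W. \<forall>y\<in>W. \<beta> (\<phi> x) (\<phi> y) = - b x y)"
  proof (rule ex)
    show "subspace W" "subspace H" "subspace M" by (rule W(1) H(1) M(1))+
    show "ssum H W = P0"
    proof (intro equalityI ssum_least[OF P.subK H(2) W(2)] subsetI)
      fix x assume x: "x \<in> P0"
      then have "\<psi> x \<in> H' <+>\<^bsub>X\<^esub> W'" unfolding H'(2) by (simp add: P.carr)
      then obtain h' w' where hw': "h' \<in> H'" "w' \<in> W'" "\<psi> x = h' \<oplus>\<^bsub>X\<^esub> w'" unfolding set_add_def' by blast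
      obtain h w where hw: "h \<in> H" "h' = \<psi> h" "w \<in> W" "w' = \<psi> w" using hw' H(3) W(3) by blast
      have PP: "h \<in> P0" "w \<in> P0" using hw memH mem by auto
      have "\<psi> x = \<psi> (h + w)" using hw' hw PP by (simp add: P.cl_add)
      then have "x = h + w" by (rule \<psi>_inj[OF x subspace_add[OF P.subK PP]])
      then show "x \<in> ssum H W" using hw by (auto intro: ssum_mem)
    qed
    show "b x y = 0" if "x \<in> H" "y \<in> W" for x y
      using BX[OF memH(1)[OF that(1)] mem(1)[OF that(2)]] H'(3) memH(2)[OF that(1)] mem(2)[OF that(2)] by simp
    show "M \<subseteq> H" using M'H by (auto simp: M_def H_def P.pre_def)
    show "b x y = 0" if "x \<in> M" "y \<in> M" for x y
      using BX[OF memM(1)[OF that(1)] memM(1)[OF that(2)]] isoM memM(2)[OF that(1)] memM(2)[OF that(2)] by simp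
    show "dim H = 2 * dim M" using M'(1,3) H(4) M(4) by simp
  qed (rule an)
  then obtain \<phi> where \<phi>: "\<forall>x y. \<phi> (x + y) = \<phi> x + \<phi> y" "\<forall>c x. \<phi> (c *s x) = c *s \<phi> x" "\<forall>w\<in>W. \<phi> w \<in> Q0"
    "\<forall>x\<in>W. \<forall>y\<in>W. \<beta> (\<phi> x) (\<phi> y) = - b x y" by (elim exE conjE) (rule that)
  have \<phi>0: "\<phi> 0 = 0" using \<phi>(2)[rule_format, of 0 0] by simp
  have sU: "subspace (\<phi> ` W)"
  proof (rule subspaceI)
    show "0 \<in> \<phi> ` W" using \<phi>0 subspace_0[OF W(1)] by (metis imageI)
    show "x + y \<in> \<phi> ` W" if "x \<in> \<phi> ` W" "y \<in> \<phi> ` W" for x y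
      using that \<phi>(1) subspace_add[OF W(1)] by (auto simp flip: \<phi>(1)[rule_format])
    show "c *s x \<in> \<phi> ` W" if "x \<in> \<phi> ` W" for c x
      using that subspace_scale[OF W(1)] by (auto simp flip: \<phi>(2)[rule_format])
  qed
  have UQ: "\<phi> ` W \<subseteq> Q0" using \<phi>(3) by blast
  define U where "U = \<chi> ` \<phi> ` W"
  have U: "VectorSpace.subspace class_ring U Y"
    unfolding U_def by (rule Q.image_subspace(1)[OF sU _ UQ subspace_scale[OF sU]])
      (use subspace_0[OF sU] in auto)
  define f where "f y = \<chi> (\<phi> (inv_into W \<psi> y))" for y
  have \<psi>W: "inj_on \<psi> W" using \<psi>_inj mem(1) by (auto intro: inj_onI)
  have f: "f (\<psi> x) = \<chi> (\<phi> x)" if "x \<in> W" for x unfolding f_def using inv_into_f_f[OF \<psi>W that] by simp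
  have lin: "linear_map class_ring (X\<lparr>carrier := W'\<rparr>) (Y\<lparr>carrier := U\<rparr>) f"
  proof -
    have vs: "vectorspace class_ring (X\<lparr>carrier := W'\<rparr>)" "vectorspace class_ring (Y\<lparr>carrier := U\<rparr>)"
      by (rule P.X.subspace_is_vs[OF W'] Q.X.subspace_is_vs[OF U])+
    have fU: "f y \<in> U" if y: "y \<in> W'" for y
    proof -
      obtain x where "x \<in> W" "y = \<psi> x" using y W(3) by blast
      then show ?thesis using f by (auto simp: U_def)
    qed
    moreover have "f (y \<oplus>\<^bsub>X\<^esub> z) = f y \<oplus>\<^bsub>Y\<^esub> f z" if yz: "y \<in> W'" "z \<in> W'" for y z
    proof -
      obtain x where x: "x \<in> W" "y = \<psi> x" using yz W(3) by blast
      obtain x' where x': "x' \<in> W" "z = \<psi> x'" using yz W(3) by blast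
      have "y \<oplus>\<^bsub>X\<^esub> z = \<psi> (x + x')" using x x' mem by (simp add: P.cl_add)
      then show ?thesis using x x' \<phi>(1,3) by (simp add: f subspace_add[OF W(1)] Q.cl_add)
    qed
    moreover have "f (c \<odot>\<^bsub>X\<^esub> y) = c \<odot>\<^bsub>Y\<^esub> f y" if y: "y \<in> W'" for c y
    proof -
      obtain x where x: "x \<in> W" "y = \<psi> x" using y W(3) by blast
      have "c \<odot>\<^bsub>X\<^esub> y = \<psi> (c *s x)" using x mem P.cl_act[of c x] by simp
      then show ?thesis using x \<phi>(2,3) Q.cl_act[of c "\<phi> x"] by (simp add: f subspace_scale[OF W(1)])
    qed
    ultimately have "f \<in> LinearCombinations.module_hom class_ring (X\<lparr>carrier := W'\<rparr>) (Y\<lparr>carrier := U\<rparr>)"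
      unfolding LinearCombinations.module_hom_def by simp
    then show ?thesis
      using vs by (intro linear_map.intro mod_hom.intro mod_hom_axioms.intro) (auto simp: vectorspace_def)
  qed
  have fB: "\<ominus>\<^bsub>class_ring\<^esub> BY (f y) (f z) = BX y z" if yz: "y \<in> W'" "z \<in> W'" for y z
  proof -
    obtain x where x: "x \<in> W" "y = \<psi> x" using yz W(3) by blast
    obtain x' where x': "x' \<in> W" "z = \<psi> x'" using yz W(3) by blast
    have "BY (f y) (f z) = - b x x'" using x x' \<phi>(3,4) by (simp add: f BY)
    then show ?thesis using x x' mem by (simp add: BX class_ring_simps)
  qed
  have "bij_betw f W' U"
  proof (rule bij_betwI')
    show "f y = f z \<longleftrightarrow> y = z" if yz: "y \<in> W'" "z \<in> W'" for y z
    proof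
      assume e: "f y = f z"
      obtain x where x: "x \<in> W" "y = \<psi> x" using yz W(3) by blast
      obtain x' where x': "x' \<in> W" "z = \<psi> x'" using yz W(3) by blast
      have "\<phi> x = \<phi> x'" using e x x' \<phi>(3) by (intro \<chi>_inj) (auto simp: f)
      moreover have "\<phi> x = \<phi> (x - x') + \<phi> x'" unfolding \<phi>(1)[rule_format, symmetric] by simp
      ultimately have "\<phi> (x - x') = 0" by simp
      moreover have "x - x' \<in> W" by (rule subspace_diff[OF W(1) x(1) x'(1)])
      moreover have "\<beta> 0 0 = 0" using \<phi>(4) subspace_0[OF W(1)] \<phi>0 by (metis bD(5) minus_zero)
      \<comment> \<open>Injectivity comes from anisotropy: a vector killed by the anti-isometry has
        norm 0.\<close>
      ultimately have "x - x' = 0" using \<phi>(4) by (intro an) (metis neg_equal_0_iff_equal)+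
      then show "y = z" using x x' by simp
    qed simp
    show "f y \<in> U" if y: "y \<in> W'" for y
    proof -
      obtain x where "x \<in> W" "y = \<psi> x" using y W(3) by blast
      then show ?thesis using f by (auto simp: U_def)
    qed
    show "\<exists>y\<in>W'. z = f y" if z: "z \<in> U" for z
    proof -
      obtain x where "x \<in> W" "z = \<chi> (\<phi> x)" using z by (auto simp: U_def)
      then show ?thesis using f mem(2) by (intro bexI[of _ "\<psi> x"]) auto
    qed
  qed
  then have "equivalent_forms class_ring (X\<lparr>carrier := W'\<rparr>) BX (Y\<lparr>carrier := U\<rparr>) (\<lambda>x y. \<ominus>\<^bsub>class_ring\<^esub> BY x y)"
    unfolding equivalent_forms_def using lin fB by - (rule exI[of _ f], simp)
  then show "\<exists>U. VectorSpace.subspace class_ring U Y \<and>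
      equivalent_forms class_ring (X\<lparr>carrier := W'\<rparr>) BX (Y\<lparr>carrier := U\<rparr>) (\<lambda>x y. \<ominus>\<^bsub>class_ring\<^esub> BY x y)"
    using U by blast
qed

text \<open>A nonisotropic part has to be exhibited. With \<open>M\<close> isotropic of largest
  dimension, a complement \<open>W\<close> of \<open>M\<close> in its orthogonal is anisotropic,
  since an isotropic vector would enlarge \<open>M\<close>.\<close>

lemma witt_simplifiesD:
  assumes ws: "witt_simplifies class_ring Y BY X BX"
    and nd: "\<forall>x\<in>P0. (\<forall>y\<in>P0. b x y = 0) \<longrightarrow> x = 0"
  shows "\<exists>W M \<phi>. subspace W \<and> W \<subseteq> P0 \<and> subspace M \<and> M \<subseteq> P0 \<and> (\<forall>x\<in>M. \<forall>y\<in>M. b x y = 0) \<and>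
    (\<forall>x\<in>M. \<forall>y\<in>W. b x y = 0) \<and> (\<forall>x\<in>W. b x x = 0 \<longrightarrow> x = 0) \<and>
    (\<forall>x\<in>P0. (\<forall>y\<in>M. b x y = 0) \<longrightarrow> (\<exists>m\<in>M. \<exists>w\<in>W. x = m + w)) \<and>
    (\<forall>w\<in>W. \<phi> w \<in> Q0) \<and> (\<forall>x\<in>W. \<forall>y\<in>W. \<phi> (x + y) = \<phi> x + \<phi> y) \<and>
    (\<forall>c. \<forall>x\<in>W. \<phi> (c *s x) = c *s \<phi> x) \<and> (\<forall>x\<in>W. \<forall>y\<in>W. \<beta> (\<phi> x) (\<phi> y) = - b x y)"
proof -
  have fP: "fd Z" if "subspace Z" "Z \<subseteq> P0" for Z by (rule fd_mono[OF P.fdK that])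
  have nd': "{m\<in>Z. \<forall>x\<in>P0. b m x = 0} = {0}" if "subspace Z" "Z \<subseteq> P0" for Z
    using nd that subspace_0 by (auto simp: bD)
  have sperp: "subspace {x\<in>P0. \<forall>z\<in>Z. b z x = 0}" for Z
    using P.subK unfolding subspace_def by (auto simp: bD)
  have dperp: "dim {x\<in>P0. \<forall>z\<in>Z. b z x = 0} + dim Z = dim P0" if "subspace Z" "Z \<subseteq> P0" for Z
    using dim_perp[OF b_bil P.fdK that] by (simp add: nd'[OF that] dim_zero)
  define I where "I Z \<longleftrightarrow> subspace Z \<and> Z \<subseteq> P0 \<and> (\<forall>x\<in>Z. \<forall>y\<in>Z. b x y = 0)" for Z
  have I0: "I {0}" using subspace_0[OF P.subK] by (simp add: I_def bD)
  have "\<exists>M. I M \<and> (\<forall>M'. I M' \<longrightarrow> M \<subseteq> M' \<longrightarrow> M' = M) \<and> (\<forall>M'. I M' \<longrightarrow> dim M' \<le> dim M)"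
    by (rule max_dim_exists[of P0 I "{0}", OF P.fdK I0]) (simp add: I_def)
  then obtain M where IM: "I M" and Mmax: "\<forall>M'. I M' \<longrightarrow> M \<subseteq> M' \<longrightarrow> M' = M"
    and Mdim: "\<forall>M'. I M' \<longrightarrow> dim M' \<le> dim M" by (elim exE conjE) (rule that)
  have M: "subspace M" "M \<subseteq> P0" "\<And>x y. x \<in> M \<Longrightarrow> y \<in> M \<Longrightarrow> b x y = 0" using IM by (auto simp: I_def)
  define Mp where "Mp = {x\<in>P0. \<forall>z\<in>M. b z x = 0}"
  have Mp: "subspace Mp" "Mp \<subseteq> P0" "M \<subseteq> Mp" unfolding Mp_def using sperp M by auto
  obtain W where W: "subspace W" "W \<subseteq> Mp" "W \<inter> M = {0}" "ssum W M = Mp"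
    using complement_exists[OF fP[OF Mp(1,2)] M(1) Mp(3)] by (elim exE conjE) (rule that)
  have WP: "W \<subseteq> P0" using W Mp by auto
  have MW: "b x y = 0" if "x \<in> M" "y \<in> W" for x y using that W(2) unfolding Mp_def by blast
  have WM: "b y x = 0" if "x \<in> M" "y \<in> W" for x y using MW[OF that] b_sym[of y] by simp
  have an: "x = 0" if x: "x \<in> W" "b x x = 0" for x
  proof -
    have xP: "x \<in> P0" using x WP by auto
    have "I (span (insert x M))" unfolding I_def
    proof (intro conjI ballI)
      show "span (insert x M) \<subseteq> P0" using xP M(2) by (intro span_minimal P.subK) auto
      fix y z assume "y \<in> span (insert x M)" "z \<in> span (insert x M)"
      then obtain c m c' m' where "y = c *s x + m" "m \<in> M" "z = c' *s x + m'" "m' \<in> M"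
        unfolding mem_span_insert[OF M(1)] by blast
      then show "b y z = 0" using x M(3) MW WM by (simp add: bD)
    qed simp
    then have "span (insert x M) = M" using Mmax span_superset[of "insert x M"] by blast
    then have "x \<in> M" using span_base[of x "insert x M"] by simp
    then show ?thesis using x(1) W(3) by blast
  qed
  \<comment> \<open>The orthogonal of \<open>W\<close> contains \<open>M\<close>, and counting
    dimensions gives dim H = 2 dim M; so it is the hyperbolic summand with Lagrangian
    \<open>M\<close>.\<close>
  define H where "H = {x\<in>P0. \<forall>z\<in>W. b z x = 0}"
  have H: "subspace H" "H \<subseteq> P0" "M \<subseteq> H" unfolding H_def using sperp M(2) WM by auto
  have HW: "b x y = 0" if "x \<in> H" "y \<in> W" for x y using that b_sym[of x] unfolding H_def by simp
  have HiW: "H \<inter> W = {0}"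
  proof -
    have "x = 0" if "x \<in> H" "x \<in> W" for x using HW[OF that] by (rule an[OF that(2)])
    then show ?thesis using subspace_0[OF H(1)] subspace_0[OF W(1)] by blast
  qed
  have d1: "dim Mp + dim M = dim P0" unfolding Mp_def by (rule dperp[OF M(1,2)])
  have d2: "dim H + dim W = dim P0" unfolding H_def by (rule dperp[OF W(1) WP])
  have d3: "dim W + dim M = dim Mp" using dim_ssum[OF fP[OF W(1) WP] fP[OF M(1,2)] W(3)] W(4) by simp
  have d4: "dim H = 2 * dim M" using d1 d2 d3 by simp
  have HWs: "ssum H W = P0"
  proof (rule dim_eq_fd[OF P.fdK subspace_ssum[OF H(1) W(1)] ssum_least[OF P.subK H(2) WP]])
    show "dim P0 \<le> dim (ssum H W)" using dim_ssum[OF fP[OF H(1,2)] fP[OF W(1) WP] HiW] d2 by simp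
  qed
  note iW = imP[OF W(1) WP] and iH = imP[OF H(1,2)] and iM = imP[OF M(1,2)]
  have "nonisotropic_part class_ring X BX (\<psi> ` W)" unfolding nonisotropic_part_def
  proof (intro conjI exI[of _ "\<psi> ` H"])
    show "VectorSpace.subspace class_ring (\<psi> ` W) X" "VectorSpace.subspace class_ring (\<psi> ` H) X"
      by (rule iW(1) iH(1))+
    show "nonisotropic class_ring (X\<lparr>carrier := \<psi> ` W\<rparr>) BX" unfolding nonisotropic_def
    proof (intro ballI impI)
      fix y assume "y \<in> carrier (X\<lparr>carrier := \<psi> ` W\<rparr>)" "BX y y = \<zero>\<^bsub>class_ring\<^esub>"
      then obtain x where x: "x \<in> W" "y = \<psi> x" "BX y y = 0" by auto
      have "x \<in> P0" using x WP by auto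
      then have "x = 0" using x by (intro an) (simp_all add: BX)
      then show "y = \<zero>\<^bsub>X\<lparr>carrier := \<psi> ` W\<rparr>\<^esub>" using x P.cl0 by simp
    qed
    show "\<psi> ` H <+>\<^bsub>X\<^esub> \<psi> ` W = carrier X"
    proof (intro equalityI subsetI)
      fix y assume "y \<in> \<psi> ` H <+>\<^bsub>X\<^esub> \<psi> ` W"
      then obtain h w where hw: "h \<in> H" "w \<in> W" "y = \<psi> h \<oplus>\<^bsub>X\<^esub> \<psi> w" unfolding set_add_def' by blast
      then have P: "h \<in> P0" "w \<in> P0" using H WP by auto
      then show "y \<in> carrier X" using hw subspace_add[OF P.subK P] by (simp add: P.carr flip: P.cl_add)
    next
      fix y assume "y \<in> carrier X"
      then obtain x where x: "x \<in> P0" "y = \<psi> x" by (auto simp: P.carr)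
      then obtain h w where hw: "h \<in> H" "w \<in> W" "x = h + w" unfolding HWs[symmetric] ssum_def by blast
      then have "h \<in> P0" "w \<in> P0" using H WP by auto
      then have "y = \<psi> h \<oplus>\<^bsub>X\<^esub> \<psi> w" using x hw by (simp add: P.cl_add)
      then show "y \<in> \<psi> ` H <+>\<^bsub>X\<^esub> \<psi> ` W" unfolding set_add_def' using hw by blast
    qed
    show "\<psi> ` H \<inter> \<psi> ` W = {\<zero>\<^bsub>X\<^esub>}"
    proof (intro equalityI subsetI)
      fix y assume "y \<in> \<psi> ` H \<inter> \<psi> ` W"
      then obtain h w where hw: "h \<in> H" "w \<in> W" "y = \<psi> h" "\<psi> h = \<psi> w" by blast
      then have P: "h \<in> P0" "w \<in> P0" using H WP by auto
      have "h = w" by (rule \<psi>_inj[OF P hw(4)])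
      then have "h = 0" using hw HiW by blast
      then show "y \<in> {\<zero>\<^bsub>X\<^esub>}" using hw P.cl0 by simp
    next
      fix y assume "y \<in> {\<zero>\<^bsub>X\<^esub>}"
      then have "y = \<psi> 0" using P.cl0 by simp
      then show "y \<in> \<psi> ` H \<inter> \<psi> ` W" using subspace_0[OF H(1)] subspace_0[OF W(1)] by blast
    qed
    show "\<forall>x\<in>\<psi> ` H. \<forall>y\<in>\<psi> ` W. BX x y = \<zero>\<^bsub>class_ring\<^esub>"
      using HW H(2) WP by (auto simp: BX subset_eq)
    have sM: "VectorSpace.subspace class_ring (\<psi> ` M) (X\<lparr>carrier := \<psi> ` H\<rparr>)"
      using iM(1) P.X.subspace_is_vs[OF iH(1)] H(3) unfolding VectorSpace.subspace_def submodule_def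
      by (auto simp: vectorspace_def)
    have "totally_isotropic class_ring (X\<lparr>carrier := \<psi> ` H\<rparr>) BX (\<psi> ` M)"
      unfolding totally_isotropic_def using sM M by (auto simp: BX subset_eq)
    then show "hyperbolic class_ring (X\<lparr>carrier := \<psi> ` H\<rparr>) BX"
      unfolding hyperbolic_def using iH(3) iM(3) d4
      by (intro exI[of _ "dim M"] conjI exI[of _ "\<psi> ` M"]) simp_all
    have "witt_index class_ring X BX = dim M" unfolding witt_index_def
    proof (rule Greatest_equality)
      show "\<exists>Z. totally_isotropic class_ring X BX Z \<and> vectorspace.dim class_ring (X\<lparr>carrier := Z\<rparr>) = dim M"
        by (intro exI[of _ "\<psi> ` M"]) (use iM M in \<open>auto simp: totally_isotropic_def BX subset_eq\<close>)
      fix n assume "\<exists>Z. totally_isotropic class_ring X BX Z \<and> vectorspace.dim class_ring (X\<lparr>carrier := Z\<rparr>) = n"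
      then obtain Z where Z: "totally_isotropic class_ring X BX Z"
        "vectorspace.dim class_ring (X\<lparr>carrier := Z\<rparr>) = n" by blast
      have Zs: "VectorSpace.subspace class_ring Z X" and Zi: "\<forall>x\<in>Z. \<forall>y\<in>Z. BX x y = 0"
        using Z(1) by (auto simp: totally_isotropic_def)
      note p = preP[OF Zs]
      have "b x y = 0" if "x \<in> P.pre Z" "y \<in> P.pre Z" for x y
        using that Zi BX[of x y] by (auto simp: P.pre_def)
      then have "I (P.pre Z)" unfolding I_def using p by blast
      then show "n \<le> dim M" using Mdim p(4) Z(2) by auto
    qed
    then show "vectorspace.dim class_ring (X\<lparr>carrier := \<psi> ` H\<rparr>) = 2 * witt_index class_ring X BX"
      using iH(3) d4 by simp
  qed
  then obtain U where U: "VectorSpace.subspace class_ring U Y"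
    "equivalent_forms class_ring (X\<lparr>carrier := \<psi> ` W\<rparr>) BX (Y\<lparr>carrier := U\<rparr>) (\<lambda>x y. \<ominus>\<^bsub>class_ring\<^esub> BY x y)"
    using ws unfolding witt_simplifies_def by blast
  obtain f where f: "linear_map class_ring (X\<lparr>carrier := \<psi> ` W\<rparr>) (Y\<lparr>carrier := U\<rparr>) f"
    "\<forall>x\<in>carrier (X\<lparr>carrier := \<psi> ` W\<rparr>). \<forall>y\<in>carrier (X\<lparr>carrier := \<psi> ` W\<rparr>). \<ominus>\<^bsub>class_ring\<^esub> BY (f x) (f y) = BX x y"
    using U(2) unfolding equivalent_forms_def by blast
  interpret f: linear_map class_ring "X\<lparr>carrier := \<psi> ` W\<rparr>" "Y\<lparr>carrier := U\<rparr>" f by (rule f(1))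
  have UY: "U \<subseteq> \<chi> ` Q0" using U(1) Q.carr unfolding VectorSpace.subspace_def submodule_def by simp
  have fU: "f (\<psi> w) \<in> \<chi> ` Q0" if "w \<in> W" for w using f.f_im[of "\<psi> w"] that UY by auto
  define \<phi> where "\<phi> w = inv_into Q0 \<chi> (f (\<psi> w))" for w
  have \<phi>: "\<phi> w \<in> Q0" "\<chi> (\<phi> w) = f (\<psi> w)" if "w \<in> W" for w
    unfolding \<phi>_def using inv_into_into[OF fU[OF that]] f_inv_into_f[OF fU[OF that]] by auto
  have \<phi>I: "\<phi> w = c" if "w \<in> W" "c \<in> Q0" "f (\<psi> w) = \<chi> c" for w c
    using \<phi>[OF that(1)] that by (intro \<chi>_inj) auto
  have \<phi>_add: "\<phi> (x + y) = \<phi> x + \<phi> y" if xy: "x \<in> W" "y \<in> W" for x y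
  proof (rule \<phi>I)
    show "x + y \<in> W" by (rule subspace_add[OF W(1) xy])
    show "\<phi> x + \<phi> y \<in> Q0" by (rule subspace_add[OF Q.subK \<phi>(1)[OF xy(1)] \<phi>(1)[OF xy(2)]])
    have "x \<in> P0" "y \<in> P0" using xy WP by auto
    then have "\<psi> (x + y) = \<psi> x \<oplus>\<^bsub>X\<lparr>carrier := \<psi> ` W\<rparr>\<^esub> \<psi> y" by (simp add: P.cl_add)
    then have "f (\<psi> (x + y)) = f (\<psi> x) \<oplus>\<^bsub>Y\<^esub> f (\<psi> y)" using f.f_add[of "\<psi> x" "\<psi> y"] xy by simp
    then show "f (\<psi> (x + y)) = \<chi> (\<phi> x + \<phi> y)" using \<phi> xy by (simp add: Q.cl_add)
  qed
  have \<phi>_scale: "\<phi> (c *s x) = c *s \<phi> x" if x: "x \<in> W" for c x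
  proof (rule \<phi>I)
    show "c *s x \<in> W" by (rule subspace_scale[OF W(1) x])
    show "c *s \<phi> x \<in> Q0" by (rule subspace_scale[OF Q.subK \<phi>(1)[OF x]])
    have "x \<in> P0" using x WP by auto
    then have "\<psi> (c *s x) = c \<odot>\<^bsub>X\<lparr>carrier := \<psi> ` W\<rparr>\<^esub> \<psi> x" using P.cl_act[of c x] by simp
    then have "f (\<psi> (c *s x)) = c \<odot>\<^bsub>Y\<^esub> f (\<psi> x)" using f.f_smult[of c "\<psi> x"] x by simp
    then show "f (\<psi> (c *s x)) = \<chi> (c *s \<phi> x)" using \<phi>[OF x] Q.cl_act[of c "\<phi> x"] by simp
  qed
  have \<phi>_form: "\<beta> (\<phi> x) (\<phi> y) = - b x y" if xy: "x \<in> W" "y \<in> W" for x y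
  proof -
    have P: "x \<in> P0" "y \<in> P0" using xy WP by auto
    have "- BY (f (\<psi> x)) (f (\<psi> y)) = b x y" using f(2) xy BX[OF P] by (simp add: class_ring_simps)
    then show ?thesis using \<phi> xy BY[OF \<phi>(1)[OF xy(1)] \<phi>(1)[OF xy(2)]] by (metis minus_minus)
  qed
  have perp: "\<exists>m\<in>M. \<exists>w\<in>W. x = m + w" if x: "x \<in> P0" "\<forall>y\<in>M. b x y = 0" for x
  proof -
    have "x \<in> ssum W M" unfolding W(4) Mp_def using x b_sym[of x] by simp
    then obtain w m where "w \<in> W" "m \<in> M" "x = w + m" unfolding ssum_def by blast
    moreover from this(3) have "x = m + w" by (simp add: add.commute)
    ultimately show ?thesis by blast
  qed
  have A: "\<forall>x\<in>M. \<forall>y\<in>M. b x y = 0" "\<forall>x\<in>M. \<forall>y\<in>W. b x y = 0" "\<forall>x\<in>W. b x x = 0 \<longrightarrow> x = 0"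
    "\<forall>x\<in>P0. (\<forall>y\<in>M. b x y = 0) \<longrightarrow> (\<exists>m\<in>M. \<exists>w\<in>W. x = m + w)" "\<forall>w\<in>W. \<phi> w \<in> Q0"
    "\<forall>x\<in>W. \<forall>y\<in>W. \<phi> (x + y) = \<phi> x + \<phi> y" "\<forall>c. \<forall>x\<in>W. \<phi> (c *s x) = c *s \<phi> x"
    "\<forall>x\<in>W. \<forall>y\<in>W. \<beta> (\<phi> x) (\<phi> y) = - b x y"
    using M(3) MW an perp \<phi>(1) \<phi>_add \<phi>_scale \<phi>_form by simp_all
  show ?thesis
    by (rule exI[of _ W], rule exI[of _ M], rule exI[of _ \<phi>], intro conjI) (rule A W(1) WP M(1,2))+
qed

end

section \<open>Condition (iii) for the given space\<close>

context realization
begin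

abbreviation (input) tX :: "'f poly" where "tX \<equiv> [:0, 1:]"

lemma kerodd_ker: "kerodd (nilp V0) i = ker V0 (tX ^ (2 * i + 1))"
  unfolding kerodd_def ker_def nilp_def pev_X_power by blast

text \<open>The witness z in the denominator of the whole space is automatically nilpotent, because
  u^(2i+1) z is u^(2i) x and one more u kills it. So passing to the null component loses
  nothing.\<close>

lemma denodd_jden: "denodd (nilp V0) i = jden V0 tX (2 * i + 1)"
proof -
  have "z \<in> nilp V0" if x: "x \<in> ker V0 (tX ^ (2 * i + 1))" and z: "z \<in> V0"
    "(u0 ^^ (2 * i)) x = (u0 ^^ (2 * i + 1)) z" for x z
  proof -
    have "(u0 ^^ Suc (2 * i + 1)) z = u0 ((u0 ^^ (2 * i)) x)" unfolding z(2) by simp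
    also have "\<dots> = (u0 ^^ (2 * i + 1)) x" by simp
    also have "\<dots> = 0" using x unfolding ker_def pev_X_power by blast
    finally show ?thesis using z(1) unfolding nilp_def by blast
  qed
  moreover have "2 * i + 1 - 1 = 2 * i" by simp
  ultimately show ?thesis
    unfolding denodd_def jden_def kerodd_ker pev_X_power \<open>2 * i + 1 - 1 = 2 * i\<close>
    by (auto simp only: mem_Collect_eq nilp_def)
qed

lemma epol_X: "epol tX" by (simp add: epol_def)

lemma t_space_simps:
  shows "carrier (t_space V u i) = cl tX (2 * i + 1) ` ker V0 (tX ^ (2 * i + 1))"
    and "\<zero>\<^bsub>t_space V u i\<^esub> = cl tX (2 * i + 1) 0"
    and "x \<in> V0 \<Longrightarrow> y \<in> V0 \<Longrightarrow>
      cl tX (2 * i + 1) x \<oplus>\<^bsub>t_space V u i\<^esub> cl tX (2 * i + 1) y = cl tX (2 * i + 1) (x + y)"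
    and "x \<in> V0 \<Longrightarrow> c \<odot>\<^bsub>t_space V u i\<^esub> cl tX (2 * i + 1) x = cl tX (2 * i + 1) (c *s x)"
proof -
  have k: "2 * i + 1 \<ge> 1" by simp
  show "carrier (t_space V u i) = cl tX (2 * i + 1) ` ker V0 (tX ^ (2 * i + 1))"
    unfolding jordan_space_def using cl_carrier[OF k] by (simp only: partial_object.simps)
  show "\<zero>\<^bsub>t_space V u i\<^esub> = cl tX (2 * i + 1) 0"
    unfolding jordan_space_def using cl_zero[OF k] by (simp only: ring_record_simps)
  show "cl tX (2 * i + 1) x \<oplus>\<^bsub>t_space V u i\<^esub> cl tX (2 * i + 1) y = cl tX (2 * i + 1) (x + y)"
    if "x \<in> V0" "y \<in> V0"
    unfolding jordan_space_def using cl_add[OF that] by (simp only: ring_record_simps)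
  show "c \<odot>\<^bsub>t_space V u i\<^esub> cl tX (2 * i + 1) x = cl tX (2 * i + 1) (c *s x)" if "x \<in> V0"
    unfolding jordan_space_def using cl_scale[OF k that] by (simp only: module.simps)
qed

lemma signed_form:
  assumes "x \<in> ker V0 (tX ^ (2 * i + 1))" "y \<in> ker V0 (tX ^ (2 * i + 1))"
  shows "signed_t_form V b u i (cl tX (2 * i + 1) x) (cl tX (2 * i + 1) y) =
    (- 1) ^ i * b0 x ((u0 ^^ (2 * i)) y)"
proof -
  have k: "2 * i + 1 - 1 = 2 * i" by simp
  have "induced_form V b u tX (2 * i + 1) (cl tX (2 * i + 1) x) (cl tX (2 * i + 1) y) = b0 x ((u0 ^^ (2 * i)) y)"
    using induced[OF epol_X assms] unfolding k pev_X_power .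
  from arg_cong[OF this, of "\<lambda>z. (- 1) ^ i * z"] show ?thesis unfolding signed_t_form_def .
qed

text \<open>The external direct sum over i > k is identified with \<open>Pn (Suc k)\<close> and the
  space of index k with \<open>C k\<close>; the two section lemmas then translate
  Witt-simplification.\<close>

lemma condN_link:
  "witt_simplifies class_ring (t_space V u k) (signed_t_form V b u k)
     (direct_sum_space {i. i > k} (t_space V u))
     (orthogonal_sum class_ring {i. i > k} (t_space V u) (signed_t_form V b u))
   \<longleftrightarrow> condN (nilp V0) k"
proof -
  have gN: "good (nilp V0)" by (rule good_nilp[OF goodV])
  obtain n where n: "nilp V0 = ker V0 (tX ^ n)" by (rule nilp_exponent[OF fV uV], rule that)
  have nilN: "(u0 ^^ n) x = 0" if "x \<in> nilp V0" for x
    using that unfolding n ker_def pev_X_power by blast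
  have "\<forall>i. \<exists>C. subspace C \<and> C \<subseteq> kerodd (nilp V0) i \<and> C \<inter> denodd (nilp V0) i = {0} \<and>
      ssum C (denodd (nilp V0) i) = kerodd (nilp V0) i" unfolding kerodd_ker denodd_jden
    using complement_exists[OF fd_ker[OF fV] sD jden_sub] by blast
  then obtain C where C: "\<forall>i. subspace (C i) \<and> C i \<subseteq> kerodd (nilp V0) i \<and> C i \<inter> denodd (nilp V0) i = {0} \<and>
      ssum (C i) (denodd (nilp V0) i) = kerodd (nilp V0) i" by (rule choice[THEN exE])
  interpret G: nil_space scale b0 u0 "nilp V0" n C using gN nilN C by unfold_locales auto
  let ?c = "\<lambda>i. cl tX (2 * i + 1)" and ?T = "t_space V u" and ?S = "signed_t_form V b u"
  let ?I = "{i. i > k}" and ?J = "{Suc k..<n}"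
  let ?X = "direct_sum_space ?I ?T" and ?BX = "orthogonal_sum class_ring ?I ?T ?S"
  have CK: "c \<in> ker V0 (tX ^ (2 * i + 1))" if "c \<in> C i" for c i
    using G.C_K[OF that] unfolding kerodd_ker .
  have CV: "c \<in> V0" if "c \<in> C i" for c i by (rule ker_V0[OF CK[OF that]])
  have C0: "0 \<in> C i" for i by (rule subspace_0[OF G.C_sub])
  have cl_C: "x = y" if xy: "x \<in> C i" "y \<in> C i" "?c i x = ?c i y" for x y i
  proof -
    have "x - y \<in> denodd (nilp V0) i" unfolding denodd_jden using xy CV by (simp add: cl_eq)
    then have "x - y = 0" using G.C_den[of i] subspace_diff[OF G.C_sub xy(1,2)] by blast
    then show ?thesis by simp
  qed
  have cl_img: "carrier (?T i) = ?c i ` C i" for i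
  proof (intro equalityI subsetI)
    fix y assume "y \<in> carrier (?T i)"
    then obtain x where x: "x \<in> kerodd (nilp V0) i" "y = ?c i x"
      unfolding t_space_simps(1) kerodd_ker by blast
    obtain c d where cd: "c \<in> C i" "d \<in> denodd (nilp V0) i" "x = c + d" using G.Kn_split[OF x(1)] by blast
    have "d \<in> V0" using cd(2) unfolding denodd_jden by (rule jden_V0)
    then have "?c i x = ?c i c" using cd CV[OF cd(1)] by (simp add: cl_eq denodd_jden)
    then show "y \<in> ?c i ` C i" using x cd by blast
  next
    fix y assume "y \<in> ?c i ` C i"
    then show "y \<in> carrier (?T i)" unfolding t_space_simps(1) using CK by blast
  qed
  \<comment> \<open>Beyond the nilpotency bound the summands vanish, which makes the infinite sum
    effectively finite.\<close>
  have Cn: "c = 0" if c: "c \<in> C i" and i: "n \<le> i" for c i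
  proof (rule G.C_nd[OF c])
    fix y assume "y \<in> C i"
    then have "(u0 ^^ n) y = 0" by (intro nilN G.Kn_N[OF G.C_K])
    then have "(u0 ^^ (2 * i)) y = 0" by (rule upow_zero_mono) (use i in simp)
    then show "b0 c ((u0 ^^ (2 * i)) y) = 0" by (simp add: bD)
  qed
  define \<sigma> where "\<sigma> F = (\<Sum>i\<in>?J. (u0 ^^ i) (F i))" for F :: "nat \<Rightarrow> 'b"
  \<comment> \<open>The decomposition is arbitrary below k + 1 but unique above k by
    \<open>uniq\<close>, and only those components enter \<open>\<psi>\<close>.\<close>
  define dec where "dec x = (SOME F. (\<forall>i. F i \<in> C i) \<and> x = \<sigma> F)" for x
  define \<psi> where "\<psi> x = (\<lambda>i\<in>?I. ?c i (dec x i))" for x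
  have \<sigma>P: "\<sigma> F \<in> G.Pn (Suc k)" if "\<And>i. F i \<in> C i" for F
    unfolding G.Pn_def G.gs_def \<sigma>_def using that by blast
  have dec: "dec x i \<in> C i" "\<sigma> (dec x) = x" if "x \<in> G.Pn (Suc k)" for x i
    using someI_ex[OF G.Pn_E[OF that]] unfolding dec_def \<sigma>_def by auto
  have uniq: "F i = F' i" if F: "\<And>i. F i \<in> C i" "\<And>i. F' i \<in> C i" "\<sigma> F = \<sigma> F'" and i: "i > k" for F F' i
  proof (cases "i < n")
    case True
    have d: "(\<Sum>i\<in>?J. (u0 ^^ i) (F i - F' i)) = 0"
      using F(3) unfolding \<sigma>_def by (simp add: upow_diff sum_subtractf)
    have "F i - F' i = 0" by (rule G.Pn_inj[of "\<lambda>i. F i - F' i" "Suc k"])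
         (use True i in \<open>simp_all add: d bD subspace_diff[OF G.C_sub F(1,2)]\<close>)
    then show ?thesis by simp
  next
    case False
    then show ?thesis using Cn[OF F(1)] Cn[OF F(2)] by simp
  qed
  have \<psi>\<sigma>: "\<psi> (\<sigma> F) = (\<lambda>i\<in>?I. ?c i (F i))" if F: "\<And>i. F i \<in> C i" for F
  proof -
    have "dec (\<sigma> F) i = F i" if "i > k" for i
      using uniq[OF dec(1)[OF \<sigma>P[OF F]] F dec(2)[OF \<sigma>P[OF F]] that] .
    then show ?thesis unfolding \<psi>_def by (intro restrict_ext) simp
  qed
  have \<psi>E: "\<exists>F. (\<forall>i. F i \<in> C i) \<and> x = \<sigma> F \<and> \<psi> x = (\<lambda>i\<in>?I. ?c i (F i))" if "x \<in> G.Pn (Suc k)" for x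
    using dec[OF that] by (intro exI[of _ "dec x"]) (simp add: \<psi>_def)
  have z: "\<psi> 0 = (\<lambda>i\<in>?I. ?c i 0)"
    using \<psi>\<sigma>[of "\<lambda>_. 0", OF C0] by (simp add: \<sigma>_def)
  have presP: "presentation scale class_ring ?X (G.Pn (Suc k)) {0} \<psi> scale 1"
  proof (rule linear_presentation)
    show "fd (G.Pn (Suc k))" by (rule G.fd_Pn)
    show "carrier ?X = \<psi> ` G.Pn (Suc k)"
    proof (intro equalityI subsetI)
      fix f assume "f \<in> carrier ?X"
      then have f: "f \<in> (\<Pi>\<^sub>E i\<in>?I. carrier (?T i))" by (simp add: direct_sum_space_def)
      have "\<forall>i. \<exists>c. c \<in> C i \<and> (i > k \<longrightarrow> f i = ?c i c)"
      proof
        fix i show "\<exists>c. c \<in> C i \<and> (i > k \<longrightarrow> f i = ?c i c)"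
        proof (cases "i > k")
          case True
          then have "f i \<in> carrier (?T i)" by (intro PiE_mem[OF f]) simp
          then have "f i \<in> ?c i ` C i" unfolding cl_img .
          then show ?thesis by blast
        next
          case False
          then show ?thesis using C0 by blast
        qed
      qed
      then obtain F where F: "\<forall>i. F i \<in> C i \<and> (i > k \<longrightarrow> f i = ?c i (F i))" by (rule choice[THEN exE])
      have "\<psi> (\<sigma> F) = f" using F f \<psi>\<sigma>[of F] by (auto simp: PiE_def extensional_def restrict_def fun_eq_iff)
      then show "f \<in> \<psi> ` G.Pn (Suc k)" using \<sigma>P[of F] F by blast
    next
      fix f assume "f \<in> \<psi> ` G.Pn (Suc k)"
      then obtain x where x: "x \<in> G.Pn (Suc k)" "f = \<psi> x" by blast
      obtain F where F: "\<forall>i. F i \<in> C i" "f = (\<lambda>i\<in>?I. ?c i (F i))" using \<psi>E[OF x(1)] x(2) by blast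
      have "{i\<in>?I. f i \<noteq> \<zero>\<^bsub>?T i\<^esub>} \<subseteq> {..<n}"
      proof
        fix i assume i: "i \<in> {i\<in>?I. f i \<noteq> \<zero>\<^bsub>?T i\<^esub>}"
        have "F i \<noteq> 0" using i unfolding F(2) t_space_simps(2) by auto
        then show "i \<in> {..<n}" using Cn[of "F i" i] F(1) by (cases "i < n") auto
      qed
      then have "finite {i\<in>?I. f i \<noteq> \<zero>\<^bsub>?T i\<^esub>}" by (rule finite_subset) simp
      moreover have "f \<in> (\<Pi>\<^sub>E i\<in>?I. carrier (?T i))" 
        unfolding F(2) restrict_PiE_iff cl_img using F(1) by blast
      ultimately show "f \<in> carrier ?X" by (simp add: direct_sum_space_def)
    qed
    show "\<zero>\<^bsub>?X\<^esub> = \<psi> 0" unfolding z by (simp add: direct_sum_space_def t_space_simps(2) del: One_nat_def)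
    show "\<psi> (x + y) = \<psi> x \<oplus>\<^bsub>?X\<^esub> \<psi> y" if xy: "x \<in> G.Pn (Suc k)" "y \<in> G.Pn (Suc k)" for x y
    proof -
      obtain F where F: "\<forall>i. F i \<in> C i" "x = \<sigma> F" "\<psi> x = (\<lambda>i\<in>?I. ?c i (F i))" using \<psi>E[OF xy(1)] by blast
      obtain F' where F': "\<forall>i. F' i \<in> C i" "y = \<sigma> F'" "\<psi> y = (\<lambda>i\<in>?I. ?c i (F' i))" using \<psi>E[OF xy(2)] by blast
      have "x + y = \<sigma> (\<lambda>i. F i + F' i)" unfolding F(2) F'(2) \<sigma>_def by (simp add: upow_add sum.distrib)
      then have "\<psi> (x + y) = (\<lambda>i\<in>?I. ?c i (F i + F' i))"
        using \<psi>\<sigma>[of "\<lambda>i. F i + F' i"] F(1) F'(1) subspace_add[OF G.C_sub] by simp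
      also have "\<dots> = (\<lambda>i\<in>?I. \<psi> x i \<oplus>\<^bsub>?T i\<^esub> \<psi> y i)"
      proof (rule restrict_ext)
        fix i assume i: "i \<in> ?I"
        show "?c i (F i + F' i) = \<psi> x i \<oplus>\<^bsub>?T i\<^esub> \<psi> y i"
          unfolding F(3) F'(3) restrict_apply'[OF i]
          using t_space_simps(3)[OF CV[OF F(1)[rule_format]] CV[OF F'(1)[rule_format]]] by (rule sym)
      qed
      also have "\<dots> = \<psi> x \<oplus>\<^bsub>?X\<^esub> \<psi> y" by (simp add: direct_sum_space_def)
      finally show ?thesis .
    qed
    show "c \<odot>\<^bsub>?X\<^esub> \<psi> x = \<psi> (c *s x)" if x: "x \<in> G.Pn (Suc k)" for c x
    proof -
      obtain F where F: "\<forall>i. F i \<in> C i" "x = \<sigma> F" "\<psi> x = (\<lambda>i\<in>?I. ?c i (F i))" using \<psi>E[OF x] by blast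
      have "c *s x = \<sigma> (\<lambda>i. c *s F i)" unfolding F(2) \<sigma>_def by (simp add: upow_scale scale_sum_right)
      then have "\<psi> (c *s x) = (\<lambda>i\<in>?I. ?c i (c *s F i))"
        using \<psi>\<sigma>[of "\<lambda>i. c *s F i"] F(1) subspace_scale[OF G.C_sub] by simp
      also have "\<dots> = (\<lambda>i\<in>?I. c \<odot>\<^bsub>?T i\<^esub> \<psi> x i)"
      proof (rule restrict_ext)
        fix i assume i: "i \<in> ?I"
        show "?c i (c *s F i) = c \<odot>\<^bsub>?T i\<^esub> \<psi> x i"
          unfolding F(3) restrict_apply'[OF i]
          using t_space_simps(4)[OF CV[OF F(1)[rule_format]]] by (rule sym)
      qed
      also have "\<dots> = c \<odot>\<^bsub>?X\<^esub> \<psi> x" by (simp add: direct_sum_space_def)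
      finally show ?thesis by simp
    qed
    show "x = 0" if x: "x \<in> G.Pn (Suc k)" and e: "\<psi> x = \<psi> 0" for x
    proof -
      obtain F where F: "\<forall>i. F i \<in> C i" "x = \<sigma> F" "\<psi> x = (\<lambda>i\<in>?I. ?c i (F i))" using \<psi>E[OF x] by blast
      have "F i = 0" if "i > k" for i
        using fun_cong[OF e[unfolded F(3) z], of i] that F(1) C0 by (intro cl_C[of _ i]) auto
      then show ?thesis unfolding F(2) \<sigma>_def by simp
    qed
  qed
  have presQ: "presentation scale class_ring (?T k) (C k) {0} (?c k) scale 1"
  proof (rule linear_presentation)
    show "fd (C k)" by (rule fd_mono[OF fd_ker[OF fV] G.C_sub]) (use CK in blast)
    show "carrier (?T k) = ?c k ` C k" by (rule cl_img)
    show "\<zero>\<^bsub>?T k\<^esub> = ?c k 0" by (rule t_space_simps(2))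
    show "x = 0" if "x \<in> C k" "?c k x = ?c k 0" for x by (rule cl_C[OF that(1) C0 that(2)])
  qed (use CV in \<open>simp_all add: t_space_simps(3,4) del: One_nat_def\<close>)
  define \<beta> where "\<beta> x y = (- 1) ^ k * b0 x ((u0 ^^ (2 * k)) y)" for x y
  have BX: "?BX (\<psi> x) (\<psi> y) = b0 x y" if xy: "x \<in> G.Pn (Suc k)" "y \<in> G.Pn (Suc k)" for x y
  proof -
    obtain F where F: "\<forall>i. F i \<in> C i" "x = \<sigma> F" "\<psi> x = (\<lambda>i\<in>?I. ?c i (F i))" using \<psi>E[OF xy(1)] by blast
    obtain F' where F': "\<forall>i. F' i \<in> C i" "y = \<sigma> F'" "\<psi> y = (\<lambda>i\<in>?I. ?c i (F' i))" using \<psi>E[OF xy(2)] by blast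
    have val: "?S i (?c i (F i)) (?c i (F' i)) = (- 1) ^ i * b0 (F i) ((u0 ^^ (2 * i)) (F' i))" for i
      by (rule signed_form[OF CK[OF F(1)[rule_format]] CK[OF F'(1)[rule_format]]])
    let ?A = "{i \<in> ?I. \<psi> x i \<noteq> \<zero>\<^bsub>?T i\<^esub>}"
    have A: "i \<in> ?A \<longleftrightarrow> i > k \<and> F i \<noteq> 0" for i
    proof -
      have "?c i (F i) = ?c i 0 \<longleftrightarrow> F i = 0"  using cl_C[OF F(1)[rule_format] C0] by metis
      then show ?thesis unfolding F(3) t_space_simps(2) by auto
    qed
    have AJ: "?A \<subseteq> ?J"
    proof
      fix i assume "i \<in> ?A"
      then have i: "i > k" "F i \<noteq> 0" unfolding A by auto
      then show "i \<in> ?J" using Cn[of "F i" i] F(1) by (cases "i < n") auto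
    qed
    have "?BX (\<psi> x) (\<psi> y) = (\<Sum>i\<in>?A. ?S i (\<psi> x i) (\<psi> y i))"
      by (simp add: orthogonal_sum_def class_ring_simps)
    also have "\<dots> = (\<Sum>i\<in>?A. (- 1) ^ i * b0 (F i) ((u0 ^^ (2 * i)) (F' i)))"
      by (rule sum.cong[OF refl]) (simp add: F(3) F'(3) val del: One_nat_def)
    also have "\<dots> = (\<Sum>i\<in>?J. (- 1) ^ i * b0 (F i) ((u0 ^^ (2 * i)) (F' i)))"
    proof (rule sum.mono_neutral_left[OF _ AJ])
      show "\<forall>i\<in>?J - ?A. (- 1) ^ i * b0 (F i) ((u0 ^^ (2 * i)) (F' i)) = 0"
      proof
        fix i assume i: "i \<in> ?J - ?A"
        then have "\<not> (i > k \<and> F i \<noteq> 0)" unfolding A[symmetric] by blast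
        then have "F i = 0" using i by auto
        then show "(- 1) ^ i * b0 (F i) ((u0 ^^ (2 * i)) (F' i)) = 0" by (simp add: bD)
      qed
    qed simp
    also have "\<dots> = b0 x y"
      unfolding F(2) F'(2) \<sigma>_def by (rule G.Pn_form[symmetric]) (use F(1) F'(1) in auto)
    finally show ?thesis .
  qed
  have BY: "?S k (?c k x) (?c k y) = \<beta> x y" if "x \<in> C k" "y \<in> C k" for x y
    unfolding \<beta>_def by (rule signed_form[OF CK[OF that(1)] CK[OF that(2)]])
  interpret WP: witt_pair scale b0 u0 ?X "G.Pn (Suc k)" \<psi> "?T k" "C k" "?c k" ?BX "?S k" \<beta>
    by (intro witt_pair.intro skew_space_axioms presP presQ witt_pair_axioms.intro BX BY)
  have nd: "\<forall>x\<in>G.Pn (Suc k). (\<forall>y\<in>G.Pn (Suc k). b0 x y = 0) \<longrightarrow> x = 0"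
    using G.Pn_nd[of _ "Suc k"] by blast
  show ?thesis
  proof
    assume ws: "witt_simplifies class_ring (?T k) (?S k) ?X ?BX"
    obtain W M \<phi> where h: "subspace W" "W \<subseteq> G.Pn (Suc k)" "subspace M" "M \<subseteq> G.Pn (Suc k)"
      "\<forall>x\<in>M. \<forall>y\<in>M. b0 x y = 0" "\<forall>x\<in>M. \<forall>y\<in>W. b0 x y = 0" "\<forall>x\<in>W. b0 x x = 0 \<longrightarrow> x = 0"
      "\<forall>x\<in>G.Pn (Suc k). (\<forall>y\<in>M. b0 x y = 0) \<longrightarrow> (\<exists>m\<in>M. \<exists>w\<in>W. x = m + w)"
      "\<forall>w\<in>W. \<phi> w \<in> C k" "\<forall>x\<in>W. \<forall>y\<in>W. \<phi> (x + y) = \<phi> x + \<phi> y"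
      "\<forall>c. \<forall>x\<in>W. \<phi> (c *s x) = c *s \<phi> x" "\<forall>x\<in>W. \<forall>y\<in>W. \<beta> (\<phi> x) (\<phi> y) = - b0 x y"
      using WP.witt_simplifiesD[OF ws nd] by (elim exE conjE) (rule that)
    show "condN (nilp V0) k"
      by (rule G.condN_of_section[of W k M \<phi>]) (use h in \<open>auto simp: \<beta>_def\<close>)
  next
    assume cN: "condN (nilp V0) k"
    show "witt_simplifies class_ring (?T k) (?S k) ?X ?BX"
      by (rule WP.witt_simplifiesI, unfold \<beta>_def) (rule G.section_of_condN[OF cN])
  qed
qed

lemma realization_main:
  "sum_of_two_skew_square_zero V b u \<longleftrightarrow>
    (\<forall>p\<in>Irr0. \<forall>r\<ge>1. hyperbolic (residue_field p) (jordan_residue_space V u p r)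
                                (hermitian_invariant V b u p r)) \<and>
    (\<forall>p\<in>Irr - (Irr0 \<union> {[:0, 1:]}). \<forall>k\<ge>1. even (jordan_number V u p k)) \<and>
    (\<forall>k. witt_simplifies class_ring
           (t_space V u k) (signed_t_form V b u k)
           (direct_sum_space {i. i > k} (t_space V u))
           (orthogonal_sum class_ring {i. i > k} (t_space V u) (signed_t_form V b u)))"
proof -
  have "even (jordan_number V u p k) \<longleftrightarrow> condII V0 p k" if "p \<in> Irr" "k \<ge> 1" for p k
    using condII_link[OF _ that(2)] that(1) by (simp add: Irr_def)
  then show ?thesis unfolding pairable_link pairable_iff[OF goodV] condN_link by (auto simp: condI_link)
qed

end

section \<open>Coordinates with respect to a basis, and the conclusion\<close>

lemma sum_fun_apply: "(\<Sum>i\<in>A. f i) x = (\<Sum>i\<in>A. f i x)" for f :: "'i \<Rightarrow> 'v \<Rightarrow> 'f::comm_monoid_add"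
  by (induction A rule: infinite_finite_induct) simp_all

lemma scale_fun_vector_space: "lin_space (\<lambda>(c::'f::field) (a :: 'v \<Rightarrow> 'f). (\<lambda>x. c * a x))"
  by unfold_locales (auto simp: fun_eq_iff algebra_simps)

theorem theorem1p16:
  fixes V :: "('f::field, 'v) module"
    and b :: "'v \<Rightarrow> 'v \<Rightarrow> 'f"
    and u :: "'v \<Rightarrow> 'v"
  assumes "CHAR('f) \<noteq> 2"
    and "vectorspace class_ring V"
    and "vectorspace.fin_dim class_ring V"
    and "bilinear_form class_ring V b"
    and "symmetric_form V b"
    and "nondegenerate class_ring V b"
    and "skew_selfadjoint V b u"
  shows "sum_of_two_skew_square_zero V b u \<longleftrightarrow>
    (\<forall>p\<in>Irr0. \<forall>r\<ge>1. hyperbolic (residue_field p) (jordan_residue_space V u p r)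
                                (hermitian_invariant V b u p r)) \<and>
    (\<forall>p\<in>Irr - (Irr0 \<union> {[:0, 1:]}). \<forall>k\<ge>1. even (jordan_number V u p k)) \<and>
    (\<forall>k. witt_simplifies class_ring
           (t_space V u k) (signed_t_form V b u k)
           (direct_sum_space {i. i > k} (t_space V u))
           (orthogonal_sum class_ring {i. i > k} (t_space V u) (signed_t_form V b u)))"
proof -
  let ?s = "\<lambda>(c::'f) (a :: 'v \<Rightarrow> 'f). (\<lambda>x. c * a x)"
  interpret V: vectorspace class_ring V by (rule assms(2))
  interpret F: lin_space ?s by (rule scale_fun_vector_space)
  obtain B where B: "finite B" "V.basis B" using V.finite_basis_exists[OF assms(3)] by blast
  have BV: "B \<subseteq> carrier V" "V.lin_indpt B" "V.span B = carrier V" using B(2) by (auto simp: V.basis_def)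
  \<comment> \<open>Coefficient families supported on the basis \<open>B\<close>; linear combination
    identifies them with the carrier. Outside \<open>V0\<close> the map \<open>g\<close> forgets
    values off \<open>B\<close>, so it stays linear on the whole type.\<close>
  define V0 where "V0 = {a :: 'v \<Rightarrow> 'f. \<forall>v. v \<notin> B \<longrightarrow> a v = 0}"
  define g where "g a = V.lincomb a B" for a
  have g_car: "g a \<in> carrier V" for a unfolding g_def using BV by (intro V.lincomb_closed) auto
  have g_add: "g (a + a') = g a \<oplus>\<^bsub>V\<^esub> g a'" for a a'
    unfolding g_def using V.lincomb_sum[OF B(1) BV(1), of a a'] by (simp add: plus_fun_def)
  have g_scale: "g (?s c a) = c \<odot>\<^bsub>V\<^esub> g a" for c a
    unfolding g_def using V.lincomb_smult[OF BV(1), of a c] B(1) by simp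
  have g_inj: "inj_on g V0"
  proof (rule inj_onI)
    fix a a' assume a: "a \<in> V0" "a' \<in> V0" "g a = g a'"
    have "g (a - a') \<oplus>\<^bsub>V\<^esub> g a' = \<zero>\<^bsub>V\<^esub> \<oplus>\<^bsub>V\<^esub> g a'" using g_car a(3) by (simp flip: g_add)
    then have "g (a - a') = \<zero>\<^bsub>V\<^esub>" using g_car by simp
    then have "a v - a' v = 0" if "v \<in> B" for v
      using V.lin_dep_crit[of B B "a - a'" v] BV B(1) that by (auto simp: g_def)
    then have "a v = a' v" for v using a(1,2) unfolding V0_def by (cases "v \<in> B") auto
    then show "a = a'" by blast
  qed
  have g_surj: "g ` V0 = carrier V"
  proof (intro equalityI subsetI)
    fix y assume "y \<in> carrier V"
    then have "y \<in> V.span B" using BV by simp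
    then obtain a where a: "y = V.lincomb a B" using V.finite_span[OF B(1) BV(1)] by auto
    define a' where "a' v = (if v \<in> B then a v else 0)" for v
    have "V.lincomb a' B = V.lincomb a B" using BV(1) by (intro V.lincomb_cong) (auto simp: a'_def)
    then have "y = g a'" using a by (simp add: g_def)
    then show "y \<in> g ` V0" by (auto simp: V0_def a'_def)
  qed (use g_car in auto)
  have g_bij: "bij_betw g V0 (carrier V)" using g_inj g_surj by (simp add: bij_betw_def)
  define h where "h = inv_into V0 g"
  have gh: "g (h y) = y" "h y \<in> V0" if "y \<in> carrier V" for y
    using that f_inv_into_f[of y g V0] inv_into_into[of y g V0] by (simp_all add: h_def g_surj)
  have hI: "h y = a" if "a \<in> V0" "g a = y" for a y using that g_inj by (auto simp: h_def)
  interpret ul: linear_map class_ring V V u using assms(7) by (simp add: skew_selfadjoint_def)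
  have u_car: "u y \<in> carrier V" if "y \<in> carrier V" for y using that by (rule ul.f_im)
  have skew: "b (u x) y = - b x (u y)" if "x \<in> carrier V" "y \<in> carrier V" for x y
    using assms(7) that by (simp add: skew_selfadjoint_def)
  define b0 where "b0 a a' = b (g a) (g a')" for a a'
  define u0 where "u0 a = h (u (g a))" for a
  have gu: "g (u0 a) = u (g a)" "u0 a \<in> V0" for a unfolding u0_def using gh[OF u_car[OF g_car]] by auto
  have sV: "F.subspace V0" by (auto simp: F.subspace_def V0_def)
  have bil: "b (x \<oplus>\<^bsub>V\<^esub> y) z = b x z + b y z" "b z (x \<oplus>\<^bsub>V\<^esub> y) = b z x + b z y"
    if "x \<in> carrier V" "y \<in> carrier V" "z \<in> carrier V" for x y z
    using assms(4) that by (simp_all add: bilinear_form_def)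
  have bil_scale: "b (c \<odot>\<^bsub>V\<^esub> x) y = c * b x y" "b x (c \<odot>\<^bsub>V\<^esub> y) = c * b x y"
    if "x \<in> carrier V" "y \<in> carrier V" for x y c
    using assms(4) that by (simp_all add: bilinear_form_def)
  have two: "(2::'f) \<noteq> 0"
  proof
    assume "(2::'f) = 0"
    then have "of_nat 2 = (0::'f)" by simp
    then have "CHAR('f) dvd 2" unfolding of_nat_eq_0_iff_char_dvd .
    then show False using assms(1) CHAR_not_1 by (metis dvd_imp_le le_antisym One_nat_def Suc_leI
      less_2_cases_iff linorder_not_less nat_less_le zero_less_numeral dvd_0_left_iff zero_neq_numeral)
  qed
  interpret S: skew_space ?s b0 u0
  proof (unfold_locales)
    show "F.bilform b0" by (simp add: F.bilform_def b0_def g_add g_scale bil bil_scale g_car)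
    show "b0 x y = b0 y x" for x y using assms(5) g_car by (simp add: b0_def symmetric_form_def)
    show "u0 (x + y) = u0 x + u0 y" for x y unfolding u0_def[of "x + y"]
      by (rule hI) (simp_all add: F.subspace_add[OF sV] gu g_add g_car)
    show "u0 (?s c x) = ?s c (u0 x)" for c x
    proof -
      have "g (?s c (u0 x)) = u (g (?s c x))" using ul.f_smult[of c "g x"] by (simp add: g_scale gu g_car)
      then show ?thesis unfolding u0_def[of "?s c x"] by (rule hI[OF F.subspace_scale[OF sV gu(2)]])
    qed
    show "b0 (u0 x) y = - b0 x (u0 y)" for x y by (simp add: b0_def gu skew g_car)
  qed (rule two)
  have good: "S.good V0" unfolding S.good_def
  proof (intro conjI ballI impI)
    show "F.fd V0" unfolding F.fd_def
    proof (intro conjI sV exI[of _ "(\<lambda>v. (\<lambda>x. if x = v then 1 else 0)) ` B"] subsetI)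
      fix a assume a: "a \<in> V0"
      have "a = (\<Sum>v\<in>B. ?s (a v) (\<lambda>x. if x = v then 1 else 0))"
      proof
        fix x
        have "(\<Sum>v\<in>B. ?s (a v) (\<lambda>x. if x = v then 1 else 0)) x = (\<Sum>v\<in>B. if x = v then a v else 0)"
          unfolding sum_fun_apply by (rule sum.cong) auto
        then show "a x = (\<Sum>v\<in>B. ?s (a v) (\<lambda>x. if x = v then 1 else 0)) x"
          using a B(1) by (auto simp: V0_def)
      qed
      also have "\<dots> \<in> F.span ((\<lambda>v. (\<lambda>x. if x = v then 1 else 0)) ` B)"
        by (intro F.span_sum F.span_scale F.span_base) auto
      finally show "a \<in> F.span ((\<lambda>v. (\<lambda>x. if x = v then 1 else 0)) ` B)" .
    qed (use B in simp)
    show "S.ustable V0" by (simp add: S.ustable_def gu)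
    fix a assume a: "a \<in> V0" "\<forall>a'\<in>V0. b0 a a' = 0"
    have "b (g a) y = 0" if y: "y \<in> carrier V" for y using a(2) gh[OF y] by (auto simp: b0_def)
    then have ga: "g a = \<zero>\<^bsub>V\<^esub>" using assms(6) g_car by (simp add: nondegenerate_def)
    have "g 0 \<oplus>\<^bsub>V\<^esub> g 0 = g 0 \<oplus>\<^bsub>V\<^esub> \<zero>\<^bsub>V\<^esub>" using g_add[of 0 0] g_car[of 0] by simp
    then have "g 0 = \<zero>\<^bsub>V\<^esub>" by (rule V.a_lcancel) (simp_all add: g_car)
    then show "a = 0" using inj_onD[OF g_inj] a(1) F.subspace_0[OF sV] ga by metis
  qed
  interpret R: realization ?s b0 u0 V b u V0 g
    by unfold_locales (simp_all add: good g_bij g_add g_scale gu b0_def assms(2))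
  show ?thesis by (rule R.realization_main)
qed

end
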